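(* Consider the regression model $Y_i=m(X_i)+\varepsilon_i$, $i=1,\dots,n$, with the kernel, bandwidth and smoothness conventions of the context, where the sequences $(X_i)$ and $(\varepsilon_i)$ are independent of each other, and fix a point $x$. (i) Suppose that $X_i$, $i\ge1$, are i.i.d. with density $f$; and that $\varepsilon_i=G(\eta_i,\eta_{i-1},\dots)$, where $(\eta_i)_{-\infty<i<\infty}$ is an i.i.d. sequence independent of $(X_i)_{i\ge1}$, $\mathrm{E}[\varepsilon_1]=0$, $\mathrm{E}[\varepsilon_1^2]=1$. Let $\mathcal H_i=\sigma(\eta_i,\eta_{i-1},\dots)$. If $$\frac{\sqrt{nh}}{n}\sum_{i=1}^n\big(\mathrm{E}[\varepsilon_i|\mathcal H_{i-1}]-\varepsilon_i\big)=o_P(1)\quad\text{and}\quad \frac{\sqrt{nh}}{n}\sum_{i=1}^n\mathrm{E}[\varepsilon_i|\mathcal H_{i-1}]=o_P(1),$$ then, as $n\to\infty$, $$\sqrt{\frac{nh}{\kappa_1}}\sqrt{\hat f_h(x)}\,\big(\hat m_h(x)-m_n(x)\big)\stackrel{d}{\to}N(0,1).\qquad( * )$$ (ii) Suppose that $X_i=\sum_{k=0}^\infty a_k\zeta_{i-k}$ with $a_0=1$, $a_k=A_0k^{-(\alpha_X+1)/2}$ ($k\ge1$) for some constant $A_0$ and $\alpha_X\in(0,1)$, where $(\zeta_i)_{-\infty<i<\infty}$ are i.i.d. centered Gaussian and $\mathrm{Var}(X_1)=1$; and that $\varepsilon_i=\sum_{k=0}^\infty c_k\eta_{i-k}$ with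 $c_0=1$, $c_k\sim C_0k^{-(\alpha+1)/2}$ as $k\to\infty$ for some $\alpha\in(0,1)$, where $(\eta_i)_{-\infty<i<\infty}$ are i.i.d., centered, with finite fourth moment, independent of $(X_i)_{i\ge 1}$, and $\mathrm{E}[\varepsilon_1^2]=1$. Let $\mathcal H_i=\sigma(\eta_i,\eta_{i-1},\dots)$. If the two $o_P(1)$ conditions displayed in (i) hold and in addition $h^5n^{1-\alpha_X}\to0$, then $( * )$ holds.
   Context: The kernel $K$ is nonnegative and bounded with $\int K(u)\,du=1$, $\int uK(u)\,du=0$, $\kappa_2:=\int u^2K(u)\,du$ (finite), $\kappa_1:=\int K^2(u)\,du\neq0$. The bandwidth $h=h_n$ satisfies $h\to0$ and $nh\to\infty$. The density $f$ of $X_1$ and the function $m$ are twice differentiable with bounded derivatives, and $f(x)>0$ for each $x$. Density estimator: $\hat f_h(x)=\frac1{nh}\sum_{i=1}^nK\left(\frac{x-X_i}{h}\right)$. Nadaraya–Watson estimator: $\hat m_h(x)=\frac{1}{nh\,\hat f_h(x)}\sum_{i=1}^nY_iK\left(\frac{x-X_i}{h}\right)$. Centering: $m_n(x)=\mathrm{E}[K((x-X_1)/h)\,m(X_1)]/\mathrm{E}[K((x-X_1)/h)]$. $\stackrel{d}{\to}$ denotes convergence in distribution. *)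

theory Defs
  imports "HOL-Probability.Probability" "HOL-Library.Landau_Symbols"
begin

definition twice_differentiable_bounded :: "(real \<Rightarrow> real) \<Rightarrow> bool" where
  "twice_differentiable_bounded g \<longleftrightarrow>
     (\<exists>g' g''. (\<forall>y. (g has_real_derivative g' y) (at y))
             \<and> (\<forall>y. (g' has_real_derivative g'' y) (at y))
             \<and> bounded (range g') \<and> bounded (range g''))"

definition iid_family :: "'a measure \<Rightarrow> 's measure \<Rightarrow> 'i set \<Rightarrow> ('i \<Rightarrow> 'a \<Rightarrow> 's) \<Rightarrow> bool" where
  "iid_family M S I Z \<longleftrightarrow>
     prob_space.indep_vars M (\<lambda>_. S) Z I
     \<and> (\<forall>i\<in>I. \<forall>j\<in>I. distr M S (Z i) = distr M S (Z j))"

text \<open>The \<open>\<sigma>\<close>-algebra generated by \<open>Z i\<close> for \<open>i \<in> I\<close>, packaged as a measure space because that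
  is the form in which \<^const>\<open>real_cond_exp\<close> takes its sub-\<open>\<sigma>\<close>-algebra; only its sets matter.\<close>

definition generated_sigma :: "'a measure \<Rightarrow> 's measure \<Rightarrow> 'i set \<Rightarrow> ('i \<Rightarrow> 'a \<Rightarrow> 's) \<Rightarrow> 'a measure" where
  "generated_sigma M S I Z =
     sigma (space M) (\<Union>i\<in>I. {Z i -` A \<inter> space M | A. A \<in> sets S})"

abbreviation past_sigma :: "'a measure \<Rightarrow> 's measure \<Rightarrow> (int \<Rightarrow> 'a \<Rightarrow> 's) \<Rightarrow> int \<Rightarrow> 'a measure" where
  "past_sigma M S Z i \<equiv> generated_sigma M S {..i} Z"

text \<open>Independence of two whole processes. The library's \<open>indep_var\<close> does not apply, because it
  requires both random elements to have values in the same type.\<close>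

definition indep_families ::
    "'a measure \<Rightarrow> 's measure \<Rightarrow> 'i set \<Rightarrow> ('i \<Rightarrow> 'a \<Rightarrow> 's)
       \<Rightarrow> 't measure \<Rightarrow> 'j set \<Rightarrow> ('j \<Rightarrow> 'a \<Rightarrow> 't) \<Rightarrow> bool" where
  "indep_families M S I Z T J W \<longleftrightarrow>
     (\<forall>i\<in>I. Z i \<in> measurable M S) \<and> (\<forall>j\<in>J. W j \<in> measurable M T)
     \<and> prob_space.indep_set M (sets (generated_sigma M S I Z)) (sets (generated_sigma M T J W))"

definition small_oP :: "'a measure \<Rightarrow> (nat \<Rightarrow> 'a \<Rightarrow> real) \<Rightarrow> bool" where
  "small_oP M Z \<longleftrightarrow>
     (\<forall>e>0. (\<lambda>n. measure M {\<omega> \<in> space M. \<bar>Z n \<omega>\<bar> > e}) \<longlonglongrightarrow> 0)"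

text \<open>In the next three definitions \<open>h\<close> is the bandwidth at the given \<open>n\<close>, not the sequence.\<close>

definition density_est ::
    "(real \<Rightarrow> real) \<Rightarrow> real \<Rightarrow> (nat \<Rightarrow> 'a \<Rightarrow> real) \<Rightarrow> nat \<Rightarrow> real \<Rightarrow> 'a \<Rightarrow> real" where
  "density_est K h X n x \<omega> = 1 / (real n * h) * (\<Sum>i=1..n. K ((x - X i \<omega>) / h))"

text \<open>Where the density estimate vanishes, division by zero makes this \<open>0\<close>; such points are
  irrelevant below, since there the factor \<open>sqrt (density_est K h X n x \<omega>)\<close> is \<open>0\<close> as well.\<close>

definition NW_est ::
    "(real \<Rightarrow> real) \<Rightarrow> real \<Rightarrow> (nat \<Rightarrow> 'a \<Rightarrow> real) \<Rightarrow> (nat \<Rightarrow> 'a \<Rightarrow> real)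
       \<Rightarrow> nat \<Rightarrow> real \<Rightarrow> 'a \<Rightarrow> real" where
  "NW_est K h X Y n x \<omega> =
     1 / (real n * h * density_est K h X n x \<omega>) * (\<Sum>i=1..n. Y i \<omega> * K ((x - X i \<omega>) / h))"

definition NW_center ::
    "'a measure \<Rightarrow> (real \<Rightarrow> real) \<Rightarrow> real \<Rightarrow> (nat \<Rightarrow> 'a \<Rightarrow> real) \<Rightarrow> (real \<Rightarrow> real) \<Rightarrow> real \<Rightarrow> real" where
  "NW_center M K h X m x =
     prob_space.expectation M (\<lambda>\<omega>. K ((x - X 1 \<omega>) / h) * m (X 1 \<omega>))
     / prob_space.expectation M (\<lambda>\<omega>. K ((x - X 1 \<omega>) / h))"

definition kernel_L2 :: "(real \<Rightarrow> real) \<Rightarrow> real" where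
  "kernel_L2 K = (\<integral>u. (K u)\<^sup>2 \<partial>lborel)"

definition NW_asymp_normal ::
    "'a measure \<Rightarrow> (real \<Rightarrow> real) \<Rightarrow> (nat \<Rightarrow> real) \<Rightarrow> (nat \<Rightarrow> 'a \<Rightarrow> real) \<Rightarrow> (nat \<Rightarrow> 'a \<Rightarrow> real)
       \<Rightarrow> (real \<Rightarrow> real) \<Rightarrow> real \<Rightarrow> bool" where
  "NW_asymp_normal M K h X Y m x \<longleftrightarrow>
     weak_conv_m
       (\<lambda>n. distr M borel (\<lambda>\<omega>.
          sqrt (real n * h n / kernel_L2 K) * sqrt (density_est K (h n) X n x \<omega>)
          * (NW_est K (h n) X Y n x \<omega> - NW_center M K (h n) X m x)))
       std_normal_distribution"

end

theory Submission
  imports Defs "HOL-Probability.Probability" "HOL-Library.Landau_Symbols"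
begin

text \<open>In both parts the regressors have the form \<open>X\<^sub>i = W\<^sub>i + \<xi>\<^sub>i\<close>, where \<open>W\<^sub>i\<close> is measurable with
  respect to the past and the innovation \<open>\<xi>\<^sub>i\<close> is independent of it with a smooth density \<open>p\<close>: in the
  i.i.d. case \<open>W\<^sub>i = 0\<close> and \<open>p = f\<close>, in the long memory case \<open>\<xi>\<^sub>i = \<zeta>\<^sub>i\<close>. Write \<open>K\<^sub>h(z) = K((x - z)/h)\<close> and
  let \<open>\<Lambda>(W\<^sub>i)\<close> be the conditional expectation of \<open>K\<^sub>h(X\<^sub>i)\<close> given the past, with mean \<open>\<lambda>\<close>. The
  studentized estimator splits into

  \<^item> the main term \<open>(nh)\<^sup>-\<^sup>1\<^sup>/\<^sup>2 \<Sum> \<epsilon>\<^sub>i (K\<^sub>h(X\<^sub>i) - \<Lambda>(W\<^sub>i))\<close>, a martingale transform given the errors. After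
    truncating the errors, dividing \<open>exp (i t S\<^sub>n)\<close> by the Gaussian characteristic function with the
    conditional variance of \<open>S\<^sub>n\<close> gives an approximate martingale, and the conditional variance converges by
    a law of large numbers for stationary functionals of an i.i.d. sequence;
  \<^item> \<open>(nh)\<^sup>-\<^sup>1\<^sup>/\<^sup>2 \<lambda> \<Sum> \<epsilon>\<^sub>i\<close>, which is \<open>o\<^sub>P(1)\<close> by the two hypotheses on the errors;
  \<^item> the bias, again a martingale transform plus a Lipschitz functional of the \<open>W\<^sub>i\<close>, and the
    cross term \<open>(nh)\<^sup>-\<^sup>1\<^sup>/\<^sup>2 \<Sum> \<epsilon>\<^sub>i (\<Lambda>(W\<^sub>i) - \<lambda>)\<close>. Lipschitz functionals of a linear process have covariances bounded by
    \<open>\<Sum>\<^sub>l \<bar>a\<^sub>l a\<^sub>l\<^sub>+\<^sub>k\<bar>\<close>, so the bias is negligible under \<open>h\<^sup>5 n\<^sup>1\<^sup>-\<^sup>\<alpha>\<^sup>X \<rightarrow> 0\<close>, and the cross term is negligible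
    when \<open>h n\<^sup>1\<^sup>-\<^sup>\<alpha> \<rightarrow> 0\<close>. The latter is not assumed; it follows from the negligibility of the sum of
    the errors, because a sum of long memory errors cannot concentrate below its natural scale.\<close>

section \<open>Convergence in probability\<close>

text \<open>One power count explains the rates. A centred functional of the \<open>W i\<close> with
  Lipschitz constant L contributes, after normalization, L^2/(nh) times a double sum of covariances.
  For the predictable part of the bias L is of order h^3: the first moment of the kernel is zero and
  \<open>c n\<close> lies within O(h^2) of \<open>m x\<close>, so first-order terms cancel. With a
  double sum of order n^(2-\<alpha>X) this gives h^5 n^(1-\<alpha>X). For the cross term L is of
  order h, and bounding the regressor covariances by a constant leaves h n^(1-\<alpha>). The
  centering is exactly the ratio for which the predictable part of the bias has mean zero, so second
  moments suffice. The studentization works because \<open>fhat\<close> and the conditional variance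
  share one limit \<open>f0\<close>, up to the factor \<kappa>1 and the second moment of the errors.
  The errors may have only two moments, while the characteristic function is expanded to third order
  and the Gaussian factor must stay bounded; hence the truncation.\<close>

lemma (in prob_space) small_oP_L2:
  fixes Z :: "nat \<Rightarrow> 'a \<Rightarrow> real"
  assumes [measurable]: "\<And>n. Z n \<in> borel_measurable M"
    and bd: "\<forall>\<^sub>F n in sequentially. integrable M (\<lambda>\<omega>. (Z n \<omega>)\<^sup>2) \<and> expectation (\<lambda>\<omega>. (Z n \<omega>)\<^sup>2) \<le> r n"
    and r: "r \<longlonglongrightarrow> 0"
  shows "small_oP M Z"
  unfolding small_oP_def
proof safe
  fix e :: real assume e: "e > 0"
  have le: "\<forall>\<^sub>F n in sequentially. prob {\<omega> \<in> space M. \<bar>Z n \<omega>\<bar> > e} \<le> r n / e\<^sup>2"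
    using bd
  proof eventually_elim
    case (elim n)
    have "prob {\<omega> \<in> space M. \<bar>Z n \<omega>\<bar> > e} \<le> prob {\<omega> \<in> space M. (Z n \<omega>)\<^sup>2 \<ge> e\<^sup>2}"
      using e by (intro finite_measure_mono) (auto intro: power_mono simp flip: abs_le_square_iff)
    also have "\<dots> \<le> expectation (\<lambda>\<omega>. (Z n \<omega>)\<^sup>2) / e\<^sup>2"
      using elim e by (intro integral_Markov_inequality_measure[where A="{}"]) auto
    also have "\<dots> \<le> r n / e\<^sup>2"
      using elim e by (intro divide_right_mono) auto
    finally show ?case .
  qed
  have lim: "(\<lambda>n. r n / e\<^sup>2) \<longlonglongrightarrow> 0"
    using tendsto_divide[OF r tendsto_const, of "e\<^sup>2"] e by simp
  show "(\<lambda>n. prob {\<omega> \<in> space M. \<bar>Z n \<omega>\<bar> > e}) \<longlonglongrightarrow> 0"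
    by (rule tendsto_sandwich[OF _ le tendsto_const lim]) auto
qed

text \<open>Closure properties of convergence in probability reduce to an inclusion of exceedance
  events. The union bound does the rest, and each use only has to name the thresholds
  \<open>d\<close> and \<open>d'\<close>.\<close>

lemma (in prob_space) small_oP_subset:
  assumes "\<And>e. e > 0 \<Longrightarrow> \<exists>d>0. \<exists>d'>0. \<forall>\<^sub>F n in sequentially. {\<omega> \<in> space M. \<bar>Z n \<omega>\<bar> > e} \<subseteq>
      {\<omega> \<in> space M. \<bar>X n \<omega>\<bar> > d} \<union> {\<omega> \<in> space M. \<bar>Y n \<omega>\<bar> > d'}"
    and [measurable]: "\<And>n. X n \<in> borel_measurable M" "\<And>n. Y n \<in> borel_measurable M"
    and "small_oP M X" "small_oP M Y"
  shows "small_oP M Z"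
  unfolding small_oP_def
proof safe
  fix e :: real assume "e > 0"
  then obtain d d' where d: "d > 0" "d' > 0" and sub: "\<forall>\<^sub>F n in sequentially. {\<omega> \<in> space M. \<bar>Z n \<omega>\<bar> > e} \<subseteq>
      {\<omega> \<in> space M. \<bar>X n \<omega>\<bar> > d} \<union> {\<omega> \<in> space M. \<bar>Y n \<omega>\<bar> > d'}"
    using assms(1) by meson
  have le: "\<forall>\<^sub>F n in sequentially. prob {\<omega> \<in> space M. \<bar>Z n \<omega>\<bar> > e} \<le>
      prob {\<omega> \<in> space M. \<bar>X n \<omega>\<bar> > d} + prob {\<omega> \<in> space M. \<bar>Y n \<omega>\<bar> > d'}"
    using sub
  proof eventually_elim
    case (elim n)
    have "prob {\<omega> \<in> space M. \<bar>Z n \<omega>\<bar> > e} \<le> prob ({\<omega> \<in> space M. \<bar>X n \<omega>\<bar> > d} \<union> {\<omega> \<in> space M. \<bar>Y n \<omega>\<bar> > d'})"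
      using elim by (intro finite_measure_mono) auto
    also have "\<dots> \<le> prob {\<omega> \<in> space M. \<bar>X n \<omega>\<bar> > d} + prob {\<omega> \<in> space M. \<bar>Y n \<omega>\<bar> > d'}"
      by (intro measure_Un_le) auto
    finally show ?case .
  qed
  have lim: "(\<lambda>n. prob {\<omega> \<in> space M. \<bar>X n \<omega>\<bar> > d} + prob {\<omega> \<in> space M. \<bar>Y n \<omega>\<bar> > d'}) \<longlonglongrightarrow> 0"
    using assms(4,5) d unfolding small_oP_def by (intro tendsto_add_zero) auto
  show "(\<lambda>n. prob {\<omega> \<in> space M. \<bar>Z n \<omega>\<bar> > e}) \<longlonglongrightarrow> 0"
    by (rule tendsto_sandwich[OF _ le tendsto_const lim]) auto
qed

lemma (in prob_space) small_oP_add: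
  assumes [measurable]: "\<And>n. X n \<in> borel_measurable M" "\<And>n. Y n \<in> borel_measurable M"
    and "small_oP M X" "small_oP M Y"
  shows "small_oP M (\<lambda>n \<omega>. X n \<omega> + Y n \<omega>)"
proof (rule small_oP_subset[OF _ assms])
  fix e :: real assume "e > 0"
  then show "\<exists>d>0. \<exists>d'>0. \<forall>\<^sub>F n in sequentially. {\<omega> \<in> space M. \<bar>X n \<omega> + Y n \<omega>\<bar> > e} \<subseteq>
      {\<omega> \<in> space M. \<bar>X n \<omega>\<bar> > d} \<union> {\<omega> \<in> space M. \<bar>Y n \<omega>\<bar> > d'}"
    by (intro exI[of _ "e/2"] conjI always_eventually) (auto simp: abs_if split: if_splits)
qed

lemma (in prob_space) small_oP_cong:
  assumes "\<forall>\<^sub>F n in sequentially. \<forall>\<omega>\<in>space M. Z n \<omega> = X n \<omega>" "small_oP M X"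
  shows "small_oP M Z"
  unfolding small_oP_def
proof safe
  fix e :: real assume "e > 0"
  then have "(\<lambda>n. prob {\<omega> \<in> space M. \<bar>X n \<omega>\<bar> > e}) \<longlonglongrightarrow> 0"
    using assms(2) by (simp add: small_oP_def)
  then show "(\<lambda>n. prob {\<omega> \<in> space M. \<bar>Z n \<omega>\<bar> > e}) \<longlonglongrightarrow> 0"
    by (rule Lim_transform_eventually)
       (use assms(1) in \<open>eventually_elim, auto intro!: arg_cong[where f=prob]\<close>)
qed

lemma (in prob_space) small_oP_bounded_mult:
  assumes [measurable]: "\<And>n. X n \<in> borel_measurable M" and X: "small_oP M X"
    and c: "\<forall>\<^sub>F n in sequentially. \<bar>c n\<bar> \<le> C"
  shows "small_oP M (\<lambda>n \<omega>. c n * X n \<omega>)"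
proof (rule small_oP_subset[OF _ _ _ X X])
  fix e :: real assume e: "e > 0"
  let ?C = "max 1 C"
  show "\<exists>d>0. \<exists>d'>0. \<forall>\<^sub>F n in sequentially. {\<omega> \<in> space M. \<bar>c n * X n \<omega>\<bar> > e} \<subseteq>
      {\<omega> \<in> space M. \<bar>X n \<omega>\<bar> > d} \<union> {\<omega> \<in> space M. \<bar>X n \<omega>\<bar> > d'}"
  proof (intro exI[of _ "e / ?C"] conjI)
    show "\<forall>\<^sub>F n in sequentially. {\<omega> \<in> space M. \<bar>c n * X n \<omega>\<bar> > e} \<subseteq>
      {\<omega> \<in> space M. \<bar>X n \<omega>\<bar> > e / ?C} \<union> {\<omega> \<in> space M. \<bar>X n \<omega>\<bar> > e / ?C}"
      using c
    proof eventually_elim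
      case (elim n)
      have "\<bar>X n \<omega>\<bar> > e / ?C" if "\<bar>c n * X n \<omega>\<bar> > e" for \<omega>
      proof -
        have "e < \<bar>c n\<bar> * \<bar>X n \<omega>\<bar>" using that by (simp add: abs_mult)
        also have "\<dots> \<le> ?C * \<bar>X n \<omega>\<bar>" using elim by (intro mult_right_mono) auto
        finally show ?thesis by (simp add: field_simps)
      qed
      then show ?case by auto
    qed
  qed (use e in auto)
qed auto

text \<open>A sequence bounded in L^2 is tight: outside an event of probability at most r/2,
  \<open>A n\<close> stays below a level \<open>L\<close>, and there \<open>U n\<close> only has to
  be small compared with \<open>e / L\<close>.\<close>

lemma (in prob_space) small_oP_mult_tight:
  fixes A U :: "nat \<Rightarrow> 'a \<Rightarrow> real"
  assumes [measurable]: "\<And>n. A n \<in> borel_measurable M" "\<And>n. U n \<in> borel_measurable M"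
    and bd: "\<forall>\<^sub>F n in sequentially. integrable M (\<lambda>\<omega>. (A n \<omega>)\<^sup>2) \<and> expectation (\<lambda>\<omega>. (A n \<omega>)\<^sup>2) \<le> C"
    and U: "small_oP M U"
  shows "small_oP M (\<lambda>n \<omega>. U n \<omega> * A n \<omega>)"
  unfolding small_oP_def
proof safe
  fix e :: real assume e: "e > 0"
  show "(\<lambda>n. prob {\<omega> \<in> space M. \<bar>U n \<omega> * A n \<omega>\<bar> > e}) \<longlonglongrightarrow> 0"
  proof (rule LIMSEQ_I)
    fix r :: real assume r: "r > 0"
    \<comment> \<open>Chebyshev at level \<open>L\<close> costs at most r/2; \<open>max 1 C\<close>
      keeps \<open>L\<close> positive for every \<open>C\<close>.\<close>
    define L where "L = sqrt (2 * max 1 C / r)"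
    have L: "L > 0" "L\<^sup>2 = 2 * max 1 C / r" unfolding L_def using r by auto
    have "(\<lambda>n. prob {\<omega> \<in> space M. \<bar>U n \<omega>\<bar> > e / L}) \<longlonglongrightarrow> 0"
      using U e L unfolding small_oP_def by auto
    from order_tendstoD(2)[OF this, of "r/2"] r
    have evU: "\<forall>\<^sub>F n in sequentially. prob {\<omega> \<in> space M. \<bar>U n \<omega>\<bar> > e / L} < r / 2" by simp
    have "\<forall>\<^sub>F n in sequentially. prob {\<omega> \<in> space M. \<bar>U n \<omega> * A n \<omega>\<bar> > e} < r"
      using evU bd
    proof eventually_elim
      case (elim n)
      have "prob {\<omega> \<in> space M. \<bar>A n \<omega>\<bar> \<ge> L} \<le> prob {\<omega> \<in> space M. (A n \<omega>)\<^sup>2 \<ge> L\<^sup>2}"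
        using L(1) by (intro finite_measure_mono) (auto intro: power_mono simp flip: abs_le_square_iff)
      also have "\<dots> \<le> expectation (\<lambda>\<omega>. (A n \<omega>)\<^sup>2) / L\<^sup>2"
        using elim L(1) by (intro integral_Markov_inequality_measure[where A="{}"]) auto
      also have "\<dots> \<le> max 1 C / L\<^sup>2"
        using elim by (intro divide_right_mono) auto
      also have "\<dots> = r / 2" using L r by (simp add: field_simps)
      finally have 1: "prob {\<omega> \<in> space M. \<bar>A n \<omega>\<bar> \<ge> L} \<le> r / 2" .
      have "\<bar>U n \<omega>\<bar> > e / L \<or> \<bar>A n \<omega>\<bar> \<ge> L" if "\<bar>U n \<omega> * A n \<omega>\<bar> > e" for \<omega>
      proof (rule ccontr)
        assume "\<not> ?thesis"
        then have "\<bar>U n \<omega>\<bar> \<le> e / L" "\<bar>A n \<omega>\<bar> \<le> L" by auto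
        then have "\<bar>U n \<omega>\<bar> * \<bar>A n \<omega>\<bar> \<le> (e / L) * L" using e L by (intro mult_mono) auto
        then show False using that L by (simp add: abs_mult)
      qed
      then have "prob {\<omega> \<in> space M. \<bar>U n \<omega> * A n \<omega>\<bar> > e} \<le>
          prob ({\<omega> \<in> space M. \<bar>U n \<omega>\<bar> > e / L} \<union> {\<omega> \<in> space M. \<bar>A n \<omega>\<bar> \<ge> L})"
        by (intro finite_measure_mono) auto
      also have "\<dots> \<le> prob {\<omega> \<in> space M. \<bar>U n \<omega>\<bar> > e / L} + prob {\<omega> \<in> space M. \<bar>A n \<omega>\<bar> \<ge> L}"
        by (intro measure_Un_le) auto
      also have "\<dots> < r" using 1 elim by linarith
      finally show ?case .
    qed
    then show "\<exists>no. \<forall>n\<ge>no. norm (prob {\<omega> \<in> space M. \<bar>U n \<omega> * A n \<omega>\<bar> > e} - 0) < r"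
      by (simp add: eventually_sequentially)
  qed
qed

text \<open>Continuity at the constant limit \<open>a\<close> is enough, which admits y |-> 1 / sqrt
  (\<kappa>1 * y) at a positive limit despite its singularity at 0.\<close>

lemma (in prob_space) small_oP_continuous:
  fixes X :: "nat \<Rightarrow> 'a \<Rightarrow> real" and g :: "real \<Rightarrow> real"
  assumes [measurable]: "\<And>n. X n \<in> borel_measurable M"
    and X: "small_oP M (\<lambda>n \<omega>. X n \<omega> - a)" and g: "isCont g a"
  shows "small_oP M (\<lambda>n \<omega>. g (X n \<omega>) - g a)"
proof (rule small_oP_subset[OF _ _ _ X X])
  fix e :: real assume e: "e > 0"
  then obtain d where d: "d > 0" "\<And>y. \<bar>y - a\<bar> < d \<Longrightarrow> \<bar>g y - g a\<bar> < e"
    using g unfolding continuous_at_eps_delta dist_real_def by meson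
  have *: "d / 2 < \<bar>y - a\<bar>" if "e < \<bar>g y - g a\<bar>" for y
    using d(2)[of y] that d(1) by (cases "\<bar>y - a\<bar> < d") auto
  show "\<exists>d>0. \<exists>d'>0. \<forall>\<^sub>F n in sequentially. {\<omega> \<in> space M. \<bar>g (X n \<omega>) - g a\<bar> > e} \<subseteq>
      {\<omega> \<in> space M. \<bar>X n \<omega> - a\<bar> > d} \<union> {\<omega> \<in> space M. \<bar>X n \<omega> - a\<bar> > d'}"
    using d * by (intro exI[of _ "d/2"] conjI always_eventually) auto
qed auto

lemma norm_iexp_diff_le: "norm (iexp a - iexp b) \<le> \<bar>a - b\<bar>"
proof -
  have "iexp a - iexp b = iexp b * (iexp (a - b) - 1)"
    by (simp add: algebra_simps flip: exp_add)
  then have "norm (iexp a - iexp b) = norm (iexp (a - b) - 1)"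
    by (simp add: norm_mult)
  also have "\<dots> \<le> \<bar>a - b\<bar>" using iexp_approx1[of "a - b" 0] by simp
  finally show ?thesis .
qed

text \<open>Slutsky's lemma for characteristic functions: the integrands differ by at most |t| e
  where \<open>R n\<close> and \<open>A n\<close> are close, and by at most 2 elsewhere. With
  \<open>A\<close> equal to 0 it later turns a negligible sum into a characteristic function tending
  to 1.\<close>

lemma (in prob_space) small_oP_char:
  fixes A R :: "nat \<Rightarrow> 'a \<Rightarrow> real"
  assumes [measurable]: "\<And>n. A n \<in> borel_measurable M" "\<And>n. R n \<in> borel_measurable M"
    and R: "small_oP M (\<lambda>n \<omega>. R n \<omega> - A n \<omega>)"
    and A: "(\<lambda>n. \<integral>\<omega>. iexp (t * A n \<omega>) \<partial>M) \<longlonglongrightarrow> l"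
  shows "(\<lambda>n. \<integral>\<omega>. iexp (t * R n \<omega>) \<partial>M) \<longlonglongrightarrow> l"
proof -
  have "(\<lambda>n. (\<integral>\<omega>. iexp (t * R n \<omega>) \<partial>M) - (\<integral>\<omega>. iexp (t * A n \<omega>) \<partial>M)) \<longlonglongrightarrow> 0"
  proof (rule LIMSEQ_I)
    fix r :: real assume r: "r > 0"
    \<comment> \<open>Dividing by |t| + 1 gives |t| e <= r/2 and is meaningful at t = 0 too.\<close>
    define e where "e = r / (2 * (\<bar>t\<bar> + 1))"
    have e: "e > 0" unfolding e_def using r by (simp add: add_pos_nonneg)
    have te: "\<bar>t\<bar> * e \<le> r / 2"
    proof -
      have "(\<bar>t\<bar> + 1) * e = r / 2" unfolding e_def by (simp add: field_simps add_pos_nonneg)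
      then show ?thesis using e by (simp add: algebra_simps)
    qed
    have "(\<lambda>n. prob {\<omega> \<in> space M. \<bar>R n \<omega> - A n \<omega>\<bar> > e}) \<longlonglongrightarrow> 0"
      using R e unfolding small_oP_def by auto
    from order_tendstoD(2)[OF this, of "r/4"] r
    have "\<forall>\<^sub>F n in sequentially. prob {\<omega> \<in> space M. \<bar>R n \<omega> - A n \<omega>\<bar> > e} < r / 4" by simp
    then have "\<forall>\<^sub>F n in sequentially. norm ((\<integral>\<omega>. iexp (t * R n \<omega>) \<partial>M) - (\<integral>\<omega>. iexp (t * A n \<omega>) \<partial>M)) < r"
    proof eventually_elim
      case (elim n)
      let ?S = "{\<omega> \<in> space M. \<bar>R n \<omega> - A n \<omega>\<bar> > e}"
      have i: "integrable M (\<lambda>\<omega>. iexp (t * R n \<omega>))" "integrable M (\<lambda>\<omega>. iexp (t * A n \<omega>))"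
        by (auto intro!: integrable_const_bound[where B=1])
      have "norm ((\<integral>\<omega>. iexp (t * R n \<omega>) \<partial>M) - (\<integral>\<omega>. iexp (t * A n \<omega>) \<partial>M))
          = norm (\<integral>\<omega>. iexp (t * R n \<omega>) - iexp (t * A n \<omega>) \<partial>M)"
        using i by simp
      also have "\<dots> \<le> (\<integral>\<omega>. norm (iexp (t * R n \<omega>) - iexp (t * A n \<omega>)) \<partial>M)"
        by (rule integral_norm_bound)
      also have "\<dots> \<le> (\<integral>\<omega>. \<bar>t\<bar> * e + 2 * indicator ?S \<omega> \<partial>M)"
      proof (rule integral_mono)
        show "integrable M (\<lambda>\<omega>. cmod (iexp (t * R n \<omega>) - iexp (t * A n \<omega>)))"
          using i by (intro integrable_norm Bochner_Integration.integrable_diff)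
        show "integrable M (\<lambda>\<omega>. \<bar>t\<bar> * e + 2 * indicator ?S \<omega>)"
          by (intro integrable_const_bound[where B="\<bar>t\<bar> * e + 2"]) (use e in \<open>auto simp: indicator_def\<close>)
        fix \<omega> assume w: "\<omega> \<in> space M"
        show "cmod (iexp (t * R n \<omega>) - iexp (t * A n \<omega>)) \<le> \<bar>t\<bar> * e + 2 * indicator ?S \<omega>"
        proof (cases "\<omega> \<in> ?S")
          case True
          have "cmod (iexp (t * R n \<omega>) - iexp (t * A n \<omega>)) \<le> cmod (iexp (t * R n \<omega>)) + cmod (iexp (t * A n \<omega>))"
            by (rule norm_triangle_ineq4)
          also have "\<dots> = 2" by simp
          finally show ?thesis using True e by (simp add: add_increasing)
        next
          case False
          then have "\<bar>t * R n \<omega> - t * A n \<omega>\<bar> \<le> \<bar>t\<bar> * e"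
            using w by (auto simp: abs_mult simp flip: right_diff_distrib intro!: mult_left_mono)
          then show ?thesis using False norm_iexp_diff_le[of "t * R n \<omega>" "t * A n \<omega>"] by simp
        qed
      qed
      also have "\<dots> = \<bar>t\<bar> * e + 2 * prob ?S"
        by (subst Bochner_Integration.integral_add) (auto simp: prob_space less_top[symmetric] intro!: integrable_real_indicator)
      also have "\<dots> < r" using te elim by linarith
      finally show ?case .
    qed
    then show "\<exists>no. \<forall>n\<ge>no. norm ((\<integral>\<omega>. iexp (t * R n \<omega>) \<partial>M) - (\<integral>\<omega>. iexp (t * A n \<omega>) \<partial>M) - 0) < r"
      by (simp add: eventually_sequentially)
  qed
  from tendsto_add[OF this A] show ?thesis by simp
qed

section \<open>Regressors with an independent innovation\<close>

text \<open>The sample point itself is the first coordinate, so that any number of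
  \<open>F\<close>-measurable quantities can be held fixed while \<xi> is integrated out.\<close>

lemma (in prob_space) distr_pair_indep_subalgebra:
  fixes \<xi> :: "'a \<Rightarrow> real"
  assumes F: "subalgebra M F" and \<xi>[measurable]: "\<xi> \<in> borel_measurable M"
    and ind: "indep_set (sets F) (sets (vimage_algebra (space M) \<xi> borel))"
  shows "restr_to_subalg M F \<Otimes>\<^sub>M distr M borel \<xi> = distr M (F \<Otimes>\<^sub>M borel) (\<lambda>\<omega>. (\<omega>, \<xi> \<omega>))"
proof (rule pair_measure_eqI)
  interpret X: prob_space "distr M borel \<xi>" by (rule prob_space_distr) simp
  interpret R: prob_space "restr_to_subalg M F" by (rule prob_space_restr_to_subalg[OF F prob_space_axioms])
  show "sigma_finite_measure (restr_to_subalg M F)" "sigma_finite_measure (distr M borel \<xi>)"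
    by unfold_locales
  show "sets (restr_to_subalg M F \<Otimes>\<^sub>M distr M borel \<xi>) = sets (distr M (F \<Otimes>\<^sub>M borel) (\<lambda>\<omega>. (\<omega>, \<xi> \<omega>)))"
    by (simp add: sets_restr_to_subalg[OF F] cong: sets_pair_measure_cong)
  fix A B assume "A \<in> sets (restr_to_subalg M F)" "B \<in> sets (distr M borel \<xi>)"
  then have A: "A \<in> sets F" and B[measurable]: "B \<in> sets borel"
    by (auto simp: sets_restr_to_subalg[OF F])
  have AM[measurable]: "A \<in> sets M" using A F by (auto simp: subalgebra_def)
  have id: "(\<lambda>\<omega>. \<omega>) \<in> measurable M F" using F by (auto simp: subalgebra_def measurable_def)
  have m: "(\<lambda>\<omega>. (\<omega>, \<xi> \<omega>)) \<in> measurable M (F \<Otimes>\<^sub>M borel)" using id by measurable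
  have "emeasure (distr M (F \<Otimes>\<^sub>M borel) (\<lambda>\<omega>. (\<omega>, \<xi> \<omega>))) (A \<times> B) = emeasure M (A \<inter> (\<xi> -` B \<inter> space M))"
    using A B sets.sets_into_space[OF AM]
    by (subst emeasure_distr[OF m]) (auto intro!: arg_cong[where f="emeasure M"])
  also have "\<dots> = emeasure M A * emeasure M (\<xi> -` B \<inter> space M)"
    using indep_setD[OF ind A in_vimage_algebra[OF B, of \<xi> "space M"]]
    by (simp add: emeasure_eq_measure flip: ennreal_mult)
  also have "\<dots> = emeasure (restr_to_subalg M F) A * emeasure (distr M borel \<xi>) B"
    by (simp add: emeasure_restr_to_subalg[OF F A] emeasure_distr)
  finally show "emeasure (restr_to_subalg M F) A * emeasure (distr M borel \<xi>) B =
     emeasure (distr M (F \<Otimes>\<^sub>M borel) (\<lambda>\<omega>. (\<omega>, \<xi> \<omega>))) (A \<times> B)" ..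
qed

text \<open>\<open>F\<close> is the past and \<open>W\<close> the predictable part of the regressor:
  given \<open>F\<close>, the regressor W + \<xi> has the density z |-> p (z - W).\<close>

locale innovation = prob_space M for M :: "'a measure" +
  fixes F :: "'a measure" and \<xi> W :: "'a \<Rightarrow> real" and p :: "real \<Rightarrow> real"
  assumes sub: "subalgebra M F"
    and \<xi>_meas: "\<xi> \<in> borel_measurable M"
    and W_meas: "W \<in> borel_measurable F"
    and ind: "indep_set (sets F) (sets (vimage_algebra (space M) \<xi> borel))"
    and p_nonneg: "\<And>y. p y \<ge> 0"
    and p_meas: "p \<in> borel_measurable borel"
    and dens: "distr M borel \<xi> = density lborel (\<lambda>y. ennreal (p y))"
begin

lemma meas_F: "f \<in> measurable F N \<Longrightarrow> f \<in> measurable M N"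
  using measurable_from_subalg[OF sub] .

text \<open>Conditioning on \<open>F\<close>, written as an iterated integral. The substitution z =
  W + y moves the dependence on \<open>W\<close> out of the arbitrary \<Phi> and into the density
  \<open>p\<close>, which will be smooth. The nonnegative version is kept separate because it is the
  one that yields integrability.\<close>

lemma nn_integral_freeze:
  fixes \<Phi> :: "'a \<times> real \<Rightarrow> ennreal"
  assumes [measurable]: "\<Phi> \<in> borel_measurable (F \<Otimes>\<^sub>M borel)"
  shows "(\<integral>\<^sup>+\<omega>. \<Phi> (\<omega>, W \<omega> + \<xi> \<omega>) \<partial>M) = (\<integral>\<^sup>+\<omega>. (\<integral>\<^sup>+z. ennreal (p (z - W \<omega>)) * \<Phi> (\<omega>, z) \<partial>lborel) \<partial>M)"
proof -
  note [measurable] = \<xi>_meas W_meas p_meas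
  interpret X: prob_space "distr M borel \<xi>" by (rule prob_space_distr) simp
  have [measurable_cong]: "sets (restr_to_subalg M F) = sets F" by (rule sets_restr_to_subalg[OF sub])
  have id: "(\<lambda>\<omega>. \<omega>) \<in> measurable M F" using sub by (auto simp: subalgebra_def measurable_def)
  have m: "(\<lambda>\<omega>. (\<omega>, \<xi> \<omega>)) \<in> measurable M (F \<Otimes>\<^sub>M borel)" using id by measurable
  have "(\<integral>\<^sup>+\<omega>. \<Phi> (\<omega>, W \<omega> + \<xi> \<omega>) \<partial>M)
      = (\<integral>\<^sup>+q. \<Phi> (fst q, W (fst q) + snd q) \<partial>distr M (F \<Otimes>\<^sub>M borel) (\<lambda>\<omega>. (\<omega>, \<xi> \<omega>)))"
    by (subst nn_integral_distr[OF m]) auto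
  also have "\<dots> = (\<integral>\<^sup>+q. \<Phi> (fst q, W (fst q) + snd q) \<partial>(restr_to_subalg M F \<Otimes>\<^sub>M distr M borel \<xi>))"
    by (simp add: distr_pair_indep_subalgebra[OF sub \<xi>_meas ind])
  also have "\<dots> = (\<integral>\<^sup>+\<omega>. (\<integral>\<^sup>+y. \<Phi> (\<omega>, W \<omega> + y) \<partial>distr M borel \<xi>) \<partial>restr_to_subalg M F)"
    by (subst X.nn_integral_fst[symmetric]) auto
  also have "\<dots> = (\<integral>\<^sup>+\<omega>. (\<integral>\<^sup>+y. \<Phi> (\<omega>, W \<omega> + y) \<partial>distr M borel \<xi>) \<partial>M)"
    by (intro nn_integral_subalgebra2[OF sub]) measurable
  also have "\<dots> = (\<integral>\<^sup>+\<omega>. (\<integral>\<^sup>+z. ennreal (p (z - W \<omega>)) * \<Phi> (\<omega>, z) \<partial>lborel) \<partial>M)"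
  proof (rule nn_integral_cong)
    fix \<omega> assume "\<omega> \<in> space M"
    then have [measurable]: "(\<lambda>z. \<Phi> (\<omega>, z)) \<in> borel_measurable borel"
      using sub by (auto simp: subalgebra_def intro!: measurable_compose[OF _ assms])
    have "(\<integral>\<^sup>+y. \<Phi> (\<omega>, W \<omega> + y) \<partial>distr M borel \<xi>) = (\<integral>\<^sup>+y. ennreal (p y) * \<Phi> (\<omega>, W \<omega> + y) \<partial>lborel)"
      unfolding dens by (subst nn_integral_density) auto
    also have "\<dots> = (\<integral>\<^sup>+z. ennreal (p (z - W \<omega>)) * \<Phi> (\<omega>, z) \<partial>lborel)"
      by (subst nn_integral_real_affine[where c=1 and t="W \<omega>", of "\<lambda>z. ennreal (p (z - W \<omega>)) * \<Phi> (\<omega>, z)"]) auto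
    finally show "(\<integral>\<^sup>+y. \<Phi> (\<omega>, W \<omega> + y) \<partial>distr M borel \<xi>) = (\<integral>\<^sup>+z. ennreal (p (z - W \<omega>)) * \<Phi> (\<omega>, z) \<partial>lborel)" .
  qed
  finally show ?thesis .
qed

lemma integral_freeze:
  fixes \<Phi> :: "'a \<times> real \<Rightarrow> 'c :: {banach, second_countable_topology}"
  assumes [measurable]: "\<Phi> \<in> borel_measurable (F \<Otimes>\<^sub>M borel)"
    and int: "integrable M (\<lambda>\<omega>. \<Phi> (\<omega>, W \<omega> + \<xi> \<omega>))"
  shows "(\<integral>\<omega>. \<Phi> (\<omega>, W \<omega> + \<xi> \<omega>) \<partial>M) = (\<integral>\<omega>. (\<integral>z. p (z - W \<omega>) *\<^sub>R \<Phi> (\<omega>, z) \<partial>lborel) \<partial>M)"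
proof -
  note [measurable] = \<xi>_meas W_meas p_meas
  interpret X: prob_space "distr M borel \<xi>" by (rule prob_space_distr) simp
  interpret R: prob_space "restr_to_subalg M F" by (rule prob_space_restr_to_subalg[OF sub prob_space_axioms])
  interpret P: pair_sigma_finite "restr_to_subalg M F" "distr M borel \<xi>" ..
  have [measurable_cong]: "sets (restr_to_subalg M F) = sets F" by (rule sets_restr_to_subalg[OF sub])
  have id: "(\<lambda>\<omega>. \<omega>) \<in> measurable M F" using sub by (auto simp: subalgebra_def measurable_def)
  have m: "(\<lambda>\<omega>. (\<omega>, \<xi> \<omega>)) \<in> measurable M (F \<Otimes>\<^sub>M borel)" using id by measurable
  have eq: "distr M (F \<Otimes>\<^sub>M borel) (\<lambda>\<omega>. (\<omega>, \<xi> \<omega>)) = restr_to_subalg M F \<Otimes>\<^sub>M distr M borel \<xi>"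
    by (simp add: distr_pair_indep_subalgebra[OF sub \<xi>_meas ind])
  have I: "integrable (distr M (F \<Otimes>\<^sub>M borel) (\<lambda>\<omega>. (\<omega>, \<xi> \<omega>))) (\<lambda>q. \<Phi> (fst q, W (fst q) + snd q))"
    by (subst integrable_distr_eq[OF m]) (use int in auto)
  have "(\<integral>\<omega>. \<Phi> (\<omega>, W \<omega> + \<xi> \<omega>) \<partial>M)
      = (\<integral>q. \<Phi> (fst q, W (fst q) + snd q) \<partial>distr M (F \<Otimes>\<^sub>M borel) (\<lambda>\<omega>. (\<omega>, \<xi> \<omega>)))"
    by (subst integral_distr[OF m]) auto
  also have "\<dots> = (\<integral>q. \<Phi> (fst q, W (fst q) + snd q) \<partial>(restr_to_subalg M F \<Otimes>\<^sub>M distr M borel \<xi>))"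
    by (simp add: eq)
  also have "\<dots> = (\<integral>\<omega>. (\<integral>y. \<Phi> (\<omega>, W \<omega> + y) \<partial>distr M borel \<xi>) \<partial>restr_to_subalg M F)"
    using I[unfolded eq] by (subst P.integral_fst'[symmetric]) auto
  also have "\<dots> = (\<integral>\<omega>. (\<integral>y. \<Phi> (\<omega>, W \<omega> + y) \<partial>distr M borel \<xi>) \<partial>M)"
    by (intro integral_subalgebra2[OF sub]) measurable
  also have "\<dots> = (\<integral>\<omega>. (\<integral>z. p (z - W \<omega>) *\<^sub>R \<Phi> (\<omega>, z) \<partial>lborel) \<partial>M)"
  proof (rule Bochner_Integration.integral_cong)
    fix \<omega> assume "\<omega> \<in> space M"
    then have [measurable]: "(\<lambda>z. \<Phi> (\<omega>, z)) \<in> borel_measurable borel"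
      using sub by (auto simp: subalgebra_def intro!: measurable_compose[OF _ assms(1)])
    have "(\<integral>y. \<Phi> (\<omega>, W \<omega> + y) \<partial>distr M borel \<xi>) = (\<integral>y. p y *\<^sub>R \<Phi> (\<omega>, W \<omega> + y) \<partial>lborel)"
      unfolding dens using p_nonneg by (subst integral_density) auto
    also have "\<dots> = (\<integral>z. p (z - W \<omega>) *\<^sub>R \<Phi> (\<omega>, z) \<partial>lborel)"
      by (subst lborel_integral_real_affine[where c=1 and t="W \<omega>", of "\<lambda>z. p (z - W \<omega>) *\<^sub>R \<Phi> (\<omega>, z)"]) auto
    finally show "(\<integral>y. \<Phi> (\<omega>, W \<omega> + y) \<partial>distr M borel \<xi>) = (\<integral>z. p (z - W \<omega>) *\<^sub>R \<Phi> (\<omega>, z) \<partial>lborel)" .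
  qed simp
  finally show ?thesis .
qed

lemma p_integral: "integrable lborel p" "(\<integral>y. p y \<partial>lborel) = 1"
proof -
  note [measurable] = \<xi>_meas p_meas
  interpret X: prob_space "distr M borel \<xi>" by (rule prob_space_distr) simp
  have "emeasure (distr M borel \<xi>) UNIV = 1" using X.emeasure_space_1 by simp
  then have "(\<integral>\<^sup>+y. ennreal (p y) \<partial>lborel) = 1"
    unfolding dens by (subst (asm) emeasure_density) auto
  then show "integrable lborel p" "(\<integral>y. p y \<partial>lborel) = 1"
    using p_nonneg by (auto intro!: integrableI_nn_integral_finite[where x=1] simp: integral_eq_nn_integral)
qed

lemma p_shift_integral: "integrable lborel (\<lambda>z. p (z - w))" "(\<integral>z. p (z - w) \<partial>lborel) = 1"
proof -
  show "integrable lborel (\<lambda>z. p (z - w))"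
    using lborel_integrable_real_affine[OF p_integral(1), of 1 "-w"] by (simp add: algebra_simps)
  show "(\<integral>z. p (z - w) \<partial>lborel) = 1"
    using p_integral(2) lborel_integral_real_affine[of 1 p "-w"] by (simp add: algebra_simps)
qed

end

lemma
  fixes q g :: "real \<Rightarrow> real"
  assumes [measurable]: "g \<in> borel_measurable borel" and q: "integrable lborel q" "\<And>z. q z \<ge> 0" "(\<integral>z. q z \<partial>lborel) = 1"
    and g2: "integrable lborel (\<lambda>z. q z * (g z)\<^sup>2)"
  shows weighted_integrable_first: "integrable lborel (\<lambda>z. q z * g z)"
    and weighted_variance_integrable: "integrable lborel (\<lambda>z. q z * (g z - c)\<^sup>2)"
    and weighted_variance: "(\<integral>z. q z * (g z - (\<integral>z. q z * g z \<partial>lborel))\<^sup>2 \<partial>lborel)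
          = (\<integral>z. q z * (g z)\<^sup>2 \<partial>lborel) - (\<integral>z. q z * g z \<partial>lborel)\<^sup>2"
proof -
  have [measurable]: "q \<in> borel_measurable borel" using q(1) by auto
  show i: "integrable lborel (\<lambda>z. q z * g z)"
  proof (rule Bochner_Integration.integrable_bound)
    show "integrable lborel (\<lambda>z. q z + q z * (g z)\<^sup>2)" using q g2 by auto
    have "q z * \<bar>g z\<bar> \<le> q z + q z * (g z)\<^sup>2" for z
    proof -
      have "0 \<le> (\<bar>g z\<bar> - 1)\<^sup>2" by simp
      then have "2 * \<bar>g z\<bar> \<le> 1 + (g z)\<^sup>2" by (simp add: power2_diff)
      then have "\<bar>g z\<bar> \<le> 1 + (g z)\<^sup>2" by linarith
      from mult_left_mono[OF this q(2)[of z]] show ?thesis by (simp add: algebra_simps)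
    qed
    then show "AE z in lborel. norm (q z * g z) \<le> norm (q z + q z * (g z)\<^sup>2)"
      using q(2) by (auto simp: abs_mult)
  qed simp
  have e: "q z * (g z - c)\<^sup>2 = q z * (g z)\<^sup>2 - 2 * c * (q z * g z) + c\<^sup>2 * q z" for z c
    by (simp add: power2_eq_square algebra_simps)
  show "integrable lborel (\<lambda>z. q z * (g z - c)\<^sup>2)" unfolding e using i q g2 by auto
  show "(\<integral>z. q z * (g z - (\<integral>z. q z * g z \<partial>lborel))\<^sup>2 \<partial>lborel)
          = (\<integral>z. q z * (g z)\<^sup>2 \<partial>lborel) - (\<integral>z. q z * g z \<partial>lborel)\<^sup>2"
    unfolding e using i q g2 by (simp add: power2_eq_square)
qed

text \<open>The conditional mean of g (W + \<xi>) given W = w, a convolution with the reflected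
  density. Smoothness in \<open>w\<close> comes from \<open>p\<close> alone, so \<open>g\<close> may
  be as rough as a kernel.\<close>

definition shift_mean :: "(real \<Rightarrow> real) \<Rightarrow> (real \<Rightarrow> 'c::{banach, second_countable_topology}) \<Rightarrow> real \<Rightarrow> 'c" where
  "shift_mean p g w = (\<integral>z. p (z - w) *\<^sub>R g z \<partial>lborel)"

lemma shift_mean_measurable [measurable]:
  assumes [measurable]: "p \<in> borel_measurable borel" "g \<in> borel_measurable borel"
  shows "shift_mean p g \<in> borel_measurable borel"
  unfolding shift_mean_def by measurable

text \<open>Innovation \<open>i\<close> is independent of \<open>F i\<close> and becomes known in
  \<open>F (Suc i)\<close>: \<open>F i\<close> is the past strictly before regressor
  \<open>i\<close>.\<close>

locale innovations = prob_space M for M :: "'a measure" +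
  fixes F :: "nat \<Rightarrow> 'a measure" and \<xi> W :: "nat \<Rightarrow> 'a \<Rightarrow> real" and p :: "real \<Rightarrow> real"
  assumes inn: "\<And>i. innovation M (F i) (\<xi> i) (W i) p"
    and mono: "\<And>i j. i \<le> j \<Longrightarrow> sets (F i) \<subseteq> sets (F j)"
    and adapted: "\<And>i. \<xi> i \<in> borel_measurable (F (Suc i))"
begin

lemma innD:
  shows "subalgebra M (F i)" "\<xi> i \<in> borel_measurable M" "W i \<in> borel_measurable (F i)"
    "W i \<in> borel_measurable M" "p y \<ge> 0" "p \<in> borel_measurable borel"
  using inn[of i] innovation.meas_F[OF inn[of i]] by (auto simp: innovation_def innovation_axioms_def)

lemma measurable_F_mono: "f \<in> measurable (F i) N \<Longrightarrow> i \<le> j \<Longrightarrow> f \<in> measurable (F j) N"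
  using mono[of i j] innD(1)[of i] innD(1)[of j] by (auto simp: measurable_def subalgebra_def)

lemma measurable_F_M: "f \<in> measurable (F i) N \<Longrightarrow> f \<in> measurable M N"
  by (rule innovation.meas_F[OF inn])

abbreviation "X i \<omega> \<equiv> W i \<omega> + \<xi> i \<omega>"

lemma X_measurable: "X i \<in> borel_measurable M"
  using innD(2,4) by measurable

lemma X_measurable_F: "i < j \<Longrightarrow> X i \<in> borel_measurable (F j)"
  using measurable_F_mono[OF adapted[of i], of j] measurable_F_mono[OF innD(3)[of i], of j]
  by (intro borel_measurable_add) auto

text \<open>Given the past the weight \<open>e\<close> is a constant and the variance is at most the
  second moment \<open>C\<close>. Estimating the nonnegative integral proves integrability and the
  bound together.\<close>

lemma square_innovation:
  fixes g :: "real \<Rightarrow> real" and e :: "'a \<Rightarrow> real"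
  assumes g[measurable]: "g \<in> borel_measurable borel"
    and g2: "\<And>w. integrable lborel (\<lambda>z. p (z - w) * (g z)\<^sup>2)" "\<And>w. (\<integral>z. p (z - w) * (g z)\<^sup>2 \<partial>lborel) \<le> C"
    and e: "e \<in> borel_measurable (F i)" "integrable M (\<lambda>\<omega>. (e \<omega>)\<^sup>2)"
  shows "integrable M (\<lambda>\<omega>. (e \<omega> * (g (X i \<omega>) - shift_mean p g (W i \<omega>)))\<^sup>2)"
    and "expectation (\<lambda>\<omega>. (e \<omega> * (g (X i \<omega>) - shift_mean p g (W i \<omega>)))\<^sup>2) \<le> C * expectation (\<lambda>\<omega>. (e \<omega>)\<^sup>2)"
proof -
  interpret I: innovation M "F i" "\<xi> i" "W i" p by (rule inn)
  note [measurable] = innD(2,3,4,6) e(1) measurable_F_M[OF e(1)]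
  let ?R = "shift_mean p g"
  have C: "0 \<le> C"
    using innD(5) by (intro order_trans[OF _ g2(2)[of 0]] Bochner_Integration.integral_nonneg) auto
  have bd: "(\<integral>\<^sup>+z. ennreal (p (z - w)) * ennreal ((a * (g z - ?R w))\<^sup>2) \<partial>lborel) \<le> ennreal (C * a\<^sup>2)" for a w
  proof -
    have v: "(\<integral>z. p (z - w) * (g z - ?R w)\<^sup>2 \<partial>lborel) \<le> C"
      using weighted_variance[of g "\<lambda>z. p (z - w)"] I.p_shift_integral[of w] innD(5) g2[of w]
      unfolding shift_mean_def real_scaleR_def by (smt (verit) g zero_le_power2)
    have i: "integrable lborel (\<lambda>z. p (z - w) * (g z - ?R w)\<^sup>2)"
      using weighted_variance_integrable[of g "\<lambda>z. p (z - w)"] I.p_shift_integral[of w] innD(5) g2[of w] g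
      by auto
    have "(\<integral>\<^sup>+z. ennreal (p (z - w)) * ennreal ((a * (g z - ?R w))\<^sup>2) \<partial>lborel)
        = (\<integral>\<^sup>+z. ennreal (a\<^sup>2 * (p (z - w) * (g z - ?R w)\<^sup>2)) \<partial>lborel)"
      using innD(5) by (intro nn_integral_cong) (simp add: power_mult_distrib ac_simps flip: ennreal_mult)
    also have "\<dots> = ennreal (\<integral>z. a\<^sup>2 * (p (z - w) * (g z - ?R w)\<^sup>2) \<partial>lborel)"
      using i innD(5) by (intro nn_integral_eq_integral) auto
    also have "\<dots> \<le> ennreal (C * a\<^sup>2)"
      using mult_left_mono[OF v, of "a\<^sup>2"] by (intro ennreal_leI) (simp add: mult.commute)
    finally show ?thesis .
  qed
  have "(\<integral>\<^sup>+\<omega>. ennreal ((e \<omega> * (g (X i \<omega>) - ?R (W i \<omega>)))\<^sup>2) \<partial>M)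
      = (\<integral>\<^sup>+\<omega>. (\<integral>\<^sup>+z. ennreal (p (z - W i \<omega>)) * ennreal ((e \<omega> * (g z - ?R (W i \<omega>)))\<^sup>2) \<partial>lborel) \<partial>M)"
    using I.nn_integral_freeze[of "\<lambda>(\<omega>, z). ennreal ((e \<omega> * (g z - ?R (W i \<omega>)))\<^sup>2)"] by simp
  also have "\<dots> \<le> (\<integral>\<^sup>+\<omega>. ennreal (C * (e \<omega>)\<^sup>2) \<partial>M)"
    by (intro nn_integral_mono bd)
  also have "\<dots> = ennreal (C * expectation (\<lambda>\<omega>. (e \<omega>)\<^sup>2))"
    using e(2) C by (subst nn_integral_eq_integral) auto
  finally have le: "(\<integral>\<^sup>+\<omega>. ennreal ((e \<omega> * (g (X i \<omega>) - ?R (W i \<omega>)))\<^sup>2) \<partial>M) \<le> ennreal (C * expectation (\<lambda>\<omega>. (e \<omega>)\<^sup>2))" .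
  show int: "integrable M (\<lambda>\<omega>. (e \<omega> * (g (X i \<omega>) - ?R (W i \<omega>)))\<^sup>2)"
    using le by (intro integrableI_bounded) (auto intro: le_less_trans)
  then show "expectation (\<lambda>\<omega>. (e \<omega> * (g (X i \<omega>) - ?R (W i \<omega>)))\<^sup>2) \<le> C * expectation (\<lambda>\<omega>. (e \<omega>)\<^sup>2)"
    using le C by (subst (asm) nn_integral_eq_integral) auto
qed

text \<open>Orthogonality of martingale increments. The weight of increment \<open>i\<close> may
  depend on everything in \<open>F i\<close>, because the subtracted conditional mean centres the
  increment given that past.\<close>

lemma square_martingale:
  fixes g :: "real \<Rightarrow> real" and e :: "nat \<Rightarrow> 'a \<Rightarrow> real"
  assumes g[measurable]: "g \<in> borel_measurable borel"
    and g2: "\<And>w. integrable lborel (\<lambda>z. p (z - w) * (g z)\<^sup>2)" "\<And>w. (\<integral>z. p (z - w) * (g z)\<^sup>2 \<partial>lborel) \<le> C"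
    and e: "\<And>i. e i \<in> borel_measurable (F i)" "\<And>i. integrable M (\<lambda>\<omega>. (e i \<omega>)\<^sup>2)"
  defines "S \<equiv> \<lambda>n \<omega>. \<Sum>i<n. e i \<omega> * (g (X i \<omega>) - shift_mean p g (W i \<omega>))"
  shows "S n \<in> borel_measurable (F n)" and "integrable M (\<lambda>\<omega>. (S n \<omega>)\<^sup>2)"
    and "expectation (\<lambda>\<omega>. (S n \<omega>)\<^sup>2) \<le> C * (\<Sum>i<n. expectation (\<lambda>\<omega>. (e i \<omega>)\<^sup>2))"
proof -
  let ?R = "shift_mean p g"
  have SF: "S n \<in> borel_measurable (F n)" for n
    unfolding S_def
  proof (intro borel_measurable_sum)
    fix i assume i: "i \<in> {..<n}"
    have [measurable]: "X i \<in> borel_measurable (F n)" "W i \<in> borel_measurable (F n)" "e i \<in> borel_measurable (F n)"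
      using i X_measurable_F[of i n] measurable_F_mono[OF innD(3), of i n] measurable_F_mono[OF e(1), of i n] by auto
    note [measurable] = innD(6)
    show "(\<lambda>\<omega>. e i \<omega> * (g (X i \<omega>) - ?R (W i \<omega>))) \<in> borel_measurable (F n)"
      by measurable
  qed
  then show "S n \<in> borel_measurable (F n)" .
  show "integrable M (\<lambda>\<omega>. (S n \<omega>)\<^sup>2)"
    "expectation (\<lambda>\<omega>. (S n \<omega>)\<^sup>2) \<le> C * (\<Sum>i<n. expectation (\<lambda>\<omega>. (e i \<omega>)\<^sup>2))"
  proof (induction n)
    case 0
    { case 1 show ?case by (simp add: S_def) }
    { case 2 show ?case by (simp add: S_def) }
  next
    case (Suc n)
    interpret I: innovation M "F n" "\<xi> n" "W n" p by (rule inn)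
    note [measurable] = innD(2,3,4,6) e(1) SF measurable_F_M[OF SF] measurable_F_M[OF e(1)]
    let ?D = "\<lambda>\<omega>. e n \<omega> * (g (X n \<omega>) - ?R (W n \<omega>))"
    note D = square_innovation[OF g g2 e(1)[of n] e(2)[of n]]
    have int: "integrable M (\<lambda>\<omega>. S n \<omega> * ?D \<omega>)"
    proof (rule Bochner_Integration.integrable_bound)
      show "integrable M (\<lambda>\<omega>. (S n \<omega>)\<^sup>2 + (?D \<omega>)\<^sup>2)" using Suc.IH(1) D(1) by auto
      have "\<bar>a * b\<bar> \<le> a\<^sup>2 + b\<^sup>2" for a b :: real
      proof -
        have "2 * (\<bar>a\<bar> * \<bar>b\<bar>) \<le> a\<^sup>2 + b\<^sup>2" using zero_le_power2[of "\<bar>a\<bar> - \<bar>b\<bar>"] by (simp add: power2_diff)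
        moreover have "0 \<le> \<bar>a\<bar> * \<bar>b\<bar>" by simp
        ultimately show ?thesis unfolding abs_mult by linarith
      qed
      then show "AE \<omega> in M. norm (S n \<omega> * ?D \<omega>) \<le> norm ((S n \<omega>)\<^sup>2 + (?D \<omega>)\<^sup>2)"
        by (intro AE_I2) (smt (verit) real_norm_def zero_le_power2)
    qed measurable
    \<comment> \<open>Given \<open>F n\<close>, only g z - ?R (W n) varies in the inner integral,
      and it integrates to 0 against the shifted density.\<close>
    have "expectation (\<lambda>\<omega>. S n \<omega> * ?D \<omega>)
        = expectation (\<lambda>\<omega>. (\<integral>z. p (z - W n \<omega>) *\<^sub>R (S n \<omega> * (e n \<omega> * (g z - ?R (W n \<omega>)))) \<partial>lborel))"
      using I.integral_freeze[of "\<lambda>(\<omega>, z). S n \<omega> * (e n \<omega> * (g z - ?R (W n \<omega>)))"] int by simp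
    also have "\<dots> = expectation (\<lambda>\<omega>. 0)"
    proof (rule Bochner_Integration.integral_cong)
      fix \<omega>
      let ?w = "W n \<omega>"
      have i: "integrable lborel (\<lambda>z. p (z - ?w) * g z)"
        using weighted_integrable_first[of g "\<lambda>z. p (z - ?w)"] I.p_shift_integral[of ?w] innD(5) g2[of ?w] by auto
      have "(\<integral>z. p (z - ?w) *\<^sub>R (S n \<omega> * (e n \<omega> * (g z - ?R ?w))) \<partial>lborel)
         = (\<integral>z. (S n \<omega> * e n \<omega>) * (p (z - ?w) * g z - ?R ?w * p (z - ?w)) \<partial>lborel)"
        by (simp add: algebra_simps)
      also have "\<dots> = 0"
        using i I.p_shift_integral[of ?w] by (simp add: shift_mean_def)
      finally show "(\<integral>z. p (z - ?w) *\<^sub>R (S n \<omega> * (e n \<omega> * (g z - ?R ?w))) \<partial>lborel) = 0" .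
    qed simp
    finally have cross: "expectation (\<lambda>\<omega>. S n \<omega> * ?D \<omega>) = 0" by simp
    have eq: "(S (Suc n) \<omega>)\<^sup>2 = (S n \<omega>)\<^sup>2 + 2 * (S n \<omega> * ?D \<omega>) + (?D \<omega>)\<^sup>2" for \<omega>
      by (simp add: S_def power2_eq_square algebra_simps)
    { case 1 show ?case unfolding eq using Suc.IH(1) D(1) int by (intro Bochner_Integration.integrable_add integrable_mult_right) auto }
    { case 2
      have "expectation (\<lambda>\<omega>. (S (Suc n) \<omega>)\<^sup>2) = expectation (\<lambda>\<omega>. (S n \<omega>)\<^sup>2) + expectation (\<lambda>\<omega>. (?D \<omega>)\<^sup>2)"
        unfolding eq using Suc.IH(1) D(1) int cross by (simp add: Bochner_Integration.integrable_add)
      then show ?case using Suc.IH(2) D(2) by (simp add: algebra_simps) }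
  qed
qed

end

section \<open>Characteristic functions of martingale transforms\<close>

lemma one_minus_exp_minus_le:
  fixes q :: real
  assumes "0 \<le> q"
  shows "\<bar>(1 - q) - exp (- q)\<bar> \<le> q\<^sup>2"
proof -
  \<comment> \<open>The product is at least 1 and 1 + q <= exp q, so multiplying by exp (-q) gives
    exp (-q) <= 1 - q + q^2.\<close>
  have "1 + q ^ 3 = (1 - q + q\<^sup>2) * (1 + q)" by (simp add: power2_eq_square power3_eq_cube algebra_simps)
  also have "\<dots> \<le> (1 - q + q\<^sup>2) * exp q"
  proof (intro mult_left_mono)
    have "0 \<le> (q - 1/2)\<^sup>2 + 3/4" by simp
    then show "0 \<le> 1 - q + q\<^sup>2" by (simp add: power2_eq_square algebra_simps)
  qed (use exp_ge_add_one_self[of q] in auto)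
  finally have "1 \<le> (1 - q + q\<^sup>2) * exp q" using assms by (smt (verit) zero_le_power)
  from mult_right_mono[OF this, of "exp (-q)"] have "exp (- q) \<le> 1 - q + q\<^sup>2"
    by (simp add: mult.assoc flip: exp_add)
  with exp_ge_add_one_self[of "-q"] show ?thesis by simp
qed

text \<open>Taylor expansion of iexp under the density \<open>r\<close>: centring kills the linear
  term, the quadratic term is \<open>q\<close>, and exp q cancels 1 - q up to q^2. In the cubic term
  only one factor |g - R| is replaced by its bound 2B. The other two keep the variance
  \<open>v\<close>, which for the kernel is of order h; a cruder bound would lose this factor and
  the sum over n steps would diverge.\<close>

lemma tilted_char_step:
  fixes g r :: "real \<Rightarrow> real"
  assumes r: "integrable lborel r" "\<And>z. r z \<ge> 0" "(\<integral>z. r z \<partial>lborel) = 1"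
    and g[measurable]: "g \<in> borel_measurable borel" and gB: "\<And>z. \<bar>g z\<bar> \<le> B"
    and R: "R = (\<integral>z. r z * g z \<partial>lborel)"
    and v: "v = (\<integral>z. r z * (g z - R)\<^sup>2 \<partial>lborel)"
    and q: "q = a\<^sup>2 * v / 2"
  shows "norm (complex_of_real (exp q) * (\<integral>z. r z *\<^sub>R iexp (a * (g z - R)) \<partial>lborel) - 1) \<le> exp q * (q\<^sup>2 + \<bar>a\<bar> ^ 3 * (2 * B) * v / 6)"
proof -
  have [measurable]: "r \<in> borel_measurable borel" using r(1) by auto
  have bd: "integrable lborel (\<lambda>z. r z *\<^sub>R f z)" if [measurable]: "f \<in> borel_measurable borel" and "\<And>z. norm (f z) \<le> c"
    for f :: "real \<Rightarrow> 'e::{banach,second_countable_topology}" and c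
  proof (rule Bochner_Integration.integrable_bound[OF integrable_mult_right[OF r(1), of c]])
    have "norm (r z *\<^sub>R f z) \<le> norm (c * r z)" for z
    proof -
      have "r z * norm (f z) \<le> r z * c" using that(2) r(2) by (intro mult_left_mono)
      also have "\<dots> = norm (c * r z)"
        using r(2)[of z] order_trans[OF norm_ge_zero that(2)] by (simp add: abs_mult)
      finally show ?thesis using r(2)[of z] by simp
    qed
    then show "AE z in lborel. norm (r z *\<^sub>R f z) \<le> norm (c * r z)" by simp
  qed measurable
  have R_le: "\<bar>R\<bar> \<le> B"
  proof -
    have "\<bar>R\<bar> \<le> (\<integral>z. \<bar>r z * g z\<bar> \<partial>lborel)" unfolding R by (rule integral_abs_bound)
    also have "\<dots> \<le> (\<integral>z. B * r z \<partial>lborel)"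
    proof (rule integral_mono)
      show "integrable lborel (\<lambda>z. \<bar>r z * g z\<bar>)" using bd[of g B] gB by (intro integrable_abs) auto
      show "\<bar>r z * g z\<bar> \<le> B * r z" for z
        using mult_left_mono[OF gB r(2), of z z] r(2)[of z] by (simp add: abs_mult mult.commute)
    qed (use r in auto)
    finally show ?thesis using r by simp
  qed
  have dB: "\<bar>g z - R\<bar> \<le> 2 * B" for z using gB[of z] R_le by linarith
  have i1: "integrable lborel (\<lambda>z. r z * g z)" using bd[of g B] gB by auto
  have dB2: "(g z - R)\<^sup>2 \<le> (2 * B)\<^sup>2" for z using dB[of z] by (metis abs_ge_zero power2_abs power_mono)
  have i2: "integrable lborel (\<lambda>z. r z * (g z - R)\<^sup>2)"
    using bd[of "\<lambda>z. (g z - R)\<^sup>2" "(2 * B)\<^sup>2"] dB2 by auto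
  have v0: "0 \<le> v" unfolding v using r by (intro Bochner_Integration.integral_nonneg) auto
  have q0: "0 \<le> q" unfolding q using v0 by simp
  let ?\<phi> = "\<integral>z. r z *\<^sub>R iexp (a * (g z - R)) \<partial>lborel"
  let ?P = "\<lambda>z. 1 + \<i> * (a * (g z - R)) - (a * (g z - R))\<^sup>2 / 2"
  have iP': "integrable lborel (\<lambda>z. complex_of_real (r z))"
    "integrable lborel (\<lambda>z. complex_of_real (r z * (a * (g z - R))))"
    "integrable lborel (\<lambda>z. complex_of_real (r z * ((a * (g z - R))\<^sup>2 / 2)))"
  proof -
    have "r z * (a * (g z - R)) = a * (r z * g z) - a * R * r z" "r z * ((a * (g z - R))\<^sup>2 / 2) = a\<^sup>2 / 2 * (r z * (g z - R)\<^sup>2)" for z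
      by (simp add: algebra_simps) (simp add: power_mult_distrib)
    note e = this
    have "integrable lborel (\<lambda>z. r z * (a * (g z - R)))" "integrable lborel (\<lambda>z. r z * ((a * (g z - R))\<^sup>2 / 2))"
      unfolding e by (intro Bochner_Integration.integrable_diff integrable_mult_right i1 i2 r)+
    then show "integrable lborel (\<lambda>z. complex_of_real (r z))"
      "integrable lborel (\<lambda>z. complex_of_real (r z * (a * (g z - R))))"
      "integrable lborel (\<lambda>z. complex_of_real (r z * ((a * (g z - R))\<^sup>2 / 2)))"
      using r by (auto simp del: of_real_mult of_real_diff of_real_divide)
  qed
  have iPall: "integrable lborel (\<lambda>z. r z *\<^sub>R ?P z)"
  proof -
    have "r z *\<^sub>R ?P z = complex_of_real (r z) + \<i> * complex_of_real (r z * (a * (g z - R))) - complex_of_real (r z * ((a * (g z - R))\<^sup>2 / 2))" for z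
      by (simp add: scaleR_conv_of_real algebra_simps)
    then show ?thesis using iP' by auto
  qed
  have lin: "(\<integral>z. r z * (a * (g z - R)) \<partial>lborel) = 0"
  proof -
    have "(\<integral>z. r z * (a * (g z - R)) \<partial>lborel) = (\<integral>z. a * (r z * g z) - (a * R) * r z \<partial>lborel)"
      by (simp add: algebra_simps)
    also have "\<dots> = 0" using i1 r by (simp add: R)
    finally show ?thesis .
  qed
  have quad: "(\<integral>z. r z * ((a * (g z - R))\<^sup>2 / 2) \<partial>lborel) = q"
  proof -
    have "(\<integral>z. r z * ((a * (g z - R))\<^sup>2 / 2) \<partial>lborel) = (\<integral>z. (a\<^sup>2 / 2) * (r z * (g z - R)\<^sup>2) \<partial>lborel)"
      by (intro Bochner_Integration.integral_cong) (simp_all add: power_mult_distrib)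
    then show ?thesis by (simp add: q v)
  qed
  have intP: "(\<integral>z. r z *\<^sub>R ?P z \<partial>lborel) = 1 - q"
  proof -
    have "(\<integral>z. r z *\<^sub>R ?P z \<partial>lborel) = (\<integral>z. complex_of_real (r z) + \<i> * complex_of_real (r z * (a * (g z - R))) - complex_of_real (r z * ((a * (g z - R))\<^sup>2 / 2)) \<partial>lborel)"
      by (intro Bochner_Integration.integral_cong) (auto simp: scaleR_conv_of_real algebra_simps)
    also have "\<dots> = (\<integral>z. complex_of_real (r z) \<partial>lborel) + \<i> * (\<integral>z. complex_of_real (r z * (a * (g z - R))) \<partial>lborel) - (\<integral>z. complex_of_real (r z * ((a * (g z - R))\<^sup>2 / 2)) \<partial>lborel)"
      using iP' by simp
    also have "\<dots> = 1 - q"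
      unfolding integral_complex_of_real lin quad r(3) by simp
    finally show ?thesis .
  qed
  have i\<phi>: "integrable lborel (\<lambda>z. r z *\<^sub>R iexp (a * (g z - R)))"
    by (rule bd[of _ 1]) auto
  have dif: "r z *\<^sub>R (iexp (a * (g z - R)) - ?P z) = r z *\<^sub>R iexp (a * (g z - R)) - r z *\<^sub>R ?P z" for z
    by (rule scaleR_diff_right)
  have "norm (?\<phi> - (1 - q)) = norm (\<integral>z. r z *\<^sub>R (iexp (a * (g z - R)) - ?P z) \<partial>lborel)"
    unfolding dif by (subst Bochner_Integration.integral_diff[OF i\<phi> iPall]) (simp only: intP)
  also have "\<dots> \<le> (\<integral>z. norm (r z *\<^sub>R (iexp (a * (g z - R)) - ?P z)) \<partial>lborel)"
    by (rule integral_norm_bound)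
  also have "\<dots> \<le> (\<integral>z. (\<bar>a\<bar> ^ 3 * (2 * B) / 6) * (r z * (g z - R)\<^sup>2) \<partial>lborel)"
  proof (rule integral_mono)
    show "integrable lborel (\<lambda>z. cmod (r z *\<^sub>R (iexp (a * (g z - R)) - ?P z)))"
      unfolding dif by (intro integrable_norm Bochner_Integration.integrable_diff i\<phi> iPall)
    show "integrable lborel (\<lambda>z. \<bar>a\<bar> ^ 3 * (2 * B) / 6 * (r z * (g z - R)\<^sup>2))" using i2 by auto
    fix z
    have "(\<Sum>k\<le>2. (\<i> * y) ^ k / fact k) = 1 + \<i> * y - y\<^sup>2 / 2" for y :: complex
      by (simp add: numeral_2_eq_2 power_mult_distrib)
    from this[of "complex_of_real (a * (g z - R))"]
    have "(\<Sum>k\<le>2. (\<i> * complex_of_real (a * (g z - R))) ^ k / fact k) = ?P z"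
      by (simp only: of_real_power of_real_divide of_real_numeral)
    then have "cmod (iexp (a * (g z - R)) - ?P z) \<le> \<bar>a * (g z - R)\<bar> ^ 3 / 6"
      using iexp_approx1[of "a * (g z - R)" 2] by (simp add: numeral_3_eq_3 fact_numeral)
    also have "\<bar>a * (g z - R)\<bar> ^ 3 / 6 = \<bar>a\<bar> ^ 3 / 6 * ((g z - R)\<^sup>2 * \<bar>g z - R\<bar>)"
      by (simp add: abs_mult power_mult_distrib power3_eq_cube power2_eq_square flip: abs_mult)
    also have "\<dots> \<le> \<bar>a\<bar> ^ 3 / 6 * ((g z - R)\<^sup>2 * (2 * B))"
      using dB by (intro mult_left_mono) auto
    finally have "cmod (iexp (a * (g z - R)) - ?P z) \<le> \<bar>a\<bar> ^ 3 * (2 * B) / 6 * (g z - R)\<^sup>2"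
      by (simp add: algebra_simps)
    from mult_left_mono[OF this r(2)[of z]]
    show "cmod (r z *\<^sub>R (iexp (a * (g z - R)) - ?P z)) \<le> \<bar>a\<bar> ^ 3 * (2 * B) / 6 * (r z * (g z - R)\<^sup>2)"
      using r(2)[of z] unfolding norm_scaleR by (simp only: abs_of_nonneg mult.left_commute)
  qed
  also have "\<dots> = \<bar>a\<bar> ^ 3 * (2 * B) * v / 6" by (simp add: v)
  finally have 1: "norm (?\<phi> - (1 - q)) \<le> \<bar>a\<bar> ^ 3 * (2 * B) * v / 6" .
  have "norm (complex_of_real (exp q) * ?\<phi> - 1)
      = norm (complex_of_real (exp q) * ((?\<phi> - (1 - q)) + complex_of_real ((1 - q) - exp (- q))))"
  proof -
    have "complex_of_real (exp q) * complex_of_real (exp (- q)) = 1"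
      by (metis exp_minus_inverse of_real_1 of_real_mult)
    then show ?thesis by (simp add: algebra_simps)
  qed
  also have "\<dots> = exp q * norm ((?\<phi> - (1 - q)) + complex_of_real ((1 - q) - exp (- q)))"
    by (simp add: norm_mult)
  also have "\<dots> \<le> exp q * (\<bar>a\<bar> ^ 3 * (2 * B) * v / 6 + q\<^sup>2)"
    using 1 one_minus_exp_minus_le[OF q0]
    by (intro mult_left_mono order_trans[OF norm_triangle_ineq] add_mono) (auto simp flip: of_real_diff simp del: of_real_diff)
  finally show ?thesis by (simp add: add.commute)
qed

context innovations begin

text \<open>\<open>exp (Q n)\<close> is the reciprocal of the Gaussian characteristic function with the conditional
  variance of \<open>S n\<close>, so each increment changes the expectation only by a third order error.\<close>

lemma tilted_char_martingale:
  fixes g :: "real \<Rightarrow> real" and b :: "nat \<Rightarrow> 'a \<Rightarrow> real" and \<theta> :: real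
  assumes g[measurable]: "g \<in> borel_measurable borel" and gB: "\<And>z. \<bar>g z\<bar> \<le> B"
    and b: "\<And>i. b i \<in> borel_measurable (F i)" "\<And>i \<omega>. \<bar>b i \<omega>\<bar> \<le> L"
    and v_def: "\<And>w. v w = (\<integral>z. p (z - w) * (g z - shift_mean p g w)\<^sup>2 \<partial>lborel)"
    and V: "\<And>w. v w \<le> V"
  defines "S \<equiv> \<lambda>n \<omega>. \<Sum>i<n. b i \<omega> * (g (X i \<omega>) - shift_mean p g (W i \<omega>))"
    and "Q \<equiv> \<lambda>n \<omega>. \<Sum>i<n. \<theta>\<^sup>2 * (b i \<omega>)\<^sup>2 * v (W i \<omega>) / 2"
    and "m \<equiv> \<theta>\<^sup>2 * L\<^sup>2 * V / 2"
  shows "norm ((\<integral>\<omega>. complex_of_real (exp (Q n \<omega>)) * iexp (\<theta> * S n \<omega>) \<partial>M) - 1)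
       \<le> real n * (exp (real n * m) * (m\<^sup>2 + (\<bar>\<theta>\<bar> * L) ^ 3 * (2 * B) * V / 6))"
proof -
  let ?R = "shift_mean p g"
  let ?\<delta> = "m\<^sup>2 + (\<bar>\<theta>\<bar> * L) ^ 3 * (2 * B) * V / 6"
  have v0: "0 \<le> v w" for w unfolding v_def using innD(5) by (intro Bochner_Integration.integral_nonneg) auto
  have V0: "0 \<le> V" using v0 V order_trans by blast
  have L0: "0 \<le> L" using b(2)[of 0] abs_ge_zero order_trans by blast
  have B0: "0 \<le> B" using gB[of 0] abs_ge_zero order_trans by blast
  note [measurable] = innD(6)
  have vm[measurable]: "v \<in> borel_measurable borel"
    unfolding v_def[abs_def] by measurable
  have m0: "0 \<le> m" unfolding m_def using V0 by auto
  have \<delta>0: "0 \<le> ?\<delta>" using V0 L0 B0 by simp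
  have qle: "\<theta>\<^sup>2 * (b i \<omega>)\<^sup>2 * v (W i \<omega>) / 2 \<le> m" for i \<omega>
  proof -
    have "(b i \<omega>)\<^sup>2 \<le> L\<^sup>2" using power_mono[OF b(2)[of i \<omega>], of 2] by simp
    then show ?thesis unfolding m_def using V v0 V0
      by (intro divide_right_mono mult_mono) auto
  qed
  have q0: "0 \<le> \<theta>\<^sup>2 * (b i \<omega>)\<^sup>2 * v (W i \<omega>) / 2" for i \<omega> using v0 by simp
  have Qle: "Q n \<omega> \<le> real n * m" for n \<omega>
    unfolding Q_def using sum_mono[of "{..<n}" _ "\<lambda>_. m", OF qle] by simp
  have meas: "S n \<in> borel_measurable (F n)" "Q n \<in> borel_measurable (F n)" for n
  proof -
    have [measurable]: "X i \<in> borel_measurable (F n)" "W i \<in> borel_measurable (F n)" "b i \<in> borel_measurable (F n)" if "i < n" for i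
      using that X_measurable_F[of i n] measurable_F_mono[OF innD(3), of i n] measurable_F_mono[OF b(1), of i n] by auto
    show "S n \<in> borel_measurable (F n)" unfolding S_def by measurable
    show "Q n \<in> borel_measurable (F n)" unfolding Q_def by measurable
  qed
  show ?thesis
  proof (induction n)
    case 0
    then show ?case by (simp add: S_def Q_def prob_space)
  next
    case (Suc n)
    interpret I: innovation M "F n" "\<xi> n" "W n" p by (rule inn)
    note [measurable] = innD(2,3,4,6) b(1) meas measurable_F_M[OF meas(1)] measurable_F_M[OF meas(2)] measurable_F_M[OF b(1)]
      measurable_F_M[OF innD(3)]
    let ?q = "\<lambda>\<omega>. \<theta>\<^sup>2 * (b n \<omega>)\<^sup>2 * v (W n \<omega>) / 2"
    let ?Z = "\<lambda>\<omega>. complex_of_real (exp (Q n \<omega>)) * iexp (\<theta> * S n \<omega>)"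
    let ?\<Phi> = "\<lambda>(\<omega>, z). ?Z \<omega> * (complex_of_real (exp (?q \<omega>)) * iexp (\<theta> * b n \<omega> * (g z - ?R (W n \<omega>))))"
    let ?\<phi> = "\<lambda>\<omega>. \<integral>z. p (z - W n \<omega>) *\<^sub>R iexp (\<theta> * b n \<omega> * (g z - ?R (W n \<omega>))) \<partial>lborel"
    have Suc_eq: "complex_of_real (exp (Q (Suc n) \<omega>)) * iexp (\<theta> * S (Suc n) \<omega>) = ?\<Phi> (\<omega>, X n \<omega>)" for \<omega>
    proof -
      have "S (Suc n) \<omega> = S n \<omega> + b n \<omega> * (g (X n \<omega>) - ?R (W n \<omega>))" "Q (Suc n) \<omega> = Q n \<omega> + ?q \<omega>"
        by (simp_all add: S_def Q_def)
      then show ?thesis by (simp add: exp_add distrib_left mult_ac)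
    qed
    have nZ: "norm (?Z \<omega>) \<le> exp (real n * m)" for \<omega> using Qle[of n \<omega>] by (simp add: norm_mult)
    have iZ: "integrable M ?Z"
      by (intro integrable_const_bound[where B="exp (real n * m)"] AE_I2 nZ) measurable
    have Phi_m: "?\<Phi> \<in> borel_measurable (F n \<Otimes>\<^sub>M borel)" by measurable
    have i\<Phi>: "integrable M (\<lambda>\<omega>. ?\<Phi> (\<omega>, X n \<omega>))"
    proof (intro integrable_const_bound[where B="exp (real (Suc n) * m)"] AE_I2)
      fix \<omega> show "cmod (?\<Phi> (\<omega>, X n \<omega>)) \<le> exp (real (Suc n) * m)"
        unfolding Suc_eq[symmetric] using Qle[of "Suc n" \<omega>] by (simp add: norm_mult)
    qed measurable
    have step: "norm (?Z \<omega> * (complex_of_real (exp (?q \<omega>)) * ?\<phi> \<omega> - 1)) \<le> exp (real (Suc n) * m) * ?\<delta>" for \<omega>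
    proof -
      let ?a = "\<theta> * b n \<omega>"
      have a: "\<bar>?a\<bar> \<le> \<bar>\<theta>\<bar> * L" using b(2) by (simp add: abs_mult mult_left_mono)
      have "norm (complex_of_real (exp (?q \<omega>)) * ?\<phi> \<omega> - 1) \<le> exp (?q \<omega>) * ((?q \<omega>)\<^sup>2 + \<bar>?a\<bar> ^ 3 * (2 * B) * v (W n \<omega>) / 6)"
      proof (rule tilted_char_step[where r="\<lambda>z. p (z - W n \<omega>)" and g=g and B=B and R="?R (W n \<omega>)"
            and v="v (W n \<omega>)" and q="?q \<omega>" and a="?a"])
        show "?R (W n \<omega>) = (\<integral>z. p (z - W n \<omega>) * g z \<partial>lborel)" by (simp add: shift_mean_def)
      qed (use gB I.p_shift_integral innD(5) in \<open>simp_all add: v_def power_mult_distrib\<close>)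
      also have "\<dots> \<le> exp (?q \<omega>) * ?\<delta>"
        using qle[of n \<omega>] q0[of n \<omega>] a V v0 V0 B0 L0
        by (intro mult_left_mono add_mono divide_right_mono power_mono mult_mono) auto
      finally have "norm (complex_of_real (exp (?q \<omega>)) * ?\<phi> \<omega> - 1) \<le> exp (?q \<omega>) * ?\<delta>" .
      then have "norm (?Z \<omega> * (complex_of_real (exp (?q \<omega>)) * ?\<phi> \<omega> - 1)) \<le> exp (Q n \<omega>) * (exp (?q \<omega>) * ?\<delta>)"
        unfolding norm_mult[of "?Z \<omega>"] by (intro mult_mono) (auto simp: norm_mult)
      also have "\<dots> = exp (Q (Suc n) \<omega>) * ?\<delta>" by (simp add: Q_def exp_add)
      also have "\<dots> \<le> exp (real (Suc n) * m) * ?\<delta>"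
        using Qle[of "Suc n" \<omega>] \<delta>0 by (intro mult_right_mono) auto
      finally show ?thesis .
    qed
    have "(\<integral>\<omega>. ?\<Phi> (\<omega>, X n \<omega>) \<partial>M) = (\<integral>\<omega>. (\<integral>z. p (z - W n \<omega>) *\<^sub>R ?\<Phi> (\<omega>, z) \<partial>lborel) \<partial>M)"
      by (rule I.integral_freeze[OF Phi_m i\<Phi>])
    \<comment> \<open>\<open>?Z\<close> and \<open>?q\<close> depend on the past only and leave the
      inner integral.\<close>
    also have "\<dots> = (\<integral>\<omega>. ?Z \<omega> * (complex_of_real (exp (?q \<omega>)) * ?\<phi> \<omega>) \<partial>M)"
      by (intro Bochner_Integration.integral_cong refl) (simp add: mult.assoc flip: mult_scaleR_right)
    finally have eq: "(\<integral>\<omega>. ?\<Phi> (\<omega>, X n \<omega>) \<partial>M) = (\<integral>\<omega>. ?Z \<omega> * (complex_of_real (exp (?q \<omega>)) * ?\<phi> \<omega>) \<partial>M)" .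
    have iZ\<phi>: "integrable M (\<lambda>\<omega>. ?Z \<omega> * (complex_of_real (exp (?q \<omega>)) * ?\<phi> \<omega> - 1))"
      by (intro integrable_const_bound[where B="exp (real (Suc n) * m) * ?\<delta>"] AE_I2 step) measurable
    have "norm ((\<integral>\<omega>. ?\<Phi> (\<omega>, X n \<omega>) \<partial>M) - (\<integral>\<omega>. ?Z \<omega> \<partial>M)) = norm (\<integral>\<omega>. ?Z \<omega> * (complex_of_real (exp (?q \<omega>)) * ?\<phi> \<omega> - 1) \<partial>M)"
    proof -
      have "(\<integral>\<omega>. ?Z \<omega> * (complex_of_real (exp (?q \<omega>)) * ?\<phi> \<omega>) \<partial>M) = (\<integral>\<omega>. ?Z \<omega> * (complex_of_real (exp (?q \<omega>)) * ?\<phi> \<omega> - 1) + ?Z \<omega> \<partial>M)"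
        by (simp add: algebra_simps)
      also have "\<dots> = (\<integral>\<omega>. ?Z \<omega> * (complex_of_real (exp (?q \<omega>)) * ?\<phi> \<omega> - 1) \<partial>M) + (\<integral>\<omega>. ?Z \<omega> \<partial>M)"
        by (rule Bochner_Integration.integral_add[OF iZ\<phi> iZ])
      finally show ?thesis unfolding eq by simp
    qed
    also have "\<dots> \<le> (\<integral>\<omega>. norm (?Z \<omega> * (complex_of_real (exp (?q \<omega>)) * ?\<phi> \<omega> - 1)) \<partial>M)" by (rule integral_norm_bound)
    also have "\<dots> \<le> (\<integral>\<omega>. exp (real (Suc n) * m) * ?\<delta> \<partial>M)"
      using iZ\<phi> step by (intro integral_mono integrable_norm) auto
    also have "\<dots> = exp (real (Suc n) * m) * ?\<delta>" by (simp add: prob_space)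
    finally have d: "norm ((\<integral>\<omega>. ?\<Phi> (\<omega>, X n \<omega>) \<partial>M) - (\<integral>\<omega>. ?Z \<omega> \<partial>M)) \<le> exp (real (Suc n) * m) * ?\<delta>" .
    \<comment> \<open>The exponent in the bound for \<open>n\<close> is enlarged to that of
      \<open>Suc n\<close>, so that the old error terms and the new one are equal and add
      up.\<close>
    have IH: "norm ((\<integral>\<omega>. ?Z \<omega> \<partial>M) - 1) \<le> real n * (exp (real (Suc n) * m) * ?\<delta>)"
      using m0 \<delta>0 by (intro order_trans[OF Suc.IH] mult_left_mono mult_right_mono) (auto simp: algebra_simps)
    have "norm ((\<integral>\<omega>. ?\<Phi> (\<omega>, X n \<omega>) \<partial>M) - 1) \<le> norm ((\<integral>\<omega>. ?\<Phi> (\<omega>, X n \<omega>) \<partial>M) - (\<integral>\<omega>. ?Z \<omega> \<partial>M)) + norm ((\<integral>\<omega>. ?Z \<omega> \<partial>M) - 1)"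
      by (rule order_trans[OF _ norm_triangle_ineq]) simp
    also have "\<dots> \<le> exp (real (Suc n) * m) * ?\<delta> + real n * (exp (real (Suc n) * m) * ?\<delta>)"
      by (intro add_mono d IH)
    also have "\<dots> = real (Suc n) * (exp (real (Suc n) * m) * ?\<delta>)"
      unfolding of_nat_Suc by (simp only: distrib_right mult_1)
    finally show ?case unfolding Suc_eq .
  qed
qed

end

section \<open>Kernel smoothing\<close>

text \<open>\<open>Bp\<close> serves at once as a bound, as a Lipschitz constant and as a bound of
  the mixed second differences of \<open>p\<close>. The last is the integrated form of a bounded
  second derivative and controls how smoothed quantities depend on \<open>w\<close>.
  \<open>m1\<close> stands for the derivative of \<open>m\<close> at \<open>x\<close>.\<close>

locale smoothing =
  fixes K p m :: "real \<Rightarrow> real" and BK Bp Bm m1 x :: real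
  assumes K_nonneg: "\<And>u. K u \<ge> 0" and K_le: "\<And>u. K u \<le> BK"
    and K_int: "integrable lborel K" "(\<integral>u. K u \<partial>lborel) = 1"
    and K_int1: "integrable lborel (\<lambda>u. u * K u)" "(\<integral>u. u * K u \<partial>lborel) = 0"
    and K_int2: "integrable lborel (\<lambda>u. u\<^sup>2 * K u)"
    and dens_meas: "p \<in> borel_measurable borel" and dens_nonneg: "\<And>y. p y \<ge> 0" and dens_le: "\<And>y. p y \<le> Bp"
    and dens_lip: "\<And>y y'. \<bar>p y - p y'\<bar> \<le> Bp * \<bar>y - y'\<bar>"
    and dens_lip2: "\<And>y y' w w'. \<bar>(p (y - w) - p (y - w')) - (p (y' - w) - p (y' - w'))\<bar> \<le> Bp * \<bar>y - y'\<bar> * \<bar>w - w'\<bar>"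
    and m_meas: "m \<in> borel_measurable borel"
    and m_lip: "\<And>y. \<bar>m y - m x\<bar> \<le> Bm * \<bar>y - x\<bar>"
    and m_taylor: "\<And>y. \<bar>m y - m x - m1 * (y - x)\<bar> \<le> Bm * (y - x)\<^sup>2"
begin

lemma K_meas [measurable]: "K \<in> borel_measurable borel"
  using K_int(1) by auto

declare dens_meas [measurable] m_meas [measurable]

text \<open>The integral of K u (1 + u^2). The weight 1 + u^2 dominates 1, |u| and u^2 together, so
  this one constant bounds all kernel integrals with growing integrands. Being at least 1, it can
  also absorb other constants.\<close>

definition \<kappa> :: real where "\<kappa> = 1 + (\<integral>u. u\<^sup>2 * K u \<partial>lborel)"

lemma bounds_nonneg: "0 \<le> BK" "0 \<le> Bp" "0 \<le> Bm" "1 \<le> \<kappa>" "0 \<le> \<kappa>"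
proof -
  show "0 \<le> BK" "0 \<le> Bp" using K_nonneg[of 0] K_le[of 0] dens_nonneg[of 0] dens_le[of 0] by auto
  show "0 \<le> Bm" using m_lip[of "x + 1"] by (simp add: order_trans[OF abs_ge_zero])
  show "1 \<le> \<kappa>" unfolding \<kappa>_def using K_nonneg by (auto intro!: Bochner_Integration.integral_nonneg)
  then show "0 \<le> \<kappa>" by simp
qed

lemma kernel_integral:
  fixes q :: "real \<Rightarrow> real"
  assumes [measurable]: "q \<in> borel_measurable borel" and q: "\<And>u. \<bar>q u\<bar> \<le> C * (1 + u\<^sup>2)"
  shows "integrable lborel (\<lambda>u. K u * q u)" "\<bar>\<integral>u. K u * q u \<partial>lborel\<bar> \<le> C * \<kappa>"
proof -
  have i: "integrable lborel (\<lambda>u. C * (K u + u\<^sup>2 * K u))" using K_int K_int2 by auto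
  have le: "\<bar>K u * q u\<bar> \<le> C * (K u + u\<^sup>2 * K u)" for u
    using mult_left_mono[OF q[of u] K_nonneg[of u]] K_nonneg[of u] by (simp add: abs_mult algebra_simps)
  show int: "integrable lborel (\<lambda>u. K u * q u)"
    by (rule Bochner_Integration.integrable_bound[OF i]) (use le in \<open>auto intro!: AE_I2 order_trans[OF le]\<close>)
  have "\<bar>\<integral>u. K u * q u \<partial>lborel\<bar> \<le> (\<integral>u. \<bar>K u * q u\<bar> \<partial>lborel)" by (rule integral_abs_bound)
  also have "\<dots> \<le> (\<integral>u. C * (K u + u\<^sup>2 * K u) \<partial>lborel)"
    using int i le by (intro integral_mono integrable_abs) auto
  also have "\<dots> = C * \<kappa>" using K_int K_int2 by (simp add: \<kappa>_def)
  finally show "\<bar>\<integral>u. K u * q u \<partial>lborel\<bar> \<le> C * \<kappa>" .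
qed

lemma abs_le_one_plus_square: "\<bar>u\<bar> \<le> 1 + u\<^sup>2" for u :: real
proof -
  have "0 \<le> (\<bar>u\<bar> - 1)\<^sup>2" by simp
  then have "2 * \<bar>u\<bar> \<le> 1 + u\<^sup>2" by (simp add: power2_diff)
  then show ?thesis by simp
qed

abbreviation Kh :: "real \<Rightarrow> real \<Rightarrow> real" where "Kh h z \<equiv> K ((x - z) / h)"

text \<open>The substitution z = x - h u; its Jacobian is the factor \<open>h\<close> carried by all
  conditional moments.\<close>

lemma shift_mean_kernel:
  fixes G :: "real \<Rightarrow> real"
  assumes h: "h > 0"
  shows "shift_mean p (\<lambda>z. Kh h z * G z) w = h * (\<integral>u. K u * (G (x - h * u) * p (x - h * u - w)) \<partial>lborel)"
    and "integrable lborel (\<lambda>u. K u * (G (x - h * u) * p (x - h * u - w))) \<Longrightarrow> integrable lborel (\<lambda>z. p (z - w) * (Kh h z * G z))"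
proof -
  have e: "p (x + - h * u - w) * (Kh h (x + - h * u) * G (x + - h * u)) = K u * (G (x - h * u) * p (x - h * u - w))" for u
    using h by (simp add: ac_simps)
  show "shift_mean p (\<lambda>z. Kh h z * G z) w = h * (\<integral>u. K u * (G (x - h * u) * p (x - h * u - w)) \<partial>lborel)"
    unfolding shift_mean_def real_scaleR_def
    using lborel_integral_real_affine[of "-h" "\<lambda>z. p (z - w) * (Kh h z * G z)" x] h by (simp only: e) simp
  assume "integrable lborel (\<lambda>u. K u * (G (x - h * u) * p (x - h * u - w)))"
  then show "integrable lborel (\<lambda>z. p (z - w) * (Kh h z * G z))"
    using lborel_integrable_real_affine_iff[of "-h" "\<lambda>z. p (z - w) * (Kh h z * G z)" x] h by (simp only: e)
qed

definition Lam :: "real \<Rightarrow> real \<Rightarrow> real" where "Lam h = shift_mean p (Kh h)"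

lemma Lam_measurable [measurable]: "Lam h \<in> borel_measurable borel"
  unfolding Lam_def by measurable

lemma Lam_eq: "h > 0 \<Longrightarrow> Lam h w = h * (\<integral>u. K u * p (x - h * u - w) \<partial>lborel)"
  using shift_mean_kernel(1)[of h "\<lambda>_. 1" w] by (simp add: Lam_def)

lemma one_plus_square_ge: "1 \<le> 1 + u\<^sup>2" for u :: real
  by simp

lemma kernel_dens: "\<bar>p y\<bar> \<le> Bp * (1 + u\<^sup>2)"
  using dens_nonneg[of y] dens_le[of y] bounds_nonneg(2) mult_left_mono[OF one_plus_square_ge[of u], of Bp] by simp

lemma kernel_bounded:
  assumes [measurable]: "q \<in> borel_measurable borel" and q: "\<And>u. \<bar>q u\<bar> \<le> C"
  shows "\<bar>\<integral>u. K u * q u \<partial>lborel\<bar> \<le> C"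
proof -
  have C: "0 \<le> C" using q[of 0] by simp
  have "\<bar>q u\<bar> \<le> C * (1 + u\<^sup>2)" for u using q[of u] C mult_left_mono[OF one_plus_square_ge[of u], of C] by simp
  from kernel_integral(1)[OF _ this] have i: "integrable lborel (\<lambda>u. K u * q u)" by simp
  have "\<bar>\<integral>u. K u * q u \<partial>lborel\<bar> \<le> (\<integral>u. \<bar>K u * q u\<bar> \<partial>lborel)" by (rule integral_abs_bound)
  also have "\<dots> \<le> (\<integral>u. C * K u \<partial>lborel)"
    using i K_int mult_left_mono[OF q K_nonneg] K_nonneg by (intro integral_mono integrable_abs) (auto simp: abs_mult mult.commute)
  finally show ?thesis using K_int by simp
qed

lemma Lam_nonneg: "h > 0 \<Longrightarrow> 0 \<le> Lam h w"
  unfolding Lam_def shift_mean_def using dens_nonneg K_nonneg by (intro Bochner_Integration.integral_nonneg) auto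

lemma Lam_le: "h > 0 \<Longrightarrow> Lam h w \<le> h * Bp"
  unfolding Lam_eq using kernel_bounded[of "\<lambda>u. p (x - h * u - w)" Bp] dens_nonneg dens_le
  by (intro mult_left_mono) auto

lemma Lam_lipschitz:
  assumes h: "h > 0"
  shows "\<bar>Lam h w - Lam h w'\<bar> \<le> h * Bp * \<bar>w - w'\<bar>"
proof -
  have i: "integrable lborel (\<lambda>u. K u * p (x - h * u - w))" for w
    using kernel_integral(1)[of "\<lambda>u. p (x - h * u - w)" Bp] kernel_dens by simp
  have "Lam h w - Lam h w' = h * (\<integral>u. K u * (p (x - h * u - w) - p (x - h * u - w')) \<partial>lborel)"
    unfolding Lam_eq[OF h] by (simp add: right_diff_distrib i)
  also have "\<bar>\<dots>\<bar> \<le> h * (Bp * \<bar>w - w'\<bar>)"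
  proof -
    have "\<bar>p (x - h * u - w) - p (x - h * u - w')\<bar> \<le> Bp * \<bar>w - w'\<bar>" for u
      using dens_lip[of "x - h * u - w" "x - h * u - w'"] by (simp add: abs_minus_commute)
    then show ?thesis
      using kernel_bounded[of "\<lambda>u. p (x - h * u - w) - p (x - h * u - w')" "Bp * \<bar>w - w'\<bar>"] h
      by (simp add: abs_mult)
  qed
  finally show ?thesis by (simp add: mult.assoc)
qed

text \<open>A first-order expansion suffices here: an error of relative order h disappears in the
  limit \<open>f0\<close>.\<close>

lemma Lam_approx:
  assumes h: "h > 0"
  shows "\<bar>Lam h w - h * p (x - w)\<bar> \<le> h\<^sup>2 * (Bp * \<kappa>)"
proof -
  have i: "integrable lborel (\<lambda>u. K u * p (x - h * u - w))"
    using kernel_integral(1)[of "\<lambda>u. p (x - h * u - w)" Bp] kernel_dens by simp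
  have "Lam h w - h * p (x - w) = h * (\<integral>u. K u * (p (x - h * u - w) - p (x - w)) \<partial>lborel)"
    unfolding Lam_eq[OF h] using K_int by (simp add: right_diff_distrib i)
  also have "\<bar>\<dots>\<bar> \<le> h * (Bp * h * \<kappa>)"
  proof -
    have "\<bar>p (x - h * u - w) - p (x - w)\<bar> \<le> Bp * h * (1 + u\<^sup>2)" for u
    proof -
      have "\<bar>p (x - h * u - w) - p (x - w)\<bar> \<le> Bp * (h * \<bar>u\<bar>)"
        using dens_lip[of "x - h * u - w" "x - w"] h by (simp add: abs_mult)
      also have "\<dots> \<le> Bp * (h * (1 + u\<^sup>2))" using h bounds_nonneg abs_le_one_plus_square[of u] by (intro mult_left_mono) auto
      finally show ?thesis by (simp add: mult.assoc)
    qed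
    then show ?thesis
      using kernel_integral(2)[of "\<lambda>u. p (x - h * u - w) - p (x - w)" "Bp * h"] h
      by (simp add: abs_mult)
  qed
  finally show ?thesis by (simp add: power2_eq_square algebra_simps)
qed

definition \<kappa>1 :: real where "\<kappa>1 = (\<integral>u. (K u)\<^sup>2 \<partial>lborel)"

lemma \<kappa>1_nonneg: "0 \<le> \<kappa>1"
  unfolding \<kappa>1_def by simp

text \<open>One factor of the squared kernel acts as the integration weight and the other is bounded
  by \<open>BK\<close>, which reduces the square to the estimates for \<open>K\<close>
  itself.\<close>

lemma Kh_square:
  assumes h: "h > 0"
  shows "integrable lborel (\<lambda>z. p (z - w) * (Kh h z)\<^sup>2)"
    and "(\<integral>z. p (z - w) * (Kh h z)\<^sup>2 \<partial>lborel) \<le> h * (BK * Bp)"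
    and "\<bar>(\<integral>z. p (z - w) * (Kh h z)\<^sup>2 \<partial>lborel) - h * \<kappa>1 * p (x - w)\<bar> \<le> h\<^sup>2 * (BK * Bp * \<kappa>)"
proof -
  have b: "\<bar>K u * p y\<bar> \<le> BK * Bp" for u y
    using K_nonneg[of u] K_le[of u] dens_nonneg[of y] dens_le[of y] by (simp add: abs_mult mult_mono)
  have b': "\<bar>K u * p y\<bar> \<le> (BK * Bp) * (1 + u\<^sup>2)" for u y
    using b[of u y] mult_left_mono[OF one_plus_square_ge[of u], of "BK * Bp"] bounds_nonneg by simp
  have e: "(\<lambda>z. Kh h z * Kh h z) = (\<lambda>z. (Kh h z)\<^sup>2)" by (simp add: power2_eq_square)
  have s: "K ((x - (x - h * u)) / h) = K u" for u using h by simp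
  have i: "integrable lborel (\<lambda>u. K u * (K u * p (x - h * u - w)))"
    using kernel_integral(1)[of "\<lambda>u. K u * p (x - h * u - w)" "BK * Bp"] b' by simp
  show "integrable lborel (\<lambda>z. p (z - w) * (Kh h z)\<^sup>2)"
    using shift_mean_kernel(2)[OF h, of "Kh h" w] i unfolding s by (simp add: power2_eq_square)
  have eq: "(\<integral>z. p (z - w) * (Kh h z)\<^sup>2 \<partial>lborel) = h * (\<integral>u. K u * (K u * p (x - h * u - w)) \<partial>lborel)"
    using shift_mean_kernel(1)[OF h, of "Kh h" w] unfolding s by (simp add: shift_mean_def power2_eq_square)
  show "(\<integral>z. p (z - w) * (Kh h z)\<^sup>2 \<partial>lborel) \<le> h * (BK * Bp)"
    unfolding eq using kernel_bounded[of "\<lambda>u. K u * p (x - h * u - w)" "BK * Bp"] b h by (intro mult_left_mono) auto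
  have iK: "integrable lborel (\<lambda>u. K u * K u)"
  proof -
    have "\<bar>K u\<bar> \<le> BK * (1 + u\<^sup>2)" for u
      using K_nonneg[of u] K_le[of u] mult_left_mono[OF one_plus_square_ge[of u], of BK] bounds_nonneg by simp
    then show ?thesis using kernel_integral(1)[of K BK] by simp
  qed
  have "(\<integral>z. p (z - w) * (Kh h z)\<^sup>2 \<partial>lborel) - h * \<kappa>1 * p (x - w)
      = h * (\<integral>u. K u * (K u * (p (x - h * u - w) - p (x - w))) \<partial>lborel)"
  proof -
    have "(\<integral>u. K u * (K u * (p (x - h * u - w) - p (x - w))) \<partial>lborel) =
       (\<integral>u. K u * (K u * p (x - h * u - w)) - p (x - w) * (K u * K u) \<partial>lborel)"
      by (simp add: algebra_simps)
    also have "\<dots> = (\<integral>u. K u * (K u * p (x - h * u - w)) \<partial>lborel) - p (x - w) * \<kappa>1"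
      using i iK by (simp add: \<kappa>1_def power2_eq_square)
    finally show ?thesis unfolding eq by (simp only: right_diff_distrib mult_ac)
  qed
  also have "\<bar>\<dots>\<bar> \<le> h * ((BK * Bp * h) * \<kappa>)"
  proof -
    have "\<bar>K u * (p (x - h * u - w) - p (x - w))\<bar> \<le> BK * Bp * h * (1 + u\<^sup>2)" for u
    proof -
      have "\<bar>K u * (p (x - h * u - w) - p (x - w))\<bar> \<le> BK * (Bp * (h * \<bar>u\<bar>))"
        using dens_lip[of "x - h * u - w" "x - w"] h K_nonneg[of u] K_le[of u] bounds_nonneg
        unfolding abs_mult by (intro mult_mono) (auto simp: abs_mult)
      also have "\<dots> \<le> BK * (Bp * (h * (1 + u\<^sup>2)))" using h bounds_nonneg abs_le_one_plus_square[of u] by (intro mult_left_mono) auto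
      finally show ?thesis by (simp add: mult.assoc)
    qed
    then show ?thesis
      using kernel_integral(2)[of "\<lambda>u. K u * (p (x - h * u - w) - p (x - w))" "BK * Bp * h"] h
      by (simp add: abs_mult)
  qed
  finally show "\<bar>(\<integral>z. p (z - w) * (Kh h z)\<^sup>2 \<partial>lborel) - h * \<kappa>1 * p (x - w)\<bar> \<le> h\<^sup>2 * (BK * Bp * \<kappa>)"
    by (simp add: power2_eq_square algebra_simps)
qed

text \<open>Replacing p (x - h u - w) by p (x - w) costs a product of two first-order differences,
  hence h^2. What remains is p (x - w) times the kernel mean of the increment \<open>?d\<close> of
  \<open>m\<close>, whose linear part integrates to 0 and whose Taylor remainder is again of order
  h^2. The Jacobian supplies the third power of h.\<close>

lemma smoothed_increment:
  assumes h: "h > 0"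
  shows "\<bar>shift_mean p (\<lambda>z. Kh h z * (m z - m x)) w\<bar> \<le> 2 * Bm * Bp * \<kappa> * h ^ 3"
proof -
  let ?d = "\<lambda>u. m (x - h * u) - m x"
  have d: "\<bar>?d u\<bar> \<le> Bm * h * \<bar>u\<bar>" "\<bar>?d u + m1 * h * u\<bar> \<le> Bm * h\<^sup>2 * u\<^sup>2" for u
    using m_lip[of "x - h * u"] m_taylor[of "x - h * u"] h by (auto simp: abs_mult power_mult_distrib algebra_simps)
  have d': "\<bar>?d u + m1 * h * u\<bar> \<le> Bm * h\<^sup>2 * (1 + u\<^sup>2)" for u
    using order_trans[OF d(2)[of u], of "Bm * h\<^sup>2 * (1 + u\<^sup>2)"] bounds_nonneg by (simp add: mult_left_mono)
  have A: "\<bar>?d u * (p (x - h * u - w) - p (x - w))\<bar> \<le> Bm * Bp * h\<^sup>2 * (1 + u\<^sup>2)" for u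
  proof -
    have "\<bar>?d u * (p (x - h * u - w) - p (x - w))\<bar> \<le> (Bm * h * \<bar>u\<bar>) * (Bp * (h * \<bar>u\<bar>))"
      unfolding abs_mult using d(1)[of u] dens_lip[of "x - h * u - w" "x - w"] h bounds_nonneg
      by (intro mult_mono) (auto simp: abs_mult)
    also have "\<dots> = Bm * Bp * h\<^sup>2 * u\<^sup>2" by (simp add: power2_eq_square)
    also have "\<dots> \<le> Bm * Bp * h\<^sup>2 * (1 + u\<^sup>2)" using bounds_nonneg by (intro mult_left_mono) auto
    finally show ?thesis .
  qed
  have iA: "integrable lborel (\<lambda>u. K u * (?d u * (p (x - h * u - w) - p (x - w))))"
    by (rule kernel_integral(1)[OF _ A]) measurable
  have iB: "integrable lborel (\<lambda>u. K u * (?d u + m1 * h * u))"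
    by (rule kernel_integral(1)[OF _ d']) measurable
  have iC: "integrable lborel (\<lambda>u. u * K u)" by (rule K_int1)
  have "(\<integral>u. K u * (?d u * p (x - h * u - w)) \<partial>lborel) =
     (\<integral>u. K u * (?d u * (p (x - h * u - w) - p (x - w))) + p (x - w) * (K u * (?d u + m1 * h * u)) - (p (x - w) * m1 * h) * (u * K u) \<partial>lborel)"
    by (intro Bochner_Integration.integral_cong) (auto simp: algebra_simps)
  also have "\<dots> = (\<integral>u. K u * (?d u * (p (x - h * u - w) - p (x - w))) \<partial>lborel) + p (x - w) * (\<integral>u. K u * (?d u + m1 * h * u) \<partial>lborel)
      - (p (x - w) * m1 * h) * (\<integral>u. u * K u \<partial>lborel)"
    using iA iB iC by simp
  finally have eq: "(\<integral>u. K u * (?d u * p (x - h * u - w)) \<partial>lborel) = (\<integral>u. K u * (?d u * (p (x - h * u - w) - p (x - w))) \<partial>lborel) + p (x - w) * (\<integral>u. K u * (?d u + m1 * h * u) \<partial>lborel)"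
    using K_int1 by simp
  have "\<bar>\<integral>u. K u * (?d u * p (x - h * u - w)) \<partial>lborel\<bar> \<le> Bm * Bp * h\<^sup>2 * \<kappa> + Bp * (Bm * h\<^sup>2 * \<kappa>)"
    unfolding eq
  proof (intro order_trans[OF abs_triangle_ineq] add_mono)
    show "\<bar>\<integral>u. K u * (?d u * (p (x - h * u - w) - p (x - w))) \<partial>lborel\<bar> \<le> Bm * Bp * h\<^sup>2 * \<kappa>"
      by (rule kernel_integral(2)[OF _ A]) measurable
    have "\<bar>\<integral>u. K u * (?d u + m1 * h * u) \<partial>lborel\<bar> \<le> Bm * h\<^sup>2 * \<kappa>"
      by (rule kernel_integral(2)[OF _ d']) measurable
    then show "\<bar>p (x - w) * (\<integral>u. K u * (?d u + m1 * h * u) \<partial>lborel)\<bar> \<le> Bp * (Bm * h\<^sup>2 * \<kappa>)"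
      unfolding abs_mult using dens_nonneg[of "x - w"] dens_le[of "x - w"] by (intro mult_mono) auto
  qed
  then have "h * \<bar>\<integral>u. K u * (?d u * p (x - h * u - w)) \<partial>lborel\<bar> \<le> h * (Bm * Bp * h\<^sup>2 * \<kappa> + Bp * (Bm * h\<^sup>2 * \<kappa>))"
    using h by (intro mult_left_mono) auto
  then show ?thesis
    using shift_mean_kernel(1)[OF h, of "\<lambda>z. m z - m x" w] h
    by (simp add: abs_mult power3_eq_cube power2_eq_square algebra_simps)
qed

text \<open>\<open>c\<close> will be the centering \<open>c n\<close>, whose distance to
  \<open>m x\<close> is of order h^2 by the lemma \<open>center\<close>.\<close>

context
  fixes h c C :: real
  assumes h: "0 < h" "h \<le> 1" and c: "\<bar>c - m x\<bar> \<le> C * h\<^sup>2"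
begin

lemma C_nonneg: "0 \<le> C"
  using order_trans[OF abs_ge_zero c] h by (simp add: zero_le_mult_iff)

lemma centered_increment:
  "\<bar>m (x - h * u) - c\<bar> \<le> Bm * h * \<bar>u\<bar> + C * h\<^sup>2"
proof -
  have "\<bar>m (x - h * u) - m x\<bar> \<le> Bm * h * \<bar>u\<bar>"
    using m_lip[of "x - h * u"] h by (simp add: abs_mult)
  with c show ?thesis by linarith
qed

text \<open>The rate h^3 survives differencing in \<open>w\<close>. Let \<open>?q\<close> be the
  difference of the densities at \<open>w\<close> and \<open>w'\<close>, and \<open>?qz\<close> its
  value at u = 0. The part with ?q - ?qz is an increment of order h times a mixed second difference
  of order h |w - w'|. The part with \<open>?qz\<close> is of order |w - w'| times the kernel mean
  of \<open>?d\<close>, which is O(h^2) since the linear term integrates to 0.\<close>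

lemma centered_lipschitz:
  "\<bar>shift_mean p (\<lambda>z. Kh h z * (m z - c)) w - shift_mean p (\<lambda>z. Kh h z * (m z - c)) w'\<bar>
    \<le> 3 * Bp * (Bm + C) * \<kappa> * h ^ 3 * \<bar>w - w'\<bar>"
proof -
  let ?d = "\<lambda>u. m (x - h * u) - c"
  let ?q = "\<lambda>u. p (x - h * u - w) - p (x - h * u - w')"
  let ?qz = "p (x - w) - p (x - w')"
  let ?D = "\<bar>w - w'\<bar>"
  note C = C_nonneg
  have hh: "h\<^sup>2 \<le> h" using h by (simp add: power2_eq_square mult_left_le)
  have q: "\<bar>?q u - ?qz\<bar> \<le> Bp * (h * \<bar>u\<bar>) * ?D" for u
    using dens_lip2[of "x - h * u" w w' x] h by (simp add: abs_mult)
  have q0: "\<bar>?qz\<bar> \<le> Bp * ?D" using dens_lip[of "x - w" "x - w'"] by (simp add: abs_minus_commute)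
  have dle: "\<bar>?d u\<bar> \<le> (Bm + C) * h * (1 + u\<^sup>2)" for u
  proof -
    have "\<bar>?d u\<bar> \<le> Bm * h * \<bar>u\<bar> + C * h\<^sup>2" by (rule centered_increment)
    also have "\<dots> \<le> Bm * h * (1 + u\<^sup>2) + C * h * (1 + u\<^sup>2)"
    proof (intro add_mono mult_left_mono abs_le_one_plus_square)
      have "C * h\<^sup>2 \<le> C * h" using C hh by (intro mult_left_mono)
      also have "\<dots> \<le> C * h * (1 + u\<^sup>2)" using C h mult_left_mono[OF one_plus_square_ge[of u], of "C * h"] by simp
      finally show "C * h\<^sup>2 \<le> C * h * (1 + u\<^sup>2)" .
    qed (use bounds_nonneg h in auto)
    finally show ?thesis by (simp add: algebra_simps)
  qed
  have A: "\<bar>?d u * (?q u - ?qz)\<bar> \<le> (Bm + C) * Bp * h\<^sup>2 * ?D * (1 + u\<^sup>2)" for u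
  proof -
    have "\<bar>?d u * (?q u - ?qz)\<bar> \<le> (Bm * h * \<bar>u\<bar> + C * h\<^sup>2) * (Bp * (h * \<bar>u\<bar>) * ?D)"
      unfolding abs_mult[of "?d u"] using q centered_increment[of u] C h bounds_nonneg by (intro mult_mono) auto
    also have "\<dots> = (Bp * h\<^sup>2 * ?D) * (Bm * u\<^sup>2) + (Bp * h\<^sup>2 * ?D) * (C * (h * \<bar>u\<bar>))"
      by (simp add: power2_eq_square algebra_simps)
    also have "\<dots> \<le> (Bp * h\<^sup>2 * ?D) * (Bm * (1 + u\<^sup>2)) + (Bp * h\<^sup>2 * ?D) * (C * (1 + u\<^sup>2))"
    proof (intro add_mono mult_left_mono)
      show "h * \<bar>u\<bar> \<le> 1 + u\<^sup>2" using mult_right_mono[OF h(2), of "\<bar>u\<bar>"] abs_le_one_plus_square[of u] by simp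
    qed (use C bounds_nonneg in auto)
    finally show ?thesis by (simp add: algebra_simps)
  qed
  have B: "\<bar>?d u * p y\<bar> \<le> (Bm + C) * h * Bp * (1 + u\<^sup>2)" for u y
  proof -
    have "\<bar>?d u * p y\<bar> \<le> ((Bm + C) * h * (1 + u\<^sup>2)) * Bp"
      unfolding abs_mult using dle[of u] dens_nonneg[of y] dens_le[of y] C h bounds_nonneg by (intro mult_mono) auto
    then show ?thesis by (simp add: algebra_simps)
  qed
  have iA: "integrable lborel (\<lambda>u. K u * (?d u * (?q u - ?qz)))"
    by (rule kernel_integral(1)[OF _ A]) measurable
  have id: "integrable lborel (\<lambda>u. K u * ?d u)"
    by (rule kernel_integral(1)[OF _ dle]) measurable
  have ip: "integrable lborel (\<lambda>u. K u * (?d u * p (x - h * u - w)))" for w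
    by (rule kernel_integral(1)[OF _ B]) measurable
  have mean: "\<bar>\<integral>u. K u * ?d u \<partial>lborel\<bar> \<le> (Bm * \<kappa> + C) * h\<^sup>2"
  proof -
    have t: "\<bar>m (x - h * u) - m x + m1 * h * u\<bar> \<le> Bm * h\<^sup>2 * (1 + u\<^sup>2)" for u
    proof -
      have "\<bar>m (x - h * u) - m x + m1 * h * u\<bar> \<le> Bm * h\<^sup>2 * u\<^sup>2"
        using m_taylor[of "x - h * u"] by (auto simp: abs_mult power_mult_distrib algebra_simps)
      also have "\<dots> \<le> Bm * h\<^sup>2 * (1 + u\<^sup>2)" using bounds_nonneg by (intro mult_left_mono) auto
      finally show ?thesis .
    qed
    have it: "integrable lborel (\<lambda>u. K u * (m (x - h * u) - m x + m1 * h * u))"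
      by (rule kernel_integral(1)[OF _ t]) measurable
    have "(\<integral>u. K u * ?d u \<partial>lborel) = (\<integral>u. K u * (m (x - h * u) - m x + m1 * h * u) - (m1 * h) * (u * K u) - (c - m x) * K u \<partial>lborel)"
      by (intro Bochner_Integration.integral_cong) (auto simp: algebra_simps)
    also have "\<dots> = (\<integral>u. K u * (m (x - h * u) - m x + m1 * h * u) \<partial>lborel) - (c - m x)"
      using it K_int K_int1 by simp
    also have "\<bar>\<dots>\<bar> \<le> Bm * h\<^sup>2 * \<kappa> + C * h\<^sup>2"
      using kernel_integral(2)[OF _ t] by (intro order_trans[OF abs_triangle_ineq4 add_mono[OF _ c]]) auto
    finally show ?thesis by (simp add: algebra_simps)
  qed
  have "shift_mean p (\<lambda>z. Kh h z * (m z - c)) w - shift_mean p (\<lambda>z. Kh h z * (m z - c)) w'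
     = h * (\<integral>u. K u * (?d u * p (x - h * u - w)) - K u * (?d u * p (x - h * u - w')) \<partial>lborel)"
    unfolding shift_mean_kernel(1)[OF h(1), of "\<lambda>z. m z - c"]
    by (subst Bochner_Integration.integral_diff[OF ip ip]) (simp add: right_diff_distrib)
  also have "\<dots> = h * (\<integral>u. K u * (?d u * (?q u - ?qz)) + ?qz * (K u * ?d u) \<partial>lborel)"
    by (intro arg_cong[where f="\<lambda>y. h * y"] Bochner_Integration.integral_cong) (auto simp: algebra_simps)
  also have "\<dots> = h * ((\<integral>u. K u * (?d u * (?q u - ?qz)) \<partial>lborel) + ?qz * (\<integral>u. K u * ?d u \<partial>lborel))"
    by (subst Bochner_Integration.integral_add[OF iA]) (use id in auto)
  finally have eq: "shift_mean p (\<lambda>z. Kh h z * (m z - c)) w - shift_mean p (\<lambda>z. Kh h z * (m z - c)) w'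
     = h * ((\<integral>u. K u * (?d u * (?q u - ?qz)) \<partial>lborel) + ?qz * (\<integral>u. K u * ?d u \<partial>lborel))" .
  have "\<bar>shift_mean p (\<lambda>z. Kh h z * (m z - c)) w - shift_mean p (\<lambda>z. Kh h z * (m z - c)) w'\<bar> \<le> h * ((Bm + C) * Bp * h\<^sup>2 * ?D * \<kappa> + (Bp * ?D) * ((Bm * \<kappa> + C) * h\<^sup>2))"
    unfolding eq abs_mult[of h] abs_of_pos[OF h(1)]
  proof (intro mult_left_mono order_trans[OF abs_triangle_ineq] add_mono)
    show "\<bar>\<integral>u. K u * (?d u * (?q u - ?qz)) \<partial>lborel\<bar> \<le> (Bm + C) * Bp * h\<^sup>2 * ?D * \<kappa>"
      by (rule kernel_integral(2)[OF _ A]) measurable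
    show "\<bar>?qz * (\<integral>u. K u * ?d u \<partial>lborel)\<bar> \<le> (Bp * ?D) * ((Bm * \<kappa> + C) * h\<^sup>2)"
      unfolding abs_mult[of ?qz] using q0 mean bounds_nonneg by (intro mult_mono) auto
  qed (use h in auto)
  also have "\<dots> = Bp * h ^ 3 * ?D * ((Bm + C) * \<kappa> + (Bm * \<kappa> + C))"
    by (simp add: power3_eq_cube power2_eq_square algebra_simps)
  also have "\<dots> \<le> Bp * h ^ 3 * ?D * (3 * ((Bm + C) * \<kappa>))"
  proof (intro mult_left_mono)
    \<comment> \<open>\<kappa> is at least 1, so the free constant \<open>C\<close> is absorbed into
      the terms that carry \<kappa>.\<close>
    have "C \<le> C * \<kappa>" "0 \<le> Bm * \<kappa>" "0 \<le> C * \<kappa>" using C bounds_nonneg mult_left_mono[of 1 \<kappa> C] by auto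
    then show "(Bm + C) * \<kappa> + (Bm * \<kappa> + C) \<le> 3 * ((Bm + C) * \<kappa>)" by (simp add: algebra_simps)
  qed (use h bounds_nonneg in auto)
  finally show ?thesis by (simp add: mult_ac)
qed

text \<open>The substitution contributes one power of h and the squared increment two more; h <= 1
  lets the offset C h^2 count as a first-order term.\<close>

lemma centered_square:
  shows "integrable lborel (\<lambda>z. p (z - w) * (Kh h z * (m z - c))\<^sup>2)"
    and "(\<integral>z. p (z - w) * (Kh h z * (m z - c))\<^sup>2 \<partial>lborel) \<le> h ^ 3 * (BK * Bp * (2 * Bm\<^sup>2 + 2 * C\<^sup>2) * \<kappa>)"
proof -
  let ?d = "\<lambda>u. m (x - h * u) - c"
  let ?G = "\<lambda>z. Kh h z * (m z - c)\<^sup>2"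
  let ?B = "BK * Bp * (2 * Bm\<^sup>2 + 2 * C\<^sup>2) * h\<^sup>2"
  have s: "K ((x - (x - h * u)) / h) = K u" for u using h by simp
  have d2: "(?d u)\<^sup>2 \<le> (2 * Bm\<^sup>2 + 2 * C\<^sup>2) * h\<^sup>2 * (1 + u\<^sup>2)" for u
  proof -
    have "(?d u)\<^sup>2 \<le> (Bm * h * \<bar>u\<bar> + C * h\<^sup>2)\<^sup>2"
      using power_mono[OF centered_increment[of u], of 2] by simp
    also have "\<dots> \<le> 2 * (Bm * h * \<bar>u\<bar>)\<^sup>2 + 2 * (C * h\<^sup>2)\<^sup>2"
      using zero_le_power2[of "Bm * h * \<bar>u\<bar> - C * h\<^sup>2"] by (simp add: power2_eq_square algebra_simps)
    also have "\<dots> = h\<^sup>2 * (2 * Bm\<^sup>2 * u\<^sup>2 + 2 * C\<^sup>2 * h\<^sup>2)"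
      by (simp add: power2_eq_square algebra_simps)
    also have "\<dots> \<le> h\<^sup>2 * (2 * Bm\<^sup>2 * (1 + u\<^sup>2) + 2 * C\<^sup>2 * (1 + u\<^sup>2))"
    proof (intro mult_left_mono add_mono)
      show "h\<^sup>2 \<le> 1 + u\<^sup>2" using h power_mono[of h 1 2] by (simp add: add_increasing2)
    qed auto
    finally show ?thesis by (simp add: algebra_simps)
  qed
  have b: "\<bar>K u * (?d u)\<^sup>2 * p y\<bar> \<le> ?B * (1 + u\<^sup>2)" for u y
  proof -
    have "\<bar>K u * (?d u)\<^sup>2 * p y\<bar> \<le> BK * ((2 * Bm\<^sup>2 + 2 * C\<^sup>2) * h\<^sup>2 * (1 + u\<^sup>2)) * Bp"
      unfolding abs_mult using K_nonneg[of u] K_le[of u] dens_nonneg[of y] dens_le[of y] bounds_nonneg d2[of u]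
      by (intro mult_mono) auto
    then show ?thesis by (simp add: mult_ac)
  qed
  have i: "integrable lborel (\<lambda>u. K u * (K u * (?d u)\<^sup>2 * p (x - h * u - w)))"
    by (rule kernel_integral(1)[OF _ b]) measurable
  have e: "Kh h z * ?G z = (Kh h z * (m z - c))\<^sup>2" for z by (simp add: power2_eq_square mult_ac)
  show "integrable lborel (\<lambda>z. p (z - w) * (Kh h z * (m z - c))\<^sup>2)"
    using shift_mean_kernel(2)[OF h(1), of ?G w] i unfolding s e by simp
  have "(\<integral>z. p (z - w) * (Kh h z * (m z - c))\<^sup>2 \<partial>lborel) = h * (\<integral>u. K u * (K u * (?d u)\<^sup>2 * p (x - h * u - w)) \<partial>lborel)"
    using shift_mean_kernel(1)[OF h(1), of ?G w] unfolding s e by (simp add: shift_mean_def)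
  also have "\<dots> \<le> h * (?B * \<kappa>)"
    using kernel_integral(2)[OF _ b, of "\<lambda>u. x - h * u - w"] h by (intro mult_left_mono) auto
  finally show "(\<integral>z. p (z - w) * (Kh h z * (m z - c))\<^sup>2 \<partial>lborel) \<le> h ^ 3 * (BK * Bp * (2 * Bm\<^sup>2 + 2 * C\<^sup>2) * \<kappa>)"
    by (simp add: power3_eq_cube power2_eq_square mult_ac)
qed

end

end

section \<open>The studentized estimator\<close>

lemma lipschitz_borel_measurable:
  fixes g :: "real \<Rightarrow> real"
  assumes "\<And>w w'. \<bar>g w - g w'\<bar> \<le> L * \<bar>w - w'\<bar>"
  shows "g \<in> borel_measurable borel"
proof -
  have "0 \<le> L" using assms[of 1 0] by (simp add: order_trans[OF abs_ge_zero])
  then have "L-lipschitz_on UNIV g" using assms by (auto simp: lipschitz_on_def dist_real_def)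
  then show ?thesis by (intro borel_measurable_continuous_onI lipschitz_on_continuous_on)
qed

text \<open>Large values are set to 0 instead of being clipped: the kept and the removed part then
  have disjoint supports, and their squares add up to y^2.\<close>

definition trunc :: "real \<Rightarrow> real \<Rightarrow> real" where
  "trunc B y = (if \<bar>y\<bar> \<le> B then y else 0)"

lemma trunc_measurable [measurable]: "trunc B \<in> borel_measurable borel"
  unfolding trunc_def[abs_def] by measurable

lemma abs_trunc_le: "0 \<le> B \<Longrightarrow> \<bar>trunc B y\<bar> \<le> B" and trunc_square_le: "(trunc B y)\<^sup>2 \<le> y\<^sup>2"
  and trunc_residual_square: "(y - trunc B y)\<^sup>2 = y\<^sup>2 - (trunc B y)\<^sup>2"
  by (auto simp: trunc_def)

lemma (in prob_space) expectation_le_sqrt: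
  assumes [measurable]: "Z \<in> borel_measurable M" and "integrable M (\<lambda>\<omega>. (Z \<omega>)\<^sup>2)"
    and "expectation (\<lambda>\<omega>. (Z \<omega>)\<^sup>2) \<le> C"
  shows "integrable M Z" "expectation (\<lambda>\<omega>. \<bar>Z \<omega>\<bar>) \<le> sqrt C"
proof -
  show i: "integrable M Z" using assms(2) by (rule square_integrable_imp_integrable[rotated]) simp
  have "(expectation (\<lambda>\<omega>. \<bar>Z \<omega>\<bar>))\<^sup>2 \<le> expectation (\<lambda>\<omega>. \<bar>Z \<omega>\<bar>\<^sup>2)"
  proof -
    have "0 \<le> variance (\<lambda>\<omega>. \<bar>Z \<omega>\<bar>)" by (rule variance_positive)
    also have "\<dots> = expectation (\<lambda>\<omega>. \<bar>Z \<omega>\<bar>\<^sup>2) - (expectation (\<lambda>\<omega>. \<bar>Z \<omega>\<bar>))\<^sup>2"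
    proof (rule variance_eq)
      show "integrable M (\<lambda>\<omega>. \<bar>Z \<omega>\<bar>)" using i by (rule integrable_abs)
      show "integrable M (\<lambda>\<omega>. \<bar>Z \<omega>\<bar>\<^sup>2)" using assms(2) by simp
    qed
    finally show ?thesis by linarith
  qed
  then have "(expectation (\<lambda>\<omega>. \<bar>Z \<omega>\<bar>))\<^sup>2 \<le> C" using assms by simp
  then show "expectation (\<lambda>\<omega>. \<bar>Z \<omega>\<bar>) \<le> sqrt C" by (rule real_le_rsqrt)
qed

text \<open>All errors are known in \<open>F 0\<close>, which makes sums weighted by errors
  martingale transforms in the regressors; this is arranged later on a product space. Independence
  is stated for pairs of times because second moments of sums involve two times. \<gamma> bounds
  covariances of Lipschitz functionals of the \<open>W i\<close> per squared Lipschitz constant. Its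
  three limits serve the bias, the averages in the density estimate and the conditional variance,
  and the cross term.\<close>

locale nw_model = innovations M F \<xi> W p + smoothing K p m BK Bp Bm m1 x
  for M :: "'a measure" and F \<xi> W p K m BK Bp Bm m1 x +
  fixes h :: "nat \<Rightarrow> real" and \<epsilon> :: "nat \<Rightarrow> 'a \<Rightarrow> real" and \<gamma> :: "nat \<Rightarrow> nat \<Rightarrow> real"
  assumes h0: "h \<longlonglongrightarrow> 0" and nh: "filterlim (\<lambda>n. real n * h n) at_top sequentially"
    and \<epsilon>_F: "\<And>i. \<epsilon> i \<in> borel_measurable (F 0)"
    and \<epsilon>_distr: "\<And>i. distr M borel (\<epsilon> i) = distr M borel (\<epsilon> 0)"
    and \<epsilon>_int: "integrable M (\<lambda>\<omega>. (\<epsilon> 0 \<omega>)\<^sup>2)" and \<epsilon>_var: "expectation (\<lambda>\<omega>. (\<epsilon> 0 \<omega>)\<^sup>2) = 1"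
    and W_distr: "\<And>i. distr M borel (W i) = distr M borel (W 0)"
    and W_cov: "\<And>g L i j. (\<And>w w'. \<bar>g w - g w'\<bar> \<le> L * \<bar>w - w'\<bar>) \<Longrightarrow> expectation (\<lambda>\<omega>. g (W 0 \<omega>)) = 0 \<Longrightarrow>
        integrable M (\<lambda>\<omega>. g (W i \<omega>) * g (W j \<omega>)) \<and> \<bar>expectation (\<lambda>\<omega>. g (W i \<omega>) * g (W j \<omega>))\<bar> \<le> L\<^sup>2 * \<gamma> i j"
    and W_\<epsilon>: "\<And>i j. indep_var (borel \<Otimes>\<^sub>M borel) (\<lambda>\<omega>. (W i \<omega>, W j \<omega>)) (borel \<Otimes>\<^sub>M borel) (\<lambda>\<omega>. (\<epsilon> i \<omega>, \<epsilon> j \<omega>))"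
    and \<gamma>_nonneg: "\<And>i j. 0 \<le> \<gamma> i j"
    and lln: "\<And>B. (\<lambda>n. expectation (\<lambda>\<omega>. \<bar>1 / real n * (\<Sum>i<n. (trunc B (\<epsilon> i \<omega>))\<^sup>2) - expectation (\<lambda>\<omega>. (trunc B (\<epsilon> 0 \<omega>))\<^sup>2)\<bar>)) \<longlonglongrightarrow> 0"
    and sum_\<epsilon>: "small_oP M (\<lambda>n \<omega>. sqrt (real n * h n) / real n * (\<Sum>i<n. \<epsilon> i \<omega>))"
    and \<gamma>_bias: "(\<lambda>n. h n ^ 5 / real n * (\<Sum>i<n. \<Sum>j<n. \<gamma> i j)) \<longlonglongrightarrow> 0"
    and \<gamma>_mean: "(\<lambda>n. 1 / (real n)\<^sup>2 * (\<Sum>i<n. \<Sum>j<n. \<gamma> i j)) \<longlonglongrightarrow> 0"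
    and \<gamma>_cross: "(\<lambda>n. h n / real n * (\<Sum>i<n. \<Sum>j<n. \<gamma> i j * \<bar>expectation (\<lambda>\<omega>. \<epsilon> i \<omega> * \<epsilon> j \<omega>)\<bar>)) \<longlonglongrightarrow> 0"
    and dens_pos: "expectation (\<lambda>\<omega>. p (x - W 0 \<omega>)) > 0"
    and \<kappa>1_pos: "\<kappa>1 > 0"
begin

text \<open>The density of W 0 + \<xi> 0 at \<open>x\<close>, with the predictable part averaged
  out.\<close>

definition "f0 = expectation (\<lambda>\<omega>. p (x - W 0 \<omega>))"
definition "s n = 1 / sqrt (real n * h n)"
definition "lam n = expectation (\<lambda>\<omega>. Lam (h n) (W 0 \<omega>))"
definition "fhat n \<omega> = 1 / (real n * h n) * (\<Sum>i<n. Kh (h n) (X i \<omega>))"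
definition "c n = expectation (\<lambda>\<omega>. Kh (h n) (X 0 \<omega>) * m (X 0 \<omega>)) / expectation (\<lambda>\<omega>. Kh (h n) (X 0 \<omega>))"
definition "\<Gamma> n = shift_mean p (\<lambda>z. Kh (h n) z * (m z - c n))"
text \<open>The numerator of \<open>c n - m x\<close> is at most 2 Bm Bp \<kappa> h^3 and its
  denominator at least h f0 / 2; the quotient is this constant times h^2.\<close>

definition "Cc = 4 * Bm * Bp * \<kappa> / f0"
definition "GG n = (\<Sum>i<n. \<Sum>j<n. \<gamma> i j)"
definition "A n \<omega> = s n * (\<Sum>i<n. \<epsilon> i \<omega> * (Kh (h n) (X i \<omega>) - Lam (h n) (W i \<omega>)))"
text \<open>The studentized estimator multiplied out: dividing by the density estimate and
  multiplying by its square root leaves one reciprocal square root.\<close>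

definition "stat n \<omega> = 1 / sqrt (\<kappa>1 * fhat n \<omega>) * (s n * (\<Sum>i<n. Kh (h n) (X i \<omega>) * (m (X i \<omega>) + \<epsilon> i \<omega> - c n)))"

lemma \<epsilon>_M [measurable]: "\<epsilon> i \<in> borel_measurable M" by (rule measurable_F_M[OF \<epsilon>_F])
lemma \<epsilon>_Fi: "\<epsilon> i \<in> borel_measurable (F j)" by (rule measurable_F_mono[OF \<epsilon>_F]) simp
lemmas [measurable] = innD(2,4)

lemma \<Gamma>_measurable [measurable]: "\<Gamma> n \<in> borel_measurable borel"
  unfolding \<Gamma>_def by measurable

lemma fhat_measurable [measurable]: "fhat n \<in> borel_measurable M"
  unfolding fhat_def[abs_def] by measurable

lemma A_measurable [measurable]: "A n \<in> borel_measurable M"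
  unfolding A_def[abs_def] by measurable

lemma stat_measurable [measurable]: "stat n \<in> borel_measurable M"
  unfolding stat_def[abs_def] by measurable

lemma f0_pos: "f0 > 0" using dens_pos by (simp add: f0_def)

text \<open>The last conjunct keeps \<open>lam n\<close> above h f0 / 2, so that the centering is a
  quotient with a controlled denominator.\<close>

lemma evn: "\<forall>\<^sub>F n in sequentially. 0 < n \<and> 0 < h n \<and> h n \<le> 1 \<and> (s n)\<^sup>2 = 1 / (real n * h n) \<and> s n > 0 \<and> h n * Bp * \<kappa> \<le> f0 / 2"
proof -
  have 1: "\<forall>\<^sub>F n in sequentially. h n < 1" using order_tendstoD(2)[OF h0, of 1] by simp
  have 2: "\<forall>\<^sub>F n in sequentially. real n * h n \<ge> 1" using nh unfolding filterlim_at_top by auto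
  have "(\<lambda>n. h n * Bp * \<kappa>) \<longlonglongrightarrow> 0" using tendsto_mult_left_zero[OF tendsto_mult_left_zero[OF h0]] by simp
  from order_tendstoD(2)[OF this, of "f0 / 2"] f0_pos have 3: "\<forall>\<^sub>F n in sequentially. h n * Bp * \<kappa> < f0 / 2" by simp
  show ?thesis using 1 2 3 eventually_gt_at_top[of 0]
  proof eventually_elim
    case (elim n)
    then have "h n > 0" using zero_less_mult_iff[of "real n" "h n"] by linarith
    with elim show ?case by (auto simp: s_def power_divide)
  qed
qed

lemma \<epsilon>_expectation:
  fixes g :: "real \<Rightarrow> real"
  assumes [measurable]: "g \<in> borel_measurable borel"
  shows "expectation (\<lambda>\<omega>. g (\<epsilon> i \<omega>)) = expectation (\<lambda>\<omega>. g (\<epsilon> 0 \<omega>))"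
    and "integrable M (\<lambda>\<omega>. g (\<epsilon> i \<omega>)) \<longleftrightarrow> integrable M (\<lambda>\<omega>. g (\<epsilon> 0 \<omega>))"
  using integral_distr[of "\<epsilon> i" M borel g] integral_distr[of "\<epsilon> 0" M borel g]
    integrable_distr_eq[of "\<epsilon> i" M borel g] integrable_distr_eq[of "\<epsilon> 0" M borel g] \<epsilon>_distr[of i] by simp_all

text \<open>In the expanded square every expectation factors, since a pair of regressor terms is
  independent of the pair of error terms. Keeping the moments of the error pairs is what lets the
  memory of the errors enter the cross term; the constant weight 1 gives the plain variance
  bound.\<close>

lemma weighted_sum_square:
  fixes g z :: "real \<Rightarrow> real"
  assumes g: "\<And>w w'. \<bar>g w - g w'\<bar> \<le> L * \<bar>w - w'\<bar>" and g0: "expectation (\<lambda>\<omega>. g (W 0 \<omega>)) = 0"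
    and [measurable]: "z \<in> borel_measurable borel" and z: "integrable M (\<lambda>\<omega>. (z (\<epsilon> 0 \<omega>))\<^sup>2)"
  shows "integrable M (\<lambda>\<omega>. (\<Sum>i<n. g (W i \<omega>) * z (\<epsilon> i \<omega>))\<^sup>2)"
    and "expectation (\<lambda>\<omega>. (\<Sum>i<n. g (W i \<omega>) * z (\<epsilon> i \<omega>))\<^sup>2)
       \<le> L\<^sup>2 * (\<Sum>i<n. \<Sum>j<n. \<gamma> i j * \<bar>expectation (\<lambda>\<omega>. z (\<epsilon> i \<omega>) * z (\<epsilon> j \<omega>))\<bar>)"
proof -
  have [measurable]: "g \<in> borel_measurable borel" using g by (rule lipschitz_borel_measurable)
  let ?G = "\<lambda>i j \<omega>. g (W i \<omega>) * g (W j \<omega>)" and ?Z = "\<lambda>i j \<omega>. z (\<epsilon> i \<omega>) * z (\<epsilon> j \<omega>)"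
  have eq: "(\<Sum>i<n. g (W i \<omega>) * z (\<epsilon> i \<omega>))\<^sup>2 = (\<Sum>i<n. \<Sum>j<n. ?G i j \<omega> * ?Z i j \<omega>)" for \<omega>
    unfolding power2_eq_square sum_product by (intro sum.cong refl) (simp add: mult_ac)
  have zi: "integrable M (?Z i j)" for i j
  proof (rule Bochner_Integration.integrable_bound)
    show "integrable M (\<lambda>\<omega>. (z (\<epsilon> i \<omega>))\<^sup>2 + (z (\<epsilon> j \<omega>))\<^sup>2)"
      using z \<epsilon>_expectation(2)[of "\<lambda>y. (z y)\<^sup>2" i] \<epsilon>_expectation(2)[of "\<lambda>y. (z y)\<^sup>2" j] by auto
    have "\<bar>a * b\<bar> \<le> a\<^sup>2 + b\<^sup>2" for a b :: real
    proof -
      have "2 * (\<bar>a\<bar> * \<bar>b\<bar>) \<le> a\<^sup>2 + b\<^sup>2" using zero_le_power2[of "\<bar>a\<bar> - \<bar>b\<bar>"] by (simp add: power2_diff)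
      moreover have "0 \<le> \<bar>a\<bar> * \<bar>b\<bar>" by simp
      ultimately show ?thesis unfolding abs_mult by linarith
    qed
    then show "AE \<omega> in M. norm (?Z i j \<omega>) \<le> norm ((z (\<epsilon> i \<omega>))\<^sup>2 + (z (\<epsilon> j \<omega>))\<^sup>2)"
      by (intro AE_I2) (smt (verit) real_norm_def zero_le_power2)
  qed measurable
  have cov: "integrable M (?G i j)" "\<bar>expectation (?G i j)\<bar> \<le> L\<^sup>2 * \<gamma> i j" for i j
    using W_cov[OF g g0, of i j] by auto
  have ind: "indep_var borel (?G i j) borel (?Z i j)" for i j
    using indep_var_compose[OF W_\<epsilon>[of i j], of "\<lambda>q. g (fst q) * g (snd q)" borel "\<lambda>q. z (fst q) * z (snd q)" borel]
    by (simp add: comp_def)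
  note I = indep_var_integrable[OF ind cov(1) zi] indep_var_lebesgue_integral[OF ind cov(1) zi]
  show "integrable M (\<lambda>\<omega>. (\<Sum>i<n. g (W i \<omega>) * z (\<epsilon> i \<omega>))\<^sup>2)" unfolding eq by (intro Bochner_Integration.integrable_sum I(1))
  have "expectation (\<lambda>\<omega>. (\<Sum>i<n. g (W i \<omega>) * z (\<epsilon> i \<omega>))\<^sup>2) = (\<Sum>i<n. \<Sum>j<n. expectation (?G i j) * expectation (?Z i j))"
  proof -
    have "expectation (\<lambda>\<omega>. \<Sum>i<n. \<Sum>j<n. ?G i j \<omega> * ?Z i j \<omega>) = (\<Sum>i<n. expectation (\<lambda>\<omega>. \<Sum>j<n. ?G i j \<omega> * ?Z i j \<omega>))"
      by (rule Bochner_Integration.integral_sum) (intro Bochner_Integration.integrable_sum I(1))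
    also have "\<dots> = (\<Sum>i<n. \<Sum>j<n. expectation (\<lambda>\<omega>. ?G i j \<omega> * ?Z i j \<omega>))"
      by (intro sum.cong refl Bochner_Integration.integral_sum I(1))
    finally show ?thesis unfolding eq I(2) .
  qed
  also have "\<dots> \<le> (\<Sum>i<n. \<Sum>j<n. L\<^sup>2 * (\<gamma> i j * \<bar>expectation (?Z i j)\<bar>))"
  proof (intro sum_mono)
    fix i j
    have "expectation (?G i j) * expectation (?Z i j) \<le> \<bar>expectation (?G i j)\<bar> * \<bar>expectation (?Z i j)\<bar>"
      unfolding abs_mult[symmetric] by (rule abs_ge_self)
    also have "\<dots> \<le> (L\<^sup>2 * \<gamma> i j) * \<bar>expectation (?Z i j)\<bar>" by (intro mult_right_mono cov(2) abs_ge_zero)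
    finally show "expectation (?G i j) * expectation (?Z i j) \<le> L\<^sup>2 * (\<gamma> i j * \<bar>expectation (?Z i j)\<bar>)" by (simp add: mult.assoc)
  qed
  finally show "expectation (\<lambda>\<omega>. (\<Sum>i<n. g (W i \<omega>) * z (\<epsilon> i \<omega>))\<^sup>2)
       \<le> L\<^sup>2 * (\<Sum>i<n. \<Sum>j<n. \<gamma> i j * \<bar>expectation (\<lambda>\<omega>. z (\<epsilon> i \<omega>) * z (\<epsilon> j \<omega>))\<bar>)"
    by (simp add: sum_distrib_left)
qed

lemma sum_square:
  fixes g :: "real \<Rightarrow> real"
  assumes g: "\<And>w w'. \<bar>g w - g w'\<bar> \<le> L * \<bar>w - w'\<bar>" and g0: "expectation (\<lambda>\<omega>. g (W 0 \<omega>)) = 0"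
  shows "integrable M (\<lambda>\<omega>. (\<Sum>i<n. g (W i \<omega>))\<^sup>2)"
    and "expectation (\<lambda>\<omega>. (\<Sum>i<n. g (W i \<omega>))\<^sup>2) \<le> L\<^sup>2 * GG n"
  using weighted_sum_square[OF g g0, of "\<lambda>_. 1" n] by (simp_all add: prob_space GG_def)

lemma Lam_integrable: "h n > 0 \<Longrightarrow> integrable M (\<lambda>\<omega>. Lam (h n) (W i \<omega>))"
  using Lam_nonneg[of "h n"] Lam_le[of "h n"] by (intro integrable_const_bound[where B="h n * Bp"]) auto

lemma lam_approx: 
  assumes "h n > 0"
  shows "\<bar>lam n - h n * f0\<bar> \<le> (h n)\<^sup>2 * (Bp * \<kappa>)"
proof -
  have i: "integrable M (\<lambda>\<omega>. p (x - W 0 \<omega>))"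
    using dens_nonneg dens_le by (intro integrable_const_bound[where B=Bp]) auto
  have "lam n - h n * f0 = expectation (\<lambda>\<omega>. Lam (h n) (W 0 \<omega>) - h n * p (x - W 0 \<omega>))"
    unfolding lam_def f0_def using Lam_integrable[OF assms] i by simp
  then have "\<bar>lam n - h n * f0\<bar> = \<bar>expectation (\<lambda>\<omega>. Lam (h n) (W 0 \<omega>) - h n * p (x - W 0 \<omega>))\<bar>"
    by (rule arg_cong)
  also have "\<dots> \<le> expectation (\<lambda>\<omega>. \<bar>Lam (h n) (W 0 \<omega>) - h n * p (x - W 0 \<omega>)\<bar>)" by (rule integral_abs_bound)
  also have "\<dots> \<le> expectation (\<lambda>\<omega>. (h n)\<^sup>2 * (Bp * \<kappa>))"
    using Lam_approx[OF assms] Lam_integrable[OF assms] i by (intro integral_mono integrable_abs) auto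
  finally show ?thesis by (simp add: prob_space)
qed

lemma Kh_expectation: "h n > 0 \<Longrightarrow> expectation (\<lambda>\<omega>. Kh (h n) (X 0 \<omega>)) = lam n"
proof -
  assume "h n > 0"
  have i: "integrable M (\<lambda>\<omega>. Kh (h n) (X 0 \<omega>))"
    using K_nonneg K_le by (intro integrable_const_bound[where B=BK]) auto
  show ?thesis
    using innovation.integral_freeze[OF inn[of 0], of "\<lambda>(\<omega>, z). Kh (h n) z"] i
    by (simp add: lam_def Lam_def shift_mean_def)
qed

text \<open>The numerator of c n - m x is the mean of the smoothed increment, of order h^3, against
  a denominator of order h. The second claim expresses the choice of the ratio: subtracting (c n - m
  x) times the mean of \<open>Lam\<close> is exactly what cancels the mean of the smoothed
  increment.\<close>

lemma center:
  assumes n: "0 < h n" "h n \<le> 1" "h n * Bp * \<kappa> \<le> f0 / 2"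
  shows "\<bar>c n - m x\<bar> \<le> Cc * (h n)\<^sup>2" and "expectation (\<lambda>\<omega>. \<Gamma> n (W 0 \<omega>)) = 0"
proof -
  let ?g = "\<lambda>z. Kh (h n) z * (m z - m x)"
  let ?R = "shift_mean p ?g"
  have cm: "\<bar>m x - m x\<bar> \<le> 0 * (h n)\<^sup>2" by simp
  note sq = centered_square[OF n(1,2) cm]
  \<comment> \<open>\<open>?g\<close> may be unbounded; its integrability comes from a
    square-integrable deviation plus a bounded conditional mean.\<close>
  have "integrable M (\<lambda>\<omega>. (1 * (?g (X 0 \<omega>) - ?R (W 0 \<omega>)))\<^sup>2)"
    by (rule square_innovation(1)[OF _ sq]) simp_all
  then have "integrable M (\<lambda>\<omega>. ?g (X 0 \<omega>) - ?R (W 0 \<omega>))"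
    unfolding mult_1 by (rule square_integrable_imp_integrable[rotated]) simp
  moreover have iR: "integrable M (\<lambda>\<omega>. ?R (W 0 \<omega>))"
    using smoothed_increment[OF n(1)] by (intro integrable_const_bound[where B="2 * Bm * Bp * \<kappa> * h n ^ 3"]) auto
  ultimately have "integrable M (\<lambda>\<omega>. (?g (X 0 \<omega>) - ?R (W 0 \<omega>)) + ?R (W 0 \<omega>))"
    by (rule Bochner_Integration.integrable_add)
  then have ig: "integrable M (\<lambda>\<omega>. ?g (X 0 \<omega>))" by simp
  have Eg: "expectation (\<lambda>\<omega>. ?g (X 0 \<omega>)) = expectation (\<lambda>\<omega>. ?R (W 0 \<omega>))"
    using innovation.integral_freeze[OF inn[of 0], of "\<lambda>(\<omega>, z). ?g z"] ig by (simp add: shift_mean_def)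
  have Egle: "\<bar>expectation (\<lambda>\<omega>. ?g (X 0 \<omega>))\<bar> \<le> 2 * Bm * Bp * \<kappa> * h n ^ 3"
  proof -
    have "\<bar>expectation (\<lambda>\<omega>. ?R (W 0 \<omega>))\<bar> \<le> expectation (\<lambda>\<omega>. \<bar>?R (W 0 \<omega>)\<bar>)" by (rule integral_abs_bound)
    also have "\<dots> \<le> expectation (\<lambda>\<omega>. 2 * Bm * Bp * \<kappa> * h n ^ 3)"
      using smoothed_increment[OF n(1)] iR by (intro integral_mono integrable_abs) auto
    finally show ?thesis unfolding Eg by (simp add: prob_space)
  qed
  have iK: "integrable M (\<lambda>\<omega>. Kh (h n) (X 0 \<omega>))"
    using K_nonneg K_le by (intro integrable_const_bound[where B=BK]) auto
  have lam_ge: "lam n \<ge> h n * f0 / 2"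
  proof -
    have "(h n)\<^sup>2 * (Bp * \<kappa>) \<le> h n * (f0 / 2)"
      using mult_left_mono[OF n(3), of "h n"] n(1) by (simp add: power2_eq_square mult_ac)
    then show ?thesis using lam_approx[OF n(1)] by (auto simp: abs_le_iff)
  qed
  then have lam_pos: "lam n > 0" using n(1) f0_pos by (intro less_le_trans[OF _ lam_ge]) auto
  have "expectation (\<lambda>\<omega>. Kh (h n) (X 0 \<omega>) * m (X 0 \<omega>)) = expectation (\<lambda>\<omega>. ?g (X 0 \<omega>) + m x * Kh (h n) (X 0 \<omega>))"
    by (simp add: algebra_simps)
  also have "\<dots> = expectation (\<lambda>\<omega>. ?g (X 0 \<omega>)) + m x * lam n"
    using ig iK Kh_expectation[OF n(1)] by simp
  finally have c: "c n - m x = expectation (\<lambda>\<omega>. ?g (X 0 \<omega>)) / lam n"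
    unfolding c_def Kh_expectation[OF n(1)] using lam_pos by (simp add: field_simps)
  have "\<bar>c n - m x\<bar> = \<bar>expectation (\<lambda>\<omega>. ?g (X 0 \<omega>))\<bar> / lam n" unfolding c using lam_pos by simp
  also have "\<dots> \<le> (2 * Bm * Bp * \<kappa> * h n ^ 3) / (h n * f0 / 2)"
    using Egle lam_ge n(1) f0_pos bounds_nonneg by (intro frac_le) auto
  also have "\<dots> = Cc * (h n)\<^sup>2"
    unfolding Cc_def using n(1) f0_pos by (simp add: field_simps power2_eq_square power3_eq_cube)
  finally show "\<bar>c n - m x\<bar> \<le> Cc * (h n)\<^sup>2" .
  have "\<Gamma> n w = ?R w - (c n - m x) * Lam (h n) w" for w
  proof -
    interpret I: innovation M "F 0" "\<xi> 0" "W 0" p by (rule inn)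
    have a: "integrable lborel (\<lambda>z. p (z - w) * ?g z)"
      using weighted_integrable_first[of ?g "\<lambda>z. p (z - w)"] I.p_shift_integral[of w] dens_nonneg sq(1)[of w] by simp
    have b: "integrable lborel (\<lambda>z. p (z - w) * Kh (h n) z)"
      using weighted_integrable_first[of "Kh (h n)" "\<lambda>z. p (z - w)"] I.p_shift_integral[of w] dens_nonneg Kh_square(1)[OF n(1), of w] by simp
    have "\<Gamma> n w = (\<integral>z. p (z - w) * ?g z - (c n - m x) * (p (z - w) * Kh (h n) z) \<partial>lborel)"
      unfolding \<Gamma>_def shift_mean_def by (intro Bochner_Integration.integral_cong) (auto simp: algebra_simps)
    then show ?thesis using a b by (simp add: Lam_def shift_mean_def)
  qed
  then have "expectation (\<lambda>\<omega>. \<Gamma> n (W 0 \<omega>)) = expectation (\<lambda>\<omega>. ?R (W 0 \<omega>)) - (c n - m x) * lam n"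
    using iR Lam_integrable[OF n(1), of 0] by (simp add: lam_def)
  also have "\<dots> = 0" unfolding c Eg using lam_pos by simp
  finally show "expectation (\<lambda>\<omega>. \<Gamma> n (W 0 \<omega>)) = 0" .
qed

text \<open>Weights known at time 0 cover the errors, their truncation residuals, and the constant 1
  of the density estimate.\<close>

lemma martingale_part:
  assumes n: "0 < h n" and e: "\<And>i. e i \<in> borel_measurable (F 0)" "\<And>i. integrable M (\<lambda>\<omega>. (e i \<omega>)\<^sup>2)"
    and C: "\<And>i. expectation (\<lambda>\<omega>. (e i \<omega>)\<^sup>2) \<le> C"
  shows "integrable M (\<lambda>\<omega>. (\<Sum>i<n. e i \<omega> * (Kh (h n) (X i \<omega>) - Lam (h n) (W i \<omega>)))\<^sup>2)"
    and "expectation (\<lambda>\<omega>. (\<Sum>i<n. e i \<omega> * (Kh (h n) (X i \<omega>) - Lam (h n) (W i \<omega>)))\<^sup>2) \<le> BK * Bp * C * (real n * h n)"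
proof -
  have ei: "\<And>i. e i \<in> borel_measurable (F i)" using measurable_F_mono[OF e(1)] by simp
  note S = square_martingale[of "Kh (h n)", OF _ Kh_square(1,2)[OF n] ei e(2), folded Lam_def]
  show "integrable M (\<lambda>\<omega>. (\<Sum>i<n. e i \<omega> * (Kh (h n) (X i \<omega>) - Lam (h n) (W i \<omega>)))\<^sup>2)"
    by (rule S(2)) measurable
  have "expectation (\<lambda>\<omega>. (\<Sum>i<n. e i \<omega> * (Kh (h n) (X i \<omega>) - Lam (h n) (W i \<omega>)))\<^sup>2)
      \<le> h n * (BK * Bp) * (\<Sum>i<n. expectation (\<lambda>\<omega>. (e i \<omega>)\<^sup>2))"
    by (rule S(3)) measurable
  also have "\<dots> \<le> h n * (BK * Bp) * (\<Sum>i<n. C)"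
    using n bounds_nonneg C by (intro mult_left_mono sum_mono) auto
  finally show "expectation (\<lambda>\<omega>. (\<Sum>i<n. e i \<omega> * (Kh (h n) (X i \<omega>) - Lam (h n) (W i \<omega>)))\<^sup>2) \<le> BK * Bp * C * (real n * h n)"
    by (simp add: mult_ac)
qed

lemma A_bounded: "\<forall>\<^sub>F n in sequentially. integrable M (\<lambda>\<omega>. (A n \<omega>)\<^sup>2) \<and> expectation (\<lambda>\<omega>. (A n \<omega>)\<^sup>2) \<le> BK * Bp"
  using evn
proof eventually_elim
  case (elim n)
  have e2: "integrable M (\<lambda>\<omega>. (\<epsilon> i \<omega>)\<^sup>2)" "expectation (\<lambda>\<omega>. (\<epsilon> i \<omega>)\<^sup>2) \<le> 1" for i
    using \<epsilon>_expectation[of "\<lambda>y. y\<^sup>2" i] \<epsilon>_int \<epsilon>_var by auto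
  have n: "0 < h n" using elim by auto
  note P = martingale_part[OF n \<epsilon>_F e2]
  have "expectation (\<lambda>\<omega>. (A n \<omega>)\<^sup>2) \<le> (s n)\<^sup>2 * (BK * Bp * 1 * (real n * h n))"
    unfolding A_def power_mult_distrib using P by (simp add: mult_left_mono)
  also have "\<dots> = BK * Bp" using elim by simp
  finally show ?case unfolding A_def power_mult_distrib using P by simp
qed

text \<open>Three parts: martingale, fluctuation of the conditional means, deterministic smoothing
  error. Their second moments are of order 1/(nh), of the order of the averaged \<gamma>, and of
  order h^2.\<close>

lemma fhat_consistent: "small_oP M (\<lambda>n \<omega>. fhat n \<omega> - f0)"
proof -
  let ?D = "\<lambda>n \<omega>. \<Sum>i<n. 1 * (Kh (h n) (X i \<omega>) - Lam (h n) (W i \<omega>))"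
  let ?L = "\<lambda>n \<omega>. \<Sum>i<n. Lam (h n) (W i \<omega>) - lam n"
  have 1: "small_oP M (\<lambda>n \<omega>. 1 / (real n * h n) * ?D n \<omega>)"
  proof (rule small_oP_L2)
    show "\<forall>\<^sub>F n in sequentially. integrable M (\<lambda>\<omega>. (1 / (real n * h n) * ?D n \<omega>)\<^sup>2)
        \<and> expectation (\<lambda>\<omega>. (1 / (real n * h n) * ?D n \<omega>)\<^sup>2) \<le> BK * Bp * (1 / (real n * h n))"
      using evn
    proof eventually_elim
      case (elim n)
      then have n: "0 < h n" by auto
      note P = martingale_part[OF n, of "\<lambda>_ _. 1" 1, simplified]
      have "expectation (\<lambda>\<omega>. (1 / (real n * h n) * ?D n \<omega>)\<^sup>2) = (1 / (real n * h n))\<^sup>2 * expectation (\<lambda>\<omega>. (?D n \<omega>)\<^sup>2)"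
        unfolding power_mult_distrib by simp
      also have "\<dots> \<le> (1 / (real n * h n))\<^sup>2 * (BK * Bp * (real n * h n))"
        using P by (intro mult_left_mono) (auto simp: prob_space)
      also have "\<dots> = BK * Bp * (1 / (real n * h n))" using elim by (simp add: power2_eq_square field_simps)
      finally show ?case unfolding power_mult_distrib using P by (auto simp: prob_space)
    qed
    show "(\<lambda>n. BK * Bp * (1 / (real n * h n))) \<longlonglongrightarrow> 0"
      using tendsto_mult_right_zero[OF tendsto_inverse_0_at_top[OF nh]] by (simp add: inverse_eq_divide)
  qed measurable
  have 2: "small_oP M (\<lambda>n \<omega>. 1 / (real n * h n) * ?L n \<omega>)"
  proof (rule small_oP_L2)
    show "\<forall>\<^sub>F n in sequentially. integrable M (\<lambda>\<omega>. (1 / (real n * h n) * ?L n \<omega>)\<^sup>2)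
        \<and> expectation (\<lambda>\<omega>. (1 / (real n * h n) * ?L n \<omega>)\<^sup>2) \<le> Bp\<^sup>2 * (1 / (real n)\<^sup>2 * GG n)"
      using evn
    proof eventually_elim
      case (elim n)
      then have n: "0 < h n" by auto
      have lip: "\<bar>(Lam (h n) w - lam n) - (Lam (h n) w' - lam n)\<bar> \<le> (h n * Bp) * \<bar>w - w'\<bar>" for w w'
        using Lam_lipschitz[OF n, of w w'] by simp
      have z: "expectation (\<lambda>\<omega>. Lam (h n) (W 0 \<omega>) - lam n) = 0"
        using Lam_integrable[OF n, of 0] by (simp add: lam_def prob_space)
      note P = sum_square[of "\<lambda>w. Lam (h n) w - lam n", OF lip z, of n]
      have "expectation (\<lambda>\<omega>. (1 / (real n * h n) * ?L n \<omega>)\<^sup>2) = (1 / (real n * h n))\<^sup>2 * expectation (\<lambda>\<omega>. (?L n \<omega>)\<^sup>2)"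
        unfolding power_mult_distrib by simp
      also have "\<dots> \<le> (1 / (real n * h n))\<^sup>2 * ((h n * Bp)\<^sup>2 * GG n)"
        using P by (intro mult_left_mono) auto
      also have "\<dots> = Bp\<^sup>2 * (1 / (real n)\<^sup>2 * GG n)" using elim by (simp add: power2_eq_square field_simps)
      finally show ?case unfolding power_mult_distrib using P by auto
    qed
    show "(\<lambda>n. Bp\<^sup>2 * (1 / (real n)\<^sup>2 * GG n)) \<longlonglongrightarrow> 0"
      using tendsto_mult_right_zero[OF \<gamma>_mean] by (simp add: GG_def)
  qed measurable
  have 3: "small_oP M (\<lambda>n \<omega>. lam n / h n - f0)"
  proof (rule small_oP_L2)
    show "\<forall>\<^sub>F n in sequentially. integrable M (\<lambda>\<omega>. (lam n / h n - f0)\<^sup>2)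
        \<and> expectation (\<lambda>\<omega>. (lam n / h n - f0)\<^sup>2) \<le> (h n * (Bp * \<kappa>))\<^sup>2"
      using evn
    proof eventually_elim
      case (elim n)
      then have n: "0 < h n" by auto
      have "\<bar>lam n / h n - f0\<bar> = \<bar>lam n - h n * f0\<bar> / h n" using n by (simp add: field_simps)
      also have "\<dots> \<le> (h n)\<^sup>2 * (Bp * \<kappa>) / h n" using lam_approx[OF n] n by (intro divide_right_mono) auto
      also have "\<dots> = h n * (Bp * \<kappa>)" using n by (simp add: power2_eq_square)
      finally have "(lam n / h n - f0)\<^sup>2 \<le> (h n * (Bp * \<kappa>))\<^sup>2"
        using power_mono[of "\<bar>lam n / h n - f0\<bar>" _ 2] by simp
      then show ?case by (simp add: prob_space)
    qed
    show "(\<lambda>n. (h n * (Bp * \<kappa>))\<^sup>2) \<longlonglongrightarrow> 0"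
      using tendsto_power[OF tendsto_mult_left_zero[OF h0, of "Bp * \<kappa>"], of 2] by simp
  qed measurable
  show ?thesis
  proof (rule small_oP_cong)
    show "small_oP M (\<lambda>n \<omega>. (1 / (real n * h n) * ?D n \<omega> + 1 / (real n * h n) * ?L n \<omega>) + (lam n / h n - f0))"
      by (intro small_oP_add 1 2 3) measurable
    show "\<forall>\<^sub>F n in sequentially. \<forall>\<omega>\<in>space M. fhat n \<omega> - f0 = (1 / (real n * h n) * ?D n \<omega> + 1 / (real n * h n) * ?L n \<omega>) + (lam n / h n - f0)"
      using evn
    proof eventually_elim
      case (elim n)
      have "?D n \<omega> + ?L n \<omega> = (\<Sum>i<n. Kh (h n) (X i \<omega>)) - real n * lam n" for \<omega>
        by (simp add: sum_subtractf)
      then have "1 / (real n * h n) * (?D n \<omega> + ?L n \<omega>) + (lam n / h n - f0) = fhat n \<omega> - f0" for \<omega>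
        using elim by (simp add: fhat_def right_diff_distrib)
      then show ?case by (auto simp only: distrib_left)
    qed
  qed
qed

end

section \<open>Negligible remainder terms\<close>

lemma (in prob_space) small_oP_mult:
  assumes [measurable]: "\<And>n. X n \<in> borel_measurable M" "\<And>n. Y n \<in> borel_measurable M"
    and "small_oP M X" "small_oP M Y"
  shows "small_oP M (\<lambda>n \<omega>. X n \<omega> * Y n \<omega>)"
proof (rule small_oP_subset[OF _ assms])
  fix e :: real assume e: "e > 0"
  have "\<bar>a\<bar> > sqrt e \<or> \<bar>b\<bar> > sqrt e" if "\<bar>a * b\<bar> > e" for a b :: real
  proof (rule ccontr)
    assume "\<not> ?thesis"
    then have "\<bar>a\<bar> * \<bar>b\<bar> \<le> sqrt e * sqrt e" using e by (intro mult_mono) auto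
    then show False using that e by (simp add: abs_mult)
  qed
  then show "\<exists>d>0. \<exists>d'>0. \<forall>\<^sub>F n in sequentially. {\<omega> \<in> space M. \<bar>X n \<omega> * Y n \<omega>\<bar> > e} \<subseteq>
      {\<omega> \<in> space M. \<bar>X n \<omega>\<bar> > d} \<union> {\<omega> \<in> space M. \<bar>Y n \<omega>\<bar> > d'}"
    using e by (intro exI[of _ "sqrt e"] conjI always_eventually) auto
qed

context nw_model begin

text \<open>\<open>T1a\<close> and \<open>T1b\<close> are the martingale and the predictable part of
  the bias, \<open>T2\<close> is the cross term and \<open>T3\<close> the sum of the errors. The
  factor 1 gives \<open>T1a\<close> the shape of a weighted martingale sum.\<close>

definition "T1a n \<omega> = s n * (\<Sum>i<n. 1 * (Kh (h n) (X i \<omega>) * (m (X i \<omega>) - c n) - \<Gamma> n (W i \<omega>)))"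
definition "T1b n \<omega> = s n * (\<Sum>i<n. \<Gamma> n (W i \<omega>))"
definition "T2 n \<omega> = s n * (\<Sum>i<n. (Lam (h n) (W i \<omega>) - lam n) * \<epsilon> i \<omega>)"
definition "T3 n \<omega> = lam n / h n * (sqrt (real n * h n) / real n * (\<Sum>i<n. \<epsilon> i \<omega>))"
definition "T n \<omega> = T1a n \<omega> + T1b n \<omega> + T2 n \<omega> + T3 n \<omega>"

lemma T_measurable [measurable]:
  "T1a n \<in> borel_measurable M" "T1b n \<in> borel_measurable M" "T2 n \<in> borel_measurable M" "T3 n \<in> borel_measurable M"
  "T n \<in> borel_measurable M"
  unfolding T_def[abs_def] T1a_def[abs_def] T1b_def[abs_def] T2_def[abs_def] T3_def[abs_def] by measurable

text \<open>There are n increments with conditional second moment of order h^3; division by nh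
  leaves h^2.\<close>

lemma T1a_small: "small_oP M T1a"
proof (rule small_oP_L2)
  let ?C = "BK * Bp * (2 * Bm\<^sup>2 + 2 * Cc\<^sup>2) * \<kappa>"
  show "\<forall>\<^sub>F n in sequentially. integrable M (\<lambda>\<omega>. (T1a n \<omega>)\<^sup>2) \<and> expectation (\<lambda>\<omega>. (T1a n \<omega>)\<^sup>2) \<le> ?C * (h n)\<^sup>2"
    using evn
  proof eventually_elim
    case (elim n)
    then have n: "0 < h n" "h n \<le> 1" "h n * Bp * \<kappa> \<le> f0 / 2" by auto
    note sq = centered_square[OF n(1,2) center(1)[OF n]]
    have m: "(\<lambda>z. Kh (h n) z * (m z - c n)) \<in> borel_measurable borel" by measurable
    note S = square_martingale[OF m sq, of "\<lambda>_ _. 1" n, folded \<Gamma>_def]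
    have S2: "integrable M (\<lambda>\<omega>. (\<Sum>i<n. 1 * (Kh (h n) (X i \<omega>) * (m (X i \<omega>) - c n) - \<Gamma> n (W i \<omega>)))\<^sup>2)"
      by (rule S(2)) auto
    have S3: "expectation (\<lambda>\<omega>. (\<Sum>i<n. 1 * (Kh (h n) (X i \<omega>) * (m (X i \<omega>) - c n) - \<Gamma> n (W i \<omega>)))\<^sup>2)
      \<le> h n ^ 3 * ?C * (\<Sum>i<n. expectation (\<lambda>\<omega>. 1\<^sup>2))"
      by (rule S(3)) auto
    have "expectation (\<lambda>\<omega>. (T1a n \<omega>)\<^sup>2) \<le> (s n)\<^sup>2 * (h n ^ 3 * ?C * (\<Sum>i<n. expectation (\<lambda>\<omega>. 1\<^sup>2)))"
      unfolding T1a_def power_mult_distrib integral_mult_right_zero by (intro mult_left_mono S3) simp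
    also have "\<dots> = ?C * (h n)\<^sup>2" using elim by (simp add: prob_space power3_eq_cube power2_eq_square field_simps)
    finally show ?case unfolding T1a_def power_mult_distrib using S2 by simp
  qed
  show "(\<lambda>n. ?C * (h n)\<^sup>2) \<longlonglongrightarrow> 0"
  proof (rule tendsto_mult_right_zero)
    show "(\<lambda>n. (h n)\<^sup>2) \<longlonglongrightarrow> 0" using tendsto_power[OF h0, of 2] by simp
  qed
qed measurable

lemma T1b_small: "small_oP M T1b"
proof (rule small_oP_L2)
  let ?C = "3 * Bp * (Bm + Cc) * \<kappa>"
  show "\<forall>\<^sub>F n in sequentially. integrable M (\<lambda>\<omega>. (T1b n \<omega>)\<^sup>2) \<and> expectation (\<lambda>\<omega>. (T1b n \<omega>)\<^sup>2) \<le> ?C\<^sup>2 * (h n ^ 5 / real n * GG n)"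
    using evn
  proof eventually_elim
    case (elim n)
    then have n: "0 < h n" "h n \<le> 1" "h n * Bp * \<kappa> \<le> f0 / 2" by auto
    have lip: "\<bar>\<Gamma> n w - \<Gamma> n w'\<bar> \<le> ?C * h n ^ 3 * \<bar>w - w'\<bar>" for w w'
      unfolding \<Gamma>_def by (rule centered_lipschitz[OF n(1,2) center(1)[OF n]])
    note S = sum_square[OF lip center(2)[OF n], of n]
    have "expectation (\<lambda>\<omega>. (T1b n \<omega>)\<^sup>2) \<le> (s n)\<^sup>2 * ((?C * h n ^ 3)\<^sup>2 * GG n)"
      unfolding T1b_def power_mult_distrib[of "s n"] integral_mult_right_zero by (intro mult_left_mono S(2)) simp
    also have "\<dots> = ?C\<^sup>2 * (h n ^ 5 / real n * GG n)"
    proof -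
      have "h n ^ 6 / h n = h n ^ 5" using n by (simp add: eval_nat_numeral)
      then have "1 / (real n * h n) * ((C * h n ^ 3)\<^sup>2 * GG n) = C\<^sup>2 * (h n ^ 5 / real n * GG n)" for C
        using elim by (simp add: power_mult_distrib field_simps flip: power_mult)
      then show ?thesis using elim by simp
    qed
    finally show ?case unfolding T1b_def power_mult_distrib[of "s n"] using S(1) by simp
  qed
  show "(\<lambda>n. ?C\<^sup>2 * (h n ^ 5 / real n * GG n)) \<longlonglongrightarrow> 0"
    using tendsto_mult_right_zero[OF \<gamma>_bias, of "?C\<^sup>2"] unfolding GG_def .
qed measurable

lemma T2_small: "small_oP M T2"
proof (rule small_oP_L2)
  let ?G = "\<lambda>n. \<Sum>i<n. \<Sum>j<n. \<gamma> i j * \<bar>expectation (\<lambda>\<omega>. \<epsilon> i \<omega> * \<epsilon> j \<omega>)\<bar>"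
  show "\<forall>\<^sub>F n in sequentially. integrable M (\<lambda>\<omega>. (T2 n \<omega>)\<^sup>2) \<and> expectation (\<lambda>\<omega>. (T2 n \<omega>)\<^sup>2) \<le> Bp\<^sup>2 * (h n / real n * ?G n)"
    using evn
  proof eventually_elim
    case (elim n)
    then have n: "0 < h n" by auto
    have lip: "\<bar>(Lam (h n) w - lam n) - (Lam (h n) w' - lam n)\<bar> \<le> (h n * Bp) * \<bar>w - w'\<bar>" for w w'
      using Lam_lipschitz[OF n, of w w'] by simp
    have z: "expectation (\<lambda>\<omega>. Lam (h n) (W 0 \<omega>) - lam n) = 0"
      using Lam_integrable[OF n, of 0] by (simp add: lam_def prob_space)
    note S = weighted_sum_square[of "\<lambda>w. Lam (h n) w - lam n", OF lip z, of "\<lambda>y. y" n, OF measurable_ident_sets[OF refl] \<epsilon>_int]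
    have "expectation (\<lambda>\<omega>. (T2 n \<omega>)\<^sup>2) \<le> (s n)\<^sup>2 * ((h n * Bp)\<^sup>2 * ?G n)"
      unfolding T2_def power_mult_distrib[of "s n"] integral_mult_right_zero by (intro mult_left_mono S(2)) simp
    also have "\<dots> = Bp\<^sup>2 * (h n / real n * ?G n)" using elim by (simp add: power2_eq_square field_simps)
    finally show ?case unfolding T2_def power_mult_distrib[of "s n"] using S(1) by simp
  qed
  show "(\<lambda>n. Bp\<^sup>2 * (h n / real n * ?G n)) \<longlonglongrightarrow> 0"
    by (rule tendsto_mult_right_zero[OF \<gamma>_cross])
qed measurable

lemma T3_small: "small_oP M T3"
  unfolding T3_def[abs_def]
proof (rule small_oP_bounded_mult[OF _ sum_\<epsilon>])
  show "\<forall>\<^sub>F n in sequentially. \<bar>lam n / h n\<bar> \<le> Bp"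
    using evn
  proof eventually_elim
    case (elim n)
    then have n: "0 < h n" by auto
    have "0 \<le> lam n" unfolding lam_def using Lam_nonneg[OF n] by simp
    moreover have "lam n \<le> expectation (\<lambda>\<omega>. h n * Bp)"
      unfolding lam_def using Lam_le[OF n] Lam_integrable[OF n] by (intro integral_mono) auto
    ultimately show ?case using n by (simp add: prob_space field_simps)
  qed
qed measurable

lemma T_small: "small_oP M T"
  unfolding T_def[abs_def] by (intro small_oP_add T1a_small T1b_small T2_small T3_small) measurable

lemma stat_decomposition: "\<forall>\<^sub>F n in sequentially. \<forall>\<omega>\<in>space M. stat n \<omega> = 1 / sqrt (\<kappa>1 * fhat n \<omega>) * (A n \<omega> + T n \<omega>)"
  using evn
proof eventually_elim
  case (elim n)
  \<comment> \<open>The normalization 1 / sqrt (nh) is rewritten as sqrt (nh) / n divided by h, the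
    form in which the error sums are assumed negligible.\<close>
  have s: "s n * lam n = lam n / h n * (sqrt (real n * h n) / real n)"
  proof -
    define y where "y = real n * h n"
    have "y > 0" using elim by (simp add: y_def)
    then have "1 / sqrt y = sqrt y / y" by (simp add: field_simps)
    then have "s n = sqrt (real n * h n) / (real n * h n)" by (simp add: s_def y_def)
    then show ?thesis by (simp add: mult_ac)
  qed
  have "s n * (\<Sum>i<n. Kh (h n) (X i \<omega>) * (m (X i \<omega>) + \<epsilon> i \<omega> - c n)) = A n \<omega> + T n \<omega>" for \<omega>
  proof -
    have "(\<Sum>i<n. Kh (h n) (X i \<omega>) * (m (X i \<omega>) + \<epsilon> i \<omega> - c n)) =
      (\<Sum>i<n. \<epsilon> i \<omega> * (Kh (h n) (X i \<omega>) - Lam (h n) (W i \<omega>))) + (\<Sum>i<n. 1 * (Kh (h n) (X i \<omega>) * (m (X i \<omega>) - c n) - \<Gamma> n (W i \<omega>)))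
       + (\<Sum>i<n. \<Gamma> n (W i \<omega>)) + (\<Sum>i<n. (Lam (h n) (W i \<omega>) - lam n) * \<epsilon> i \<omega>) + lam n * (\<Sum>i<n. \<epsilon> i \<omega>)"
      unfolding sum_distrib_left sum.distrib[symmetric] by (intro sum.cong refl) (simp add: algebra_simps)
    then have "s n * (\<Sum>i<n. Kh (h n) (X i \<omega>) * (m (X i \<omega>) + \<epsilon> i \<omega> - c n)) = A n \<omega> + T1a n \<omega> + T1b n \<omega> + T2 n \<omega> + (s n * lam n) * (\<Sum>i<n. \<epsilon> i \<omega>)"
      unfolding A_def T1a_def T1b_def T2_def by (simp only: distrib_left mult.assoc)
    then show ?thesis unfolding s T_def T3_def by (simp add: mult.assoc)
  qed
  then show ?case by (simp add: stat_def)
qed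

section \<open>Conditional variance and central limit theorem\<close>

lemma var_Kh:
  assumes n: "0 < h n"
  shows "(\<integral>z. p (z - w) * (Kh (h n) z - Lam (h n) w)\<^sup>2 \<partial>lborel) \<le> h n * (BK * Bp)" (is "?v \<le> _")
    and "\<bar>(\<integral>z. p (z - w) * (Kh (h n) z - Lam (h n) w)\<^sup>2 \<partial>lborel) - h n * \<kappa>1 * p (x - w)\<bar> \<le> (h n)\<^sup>2 * (BK * Bp * \<kappa> + Bp\<^sup>2)"
proof -
  interpret I: innovation M "F 0" "\<xi> 0" "W 0" p by (rule inn)
  have "?v = (\<integral>z. p (z - w) * (Kh (h n) z)\<^sup>2 \<partial>lborel) - (Lam (h n) w)\<^sup>2"
    using weighted_variance[of "Kh (h n)" "\<lambda>z. p (z - w)"] I.p_shift_integral[of w] dens_nonneg Kh_square(1)[OF n, of w]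
    by (simp add: Lam_def shift_mean_def)
  moreover have "(Lam (h n) w)\<^sup>2 \<le> (h n)\<^sup>2 * Bp\<^sup>2"
    using Lam_nonneg[OF n, of w] Lam_le[OF n, of w] power_mono[of "Lam (h n) w" "h n * Bp" 2] by (simp add: power_mult_distrib)
  ultimately show "?v \<le> h n * (BK * Bp)" "\<bar>?v - h n * \<kappa>1 * p (x - w)\<bar> \<le> (h n)\<^sup>2 * (BK * Bp * \<kappa> + Bp\<^sup>2)"
    using Kh_square(2,3)[OF n, of w] zero_le_power2[of "Lam (h n) w"] zero_le_mult_iff[of "(h n)\<^sup>2" "Bp\<^sup>2"]
    unfolding distrib_left[of "(h n)\<^sup>2"] by linarith+
qed

definition "vv n w = (\<integral>z. p (z - w) * (Kh (h n) z - Lam (h n) w)\<^sup>2 \<partial>lborel)"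

lemma vv_measurable [measurable]: "vv n \<in> borel_measurable borel"
  unfolding vv_def[abs_def] by measurable

text \<open>Three errors are separated. Replacing \<open>vv n\<close> by its leading term h
  \<kappa>1 p (x - W i) costs order h. The fluctuation of p (x - W i) around \<open>f0\<close> is a
  Lipschitz functional with bounded error weights, controlled through \<gamma>. The average of the
  truncated squared errors obeys the law of large numbers.\<close>

lemma conditional_variance:
  assumes B: "0 \<le> B"
  defines "\<beta> \<equiv> expectation (\<lambda>\<omega>. (trunc B (\<epsilon> 0 \<omega>))\<^sup>2)"
  shows "(\<lambda>n. expectation (\<lambda>\<omega>. \<bar>1 / (real n * h n) * (\<Sum>i<n. (trunc B (\<epsilon> i \<omega>))\<^sup>2 * vv n (W i \<omega>)) - \<kappa>1 * f0 * \<beta>\<bar>)) \<longlonglongrightarrow> 0"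
proof -
  let ?b = "\<lambda>i \<omega>. (trunc B (\<epsilon> i \<omega>))\<^sup>2"
  let ?V = "\<lambda>n \<omega>. 1 / (real n * h n) * (\<Sum>i<n. ?b i \<omega> * vv n (W i \<omega>))"
  let ?P = "\<lambda>n \<omega>. 1 / real n * (\<Sum>i<n. (p (x - W i \<omega>) - f0) * ?b i \<omega>)"
  let ?L = "\<lambda>n \<omega>. 1 / real n * (\<Sum>i<n. ?b i \<omega>) - \<beta>"
  let ?C = "B\<^sup>2 * (BK * Bp * \<kappa> + Bp\<^sup>2)"
  have b: "0 \<le> ?b i \<omega>" "?b i \<omega> \<le> B\<^sup>2" for i \<omega>
    using power_mono[OF abs_trunc_le[OF B, of "\<epsilon> i \<omega>"], of 2] by simp_all
  have bb: "\<bar>?b i \<omega> * ?b j \<omega>\<bar> \<le> B ^ 4" for i j \<omega>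
    using mult_mono[OF b(2)[of i \<omega>] b(2)[of j \<omega>]] b(1) by (simp add: abs_mult flip: power_add)
  have ip: "integrable M (\<lambda>\<omega>. p (x - W i \<omega>))" for i
    using dens_nonneg dens_le by (intro integrable_const_bound[where B=Bp]) auto
  have lim: "(\<lambda>n. ?C * h n + (\<kappa>1 * sqrt (Bp\<^sup>2 * B ^ 4 * (1 / (real n)\<^sup>2 * GG n)) + \<kappa>1 * f0 * expectation (\<lambda>\<omega>. \<bar>?L n \<omega>\<bar>))) \<longlonglongrightarrow> 0"
  proof (intro tendsto_add_zero)
    show "(\<lambda>n. ?C * h n) \<longlonglongrightarrow> 0" using tendsto_mult_right_zero[OF h0] .
    have "(\<lambda>n. Bp\<^sup>2 * B ^ 4 * (1 / (real n)\<^sup>2 * GG n)) \<longlonglongrightarrow> 0" using tendsto_mult_right_zero[OF \<gamma>_mean] unfolding GG_def .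
    from tendsto_mult_right_zero[OF tendsto_real_sqrt[OF this, simplified]]
    show "(\<lambda>n. \<kappa>1 * sqrt (Bp\<^sup>2 * B ^ 4 * (1 / (real n)\<^sup>2 * GG n))) \<longlonglongrightarrow> 0" by simp
    show "(\<lambda>n. \<kappa>1 * f0 * expectation (\<lambda>\<omega>. \<bar>?L n \<omega>\<bar>)) \<longlonglongrightarrow> 0"
      using tendsto_mult_right_zero[OF lln[of B]] unfolding \<beta>_def .
  qed
  have le: "\<forall>\<^sub>F n in sequentially. expectation (\<lambda>\<omega>. \<bar>?V n \<omega> - \<kappa>1 * f0 * \<beta>\<bar>) \<le> ?C * h n + (\<kappa>1 * sqrt (Bp\<^sup>2 * B ^ 4 * (1 / (real n)\<^sup>2 * GG n)) + \<kappa>1 * f0 * expectation (\<lambda>\<omega>. \<bar>?L n \<omega>\<bar>))"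
    using evn
  proof eventually_elim
    case (elim n)
    then have n: "0 < h n" "0 < n" by auto
    have P2: "integrable M (\<lambda>\<omega>. (\<Sum>i<n. (p (x - W i \<omega>) - f0) * ?b i \<omega>)\<^sup>2)"
      "expectation (\<lambda>\<omega>. (\<Sum>i<n. (p (x - W i \<omega>) - f0) * ?b i \<omega>)\<^sup>2) \<le> Bp\<^sup>2 * (B ^ 4 * GG n)"
    proof -
      have lip: "\<bar>(p (x - w) - f0) - (p (x - w') - f0)\<bar> \<le> Bp * \<bar>w - w'\<bar>" for w w'
        using dens_lip[of "x - w" "x - w'"] by (simp add: abs_minus_commute)
      have z: "expectation (\<lambda>\<omega>. p (x - W 0 \<omega>) - f0) = 0"
        using ip[of 0] by (simp add: f0_def prob_space)
      \<comment> \<open>The weights are already squares, so their second moment is a fourth moment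
        of truncated errors, at most B^4.\<close>
      have i4: "integrable M (\<lambda>\<omega>. ((trunc B (\<epsilon> 0 \<omega>))\<^sup>2)\<^sup>2)"
        using bb[of 0 _ 0] by (intro integrable_const_bound[where B="B^4"]) (auto simp: power2_eq_square)
      note S = weighted_sum_square[of "\<lambda>w. p (x - w) - f0", OF lip z, of "\<lambda>y. (trunc B y)\<^sup>2", OF _ i4, of n]
      show "integrable M (\<lambda>\<omega>. (\<Sum>i<n. (p (x - W i \<omega>) - f0) * ?b i \<omega>)\<^sup>2)" by (rule S(1)) measurable
      have "expectation (\<lambda>\<omega>. (\<Sum>i<n. (p (x - W i \<omega>) - f0) * ?b i \<omega>)\<^sup>2) \<le> Bp\<^sup>2 * (\<Sum>i<n. \<Sum>j<n. \<gamma> i j * \<bar>expectation (\<lambda>\<omega>. ?b i \<omega> * ?b j \<omega>)\<bar>)"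
        by (rule S(2)) measurable
      also have "\<dots> \<le> Bp\<^sup>2 * (\<Sum>i<n. \<Sum>j<n. \<gamma> i j * B ^ 4)"
      proof (intro mult_left_mono sum_mono \<gamma>_nonneg)
        fix i j
        have "\<bar>expectation (\<lambda>\<omega>. ?b i \<omega> * ?b j \<omega>)\<bar> \<le> expectation (\<lambda>\<omega>. \<bar>?b i \<omega> * ?b j \<omega>\<bar>)" by (rule integral_abs_bound)
        also have "\<dots> \<le> expectation (\<lambda>\<omega>. B ^ 4)"
          using bb[of i _ j] by (intro integral_mono integrable_abs integrable_const_bound[where B="B^4"]) auto
        finally show "\<bar>expectation (\<lambda>\<omega>. ?b i \<omega> * ?b j \<omega>)\<bar> \<le> B ^ 4" by (simp add: prob_space)
      qed simp
      also have "\<dots> = Bp\<^sup>2 * (B ^ 4 * GG n)" unfolding GG_def sum_distrib_right[symmetric] by (simp add: mult_ac)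
      finally show "expectation (\<lambda>\<omega>. (\<Sum>i<n. (p (x - W i \<omega>) - f0) * ?b i \<omega>)\<^sup>2) \<le> Bp\<^sup>2 * (B ^ 4 * GG n)" .
    qed
    have EP: "integrable M (?P n)" "expectation (\<lambda>\<omega>. \<bar>?P n \<omega>\<bar>) \<le> sqrt (Bp\<^sup>2 * B ^ 4 * (1 / (real n)\<^sup>2 * GG n))"
    proof -
      have "integrable M (\<lambda>\<omega>. (?P n \<omega>)\<^sup>2)" unfolding power_mult_distrib using P2(1) by simp
      moreover have "expectation (\<lambda>\<omega>. (?P n \<omega>)\<^sup>2) \<le> (1 / real n)\<^sup>2 * (Bp\<^sup>2 * (B ^ 4 * GG n))"
        unfolding power_mult_distrib[of "1 / real n"] integral_mult_right_zero by (intro mult_left_mono P2(2)) simp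
      moreover have "(1 / real n)\<^sup>2 * (Bp\<^sup>2 * (B ^ 4 * GG n)) = Bp\<^sup>2 * B ^ 4 * (1 / (real n)\<^sup>2 * GG n)"
        by (simp add: power_divide)
      ultimately show "integrable M (?P n)" "expectation (\<lambda>\<omega>. \<bar>?P n \<omega>\<bar>) \<le> sqrt (Bp\<^sup>2 * B ^ 4 * (1 / (real n)\<^sup>2 * GG n))"
        using expectation_le_sqrt[of "?P n"] by auto
    qed
    have iL: "integrable M (?L n)"
      using b by (intro Bochner_Integration.integrable_diff integrable_mult_right Bochner_Integration.integrable_sum integrable_const integrable_const_bound[where B="B\<^sup>2" and f="?b _"]) auto
    have pw: "\<bar>?V n \<omega> - \<kappa>1 * f0 * \<beta>\<bar> \<le> ?C * h n + (\<kappa>1 * \<bar>?P n \<omega>\<bar> + \<kappa>1 * f0 * \<bar>?L n \<omega>\<bar>)" for \<omega>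
    proof -
      have d: "\<bar>?b i \<omega> * (vv n (W i \<omega>) - h n * \<kappa>1 * p (x - W i \<omega>))\<bar> \<le> ?C * (h n)\<^sup>2" for i
      proof -
        have "\<bar>?b i \<omega> * (vv n (W i \<omega>) - h n * \<kappa>1 * p (x - W i \<omega>))\<bar> \<le> B\<^sup>2 * ((h n)\<^sup>2 * (BK * Bp * \<kappa> + Bp\<^sup>2))"
          unfolding abs_mult using b[of i \<omega>] var_Kh(2)[OF n(1), of "W i \<omega>"] by (intro mult_mono) (auto simp: vv_def)
        then show ?thesis by (simp add: mult_ac)
      qed
      have "\<bar>\<Sum>i<n. ?b i \<omega> * (vv n (W i \<omega>) - h n * \<kappa>1 * p (x - W i \<omega>))\<bar> \<le> (\<Sum>i<n. ?C * (h n)\<^sup>2)"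
        by (intro order_trans[OF sum_abs] sum_mono d)
      then have "1 / (real n * h n) * \<bar>\<Sum>i<n. ?b i \<omega> * (vv n (W i \<omega>) - h n * \<kappa>1 * p (x - W i \<omega>))\<bar> \<le> 1 / (real n * h n) * (real n * (?C * (h n)\<^sup>2))"
        using n by (intro mult_left_mono) auto
      also have "\<dots> = ?C * h n" using n by (simp add: power2_eq_square)
      finally have 1: "\<bar>1 / (real n * h n) * (\<Sum>i<n. ?b i \<omega> * (vv n (W i \<omega>) - h n * \<kappa>1 * p (x - W i \<omega>)))\<bar> \<le> ?C * h n"
        using n by (simp add: abs_mult)
      have eq: "1 / (real n * h n) * (\<Sum>i<n. ?b i \<omega> * (vv n (W i \<omega>) - h n * \<kappa>1 * p (x - W i \<omega>))) + (\<kappa>1 * ?P n \<omega> + \<kappa>1 * f0 * ?L n \<omega>) = ?V n \<omega> - \<kappa>1 * f0 * \<beta>"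
      proof -
        have e1: "(\<Sum>i<n. ?b i \<omega> * (vv n (W i \<omega>) - h n * \<kappa>1 * p (x - W i \<omega>))) = (\<Sum>i<n. ?b i \<omega> * vv n (W i \<omega>)) - h n * \<kappa>1 * (\<Sum>i<n. ?b i \<omega> * p (x - W i \<omega>))"
          unfolding sum_distrib_left sum_subtractf[symmetric] by (intro sum.cong refl) (simp add: algebra_simps)
        have e2: "(\<Sum>i<n. (p (x - W i \<omega>) - f0) * ?b i \<omega>) = (\<Sum>i<n. ?b i \<omega> * p (x - W i \<omega>)) - f0 * (\<Sum>i<n. ?b i \<omega>)"
          unfolding sum_distrib_left sum_subtractf[symmetric] by (intro sum.cong refl) (simp add: algebra_simps)
        have "1 / (real n * h n) * (a - h n * \<kappa>1 * b) + (\<kappa>1 * (1 / real n * (b - f0 * d)) + \<kappa>1 * f0 * (1 / real n * d - \<beta>)) = 1 / (real n * h n) * a - \<kappa>1 * f0 * \<beta>" for a b d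
          using n by (simp add: field_simps)
        then show ?thesis unfolding e1 e2 .
      qed
      have "\<bar>?V n \<omega> - \<kappa>1 * f0 * \<beta>\<bar> \<le> ?C * h n + (\<bar>\<kappa>1 * ?P n \<omega>\<bar> + \<bar>\<kappa>1 * f0 * ?L n \<omega>\<bar>)"
        unfolding eq[symmetric] by (intro order_trans[OF abs_triangle_ineq] add_mono 1 abs_triangle_ineq)
      then show ?thesis using \<kappa>1_nonneg f0_pos by (simp add: abs_mult)
    qed
    have "expectation (\<lambda>\<omega>. \<bar>?V n \<omega> - \<kappa>1 * f0 * \<beta>\<bar>) \<le> expectation (\<lambda>\<omega>. ?C * h n + (\<kappa>1 * \<bar>?P n \<omega>\<bar> + \<kappa>1 * f0 * \<bar>?L n \<omega>\<bar>))"
    proof (rule integral_mono')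
      show "integrable M (\<lambda>\<omega>. ?C * h n + (\<kappa>1 * \<bar>?P n \<omega>\<bar> + \<kappa>1 * f0 * \<bar>?L n \<omega>\<bar>))"
        by (intro Bochner_Integration.integrable_add integrable_mult_right integrable_abs EP(1) iL) simp
    qed (rule pw order_trans[OF abs_ge_zero pw])+
    also have "\<dots> = ?C * h n + (\<kappa>1 * expectation (\<lambda>\<omega>. \<bar>?P n \<omega>\<bar>) + \<kappa>1 * f0 * expectation (\<lambda>\<omega>. \<bar>?L n \<omega>\<bar>))"
    proof -
      have iP: "integrable M (\<lambda>\<omega>. \<kappa>1 * \<bar>?P n \<omega>\<bar>)" by (rule integrable_mult_right[OF integrable_abs[OF EP(1)]])
      have iL': "integrable M (\<lambda>\<omega>. \<kappa>1 * f0 * \<bar>?L n \<omega>\<bar>)" by (rule integrable_mult_right[OF integrable_abs[OF iL]])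
      have ic: "integrable M (\<lambda>\<omega>. ?C * h n)" by simp
      show ?thesis
        unfolding Bochner_Integration.integral_add[OF ic Bochner_Integration.integrable_add[OF iP iL']]
          Bochner_Integration.integral_add[OF iP iL'] integral_mult_right_zero by (simp add: prob_space)
    qed
    also have "\<dots> \<le> ?C * h n + (\<kappa>1 * sqrt (Bp\<^sup>2 * B ^ 4 * (1 / (real n)\<^sup>2 * GG n)) + \<kappa>1 * f0 * expectation (\<lambda>\<omega>. \<bar>?L n \<omega>\<bar>))"
      by (intro add_left_mono add_right_mono mult_left_mono EP(2) \<kappa>1_nonneg)
    finally show ?case .
  qed
  show ?thesis
    by (rule tendsto_sandwich[OF _ le tendsto_const lim]) (simp add: Bochner_Integration.integral_nonneg)
qed

end

lemma abs_one_minus_exp_le: "\<bar>1 - exp y\<bar> \<le> \<bar>y\<bar> * exp \<bar>y\<bar>" for y :: real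
proof -
  have 1: "z \<ge> 0 \<Longrightarrow> exp z - 1 \<le> z * exp z" for z :: real
    using mult_right_mono[OF exp_ge_add_one_self[of "-z"], of "exp z"] by (simp add: exp_minus field_simps)
  show ?thesis
  proof (cases "y \<ge> 0")
    case True
    then show ?thesis using 1[of y] by simp
  next
    case False
    have "1 - exp y \<le> - y" using exp_ge_add_one_self[of y] by linarith
    also have "\<dots> \<le> \<bar>y\<bar> * exp \<bar>y\<bar>" using mult_left_mono[of 1 "exp \<bar>y\<bar>" "\<bar>y\<bar>"] by simp
    finally show ?thesis using False by simp
  qed
qed

context nw_model begin

text \<open>By the tilted estimate the mean of exp (?Q n) times iexp of the normalized sum is close
  to 1. Since \<open>?Q n\<close> stays below \<open>M0\<close> and converges in mean to the
  constant \<open>q\<close>, the random factor may be replaced by exp q. \<open>?e1\<close> is the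
  error of the tilting and \<open>?e2\<close> that of the replacement.\<close>

lemma clt_truncated:
  assumes B: "0 < B"
  defines "\<beta> \<equiv> expectation (\<lambda>\<omega>. (trunc B (\<epsilon> 0 \<omega>))\<^sup>2)"
  shows "(\<lambda>n. \<integral>\<omega>. iexp (t * (s n * (\<Sum>i<n. trunc B (\<epsilon> i \<omega>) * (Kh (h n) (X i \<omega>) - Lam (h n) (W i \<omega>))))) \<partial>M)
     \<longlonglongrightarrow> exp (- (t\<^sup>2 * (\<kappa>1 * f0 * \<beta>) / 2))"
proof -
  let ?S = "\<lambda>n \<omega>. \<Sum>i<n. trunc B (\<epsilon> i \<omega>) * (Kh (h n) (X i \<omega>) - Lam (h n) (W i \<omega>))"
  let ?Q = "\<lambda>n \<omega>. \<Sum>i<n. (t * s n)\<^sup>2 * (trunc B (\<epsilon> i \<omega>))\<^sup>2 * vv n (W i \<omega>) / 2"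
  let ?V = "\<lambda>n \<omega>. 1 / (real n * h n) * (\<Sum>i<n. (trunc B (\<epsilon> i \<omega>))\<^sup>2 * vv n (W i \<omega>))"
  define q where "q = t\<^sup>2 * (\<kappa>1 * f0 * \<beta>) / 2"
  define M0 where "M0 = t\<^sup>2 * B\<^sup>2 * (BK * Bp) / 2"
  have M0: "0 \<le> M0" unfolding M0_def using bounds_nonneg by simp
  have q0: "0 \<le> q" unfolding q_def \<beta>_def using \<kappa>1_nonneg f0_pos by simp
  have b: "\<bar>trunc B y\<bar> \<le> B" for y using abs_trunc_le[of B y] B by simp
  have [measurable]: "(\<lambda>\<omega>. ?Q n \<omega>) \<in> borel_measurable M" "(\<lambda>\<omega>. ?S n \<omega>) \<in> borel_measurable M" for n by measurable
  have gen: "E - complex_of_real (exp (- q)) * (complex_of_real (exp y) * E) = E * complex_of_real (1 - exp (y - q))" for E y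
  proof -
    have "exp (y - q) = exp (- q) * exp y" by (simp add: exp_diff exp_minus field_simps)
    then show ?thesis by (simp add: right_diff_distrib)
  qed
  let ?e1 = "\<lambda>n. exp M0 * (M0\<^sup>2 / real n + \<bar>t\<bar> ^ 3 * B ^ 3 * (2 * BK) * (BK * Bp) / 6 * s n)"
  let ?e2 = "\<lambda>n. exp (M0 + q) * (t\<^sup>2 / 2) * expectation (\<lambda>\<omega>. \<bar>?V n \<omega> - \<kappa>1 * f0 * \<beta>\<bar>)"
  have bound: "\<forall>\<^sub>F n in sequentially. norm ((\<integral>\<omega>. iexp (t * (s n * ?S n \<omega>)) \<partial>M) - exp (- q)) \<le> ?e2 n + exp (- q) * ?e1 n"
    using evn
  proof eventually_elim
    case (elim n)
    then have n: "0 < h n" "0 < n" "0 < s n" and s2: "(s n)\<^sup>2 = 1 / (real n * h n)" by auto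
    have trF: "(\<lambda>\<omega>. trunc B (\<epsilon> i \<omega>)) \<in> borel_measurable (F i)" for i
      using \<epsilon>_Fi[of i i] by measurable
    have KB: "\<bar>Kh (h n) z\<bar> \<le> BK" for z using K_nonneg K_le by simp
    define mm where "mm = (t * s n)\<^sup>2 * B\<^sup>2 * (h n * (BK * Bp)) / 2"
    have nmm: "real n * mm = M0"
      unfolding mm_def M0_def power_mult_distrib s2 using n by simp
    have vv: "vv n w = (\<integral>z. p (z - w) * (Kh (h n) z - shift_mean p (Kh (h n)) w)\<^sup>2 \<partial>lborel)" for w
      by (simp add: vv_def Lam_def)
    have vv_le: "vv n w \<le> h n * (BK * Bp)" for w using var_Kh(1)[OF n(1)] by (simp add: vv_def)
    have vv0: "0 \<le> vv n w" for w unfolding vv_def using dens_nonneg by (intro Bochner_Integration.integral_nonneg) auto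
    have E1: "norm ((\<integral>\<omega>. complex_of_real (exp (?Q n \<omega>)) * iexp (t * s n * ?S n \<omega>) \<partial>M) - 1) \<le> ?e1 n"
    proof -
      have Km: "Kh (h n) \<in> borel_measurable borel" by measurable
      have "norm ((\<integral>\<omega>. complex_of_real (exp (?Q n \<omega>)) * iexp (t * s n * ?S n \<omega>) \<partial>M) - 1)
        \<le> real n * (exp (real n * mm) * (mm\<^sup>2 + (\<bar>t * s n\<bar> * B) ^ 3 * (2 * BK) * (h n * (BK * Bp)) / 6))"
        using tilted_char_martingale[where g="Kh (h n)" and B=BK and L=B and b="\<lambda>i \<omega>. trunc B (\<epsilon> i \<omega>)" and v="vv n" and V="h n * (BK * Bp)" and \<theta>="t * s n" and n=n,
            OF Km KB trF b vv vv_le]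
        unfolding mm_def Lam_def .
      also have "\<dots> = ?e1 n"
      proof -
        \<comment> \<open>Over n steps the squared term adds up to M0^2 / n, and the cubic term is
          of order s^3 n h = s.\<close>
        have "real n * mm\<^sup>2 = M0\<^sup>2 / real n" using n(2) nmm[symmetric] by (simp add: power2_eq_square)
        moreover have "real n * ((\<bar>t * s n\<bar> * B) ^ 3 * (2 * BK) * (h n * (BK * Bp)) / 6) = \<bar>t\<bar> ^ 3 * B ^ 3 * (2 * BK) * (BK * Bp) / 6 * s n"
        proof -
          have "s n ^ 3 * (real n * h n) = s n" using n s2 by (simp add: power3_eq_cube power2_eq_square)
          moreover have "(\<bar>t * s n\<bar> * B) ^ 3 = \<bar>t\<bar> ^ 3 * s n ^ 3 * B ^ 3" using n by (simp add: abs_mult power_mult_distrib)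
          ultimately show ?thesis by (simp add: mult_ac)
        qed
        ultimately show ?thesis unfolding nmm by (simp add: distrib_left mult.left_commute[of "real n"])
      qed
      finally show ?thesis .
    qed
    have QV: "?Q n \<omega> = t\<^sup>2 / 2 * ?V n \<omega>" for \<omega>
      unfolding power_mult_distrib[of t] s2 by (simp add: sum_distrib_left mult_ac)
    have Q: "0 \<le> ?Q n \<omega>" "?Q n \<omega> \<le> M0" for \<omega>
    proof -
      show "0 \<le> ?Q n \<omega>" using vv0 by (intro sum_nonneg) auto
      have "?Q n \<omega> \<le> (\<Sum>i<n. mm)"
        unfolding mm_def
      proof (intro sum_mono divide_right_mono mult_mono)
        show "(trunc B (\<epsilon> i \<omega>))\<^sup>2 \<le> B\<^sup>2" for i using power_mono[OF b[of "\<epsilon> i \<omega>"], of 2] by simp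
      qed (use vv_le vv0 in auto)
      then show "?Q n \<omega> \<le> M0" using nmm by simp
    qed
    have iQ: "integrable M (?Q n)"
      using Q by (intro integrable_const_bound[where B=M0]) auto
    have iE: "integrable M (\<lambda>\<omega>. iexp (t * (s n * ?S n \<omega>)))"
      by (intro integrable_const_bound[where B=1]) auto
    have iEQ: "integrable M (\<lambda>\<omega>. complex_of_real (exp (?Q n \<omega>)) * iexp (t * (s n * ?S n \<omega>)))"
      using Q(2) by (intro integrable_const_bound[where B="exp M0"] AE_I2) (auto simp: norm_mult)
    have split: "(\<integral>\<omega>. iexp (t * (s n * ?S n \<omega>)) \<partial>M) - exp (- q)
       = (\<integral>\<omega>. iexp (t * (s n * ?S n \<omega>)) - complex_of_real (exp (- q)) * (complex_of_real (exp (?Q n \<omega>)) * iexp (t * (s n * ?S n \<omega>))) \<partial>M)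
         + complex_of_real (exp (- q)) * ((\<integral>\<omega>. complex_of_real (exp (?Q n \<omega>)) * iexp (t * (s n * ?S n \<omega>)) \<partial>M) - 1)"
      by (subst Bochner_Integration.integral_diff[OF iE integrable_mult_right[OF iEQ]]) (simp add: right_diff_distrib)
    have "norm ((\<integral>\<omega>. iexp (t * (s n * ?S n \<omega>)) \<partial>M) - exp (- q))
      \<le> norm (\<integral>\<omega>. iexp (t * (s n * ?S n \<omega>)) - complex_of_real (exp (- q)) * (complex_of_real (exp (?Q n \<omega>)) * iexp (t * (s n * ?S n \<omega>))) \<partial>M)
       + norm (complex_of_real (exp (- q)) * ((\<integral>\<omega>. complex_of_real (exp (?Q n \<omega>)) * iexp (t * (s n * ?S n \<omega>)) \<partial>M) - 1))"
      unfolding split by (rule norm_triangle_ineq)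
    also have "\<dots> \<le> ?e2 n + exp (- q) * ?e1 n"
    proof (rule add_mono)
      show "norm (complex_of_real (exp (- q)) * ((\<integral>\<omega>. complex_of_real (exp (?Q n \<omega>)) * iexp (t * (s n * ?S n \<omega>)) \<partial>M) - 1)) \<le> exp (- q) * ?e1 n"
        using mult_left_mono[OF E1, of "exp (-q)"] by (simp only: norm_mult norm_of_real abs_exp_cancel exp_ge_zero mult.assoc simp_thms)
      have pw: "norm (iexp (t * (s n * ?S n \<omega>)) - complex_of_real (exp (- q)) * (complex_of_real (exp (?Q n \<omega>)) * iexp (t * (s n * ?S n \<omega>)))) \<le> exp (M0 + q) * (t\<^sup>2 / 2) * \<bar>?V n \<omega> - \<kappa>1 * f0 * \<beta>\<bar>" for \<omega>
      proof -
        have "iexp (t * (s n * ?S n \<omega>)) - complex_of_real (exp (- q)) * (complex_of_real (exp (?Q n \<omega>)) * iexp (t * (s n * ?S n \<omega>)))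
           = iexp (t * (s n * ?S n \<omega>)) * complex_of_real (1 - exp (?Q n \<omega> - q))"
          by (rule gen)
        then have "norm (iexp (t * (s n * ?S n \<omega>)) - complex_of_real (exp (- q)) * (complex_of_real (exp (?Q n \<omega>)) * iexp (t * (s n * ?S n \<omega>))))
           = \<bar>1 - exp (?Q n \<omega> - q)\<bar>" by (simp only: norm_mult norm_of_real norm_exp_i_times mult_1)
        also have "\<dots> \<le> \<bar>?Q n \<omega> - q\<bar> * exp \<bar>?Q n \<omega> - q\<bar>" by (rule abs_one_minus_exp_le)
        also have "\<dots> \<le> \<bar>?Q n \<omega> - q\<bar> * exp (M0 + q)" using Q[of \<omega>] q0 M0 by (intro mult_left_mono) auto
        also have "?Q n \<omega> - q = t\<^sup>2 / 2 * (?V n \<omega> - \<kappa>1 * f0 * \<beta>)" unfolding QV q_def by (simp add: right_diff_distrib)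
        also have "\<bar>t\<^sup>2 / 2 * (?V n \<omega> - \<kappa>1 * f0 * \<beta>)\<bar> = t\<^sup>2 / 2 * \<bar>?V n \<omega> - \<kappa>1 * f0 * \<beta>\<bar>" by (simp only: abs_mult) simp
        finally show ?thesis by (simp only: mult_ac)
      qed
      have iV: "integrable M (\<lambda>\<omega>. \<bar>?V n \<omega> - \<kappa>1 * f0 * \<beta>\<bar>)"
      \<comment> \<open>For t = 0 the tilt \<open>?Q n\<close> vanishes and carries no information
        on \<open>?V n\<close>, whose boundedness is then shown directly.\<close>
      proof (cases "t = 0")
        case False
        then have "?V n \<omega> = 2 / t\<^sup>2 * ?Q n \<omega>" for \<omega> unfolding QV by simp
        then show ?thesis using iQ by (simp only:) (intro integrable_abs Bochner_Integration.integrable_diff integrable_mult_right integrable_const, simp)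
      next
        case True
        have "\<bar>(trunc B (\<epsilon> i \<omega>))\<^sup>2 * vv n (W i \<omega>)\<bar> \<le> B\<^sup>2 * (h n * (BK * Bp))" for i \<omega>
          unfolding abs_mult using vv0 vv_le power_mono[OF b[of "\<epsilon> i \<omega>"], of 2] by (intro mult_mono) auto
        then show ?thesis
          by (intro integrable_abs Bochner_Integration.integrable_diff integrable_mult_right integrable_const Bochner_Integration.integrable_sum
              integrable_const_bound[where B="B\<^sup>2 * (h n * (BK * Bp))"]) auto
      qed
      have "norm (\<integral>\<omega>. iexp (t * (s n * ?S n \<omega>)) - complex_of_real (exp (- q)) * (complex_of_real (exp (?Q n \<omega>)) * iexp (t * (s n * ?S n \<omega>))) \<partial>M)
         \<le> (\<integral>\<omega>. norm (iexp (t * (s n * ?S n \<omega>)) - complex_of_real (exp (- q)) * (complex_of_real (exp (?Q n \<omega>)) * iexp (t * (s n * ?S n \<omega>)))) \<partial>M)"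
        by (rule integral_norm_bound)
      also have "\<dots> \<le> (\<integral>\<omega>. exp (M0 + q) * (t\<^sup>2 / 2) * \<bar>?V n \<omega> - \<kappa>1 * f0 * \<beta>\<bar> \<partial>M)"
        by (rule integral_mono'[OF integrable_mult_right[OF iV] pw]) simp
      also have "\<dots> = ?e2 n" by (rule integral_mult_right_zero)
      finally show "norm (\<integral>\<omega>. iexp (t * (s n * ?S n \<omega>)) - complex_of_real (exp (- q)) * (complex_of_real (exp (?Q n \<omega>)) * iexp (t * (s n * ?S n \<omega>))) \<partial>M) \<le> ?e2 n" .
    qed
    finally show ?case .
  qed
  have s0: "s \<longlonglongrightarrow> 0"
  proof -
    have "filterlim (\<lambda>n. sqrt (real n * h n)) at_top sequentially"
      by (rule filterlim_compose[OF sqrt_at_top nh])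
    then show ?thesis unfolding s_def[abs_def] using tendsto_inverse_0_at_top by (simp add: inverse_eq_divide)
  qed
  have lim: "(\<lambda>n. ?e2 n + exp (- q) * ?e1 n) \<longlonglongrightarrow> 0"
  proof (intro tendsto_add_zero tendsto_mult_right_zero)
    show "(\<lambda>n. expectation (\<lambda>\<omega>. \<bar>?V n \<omega> - \<kappa>1 * f0 * \<beta>\<bar>)) \<longlonglongrightarrow> 0"
      using conditional_variance[of B] B unfolding \<beta>_def by simp
    show "(\<lambda>n. M0\<^sup>2 / real n) \<longlonglongrightarrow> 0" by (rule lim_const_over_n)
  qed (rule s0)
  have "(\<lambda>n. (\<integral>\<omega>. iexp (t * (s n * ?S n \<omega>)) \<partial>M) - exp (- q)) \<longlonglongrightarrow> 0"
    by (rule Lim_null_comparison[OF bound lim])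
  then show ?thesis unfolding q_def by (simp only: LIM_zero_iff)
qed

lemma trunc_variance_limit: "(\<lambda>N. expectation (\<lambda>\<omega>. (trunc (real N) (\<epsilon> 0 \<omega>))\<^sup>2)) \<longlonglongrightarrow> 1"
proof -
  have "(\<lambda>N. expectation (\<lambda>\<omega>. (trunc (real N) (\<epsilon> 0 \<omega>))\<^sup>2)) \<longlonglongrightarrow> expectation (\<lambda>\<omega>. (\<epsilon> 0 \<omega>)\<^sup>2)"
  proof (rule integral_dominated_convergence[where w="\<lambda>\<omega>. (\<epsilon> 0 \<omega>)\<^sup>2"])
    show "AE \<omega> in M. (\<lambda>N. (trunc (real N) (\<epsilon> 0 \<omega>))\<^sup>2) \<longlonglongrightarrow> (\<epsilon> 0 \<omega>)\<^sup>2"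
    proof (intro AE_I2 tendsto_eventually)
      fix \<omega>
      obtain N0 :: nat where "\<bar>\<epsilon> 0 \<omega>\<bar> \<le> real N0" using real_arch_simple by blast
      then show "\<forall>\<^sub>F N in sequentially. (trunc (real N) (\<epsilon> 0 \<omega>))\<^sup>2 = (\<epsilon> 0 \<omega>)\<^sup>2"
        by (auto simp: eventually_sequentially trunc_def intro!: exI[of _ N0])
    qed
  qed (use \<epsilon>_int trunc_square_le in auto)
  then show ?thesis by (simp add: \<epsilon>_var)
qed

text \<open>The truncation level is fixed before \<open>n\<close>: the removed part has second
  moment at most BK Bp (1 - \<beta> N) for all large \<open>n\<close>, and \<beta> N tends to 1. One
  third of \<open>r\<close> each pays for the removal, for the truncated limit theorem and for the
  change of variance.\<close>

lemma clt: "(\<lambda>n. \<integral>\<omega>. iexp (t * A n \<omega>) \<partial>M) \<longlonglongrightarrow> exp (- (t\<^sup>2 * (\<kappa>1 * f0) / 2))"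
proof (rule LIMSEQ_I)
  fix r :: real assume r: "r > 0"
  define \<beta> where "\<beta> N = expectation (\<lambda>\<omega>. (trunc (real N) (\<epsilon> 0 \<omega>))\<^sup>2)" for N :: nat
  have \<beta>: "\<beta> \<longlonglongrightarrow> 1" using trunc_variance_limit unfolding \<beta>_def .
  have l1: "(\<lambda>N. \<bar>t\<bar> * sqrt (BK * Bp * (1 - \<beta> N))) \<longlonglongrightarrow> \<bar>t\<bar> * sqrt (BK * Bp * (1 - 1))"
    by (intro tendsto_intros \<beta>)
  have l2: "(\<lambda>N. norm (complex_of_real (exp (- (t\<^sup>2 * (\<kappa>1 * f0 * \<beta> N) / 2))) - complex_of_real (exp (- (t\<^sup>2 * (\<kappa>1 * f0 * 1) / 2)))))
     \<longlonglongrightarrow> norm (complex_of_real (exp (- (t\<^sup>2 * (\<kappa>1 * f0 * 1) / 2))) - complex_of_real (exp (- (t\<^sup>2 * (\<kappa>1 * f0 * 1) / 2))))"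
    by (intro tendsto_intros \<beta>) simp
  have "\<forall>\<^sub>F N in sequentially. \<bar>t\<bar> * sqrt (BK * Bp * (1 - \<beta> N)) < r / 3" using order_tendstoD(2)[OF l1, of "r/3"] r by simp
  moreover have "\<forall>\<^sub>F N in sequentially. norm (complex_of_real (exp (- (t\<^sup>2 * (\<kappa>1 * f0 * \<beta> N) / 2))) - complex_of_real (exp (- (t\<^sup>2 * (\<kappa>1 * f0) / 2)))) < r / 3"
    using order_tendstoD(2)[OF l2, of "r/3"] r by simp
  ultimately have "\<forall>\<^sub>F N in sequentially. N > 0 \<and> \<bar>t\<bar> * sqrt (BK * Bp * (1 - \<beta> N)) < r / 3 \<and>
     norm (complex_of_real (exp (- (t\<^sup>2 * (\<kappa>1 * f0 * \<beta> N) / 2))) - complex_of_real (exp (- (t\<^sup>2 * (\<kappa>1 * f0) / 2)))) < r / 3"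
    using eventually_gt_at_top[of 0] by eventually_elim auto
  then obtain N :: nat where N: "N > 0" "\<bar>t\<bar> * sqrt (BK * Bp * (1 - \<beta> N)) < r / 3"
     "norm (complex_of_real (exp (- (t\<^sup>2 * (\<kappa>1 * f0 * \<beta> N) / 2))) - complex_of_real (exp (- (t\<^sup>2 * (\<kappa>1 * f0) / 2)))) < r / 3"
    unfolding eventually_sequentially by blast
  let ?A = "\<lambda>n \<omega>. s n * (\<Sum>i<n. trunc (real N) (\<epsilon> i \<omega>) * (Kh (h n) (X i \<omega>) - Lam (h n) (W i \<omega>)))"
  have "(\<lambda>n. \<integral>\<omega>. iexp (t * ?A n \<omega>) \<partial>M) \<longlonglongrightarrow> exp (- (t\<^sup>2 * (\<kappa>1 * f0 * \<beta> N) / 2))"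
    using clt_truncated[of "real N" t] N(1) unfolding \<beta>_def by simp
  from LIMSEQ_D[OF this, of "r/3"] r
  have "\<forall>\<^sub>F n in sequentially. norm ((\<integral>\<omega>. iexp (t * ?A n \<omega>) \<partial>M) - exp (- (t\<^sup>2 * (\<kappa>1 * f0 * \<beta> N) / 2))) < r / 3"
    by (auto simp: eventually_sequentially)
  then have "\<forall>\<^sub>F n in sequentially. norm ((\<integral>\<omega>. iexp (t * A n \<omega>) \<partial>M) - exp (- (t\<^sup>2 * (\<kappa>1 * f0) / 2))) < r"
    using evn
  proof eventually_elim
    case (elim n)
    then have n: "0 < h n" and s2: "(s n)\<^sup>2 = 1 / (real n * h n)" and nn: "0 < n" by auto
    let ?e = "\<lambda>i \<omega>. \<epsilon> i \<omega> - trunc (real N) (\<epsilon> i \<omega>)"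
    have eF: "?e i \<in> borel_measurable (F 0)" for i using \<epsilon>_F[of i] by measurable
    have i2: "integrable M (\<lambda>\<omega>. (?e i \<omega>)\<^sup>2)" and E2: "expectation (\<lambda>\<omega>. (?e i \<omega>)\<^sup>2) \<le> 1 - \<beta> N" for i
    proof -
      have i0: "integrable M (\<lambda>\<omega>. (trunc (real N) (\<epsilon> 0 \<omega>))\<^sup>2)"
        by (rule Bochner_Integration.integrable_bound[OF \<epsilon>_int]) (auto simp: trunc_square_le)
      have "integrable M (\<lambda>\<omega>. (?e 0 \<omega>)\<^sup>2)" "expectation (\<lambda>\<omega>. (?e 0 \<omega>)\<^sup>2) = 1 - \<beta> N"
        unfolding trunc_residual_square \<beta>_def using i0 \<epsilon>_int \<epsilon>_var by auto
      then show "integrable M (\<lambda>\<omega>. (?e i \<omega>)\<^sup>2)" "expectation (\<lambda>\<omega>. (?e i \<omega>)\<^sup>2) \<le> 1 - \<beta> N"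
        using \<epsilon>_expectation[of "\<lambda>y. (y - trunc (real N) y)\<^sup>2" i] by auto
    qed
    note P = martingale_part[OF n eF i2 E2]
    have diff: "A n \<omega> - ?A n \<omega> = s n * (\<Sum>i<n. ?e i \<omega> * (Kh (h n) (X i \<omega>) - Lam (h n) (W i \<omega>)))" for \<omega>
      unfolding A_def right_diff_distrib[symmetric] sum_subtractf[symmetric] by (simp add: algebra_simps)
    have "expectation (\<lambda>\<omega>. (A n \<omega> - ?A n \<omega>)\<^sup>2) \<le> (s n)\<^sup>2 * (BK * Bp * (1 - \<beta> N) * (real n * h n))"
      unfolding diff power_mult_distrib[of "s n"] integral_mult_right_zero by (intro mult_left_mono P(2)) simp
    also have "\<dots> = BK * Bp * (1 - \<beta> N)" unfolding s2 using n nn by simp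
    finally have d2: "expectation (\<lambda>\<omega>. (A n \<omega> - ?A n \<omega>)\<^sup>2) \<le> BK * Bp * (1 - \<beta> N)" .
    have id2: "integrable M (\<lambda>\<omega>. (A n \<omega> - ?A n \<omega>)\<^sup>2)"
      unfolding diff power_mult_distrib[of "s n"] using P(1) by simp
    have dm: "(\<lambda>\<omega>. A n \<omega> - ?A n \<omega>) \<in> borel_measurable M" by measurable
    note d1 = expectation_le_sqrt[OF dm id2 d2]
    have iA: "integrable M (\<lambda>\<omega>. iexp (t * A n \<omega>))" "integrable M (\<lambda>\<omega>. iexp (t * ?A n \<omega>))"
      by (intro integrable_const_bound[where B=1]; simp)+
    have "norm ((\<integral>\<omega>. iexp (t * A n \<omega>) \<partial>M) - (\<integral>\<omega>. iexp (t * ?A n \<omega>) \<partial>M)) = norm (\<integral>\<omega>. iexp (t * A n \<omega>) - iexp (t * ?A n \<omega>) \<partial>M)"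
      by (subst Bochner_Integration.integral_diff[OF iA]) simp
    also have "\<dots> \<le> (\<integral>\<omega>. norm (iexp (t * A n \<omega>) - iexp (t * ?A n \<omega>)) \<partial>M)" by (rule integral_norm_bound)
    also have "\<dots> \<le> (\<integral>\<omega>. \<bar>t\<bar> * \<bar>A n \<omega> - ?A n \<omega>\<bar> \<partial>M)"
    proof (rule integral_mono')
      show "integrable M (\<lambda>\<omega>. \<bar>t\<bar> * \<bar>A n \<omega> - ?A n \<omega>\<bar>)" using d1(1) by (intro integrable_mult_right integrable_abs)
      show "norm (iexp (t * A n \<omega>) - iexp (t * ?A n \<omega>)) \<le> \<bar>t\<bar> * \<bar>A n \<omega> - ?A n \<omega>\<bar>" for \<omega>
        using norm_iexp_diff_le[of "t * A n \<omega>" "t * ?A n \<omega>"] unfolding right_diff_distrib[symmetric] abs_mult[of t] .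
    qed simp
    also have "\<dots> = \<bar>t\<bar> * expectation (\<lambda>\<omega>. \<bar>A n \<omega> - ?A n \<omega>\<bar>)" by (rule integral_mult_right_zero)
    also have "\<dots> \<le> \<bar>t\<bar> * sqrt (BK * Bp * (1 - \<beta> N))" by (intro mult_left_mono d1(2)) simp
    finally have "norm ((\<integral>\<omega>. iexp (t * A n \<omega>) \<partial>M) - (\<integral>\<omega>. iexp (t * ?A n \<omega>) \<partial>M)) < r / 3" using N(2) by linarith
    from norm_diff_triangle_less[OF norm_diff_triangle_less[OF this elim(1)] N(3)]
    show ?case by simp
  qed
  then show "\<exists>no. \<forall>n\<ge>no. norm ((\<integral>\<omega>. iexp (t * A n \<omega>) \<partial>M) - exp (- (t\<^sup>2 * (\<kappa>1 * f0) / 2))) < r"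
    by (simp only: eventually_sequentially)
qed

text \<open>The random factor is replaced by its limit \<open>u0\<close>; the tight term
  \<open>A\<close> and the negligible term \<open>T\<close> absorb the difference. The limit
  variance is \<kappa>1 f0 u0^2 = 1.\<close>

theorem stat_char: "(\<lambda>n. \<integral>\<omega>. iexp (t * stat n \<omega>) \<partial>M) \<longlonglongrightarrow> exp (- (t\<^sup>2 / 2))"
proof -
  define u0 where "u0 = 1 / sqrt (\<kappa>1 * f0)"
  have kf: "\<kappa>1 * f0 > 0" using \<kappa>1_pos f0_pos by simp
  have U: "small_oP M (\<lambda>n \<omega>. 1 / sqrt (\<kappa>1 * fhat n \<omega>) - u0)"
    unfolding u0_def
    by (rule small_oP_continuous[OF fhat_measurable fhat_consistent, of "\<lambda>y. 1 / sqrt (\<kappa>1 * y)"])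
      (use kf in \<open>auto intro!: continuous_intros\<close>)
  have small: "small_oP M (\<lambda>n \<omega>. stat n \<omega> - u0 * A n \<omega>)"
  proof (rule small_oP_cong)
    show "small_oP M (\<lambda>n \<omega>. (1 / sqrt (\<kappa>1 * fhat n \<omega>) - u0) * A n \<omega> + ((1 / sqrt (\<kappa>1 * fhat n \<omega>) - u0) * T n \<omega> + u0 * T n \<omega>))"
    proof (intro small_oP_add)
      show "small_oP M (\<lambda>n \<omega>. (1 / sqrt (\<kappa>1 * fhat n \<omega>) - u0) * A n \<omega>)"
        by (rule small_oP_mult_tight[OF A_measurable _ A_bounded U]) measurable
      show "small_oP M (\<lambda>n \<omega>. (1 / sqrt (\<kappa>1 * fhat n \<omega>) - u0) * T n \<omega>)"
        by (rule small_oP_mult[OF _ _ U T_small]) measurable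
      show "small_oP M (\<lambda>n \<omega>. u0 * T n \<omega>)"
        by (rule small_oP_bounded_mult[OF T_measurable(5) T_small, of "\<lambda>_. u0" "\<bar>u0\<bar>"]) simp
    qed measurable
    show "\<forall>\<^sub>F n in sequentially. \<forall>\<omega>\<in>space M. stat n \<omega> - u0 * A n \<omega> = (1 / sqrt (\<kappa>1 * fhat n \<omega>) - u0) * A n \<omega> + ((1 / sqrt (\<kappa>1 * fhat n \<omega>) - u0) * T n \<omega> + u0 * T n \<omega>)"
      using stat_decomposition by eventually_elim (simp add: algebra_simps)
  qed
  have lim: "(\<lambda>n. \<integral>\<omega>. iexp (t * (u0 * A n \<omega>)) \<partial>M) \<longlonglongrightarrow> exp (- (t\<^sup>2 / 2))"
  proof -
    have "(t * u0)\<^sup>2 * (\<kappa>1 * f0) / 2 = t\<^sup>2 / 2"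
      unfolding u0_def power_mult_distrib power_divide using kf \<kappa>1_pos f0_pos by simp
    then show ?thesis using clt[of "t * u0"] by (simp only: mult.assoc)
  qed
  show ?thesis
    by (rule small_oP_char[OF _ stat_measurable small lim]) measurable
qed

end

section \<open>A law of large numbers for stationary functionals\<close>

lemma (in prob_space) indep_vars_reindex:
  assumes f: "inj_on f I" and X: "indep_vars M' X (f ` I)"
  shows "indep_vars (\<lambda>i. M' (f i)) (\<lambda>i. X (f i)) I"
  unfolding indep_vars_def2
proof
  show "\<forall>i\<in>I. random_variable (M' (f i)) (X (f i))" using X by (auto simp: indep_vars_def2)
  let ?E = "\<lambda>i. {X i -` A \<inter> space M |A. A \<in> sets (M' i)}"
  have E: "indep_sets ?E (f ` I)" using X by (simp add: indep_vars_def2)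
  show "indep_sets (\<lambda>i. ?E (f i)) I"
  proof (rule indep_setsI)
    show "?E (f i) \<subseteq> events" if "i \<in> I" for i using E that by (auto simp: indep_sets_def)
    fix A J assume J: "J \<noteq> {}" "J \<subseteq> I" "finite J" and A: "\<forall>j\<in>J. A j \<in> ?E (f j)"
    have inj: "inj_on f J" using f J(2) by (rule inj_on_subset)
    let ?A = "\<lambda>k. A (the_inv_into J f k)"
    have A': "\<forall>k\<in>f ` J. ?A k \<in> ?E k"
    proof
      fix k assume "k \<in> f ` J"
      then obtain j where "j \<in> J" "k = f j" by auto
      then show "?A k \<in> ?E k" using bspec[OF A, of j] by (simp add: the_inv_into_f_f[OF inj])
    qed
    have "prob (\<Inter>k\<in>f ` J. ?A k) = (\<Prod>k\<in>f ` J. prob (?A k))"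
      using J by (intro indep_setsD[OF E] A') auto
    also have "(\<Inter>k\<in>f ` J. ?A k) = (\<Inter>j\<in>J. A j)"
      by (auto simp: the_inv_into_f_f[OF inj])
    also have "(\<Prod>k\<in>f ` J. prob (?A k)) = (\<Prod>j\<in>J. prob (A j))"
      by (simp add: prod.reindex[OF inj] the_inv_into_f_f[OF inj])
    finally show "prob (\<Inter>j\<in>J. A j) = (\<Prod>j\<in>J. prob (A j))" .
  qed
qed

text \<open>The values lie in an arbitrary measurable space, so the law of large numbers is built up
  from measurable boxes instead of by topological approximation.\<close>

locale iid_seq = prob_space M for M :: "'a measure" +
  fixes S :: "'s measure" and \<eta> :: "int \<Rightarrow> 'a \<Rightarrow> 's"
  assumes indep: "indep_vars (\<lambda>_. S) \<eta> UNIV"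
    and identical: "\<And>i j. distr M S (\<eta> i) = distr M S (\<eta> j)"
begin

lemma \<eta>_measurable [measurable]: "\<eta> i \<in> measurable M S"
  using indep by (auto simp: indep_vars_def)

text \<open>Coordinate \<open>k\<close> is the value k steps back. All times thus share one sequence
  space, and stationarity becomes the statement that all pasts have the same law.\<close>

definition past :: "int \<Rightarrow> 'a \<Rightarrow> nat \<Rightarrow> 's" where "past i \<omega> = (\<lambda>k. \<eta> (i - int k) \<omega>)"

abbreviation "PS \<equiv> PiM (UNIV :: nat set) (\<lambda>_. S)"

definition law :: "(nat \<Rightarrow> 's) measure" where "law = PiM UNIV (\<lambda>_. distr M S (\<eta> 0))"

lemma past_measurable [measurable]: "past i \<in> measurable M PS"
  using measurable_restrict[of UNIV "\<lambda>k. \<eta> (i - int k)" M "\<lambda>_. S", OF \<eta>_measurable] by (simp only: past_def[abs_def] restrict_UNIV)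

lemma distr_past: "distr M PS (past i) = law"
proof -
  have "indep_vars (\<lambda>_. S) (\<lambda>k. \<eta> (i - int k)) (UNIV :: nat set)"
    by (rule indep_vars_reindex[of "\<lambda>k. i - int k"]) (auto simp: inj_on_def intro: indep_vars_subset[OF indep])
  then have "distr M PS (\<lambda>\<omega>. \<lambda>k\<in>UNIV. \<eta> (i - int k) \<omega>) = PiM UNIV (\<lambda>k. distr M S (\<eta> (i - int k)))"
    by (subst (asm) indep_vars_iff_distr_eq_PiM') auto
  also have "(\<lambda>k. distr M S (\<eta> (i - int k))) = (\<lambda>_. distr M S (\<eta> 0))" using identical by auto
  finally show ?thesis by (simp add: law_def past_def[abs_def])
qed

lemma sets_law [measurable_cong]: "sets law = sets PS" and space_law: "space law = space PS"
  by (simp_all flip: distr_past[of 0])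

lemma prob_space_law: "prob_space law"
  unfolding distr_past[of 0, symmetric] by (rule prob_space_distr) measurable

lemma past_integrable:
  fixes g :: "(nat \<Rightarrow> 's) \<Rightarrow> real"
  assumes [measurable]: "g \<in> borel_measurable PS"
  shows "integrable M (\<lambda>\<omega>. g (past i \<omega>)) \<longleftrightarrow> integrable law g"
    and "expectation (\<lambda>\<omega>. g (past i \<omega>)) = integral\<^sup>L law g"
  unfolding distr_past[of i, symmetric] by (simp_all add: integrable_distr_eq integral_distr)

text \<open>The shift by one is there because observations are numbered from 1.\<close>

definition avg :: "((nat \<Rightarrow> 's) \<Rightarrow> real) \<Rightarrow> nat \<Rightarrow> 'a \<Rightarrow> real" where
  "avg g n \<omega> = 1 / real n * (\<Sum>i<n. g (past (int i + 1) \<omega>))"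

text \<open>Convergence in mean, because this form passes to L^1 limits of the functional.\<close>

definition lln_holds :: "((nat \<Rightarrow> 's) \<Rightarrow> real) \<Rightarrow> bool" where
  "lln_holds g \<longleftrightarrow> integrable law g \<and> (\<lambda>n. expectation (\<lambda>\<omega>. \<bar>avg g n \<omega> - integral\<^sup>L law g\<bar>)) \<longlonglongrightarrow> 0"

lemma avg_integrable:
  assumes "integrable law g"
  shows "integrable M (avg g n)"
proof -
  have "g \<in> borel_measurable PS" using assms by (auto simp: measurable_def sets_law space_law dest!: borel_measurable_integrable)
  then show ?thesis unfolding avg_def[abs_def] using assms by (intro integrable_mult_right Bochner_Integration.integrable_sum) (simp add: past_integrable)
qed

lemma avg_abs_le:
  assumes g: "integrable law g"
  shows "expectation (\<lambda>\<omega>. \<bar>avg g n \<omega>\<bar>) \<le> integral\<^sup>L law (\<lambda>y. \<bar>g y\<bar>)"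
proof -
  have m[measurable]: "g \<in> borel_measurable PS" using g by (auto simp: measurable_def sets_law space_law dest!: borel_measurable_integrable)
  have ga: "integrable law (\<lambda>y. \<bar>g y\<bar>)" using g by simp
  have "expectation (\<lambda>\<omega>. \<bar>avg g n \<omega>\<bar>) \<le> expectation (avg (\<lambda>y. \<bar>g y\<bar>) n)"
    using avg_integrable[OF g, of n] avg_integrable[OF ga, of n]
  proof (intro integral_mono integrable_abs)
    show "\<bar>avg g n \<omega>\<bar> \<le> avg (\<lambda>y. \<bar>g y\<bar>) n \<omega>" for \<omega>
      unfolding avg_def abs_mult by (intro mult_mono sum_abs) auto
  qed
  also have "\<dots> = 1 / real n * (\<Sum>i<n. expectation (\<lambda>\<omega>. \<bar>g (past (int i + 1) \<omega>)\<bar>))"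
    unfolding avg_def[abs_def] integral_mult_right_zero
    using past_integrable(1)[of "\<lambda>y. \<bar>g y\<bar>"] ga by (subst Bochner_Integration.integral_sum) auto
  also have "\<dots> = 1 / real n * (real n * integral\<^sup>L law (\<lambda>y. \<bar>g y\<bar>))"
    using past_integrable(2)[of "\<lambda>y. \<bar>g y\<bar>"] by simp
  also have "\<dots> \<le> integral\<^sup>L law (\<lambda>y. \<bar>g y\<bar>)" by (cases "n = 0") auto
  finally show ?thesis .
qed

text \<open>Averaging contracts the L^1 norm for every \<open>n\<close> (\<open>avg_abs_le\<close>),
  so an approximation of \<open>g\<close> under \<open>law\<close> carries over to all averages at
  once.\<close>

lemma lln_closed:
  assumes g: "integrable law g"
    and approx: "\<And>e. e > 0 \<Longrightarrow> \<exists>g'. lln_holds g' \<and> integral\<^sup>L law (\<lambda>y. \<bar>g y - g' y\<bar>) < e"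
  shows "lln_holds g"
  unfolding lln_holds_def
proof
  show "(\<lambda>n. expectation (\<lambda>\<omega>. \<bar>avg g n \<omega> - integral\<^sup>L law g\<bar>)) \<longlonglongrightarrow> 0"
  proof (rule LIMSEQ_I)
    fix r :: real assume r: "r > 0"
    from approx[of "r/3"] r obtain g' where g': "lln_holds g'" and d: "integral\<^sup>L law (\<lambda>y. \<bar>g y - g' y\<bar>) < r / 3" by auto
    have ig': "integrable law g'" using g' by (simp add: lln_holds_def)
    have ig: "integrable law (\<lambda>y. g y - g' y)" using g ig' by simp
    from g' r obtain no where no: "\<And>n. n \<ge> no \<Longrightarrow> norm (expectation (\<lambda>\<omega>. \<bar>avg g' n \<omega> - integral\<^sup>L law g'\<bar>) - 0) < r / 3"
      unfolding lln_holds_def using LIMSEQ_D[of _ 0 "r/3"] by (metis divide_pos_pos zero_less_numeral)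
    have "expectation (\<lambda>\<omega>. \<bar>avg g n \<omega> - integral\<^sup>L law g\<bar>) < r" if "n \<ge> no" for n
    proof -
      have pw: "\<bar>avg g n \<omega> - integral\<^sup>L law g\<bar> \<le> \<bar>avg (\<lambda>y. g y - g' y) n \<omega>\<bar> + (\<bar>avg g' n \<omega> - integral\<^sup>L law g'\<bar> + \<bar>integral\<^sup>L law (\<lambda>y. g y - g' y)\<bar>)" for \<omega>
      proof -
        have "avg g n \<omega> = avg (\<lambda>y. g y - g' y) n \<omega> + avg g' n \<omega>" by (simp add: avg_def sum_subtractf algebra_simps)
        moreover have "integral\<^sup>L law g = integral\<^sup>L law g' + integral\<^sup>L law (\<lambda>y. g y - g' y)" using g ig' by simp
        ultimately show ?thesis by linarith
      qed
      have i1: "integrable M (\<lambda>\<omega>. \<bar>avg (\<lambda>y. g y - g' y) n \<omega>\<bar>)" using avg_integrable[OF ig] by simp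
      have i2: "integrable M (\<lambda>\<omega>. \<bar>avg g' n \<omega> - integral\<^sup>L law g'\<bar>)" using avg_integrable[OF ig', of n] by simp
      have "expectation (\<lambda>\<omega>. \<bar>avg g n \<omega> - integral\<^sup>L law g\<bar>) \<le> expectation (\<lambda>\<omega>. \<bar>avg (\<lambda>y. g y - g' y) n \<omega>\<bar> + (\<bar>avg g' n \<omega> - integral\<^sup>L law g'\<bar> + \<bar>integral\<^sup>L law (\<lambda>y. g y - g' y)\<bar>))"
        using i1 i2 avg_integrable[OF g, of n] by (intro integral_mono pw) auto
      also have "\<dots> = expectation (\<lambda>\<omega>. \<bar>avg (\<lambda>y. g y - g' y) n \<omega>\<bar>) + (expectation (\<lambda>\<omega>. \<bar>avg g' n \<omega> - integral\<^sup>L law g'\<bar>) + \<bar>integral\<^sup>L law (\<lambda>y. g y - g' y)\<bar>)"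
        using i1 i2 by (simp add: prob_space)
      also have "\<dots> < r / 3 + (r / 3 + r / 3)"
        using le_less_trans[OF avg_abs_le[OF ig] d] no[OF that] le_less_trans[OF integral_abs_bound d]
        by (intro add_strict_mono) (auto simp only: diff_zero real_norm_def abs_less_iff)
      finally show ?thesis by simp
    qed
    then show "\<exists>no. \<forall>n\<ge>no. norm (expectation (\<lambda>\<omega>. \<bar>avg g n \<omega> - integral\<^sup>L law g\<bar>) - 0) < r"
      by (intro exI[of _ no]) (auto simp: abs_of_nonneg Bochner_Integration.integral_nonneg)
  qed
qed (rule g)

lemma lln_const: "lln_holds (\<lambda>_. c)"
proof -
  interpret L: prob_space law by (rule prob_space_law)
  have "(\<lambda>n. expectation (\<lambda>\<omega>. \<bar>avg (\<lambda>_. c) n \<omega> - c\<bar>)) \<longlonglongrightarrow> 0"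
    by (rule tendsto_eventually) (auto simp: avg_def eventually_sequentially intro!: exI[of _ 1])
  then show ?thesis unfolding lln_holds_def by (simp add: L.prob_space)
qed

lemma lln_add:
  assumes f: "lln_holds f" and g: "lln_holds g"
  shows "lln_holds (\<lambda>y. f y + a * g y)"
  unfolding lln_holds_def
proof
  have i: "integrable law f" "integrable law g" using f g by (auto simp: lln_holds_def)
  then show "integrable law (\<lambda>y. f y + a * g y)" by simp
  show "(\<lambda>n. expectation (\<lambda>\<omega>. \<bar>avg (\<lambda>y. f y + a * g y) n \<omega> - integral\<^sup>L law (\<lambda>y. f y + a * g y)\<bar>)) \<longlonglongrightarrow> 0"
  proof (rule tendsto_sandwich[OF _ _ tendsto_const])
    show "(\<lambda>n. expectation (\<lambda>\<omega>. \<bar>avg f n \<omega> - integral\<^sup>L law f\<bar>) + \<bar>a\<bar> * expectation (\<lambda>\<omega>. \<bar>avg g n \<omega> - integral\<^sup>L law g\<bar>)) \<longlonglongrightarrow> 0"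
      using f g unfolding lln_holds_def by (intro tendsto_add_zero tendsto_mult_right_zero) auto
    show "\<forall>\<^sub>F n in sequentially. expectation (\<lambda>\<omega>. \<bar>avg (\<lambda>y. f y + a * g y) n \<omega> - integral\<^sup>L law (\<lambda>y. f y + a * g y)\<bar>)
       \<le> expectation (\<lambda>\<omega>. \<bar>avg f n \<omega> - integral\<^sup>L law f\<bar>) + \<bar>a\<bar> * expectation (\<lambda>\<omega>. \<bar>avg g n \<omega> - integral\<^sup>L law g\<bar>)"
    proof (rule always_eventually, rule allI)
      fix n
      have i1: "integrable M (\<lambda>\<omega>. \<bar>avg f n \<omega> - integral\<^sup>L law f\<bar>)" "integrable M (\<lambda>\<omega>. \<bar>avg g n \<omega> - integral\<^sup>L law g\<bar>)"
        using avg_integrable[OF i(1), of n] avg_integrable[OF i(2), of n] by simp_all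
      have eq: "avg (\<lambda>y. f y + a * g y) n \<omega> - integral\<^sup>L law (\<lambda>y. f y + a * g y) = (avg f n \<omega> - integral\<^sup>L law f) + a * (avg g n \<omega> - integral\<^sup>L law g)" for \<omega>
      proof -
        have "avg (\<lambda>y. f y + a * g y) n \<omega> = avg f n \<omega> + a * avg g n \<omega>"
          by (simp add: avg_def sum.distrib sum_distrib_left[symmetric] distrib_left)
        moreover have "integral\<^sup>L law (\<lambda>y. f y + a * g y) = integral\<^sup>L law f + a * integral\<^sup>L law g" using i by simp
        ultimately show ?thesis by (simp add: algebra_simps)
      qed
      have "expectation (\<lambda>\<omega>. \<bar>avg (\<lambda>y. f y + a * g y) n \<omega> - integral\<^sup>L law (\<lambda>y. f y + a * g y)\<bar>)
         \<le> expectation (\<lambda>\<omega>. \<bar>avg f n \<omega> - integral\<^sup>L law f\<bar> + \<bar>a\<bar> * \<bar>avg g n \<omega> - integral\<^sup>L law g\<bar>)"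
        unfolding eq using i1
        by (intro integral_mono' order_trans[OF abs_triangle_ineq]) (auto simp: abs_mult)
      then show "expectation (\<lambda>\<omega>. \<bar>avg (\<lambda>y. f y + a * g y) n \<omega> - integral\<^sup>L law (\<lambda>y. f y + a * g y)\<bar>)
         \<le> expectation (\<lambda>\<omega>. \<bar>avg f n \<omega> - integral\<^sup>L law f\<bar>) + \<bar>a\<bar> * expectation (\<lambda>\<omega>. \<bar>avg g n \<omega> - integral\<^sup>L law g\<bar>)"
        using i1 by simp
    qed
  qed (simp add: Bochner_Integration.integral_nonneg)
qed

lemma card_near: "card {j. j < (n::nat) \<and> \<bar>int i - int j\<bar> \<le> int d} \<le> 2 * d + 1"
proof -
  have "{j. j < n \<and> \<bar>int i - int j\<bar> \<le> int d} \<subseteq> {i - d..i + d}" by auto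
  then have "card {j. j < n \<and> \<bar>int i - int j\<bar> \<le> int d} \<le> card {i - d..i + d}" by (rule card_mono[rotated]) simp
  then show ?thesis by simp
qed

text \<open>A box constrains finitely many coordinates, all at most \<open>d\<close>. Its
  occurrences at times more than \<open>d\<close> apart involve disjoint sets of noise variables and
  are uncorrelated, so the variance of a sum of n indicators is at most n (2d + 1).\<close>

lemma lln_box:
  assumes A: "A \<in> prod_algebra UNIV (\<lambda>_. S)"
  shows "lln_holds (indicator A)"
proof -
  interpret L: prob_space law by (rule prob_space_law)
  from prod_algebraE[OF A] obtain J E where AE: "A = prod_emb UNIV (\<lambda>_. S) J (Pi\<^sub>E J E)"
    and J: "finite J" "J \<noteq> {}" and E: "\<And>k. k \<in> J \<Longrightarrow> E k \<in> sets S" by (metis UNIV_not_empty)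
  have Am[measurable]: "A \<in> sets PS" using A unfolding sets_PiM by (rule sigma_sets.Basic)
  have Al: "A \<in> sets law" using Am by (simp add: sets_law)
  let ?B = "\<lambda>i. past i -` A \<inter> space M"
  let ?P = "measure law A"
  have B[measurable]: "?B i \<in> events" for i by measurable
  have pB: "prob (?B i) = ?P" for i
    unfolding distr_past[of i, symmetric] by (subst measure_distr) auto
  have memA: "past i \<omega> \<in> A \<longleftrightarrow> (\<forall>k\<in>J. \<eta> (i - int k) \<omega> \<in> E k)" if "\<omega> \<in> space M" for i \<omega>
    using that measurable_space[OF \<eta>_measurable] unfolding AE prod_emb_def
    by (auto simp: past_def space_PiM restrict_def PiE_iff extensional_def)
  define d where "d = Max J"
  have d: "k \<le> d" if "k \<in> J" for k using J(1) that by (simp add: d_def)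
  have indepB: "prob (?B i \<inter> ?B j) = ?P * ?P" if far: "\<bar>i - j\<bar> > int d" for i j
  proof -
    let ?I = "(\<lambda>k. i - int k) ` J" and ?J = "(\<lambda>k. j - int k) ` J"
    have disj: "?I \<inter> ?J = {}"
    proof (rule ccontr)
      assume "?I \<inter> ?J \<noteq> {}"
      then obtain k l where "k \<in> J" "l \<in> J" "i - int k = j - int l" by auto
      then show False using d[of k] d[of l] far by auto
    qed
    \<comment> \<open>Both boxes as one family of constraints indexed by noise times; the two index
      sets are disjoint, so the case distinction is consistent.\<close>
    let ?A = "\<lambda>m. if m \<in> ?I then E (nat (i - m)) else E (nat (j - m))"
    have AS: "?A m \<in> sets S" if "m \<in> ?I \<union> ?J" for m using that E by auto
    have inj: "inj_on (\<lambda>k. l - int k) J" for l by (auto simp: inj_on_def)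
    have 1: "?B i \<inter> ?B j = (\<Inter>m\<in>?I \<union> ?J. \<eta> m -` ?A m \<inter> space M)"
    proof -
      have n: "j - int k \<notin> ?I" if "k \<in> J" for k using disj that by auto
      have a: "?A (i - int k) = E k" "?A (j - int k) = E k" if "k \<in> J" for k using that n[OF that] by auto
      have "(\<Inter>m\<in>?I \<union> ?J. \<eta> m -` ?A m \<inter> space M)
        = (\<Inter>k\<in>J. \<eta> (i - int k) -` ?A (i - int k) \<inter> space M) \<inter> (\<Inter>k\<in>J. \<eta> (j - int k) -` ?A (j - int k) \<inter> space M)"
        by (simp only: INT_Un INF_image comp_def)
      also have "\<dots> = (\<Inter>k\<in>J. \<eta> (i - int k) -` E k \<inter> space M) \<inter> (\<Inter>k\<in>J. \<eta> (j - int k) -` E k \<inter> space M)"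
        by (intro arg_cong2[where f="(\<inter>)"] INF_cong refl) (simp_all only: a)
      also have "\<dots> = ?B i \<inter> ?B j" using J(2) by (auto simp: memA)
      finally show ?thesis ..
    qed
    have 2: "?B l = (\<Inter>m\<in>(\<lambda>k. l - int k) ` J. \<eta> m -` E (nat (l - m)) \<inter> space M)" for l
      using J(2) by (auto simp: memA)
    have "prob (?B i \<inter> ?B j) = (\<Prod>m\<in>?I \<union> ?J. prob (\<eta> m -` ?A m \<inter> space M))"
      unfolding 1 using J by (intro indep_varsD[OF indep] AS) auto
    also have "\<dots> = (\<Prod>m\<in>?I. prob (\<eta> m -` ?A m \<inter> space M)) * (\<Prod>m\<in>?J. prob (\<eta> m -` ?A m \<inter> space M))"
      using J disj by (intro prod.union_disjoint) auto
    also have "(\<Prod>m\<in>?I. prob (\<eta> m -` ?A m \<inter> space M)) = (\<Prod>m\<in>?I. prob (\<eta> m -` E (nat (i - m)) \<inter> space M))"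
      by (intro prod.cong) auto
    also have "\<dots> = prob (?B i)"
      unfolding 2[of i] using J E by (intro indep_varsD[OF indep, symmetric]) auto
    also have "(\<Prod>m\<in>?J. prob (\<eta> m -` ?A m \<inter> space M)) = (\<Prod>m\<in>?J. prob (\<eta> m -` E (nat (j - m)) \<inter> space M))"
      using disj by (intro prod.cong) auto
    also have "\<dots> = prob (?B j)"
      unfolding 2[of j] using J E by (intro indep_varsD[OF indep, symmetric]) auto
    finally show ?thesis by (simp add: pB)
  qed
  let ?Z = "\<lambda>i \<omega>. indicator (?B (int i + 1)) \<omega> - ?P"
  have Zint: "integrable M (\<lambda>\<omega>. ?Z i \<omega> * ?Z j \<omega>)" for i j
  proof (rule integrable_const_bound[where B="1"])
    have "\<bar>?Z i \<omega>\<bar> \<le> 1" for i \<omega>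
    proof -
      have "0 \<le> (indicator (?B (int i + 1)) \<omega> :: real)" "indicator (?B (int i + 1)) \<omega> \<le> (1 :: real)" by simp_all
      then show ?thesis using L.prob_le_1[of A] measure_nonneg[of law A] unfolding abs_le_iff by linarith
    qed
    then show "AE \<omega> in M. norm (?Z i \<omega> * ?Z j \<omega>) \<le> 1"
      by (intro AE_I2) (simp add: abs_mult mult_le_one)
  qed measurable
  have cov: "expectation (\<lambda>\<omega>. ?Z i \<omega> * ?Z j \<omega>) = prob (?B (int i + 1) \<inter> ?B (int j + 1)) - ?P * ?P" for i j
  proof -
    have eq: "?Z i \<omega> * ?Z j \<omega> = indicator (?B (int i + 1) \<inter> ?B (int j + 1)) \<omega> - ?P * indicator (?B (int i + 1)) \<omega> - ?P * indicator (?B (int j + 1)) \<omega> + ?P * ?P" for \<omega>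
      by (auto simp: indicator_def algebra_simps)
    have ii: "integrable M (indicator C :: 'a \<Rightarrow> real)" if "C \<in> events" for C
      using that by (intro integrable_real_indicator) (auto simp: less_top[symmetric])
    note I = ii[OF B[of "int i + 1"]] ii[OF B[of "int j + 1"]] ii[OF sets.Int[OF B[of "int i + 1"] B[of "int j + 1"]]]
    have e: "expectation (indicator C) = prob C" if "C \<in> events" for C
      using that by simp
    have "expectation (\<lambda>\<omega>. ?Z i \<omega> * ?Z j \<omega>) = prob (?B (int i + 1) \<inter> ?B (int j + 1)) - ?P * prob (?B (int i + 1)) - ?P * prob (?B (int j + 1)) + ?P * ?P"
      unfolding eq using I e[OF B[of "int i + 1"]] e[OF B[of "int j + 1"]] e[OF sets.Int[OF B[of "int i + 1"] B[of "int j + 1"]]]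
      by (simp add: prob_space)
    then show ?thesis by (simp add: pB)
  qed
  have covle: "expectation (\<lambda>\<omega>. ?Z i \<omega> * ?Z j \<omega>) \<le> (if \<bar>int i - int j\<bar> \<le> int d then 1 else 0)" for i j
  proof (cases "\<bar>int i - int j\<bar> \<le> int d")
    case False
    then show ?thesis using cov[of i j] indepB[of "int i + 1" "int j + 1"] by simp
  next
    case True
    have "prob (?B (int i + 1) \<inter> ?B (int j + 1)) \<le> 1" by (rule prob_le_1)
    moreover have "0 \<le> ?P * ?P" by (intro mult_nonneg_nonneg measure_nonneg)
    ultimately show ?thesis unfolding cov if_P[OF True] by linarith
  qed
  have sq: "expectation (\<lambda>\<omega>. (\<Sum>i<n. ?Z i \<omega>)\<^sup>2) \<le> real n * real (2 * d + 1)"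
    and sqi: "integrable M (\<lambda>\<omega>. (\<Sum>i<n. ?Z i \<omega>)\<^sup>2)" for n
  proof -
    have eq: "(\<Sum>i<n. ?Z i \<omega>)\<^sup>2 = (\<Sum>i<n. \<Sum>j<n. ?Z i \<omega> * ?Z j \<omega>)" for \<omega>
      unfolding power2_eq_square sum_product ..
    show "integrable M (\<lambda>\<omega>. (\<Sum>i<n. ?Z i \<omega>)\<^sup>2)" unfolding eq by (intro Bochner_Integration.integrable_sum Zint)
    have "expectation (\<lambda>\<omega>. (\<Sum>i<n. ?Z i \<omega>)\<^sup>2) = (\<Sum>i<n. expectation (\<lambda>\<omega>. \<Sum>j<n. ?Z i \<omega> * ?Z j \<omega>))"
      unfolding eq by (intro Bochner_Integration.integral_sum Bochner_Integration.integrable_sum Zint)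
    also have "\<dots> = (\<Sum>i<n. \<Sum>j<n. expectation (\<lambda>\<omega>. ?Z i \<omega> * ?Z j \<omega>))"
      by (intro sum.cong refl Bochner_Integration.integral_sum Zint)
    also have "\<dots> \<le> (\<Sum>i<n. \<Sum>j<n. if \<bar>int i - int j\<bar> \<le> int d then 1 else 0)"
      by (intro sum_mono covle)
    also have "\<dots> = (\<Sum>i<n. real (card {j. j < n \<and> \<bar>int i - int j\<bar> \<le> int d}))"
      by (intro sum.cong refl) (simp add: sum.If_cases lessThan_def Collect_conj_eq[symmetric])
    also have "\<dots> \<le> (\<Sum>i<n. real (2 * d + 1))" using card_near by (intro sum_mono of_nat_mono)
    finally show "expectation (\<lambda>\<omega>. (\<Sum>i<n. ?Z i \<omega>)\<^sup>2) \<le> real n * real (2 * d + 1)" by simp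
  qed
  have indA: "indicator A (past i \<omega>) = (indicator (?B i) \<omega> :: real)" if "\<omega> \<in> space M" for i \<omega>
    using that by (auto simp: indicator_def)
  have "(\<lambda>n. expectation (\<lambda>\<omega>. \<bar>avg (indicator A) n \<omega> - ?P\<bar>)) \<longlonglongrightarrow> 0"
  proof (rule tendsto_sandwich[OF _ _ tendsto_const])
    have "(\<lambda>n. real (2 * d + 1) / real n) \<longlonglongrightarrow> 0" by (rule lim_const_over_n)
    from tendsto_real_sqrt[OF this] show "(\<lambda>n. sqrt (real (2 * d + 1) / real n)) \<longlonglongrightarrow> 0" by simp
    show "\<forall>\<^sub>F n in sequentially. expectation (\<lambda>\<omega>. \<bar>avg (indicator A) n \<omega> - ?P\<bar>) \<le> sqrt (real (2 * d + 1) / real n)"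
      using eventually_gt_at_top[of 0]
    proof eventually_elim
      case (elim n)
      have eq: "avg (indicator A) n \<omega> - ?P = 1 / real n * (\<Sum>i<n. ?Z i \<omega>)" if "\<omega> \<in> space M" for \<omega>
        using elim indA[OF that] by (simp add: avg_def sum_subtractf right_diff_distrib)
      have m: "(\<lambda>\<omega>. 1 / real n * (\<Sum>i<n. ?Z i \<omega>)) \<in> borel_measurable M" by measurable
      have i: "integrable M (\<lambda>\<omega>. (1 / real n * (\<Sum>i<n. ?Z i \<omega>))\<^sup>2)" unfolding power_mult_distrib using sqi by simp
      have "expectation (\<lambda>\<omega>. (1 / real n * (\<Sum>i<n. ?Z i \<omega>))\<^sup>2) \<le> (1 / real n)\<^sup>2 * (real n * real (2 * d + 1))"
        unfolding power_mult_distrib integral_mult_right_zero by (intro mult_left_mono sq) simp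
      also have "\<dots> = real (2 * d + 1) / real n" using elim by (simp add: power2_eq_square)
      finally have "expectation (\<lambda>\<omega>. \<bar>1 / real n * (\<Sum>i<n. ?Z i \<omega>)\<bar>) \<le> sqrt (real (2 * d + 1) / real n)"
        using expectation_le_sqrt(2)[OF m i] by blast
      then show ?case by (subst Bochner_Integration.integral_cong[OF refl, where g="\<lambda>\<omega>. \<bar>1 / real n * (\<Sum>i<n. ?Z i \<omega>)\<bar>"]) (simp_all only: eq)
    qed
  qed (simp add: Bochner_Integration.integral_nonneg)
  moreover have "integrable law (indicator A :: _ \<Rightarrow> real)" using Al by (intro integrable_real_indicator) (auto simp: less_top[symmetric] L.emeasure_eq_measure)
  moreover have "integral\<^sup>L law (indicator A) = ?P" using Al by simp
  ultimately show ?thesis unfolding lln_holds_def by simp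
qed

text \<open>The sets obeying the law of large numbers form a Dynkin system containing the boxes.
  Countable disjoint unions are reached as L^1 limits of finite ones.\<close>

lemma lln_set:
  assumes "A \<in> sets PS"
  shows "lln_holds (indicator A)"
proof -
  interpret L: prob_space law by (rule prob_space_law)
  let ?\<Omega> = "\<Pi>\<^sub>E k\<in>(UNIV::nat set). space S"
  have "A \<in> sigma_sets ?\<Omega> (prod_algebra UNIV (\<lambda>_. S))" using assms by (simp add: sets_PiM)
  then show ?thesis
  proof (induction rule: sigma_sets_induct_disjoint[OF Int_stable_prod_algebra prod_algebra_sets_into_space, consumes 1, case_names basic empty compl union])
    case (basic A)
    then show ?case by (rule lln_box)
  next
    case empty
    show ?case using lln_const[of 0] by (simp add: indicator_def[abs_def])
  next
    case (compl A)
    have l: "lln_holds (\<lambda>y. 1 + (-1) * indicator A y)" by (intro lln_add lln_const compl(2))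
    then have i: "integrable law (\<lambda>y. 1 + (-1) * indicator A y :: real)" by (simp add: lln_holds_def)
    have eq: "indicator (?\<Omega> - A) y = (1 + (-1) * indicator A y :: real)" if "y \<in> space law" for y
      using that by (auto simp: indicator_def space_law space_PiM)
    have m: "?\<Omega> - A \<in> sets law" using compl(1) unfolding sets_law sets_PiM by (rule sigma_sets.Compl)
    show ?case
    \<comment> \<open>The two functions agree on \<open>space law\<close> only, so the passage uses
      L^1 distance 0 in place of equality.\<close>
    proof (rule lln_closed)
      show "integrable law (indicator (?\<Omega> - A) :: _ \<Rightarrow> real)"
        using i by (subst Bochner_Integration.integrable_cong[OF refl eq]) auto
      fix e :: real assume e: "e > 0"
      have "integral\<^sup>L law (\<lambda>y. \<bar>indicator (?\<Omega> - A) y - (1 + (-1) * indicator A y)\<bar>) = integral\<^sup>L law (\<lambda>y. 0 :: real)"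
        by (intro Bochner_Integration.integral_cong refl) (simp only: eq diff_self abs_zero)
      then show "\<exists>g'. lln_holds g' \<and> integral\<^sup>L law (\<lambda>y. \<bar>indicator (?\<Omega> - A) y - g' y\<bar>) < e"
        using e by (intro exI[of _ "\<lambda>y. 1 + (-1) * indicator A y"] conjI l) simp
    qed
  next
    case (union A)
    have Am: "A k \<in> sets law" for k using union(2) unfolding sets_law sets_PiM by auto
    have fin: "lln_holds (\<lambda>y. \<Sum>k<N. indicator (A k) y)" for N
    proof (induction N)
      case 0 then show ?case using lln_const[of 0] by simp
    next
      case (Suc N) then show ?case using lln_add[OF Suc union(3)[of N], of 1] by simp
    qed
    have eq: "(\<Sum>k<N. indicator (A k) y) = (indicator (\<Union>k<N. A k) y :: real)" for N y
      using union(1) by (subst indicator_UN_disjoint) (auto simp: disjoint_family_on_def)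
    have sum: "(\<lambda>N. \<Sum>k<N. measure law (A k)) \<longlonglongrightarrow> measure law (\<Union>k. A k)"
      using L.finite_measure_UNION[of A] Am union(1) by (auto simp: sums_def)
    have sN: "measure law (\<Union>k<N. A k) = (\<Sum>k<N. measure law (A k))" for N
      using Am union(1) by (subst L.finite_measure_finite_Union) (auto simp: disjoint_family_on_def)
    have U: "(\<Union>k. A k) \<in> sets law" "(\<Union>k<N. A k) \<in> sets law" for N using Am by auto
    show ?case
    proof (rule lln_closed)
      show "integrable law (indicator (\<Union>k. A k) :: _ \<Rightarrow> real)"
        using U by (intro integrable_real_indicator) (auto simp: less_top[symmetric] L.emeasure_eq_measure)
      fix e :: real assume e: "e > 0"
      from LIMSEQ_D[OF sum e] obtain N where N: "norm ((\<Sum>k<N. measure law (A k)) - measure law (\<Union>k. A k)) < e" by blast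
      have "integral\<^sup>L law (\<lambda>y. \<bar>indicator (\<Union>k. A k) y - (\<Sum>k<N. indicator (A k) y) :: real\<bar>) = integral\<^sup>L law (indicator ((\<Union>k. A k) - (\<Union>k<N. A k)))"
        by (intro Bochner_Integration.integral_cong refl) (simp only: eq, auto simp: indicator_def of_bool_def)
      also have "\<dots> = measure law (\<Union>k. A k) - measure law (\<Union>k<N. A k)"
        using U L.finite_measure_Diff[OF U(1) U(2)[of N]] by auto
      also have "\<dots> < e" using N unfolding sN by simp
      finally show "\<exists>g'. lln_holds g' \<and> integral\<^sup>L law (\<lambda>y. \<bar>indicator (\<Union>k. A k) y - g' y\<bar>) < e"
        using fin[of N] by blast
    qed
  qed
qed

text \<open>A mean ergodic theorem for the shift of an i.i.d. sequence, obtained by density: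
  indicators, linear combinations, then dominated limits, which are limits in L^1.\<close>

theorem lln:
  assumes "integrable law g"
  shows "lln_holds g"
  using assms
proof (induction rule: integrable_induct)
  case (base A c)
  have "lln_holds (\<lambda>y. 0 + c * indicator A y)"
    using base by (intro lln_add lln_const lln_set) (simp add: sets_law)
  then show ?case by (simp add: mult.commute)
next
  case (add f g)
  then show ?case using lln_add[of f g 1] by simp
next
  case (lim f s)
  show ?case
  proof (rule lln_closed[OF lim.hyps(4)])
    fix e :: real assume e: "e > 0"
    have "(\<lambda>i. integral\<^sup>L law (\<lambda>y. \<bar>f y - s i y\<bar>)) \<longlonglongrightarrow> integral\<^sup>L law (\<lambda>y. 0 :: real)"
    proof (rule integral_dominated_convergence[where w="\<lambda>y. 3 * \<bar>f y\<bar>"])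
      show "AE y in law. (\<lambda>i. \<bar>f y - s i y\<bar>) \<longlonglongrightarrow> 0"
      proof (intro AE_I2)
        fix y assume "y \<in> space law"
        then have "(\<lambda>i. f y - s i y) \<longlonglongrightarrow> f y - f y" by (intro tendsto_diff tendsto_const lim.hyps(2))
        then show "(\<lambda>i. \<bar>f y - s i y\<bar>) \<longlonglongrightarrow> 0" by (intro tendsto_rabs_zero) simp
      qed
      show "AE y in law. norm \<bar>f y - s i y\<bar> \<le> 3 * \<bar>f y\<bar>" for i
        using lim.hyps(3)[of _ i] by (intro AE_I2) (force simp: abs_le_iff)
    qed (use lim.hyps(1,4) in auto)
    from LIMSEQ_D[OF this e] obtain i where "\<bar>integral\<^sup>L law (\<lambda>y. \<bar>f y - s i y\<bar>)\<bar> < e" by auto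
    then show "\<exists>g'. lln_holds g' \<and> integral\<^sup>L law (\<lambda>y. \<bar>f y - g' y\<bar>) < e" using lim.IH[of i] by auto
  qed
qed

end

section \<open>Covariances of Lipschitz functionals\<close>

lemma sets_generated_sigma:
  "sets (generated_sigma M S I Z) = sigma_sets (space M) (\<Union>i\<in>I. {Z i -` A \<inter> space M | A. A \<in> sets S})"
  unfolding generated_sigma_def by (rule sets_measure_of) auto

lemma space_generated_sigma [simp]: "space (generated_sigma M S I Z) = space M"
  unfolding generated_sigma_def by (rule space_measure_of) auto

lemma subalgebra_generated_sigma:
  assumes "\<And>i. i \<in> I \<Longrightarrow> Z i \<in> measurable M S"
  shows "subalgebra M (generated_sigma M S I Z)"
  unfolding subalgebra_def
proof
  show "sets (generated_sigma M S I Z) \<subseteq> sets M"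
    unfolding sets_generated_sigma by (rule sets.sigma_sets_subset) (use assms in \<open>auto intro: measurable_sets\<close>)
qed simp

lemma generated_sigma_measurable:
  assumes "\<And>i. i \<in> I \<Longrightarrow> Z i \<in> measurable M S" "i \<in> I"
  shows "Z i \<in> measurable (generated_sigma M S I Z) S"
proof (rule measurableI)
  show "Z i \<omega> \<in> space S" if "\<omega> \<in> space (generated_sigma M S I Z)" for \<omega>
    using that measurable_space[OF assms(1)[OF assms(2)]] by simp
  show "Z i -` A \<inter> space (generated_sigma M S I Z) \<in> sets (generated_sigma M S I Z)" if "A \<in> sets S" for A
    unfolding space_generated_sigma sets_generated_sigma using that assms(2) by (intro sigma_sets.Basic) auto
qed

lemma sets_generated_sigma_mono:
  assumes "I \<subseteq> J"
  shows "sets (generated_sigma M S I Z) \<subseteq> sets (generated_sigma M S J Z)"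
  unfolding sets_generated_sigma using assms by (intro sigma_sets_mono') blast

lemma (in prob_space) indep_set_generated_sigma:
  assumes ind: "indep_vars (\<lambda>_. S) Z K" and IJ: "I \<subseteq> K" "J \<subseteq> K" "I \<inter> J = {}"
  shows "indep_set (sets (generated_sigma M S I Z)) (sets (generated_sigma M S J Z))"
proof -
  let ?E = "\<lambda>i. {Z i -` A \<inter> space M | A. A \<in> sets S}"
  have "indep_sets (\<lambda>b. sigma_sets (space M) (\<Union>i\<in>case_bool I J b. ?E i)) UNIV"
  proof (rule indep_sets_collect_sigma)
    show "indep_sets ?E (\<Union>b\<in>UNIV. case_bool I J b)"
      using ind IJ by (intro indep_sets_mono_index[OF _ iffD1[OF indep_vars_def2, THEN conjunct2]]) (auto simp: UNIV_bool indep_vars_def2)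
    show "Int_stable (?E i)" for i
    proof (rule Int_stableI)
      fix a b assume "a \<in> ?E i" "b \<in> ?E i"
      then obtain A B where "a = Z i -` A \<inter> space M" "b = Z i -` B \<inter> space M" "A \<in> sets S" "B \<in> sets S" by auto
      then show "a \<inter> b \<in> ?E i" by (intro CollectI exI[of _ "A \<inter> B"]) auto
    qed
    show "disjoint_family_on (case_bool I J) UNIV"
      using IJ by (auto simp: disjoint_family_on_def split: bool.split)
  qed
  moreover have "(\<lambda>b. sigma_sets (space M) (\<Union>i\<in>case_bool I J b. ?E i)) = case_bool (sets (generated_sigma M S I Z)) (sets (generated_sigma M S J Z))"
    unfolding sets_generated_sigma by (rule ext) (simp split: bool.split)
  ultimately show ?thesis unfolding indep_set_def by simp
qed

lemma sets_vimage_algebra_generated: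
  assumes "i \<in> I"
  shows "sets (vimage_algebra (space M) (Z i) S) \<subseteq> sets (generated_sigma M S I Z)"
  unfolding sets_vimage_algebra sets_generated_sigma using assms by (intro sigma_sets_mono') auto

lemma (in prob_space) indep_set_mono:
  assumes "indep_set A B" "A' \<subseteq> A" "B' \<subseteq> B"
  shows "indep_set A' B'"
  using assms unfolding indep_sets2_eq by blast

text \<open>The freezing argument of \<open>innovation\<close> with the law of \<xi> in place of a
  density; noise variables need not have one.\<close>

lemma (in prob_space) indep_integral:
  fixes \<Phi> :: "'a \<times> real \<Rightarrow> 'c :: {banach, second_countable_topology}"
  assumes F: "subalgebra M F" and \<xi>[measurable]: "\<xi> \<in> borel_measurable M"
    and ind: "indep_set (sets F) (sets (vimage_algebra (space M) \<xi> borel))"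
    and [measurable]: "\<Phi> \<in> borel_measurable (F \<Otimes>\<^sub>M borel)"
    and int: "integrable M (\<lambda>\<omega>. \<Phi> (\<omega>, \<xi> \<omega>))"
  shows "(\<integral>\<omega>. \<Phi> (\<omega>, \<xi> \<omega>) \<partial>M) = (\<integral>\<omega>. (\<integral>y. \<Phi> (\<omega>, y) \<partial>distr M borel \<xi>) \<partial>M)"
proof -
  interpret X: prob_space "distr M borel \<xi>" by (rule prob_space_distr) simp
  interpret R: prob_space "restr_to_subalg M F" by (rule prob_space_restr_to_subalg[OF F prob_space_axioms])
  interpret P: pair_sigma_finite "restr_to_subalg M F" "distr M borel \<xi>" ..
  have [measurable_cong]: "sets (restr_to_subalg M F) = sets F" by (rule sets_restr_to_subalg[OF F])
  have id: "(\<lambda>\<omega>. \<omega>) \<in> measurable M F" using F by (auto simp: subalgebra_def measurable_def)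
  have m: "(\<lambda>\<omega>. (\<omega>, \<xi> \<omega>)) \<in> measurable M (F \<Otimes>\<^sub>M borel)" using id by measurable
  have eq: "distr M (F \<Otimes>\<^sub>M borel) (\<lambda>\<omega>. (\<omega>, \<xi> \<omega>)) = restr_to_subalg M F \<Otimes>\<^sub>M distr M borel \<xi>"
    by (simp add: distr_pair_indep_subalgebra[OF F \<xi> ind])
  have I: "integrable (restr_to_subalg M F \<Otimes>\<^sub>M distr M borel \<xi>) \<Phi>"
    unfolding eq[symmetric] by (subst integrable_distr_eq[OF m]) (use int in auto)
  have "(\<integral>\<omega>. \<Phi> (\<omega>, \<xi> \<omega>) \<partial>M) = (\<integral>q. \<Phi> q \<partial>distr M (F \<Otimes>\<^sub>M borel) (\<lambda>\<omega>. (\<omega>, \<xi> \<omega>)))"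
    by (subst integral_distr[OF m]) auto
  also have "\<dots> = (\<integral>\<omega>. (\<integral>y. \<Phi> (\<omega>, y) \<partial>distr M borel \<xi>) \<partial>restr_to_subalg M F)"
    unfolding eq by (rule P.integral_fst'[OF I, symmetric])
  also have "\<dots> = (\<integral>\<omega>. (\<integral>y. \<Phi> (\<omega>, y) \<partial>distr M borel \<xi>) \<partial>M)"
    by (intro integral_subalgebra2[OF F]) measurable
  finally show ?thesis .
qed

lemma abs_mult_le_squares: "\<bar>a * b\<bar> \<le> a\<^sup>2 + b\<^sup>2" for a b :: real
proof -
  have "2 * (\<bar>a\<bar> * \<bar>b\<bar>) \<le> a\<^sup>2 + b\<^sup>2" using zero_le_power2[of "\<bar>a\<bar> - \<bar>b\<bar>"] by (simp add: power2_diff)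
  moreover have "0 \<le> \<bar>a\<bar> * \<bar>b\<bar>" by simp
  ultimately show ?thesis unfolding abs_mult by linarith
qed

lemma integrable_mult_squares:
  fixes f g :: "'a \<Rightarrow> real"
  assumes [measurable]: "f \<in> borel_measurable M" "g \<in> borel_measurable M"
    and "integrable M (\<lambda>\<omega>. (f \<omega>)\<^sup>2)" "integrable M (\<lambda>\<omega>. (g \<omega>)\<^sup>2)"
  shows "integrable M (\<lambda>\<omega>. f \<omega> * g \<omega>)"
proof (rule Bochner_Integration.integrable_bound)
  show "integrable M (\<lambda>\<omega>. (f \<omega>)\<^sup>2 + (g \<omega>)\<^sup>2)" using assms by simp
  show "AE \<omega> in M. norm (f \<omega> * g \<omega>) \<le> norm ((f \<omega>)\<^sup>2 + (g \<omega>)\<^sup>2)"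
    using abs_mult_le_squares by (intro AE_I2) (smt (verit) real_norm_def)
qed measurable

lemma integrable_add_square:
  fixes f g :: "'a \<Rightarrow> real"
  assumes [measurable]: "f \<in> borel_measurable M" "g \<in> borel_measurable M"
    and "integrable M (\<lambda>\<omega>. (f \<omega>)\<^sup>2)" "integrable M (\<lambda>\<omega>. (g \<omega>)\<^sup>2)"
  shows "integrable M (\<lambda>\<omega>. (f \<omega> + g \<omega>)\<^sup>2)"
  unfolding power2_sum mult.assoc
  using assms integrable_mult_squares[OF assms] by (intro Bochner_Integration.integrable_add integrable_mult_right)

lemma Cauchy_Schwarz_expectation:
  fixes f g :: "'a \<Rightarrow> real"
  assumes [measurable]: "f \<in> borel_measurable M" "g \<in> borel_measurable M"
    and i: "integrable M (\<lambda>\<omega>. (f \<omega>)\<^sup>2)" "integrable M (\<lambda>\<omega>. (g \<omega>)\<^sup>2)"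
  shows "\<bar>\<integral>\<omega>. f \<omega> * g \<omega> \<partial>M\<bar> \<le> sqrt ((\<integral>\<omega>. (f \<omega>)\<^sup>2 \<partial>M) * (\<integral>\<omega>. (g \<omega>)\<^sup>2 \<partial>M))"
proof -
  let ?A = "\<integral>\<omega>. \<bar>f \<omega> * g \<omega>\<bar> \<partial>M"
  have fg: "integrable M (\<lambda>\<omega>. \<bar>f \<omega> * g \<omega>\<bar>)" using integrable_mult_squares[OF assms] by simp
  have "(\<integral>\<^sup>+\<omega>. ennreal \<bar>f \<omega>\<bar> * ennreal \<bar>g \<omega>\<bar> \<partial>M)\<^sup>2 \<le> (\<integral>\<^sup>+\<omega>. (ennreal \<bar>f \<omega>\<bar>)\<^sup>2 \<partial>M) * (\<integral>\<^sup>+\<omega>. (ennreal \<bar>g \<omega>\<bar>)\<^sup>2 \<partial>M)"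
    by (rule Cauchy_Schwarz_nn_integral) measurable
  also have "(\<integral>\<^sup>+\<omega>. ennreal \<bar>f \<omega>\<bar> * ennreal \<bar>g \<omega>\<bar> \<partial>M) = ennreal ?A"
    using fg by (subst nn_integral_eq_integral[symmetric]) (auto simp: abs_mult ennreal_mult)
  also have "(\<integral>\<^sup>+\<omega>. (ennreal \<bar>f \<omega>\<bar>)\<^sup>2 \<partial>M) = ennreal (\<integral>\<omega>. (f \<omega>)\<^sup>2 \<partial>M)"
    using i by (subst nn_integral_eq_integral[symmetric]) (auto simp: ennreal_power)
  also have "(\<integral>\<^sup>+\<omega>. (ennreal \<bar>g \<omega>\<bar>)\<^sup>2 \<partial>M) = ennreal (\<integral>\<omega>. (g \<omega>)\<^sup>2 \<partial>M)"
    using i by (subst nn_integral_eq_integral[symmetric]) (auto simp: ennreal_power)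
  finally have "?A\<^sup>2 \<le> (\<integral>\<omega>. (f \<omega>)\<^sup>2 \<partial>M) * (\<integral>\<omega>. (g \<omega>)\<^sup>2 \<partial>M)"
    by (simp add: ennreal_power flip: ennreal_mult)
  then have "?A \<le> sqrt ((\<integral>\<omega>. (f \<omega>)\<^sup>2 \<partial>M) * (\<integral>\<omega>. (g \<omega>)\<^sup>2 \<partial>M))" by (rule real_le_rsqrt)
  then show ?thesis using integral_abs_bound[of M "\<lambda>\<omega>. f \<omega> * g \<omega>"] by linarith
qed

text \<open>Each approximant is the limit plus a difference; the three products containing a
  difference vanish by Cauchy-Schwarz.\<close>

lemma product_L2_limit:
  fixes f g :: "'a \<Rightarrow> real" and fN gN :: "nat \<Rightarrow> 'a \<Rightarrow> real"
  assumes [measurable]: "f \<in> borel_measurable M" "g \<in> borel_measurable M" "\<And>n. fN n \<in> borel_measurable M" "\<And>n. gN n \<in> borel_measurable M"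
    and i: "integrable M (\<lambda>\<omega>. (f \<omega>)\<^sup>2)" "integrable M (\<lambda>\<omega>. (g \<omega>)\<^sup>2)"
    and d: "\<And>n. integrable M (\<lambda>\<omega>. (fN n \<omega> - f \<omega>)\<^sup>2)" "\<And>n. integrable M (\<lambda>\<omega>. (gN n \<omega> - g \<omega>)\<^sup>2)"
    and l: "(\<lambda>n. \<integral>\<omega>. (fN n \<omega> - f \<omega>)\<^sup>2 \<partial>M) \<longlonglongrightarrow> 0" "(\<lambda>n. \<integral>\<omega>. (gN n \<omega> - g \<omega>)\<^sup>2 \<partial>M) \<longlonglongrightarrow> 0"
  shows "(\<lambda>n. \<integral>\<omega>. fN n \<omega> * gN n \<omega> \<partial>M) \<longlonglongrightarrow> (\<integral>\<omega>. f \<omega> * g \<omega> \<partial>M)"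
proof -
  let ?df = "\<lambda>n \<omega>. fN n \<omega> - f \<omega>" and ?dg = "\<lambda>n \<omega>. gN n \<omega> - g \<omega>"
  have z: "(\<lambda>n. \<integral>\<omega>. u n \<omega> * v n \<omega> \<partial>M) \<longlonglongrightarrow> 0"
    if [measurable]: "\<And>n. u n \<in> borel_measurable M" "\<And>n. v n \<in> borel_measurable M"
      and "\<And>n. integrable M (\<lambda>\<omega>. (u n \<omega>)\<^sup>2)" "\<And>n. integrable M (\<lambda>\<omega>. (v n \<omega>)\<^sup>2)"
      and "(\<lambda>n. (\<integral>\<omega>. (u n \<omega>)\<^sup>2 \<partial>M) * (\<integral>\<omega>. (v n \<omega>)\<^sup>2 \<partial>M)) \<longlonglongrightarrow> 0" for u v :: "nat \<Rightarrow> 'a \<Rightarrow> real"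
  proof (rule Lim_null_comparison)
    show "\<forall>\<^sub>F n in sequentially. norm (\<integral>\<omega>. u n \<omega> * v n \<omega> \<partial>M) \<le> sqrt ((\<integral>\<omega>. (u n \<omega>)\<^sup>2 \<partial>M) * (\<integral>\<omega>. (v n \<omega>)\<^sup>2 \<partial>M))"
      unfolding real_norm_def by (intro always_eventually allI Cauchy_Schwarz_expectation that)
    show "(\<lambda>n. sqrt ((\<integral>\<omega>. (u n \<omega>)\<^sup>2 \<partial>M) * (\<integral>\<omega>. (v n \<omega>)\<^sup>2 \<partial>M))) \<longlonglongrightarrow> 0"
      using tendsto_real_sqrt[OF that(5)] by simp
  qed
  have z1: "(\<lambda>n. \<integral>\<omega>. ?df n \<omega> * ?dg n \<omega> \<partial>M) \<longlonglongrightarrow> 0"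
    by (rule z) (use d tendsto_mult_zero[OF l] in auto)
  have z2: "(\<lambda>n. \<integral>\<omega>. ?df n \<omega> * g \<omega> \<partial>M) \<longlonglongrightarrow> 0"
    by (rule z) (use d i tendsto_mult_left_zero[OF l(1)] in auto)
  have z3: "(\<lambda>n. \<integral>\<omega>. f \<omega> * ?dg n \<omega> \<partial>M) \<longlonglongrightarrow> 0"
    by (rule z) (use d i tendsto_mult_right_zero[OF l(2)] in auto)
  have I: "integrable M (\<lambda>\<omega>. ?df n \<omega> * ?dg n \<omega>)" "integrable M (\<lambda>\<omega>. ?df n \<omega> * g \<omega>)" "integrable M (\<lambda>\<omega>. f \<omega> * ?dg n \<omega>)" "integrable M (\<lambda>\<omega>. f \<omega> * g \<omega>)" for n
    using d i by (auto intro!: integrable_mult_squares)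
  have "(\<integral>\<omega>. fN n \<omega> * gN n \<omega> \<partial>M) = ((\<integral>\<omega>. ?df n \<omega> * ?dg n \<omega> \<partial>M) + (\<integral>\<omega>. ?df n \<omega> * g \<omega> \<partial>M) + (\<integral>\<omega>. f \<omega> * ?dg n \<omega> \<partial>M)) + (\<integral>\<omega>. f \<omega> * g \<omega> \<partial>M)" for n
  proof -
    have "(\<integral>\<omega>. fN n \<omega> * gN n \<omega> \<partial>M) = (\<integral>\<omega>. ((?df n \<omega> * ?dg n \<omega> + ?df n \<omega> * g \<omega>) + f \<omega> * ?dg n \<omega>) + f \<omega> * g \<omega> \<partial>M)"
      by (intro Bochner_Integration.integral_cong refl) (simp add: algebra_simps)
    also have "\<dots> = ((\<integral>\<omega>. ?df n \<omega> * ?dg n \<omega> \<partial>M) + (\<integral>\<omega>. ?df n \<omega> * g \<omega> \<partial>M) + (\<integral>\<omega>. f \<omega> * ?dg n \<omega> \<partial>M)) + (\<integral>\<omega>. f \<omega> * g \<omega> \<partial>M)"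
      unfolding Bochner_Integration.integral_add[OF Bochner_Integration.integrable_add[OF Bochner_Integration.integrable_add[OF I(1,2)] I(3)] I(4)]
        Bochner_Integration.integral_add[OF Bochner_Integration.integrable_add[OF I(1,2)] I(3)] Bochner_Integration.integral_add[OF I(1,2)] ..
    finally show ?thesis .
  qed
  moreover have "(\<lambda>n. ((\<integral>\<omega>. ?df n \<omega> * ?dg n \<omega> \<partial>M) + (\<integral>\<omega>. ?df n \<omega> * g \<omega> \<partial>M) + (\<integral>\<omega>. f \<omega> * ?dg n \<omega> \<partial>M)) + (\<integral>\<omega>. f \<omega> * g \<omega> \<partial>M)) \<longlonglongrightarrow> 0 + 0 + 0 + (\<integral>\<omega>. f \<omega> * g \<omega> \<partial>M)"
    by (intro tendsto_add z1 z2 z3 tendsto_const)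
  ultimately show ?thesis by simp
qed

lemma (in prob_space) lipschitz_square_integrable:
  fixes g :: "real \<Rightarrow> real"
  assumes [measurable]: "Z \<in> borel_measurable M" and Z: "integrable M (\<lambda>\<omega>. (Z \<omega>)\<^sup>2)"
    and g: "\<And>w w'. \<bar>g w - g w'\<bar> \<le> L * \<bar>w - w'\<bar>"
  shows "integrable M (\<lambda>\<omega>. (g (Z \<omega>))\<^sup>2)"
proof -
  have [measurable]: "g \<in> borel_measurable borel" using g by (rule lipschitz_borel_measurable)
  have "integrable M (\<lambda>\<omega>. (g (Z \<omega>) - g 0)\<^sup>2)"
  proof (rule Bochner_Integration.integrable_bound)
    show "integrable M (\<lambda>\<omega>. L\<^sup>2 * (Z \<omega>)\<^sup>2)" using Z by simp
    have "(g z - g 0)\<^sup>2 \<le> L\<^sup>2 * z\<^sup>2" for z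
      using power_mono[OF g[of z 0], of 2] by (simp add: power_mult_distrib)
    then show "AE \<omega> in M. norm ((g (Z \<omega>) - g 0)\<^sup>2) \<le> norm (L\<^sup>2 * (Z \<omega>)\<^sup>2)" by auto
  qed measurable
  from integrable_add_square[OF _ _ this, of "\<lambda>_. g 0"] show ?thesis by simp
qed

text \<open>Subtracting u 0 and v 0 leaves the covariance unchanged and bounds both functions by
  multiples of |Z|. The mean of the product and the product of the means each cost A B E[Z^2], hence
  the factor 2.\<close>

lemma (in prob_space) covariance_lipschitz:
  fixes u v :: "real \<Rightarrow> real"
  assumes [measurable]: "Z \<in> borel_measurable M" and Z: "integrable M (\<lambda>\<omega>. (Z \<omega>)\<^sup>2)"
    and u: "\<And>w w'. \<bar>u w - u w'\<bar> \<le> A * \<bar>w - w'\<bar>" and v: "\<And>w w'. \<bar>v w - v w'\<bar> \<le> B * \<bar>w - w'\<bar>"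
  shows "\<bar>expectation (\<lambda>\<omega>. u (Z \<omega>) * v (Z \<omega>)) - expectation (\<lambda>\<omega>. u (Z \<omega>)) * expectation (\<lambda>\<omega>. v (Z \<omega>))\<bar> \<le> 2 * (A * B) * expectation (\<lambda>\<omega>. (Z \<omega>)\<^sup>2)"
proof -
  have [measurable]: "u \<in> borel_measurable borel" "v \<in> borel_measurable borel"
    by (rule lipschitz_borel_measurable, rule u) (rule lipschitz_borel_measurable, rule v)
  have AB: "0 \<le> A" "0 \<le> B" using u[of 1 0] v[of 1 0] by (auto simp: order_trans[OF abs_ge_zero])
  have bd: "expectation (\<lambda>\<omega>. (g (Z \<omega>) - g 0)\<^sup>2) \<le> L\<^sup>2 * expectation (\<lambda>\<omega>. (Z \<omega>)\<^sup>2)" "integrable M (\<lambda>\<omega>. (g (Z \<omega>) - g 0)\<^sup>2)"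
    "integrable M (\<lambda>\<omega>. g (Z \<omega>) - g 0)" "\<bar>expectation (\<lambda>\<omega>. g (Z \<omega>) - g 0)\<bar> \<le> L * sqrt (expectation (\<lambda>\<omega>. (Z \<omega>)\<^sup>2))"
    if g: "\<And>w w'. \<bar>g w - g w'\<bar> \<le> L * \<bar>w - w'\<bar>" and L: "0 \<le> L" for g :: "real \<Rightarrow> real" and L
  proof -
    have [measurable]: "g \<in> borel_measurable borel" using g by (rule lipschitz_borel_measurable)
    show i: "integrable M (\<lambda>\<omega>. (g (Z \<omega>) - g 0)\<^sup>2)"
      by (rule lipschitz_square_integrable[OF _ Z, of "\<lambda>z. g z - g 0" L]) (use g in auto)
    have "expectation (\<lambda>\<omega>. (g (Z \<omega>) - g 0)\<^sup>2) \<le> expectation (\<lambda>\<omega>. L\<^sup>2 * (Z \<omega>)\<^sup>2)"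
    proof (rule integral_mono[OF i])
      show "integrable M (\<lambda>\<omega>. L\<^sup>2 * (Z \<omega>)\<^sup>2)" using Z by simp
      show "(g (Z \<omega>) - g 0)\<^sup>2 \<le> L\<^sup>2 * (Z \<omega>)\<^sup>2" for \<omega>
        using power_mono[OF g[of "Z \<omega>" 0], of 2] by (simp add: power_mult_distrib)
    qed
    then show b: "expectation (\<lambda>\<omega>. (g (Z \<omega>) - g 0)\<^sup>2) \<le> L\<^sup>2 * expectation (\<lambda>\<omega>. (Z \<omega>)\<^sup>2)" by simp
    have m: "(\<lambda>\<omega>. g (Z \<omega>) - g 0) \<in> borel_measurable M" by measurable
    note E = expectation_le_sqrt[OF m i b]
    show "integrable M (\<lambda>\<omega>. g (Z \<omega>) - g 0)" by (rule E(1))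
    have "\<bar>expectation (\<lambda>\<omega>. g (Z \<omega>) - g 0)\<bar> \<le> expectation (\<lambda>\<omega>. \<bar>g (Z \<omega>) - g 0\<bar>)" by (rule integral_abs_bound)
    also have "\<dots> \<le> sqrt (L\<^sup>2 * expectation (\<lambda>\<omega>. (Z \<omega>)\<^sup>2))" by (rule E(2))
    also have "\<dots> = L * sqrt (expectation (\<lambda>\<omega>. (Z \<omega>)\<^sup>2))" using L by (simp add: real_sqrt_mult)
    finally show "\<bar>expectation (\<lambda>\<omega>. g (Z \<omega>) - g 0)\<bar> \<le> L * sqrt (expectation (\<lambda>\<omega>. (Z \<omega>)\<^sup>2))" .
  qed
  note U = bd[OF u AB(1)] and V = bd[OF v AB(2)]
  let ?u = "\<lambda>\<omega>. u (Z \<omega>) - u 0" and ?v = "\<lambda>\<omega>. v (Z \<omega>) - v 0" and ?s = "expectation (\<lambda>\<omega>. (Z \<omega>)\<^sup>2)"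
  have s0: "0 \<le> ?s" by (simp add: Bochner_Integration.integral_nonneg)
  have iu: "integrable M (\<lambda>\<omega>. u (Z \<omega>))" using Bochner_Integration.integrable_add[OF U(3) integrable_const[of "u 0"]] by simp
  have iv: "integrable M (\<lambda>\<omega>. v (Z \<omega>))" using Bochner_Integration.integrable_add[OF V(3) integrable_const[of "v 0"]] by simp
  have iuv: "integrable M (\<lambda>\<omega>. ?u \<omega> * ?v \<omega>)" by (rule integrable_mult_squares) (use U(2) V(2) in measurable)
  have eu: "expectation ?u = expectation (\<lambda>\<omega>. u (Z \<omega>)) - u 0" "expectation ?v = expectation (\<lambda>\<omega>. v (Z \<omega>)) - v 0"
    using iu iv by (simp_all add: prob_space)
  have euv: "expectation (\<lambda>\<omega>. u (Z \<omega>) * v (Z \<omega>)) = expectation (\<lambda>\<omega>. ?u \<omega> * ?v \<omega>) + (u 0 * expectation (\<lambda>\<omega>. v (Z \<omega>)) + v 0 * expectation (\<lambda>\<omega>. u (Z \<omega>)) - u 0 * v 0)"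
  proof -
    have "expectation (\<lambda>\<omega>. u (Z \<omega>) * v (Z \<omega>)) = expectation (\<lambda>\<omega>. ?u \<omega> * ?v \<omega> + (u 0 * v (Z \<omega>) + v 0 * u (Z \<omega>) - u 0 * v 0))"
      by (intro Bochner_Integration.integral_cong refl) (simp add: algebra_simps)
    also have "\<dots> = expectation (\<lambda>\<omega>. ?u \<omega> * ?v \<omega>) + expectation (\<lambda>\<omega>. u 0 * v (Z \<omega>) + v 0 * u (Z \<omega>) - u 0 * v 0)"
      by (rule Bochner_Integration.integral_add[OF iuv]) (use iu iv in simp)
    also have "expectation (\<lambda>\<omega>. u 0 * v (Z \<omega>) + v 0 * u (Z \<omega>) - u 0 * v 0) = u 0 * expectation (\<lambda>\<omega>. v (Z \<omega>)) + v 0 * expectation (\<lambda>\<omega>. u (Z \<omega>)) - u 0 * v 0"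
      using iu iv by (simp add: prob_space)
    finally show ?thesis .
  qed
  have "expectation (\<lambda>\<omega>. u (Z \<omega>) * v (Z \<omega>)) - expectation (\<lambda>\<omega>. u (Z \<omega>)) * expectation (\<lambda>\<omega>. v (Z \<omega>))
     = expectation (\<lambda>\<omega>. ?u \<omega> * ?v \<omega>) - expectation ?u * expectation ?v"
    unfolding euv eu by (simp add: algebra_simps)
  moreover have "\<bar>expectation (\<lambda>\<omega>. ?u \<omega> * ?v \<omega>)\<bar> \<le> A * B * ?s"
  proof -
    have "\<bar>expectation (\<lambda>\<omega>. ?u \<omega> * ?v \<omega>)\<bar> \<le> sqrt (expectation (\<lambda>\<omega>. (?u \<omega>)\<^sup>2) * expectation (\<lambda>\<omega>. (?v \<omega>)\<^sup>2))"
      by (rule Cauchy_Schwarz_expectation) (use U(2) V(2) in measurable)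
    also have "\<dots> \<le> sqrt ((A\<^sup>2 * ?s) * (B\<^sup>2 * ?s))"
      using U(1) V(1) s0 by (intro real_sqrt_le_mono mult_mono) (auto simp: Bochner_Integration.integral_nonneg)
    also have "(A\<^sup>2 * ?s) * (B\<^sup>2 * ?s) = (A * B * ?s)\<^sup>2" by (simp add: power2_eq_square)
    also have "sqrt \<dots> = A * B * ?s" using AB s0 by simp
    finally show ?thesis .
  qed
  moreover have "\<bar>expectation ?u * expectation ?v\<bar> \<le> A * B * ?s"
  proof -
    have "\<bar>expectation ?u * expectation ?v\<bar> \<le> (A * sqrt ?s) * (B * sqrt ?s)"
      unfolding abs_mult using U(4) V(4) AB s0 by (intro mult_mono) auto
    also have "\<dots> = A * B * ?s" using s0 by simp
    finally show ?thesis .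
  qed
  ultimately show ?thesis by linarith
qed

section \<open>Functionals of finitely many noise variables\<close>

locale noise = iid_seq M "borel :: real measure" \<eta> for M :: "'a measure" and \<eta> :: "int \<Rightarrow> 'a \<Rightarrow> real" +
  assumes \<eta>0_square: "integrable M (\<lambda>\<omega>. (\<eta> 0 \<omega>)\<^sup>2)" and \<eta>0_mean: "expectation (\<eta> 0) = 0"
begin

definition "\<sigma>2 = expectation (\<lambda>\<omega>. (\<eta> 0 \<omega>)\<^sup>2)"

lemma \<sigma>2_nonneg: "0 \<le> \<sigma>2" unfolding \<sigma>2_def by simp

lemma \<eta>_transfer:
  fixes g :: "real \<Rightarrow> real"
  assumes [measurable]: "g \<in> borel_measurable borel"
  shows "integrable M (\<lambda>\<omega>. g (\<eta> i \<omega>)) \<longleftrightarrow> integrable M (\<lambda>\<omega>. g (\<eta> 0 \<omega>))"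
    and "expectation (\<lambda>\<omega>. g (\<eta> i \<omega>)) = expectation (\<lambda>\<omega>. g (\<eta> 0 \<omega>))"
  using integrable_distr_eq[of "\<eta> i" M borel g] integrable_distr_eq[of "\<eta> 0" M borel g]
    integral_distr[of "\<eta> i" M borel g] integral_distr[of "\<eta> 0" M borel g] identical[of i 0] by simp_all

lemma \<eta>_square: "integrable M (\<lambda>\<omega>. (\<eta> i \<omega>)\<^sup>2)" "expectation (\<lambda>\<omega>. (\<eta> i \<omega>)\<^sup>2) = \<sigma>2"
  using \<eta>_transfer[of "\<lambda>y. y\<^sup>2" i] \<eta>0_square by (auto simp: \<sigma>2_def)

lemma \<eta>_integrable: "integrable M (\<eta> i)"
  by (rule square_integrable_imp_integrable[OF _ \<eta>_square(1)]) simp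

lemma \<eta>_mean: "expectation (\<eta> i) = 0"
  using \<eta>_transfer(2)[of "\<lambda>y. y" i] \<eta>0_mean by simp

lemma \<eta>_orthogonal: "i \<noteq> j \<Longrightarrow> expectation (\<lambda>\<omega>. \<eta> i \<omega> * \<eta> j \<omega>) = 0"
proof -
  assume ij: "i \<noteq> j"
  have "expectation (\<lambda>\<omega>. \<Prod>k\<in>{i, j}. \<eta> k \<omega>) = (\<Prod>k\<in>{i, j}. expectation (\<eta> k))"
    by (rule indep_vars_lebesgue_integral) (auto intro: indep_vars_subset[OF indep] \<eta>_integrable)
  then show ?thesis using ij by (simp add: \<eta>_mean)
qed

lemma linear_sum_square:
  assumes "finite J"
  shows "integrable M (\<lambda>\<omega>. (\<Sum>j\<in>J. a j * \<eta> j \<omega>)\<^sup>2)"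
    and "expectation (\<lambda>\<omega>. (\<Sum>j\<in>J. a j * \<eta> j \<omega>)\<^sup>2) = \<sigma>2 * (\<Sum>j\<in>J. (a j)\<^sup>2)"
proof -
  have eq: "(\<Sum>j\<in>J. a j * \<eta> j \<omega>)\<^sup>2 = (\<Sum>i\<in>J. \<Sum>j\<in>J. a i * a j * (\<eta> i \<omega> * \<eta> j \<omega>))" for \<omega>
    unfolding power2_eq_square sum_product by (intro sum.cong refl) (simp add: mult_ac)
  have i: "integrable M (\<lambda>\<omega>. a i * a j * (\<eta> i \<omega> * \<eta> j \<omega>))" for i j
    by (intro integrable_mult_right integrable_mult_squares \<eta>_square) simp_all
  show "integrable M (\<lambda>\<omega>. (\<Sum>j\<in>J. a j * \<eta> j \<omega>)\<^sup>2)" unfolding eq by (intro Bochner_Integration.integrable_sum i)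
  have "expectation (\<lambda>\<omega>. (\<Sum>j\<in>J. a j * \<eta> j \<omega>)\<^sup>2) = (\<Sum>i\<in>J. expectation (\<lambda>\<omega>. \<Sum>j\<in>J. a i * a j * (\<eta> i \<omega> * \<eta> j \<omega>)))"
    unfolding eq by (intro Bochner_Integration.integral_sum Bochner_Integration.integrable_sum i)
  also have "\<dots> = (\<Sum>i\<in>J. \<Sum>j\<in>J. a i * a j * expectation (\<lambda>\<omega>. \<eta> i \<omega> * \<eta> j \<omega>))"
    by (intro sum.cong refl) (subst Bochner_Integration.integral_sum[OF i], simp only: integral_mult_right_zero)
  also have "\<dots> = (\<Sum>i\<in>J. \<Sum>j\<in>J. if j = i then (a i)\<^sup>2 * \<sigma>2 else 0)"
    using \<eta>_orthogonal \<eta>_square(2) by (intro sum.cong refl) (auto simp: power2_eq_square)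
  also have "\<dots> = \<sigma>2 * (\<Sum>j\<in>J. (a j)\<^sup>2)" using assms by (simp add: sum_distrib_left mult.commute)
  finally show "expectation (\<lambda>\<omega>. (\<Sum>j\<in>J. a j * \<eta> j \<omega>)\<^sup>2) = \<sigma>2 * (\<Sum>j\<in>J. (a j)\<^sup>2)" .
qed

text \<open>Induction over the noise variables by the law of total covariance. Integrating out
  variable \<open>i\<close> turns \<open>g\<close> and \<open>g'\<close> into \<open>h\<close> and
  \<open>h'\<close>, which keep the Lipschitz constants because they are averages of shifted copies;
  hence the induction must leave \<open>g\<close> and \<open>g'\<close> arbitrary. The conditional
  covariance concerns functions of one variable with constants L |a i| and L' |b i|.\<close>

lemma covariance_finite:
  fixes g g' :: "real \<Rightarrow> real" and a b :: "int \<Rightarrow> real"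
  assumes "finite J"
    and "\<And>w w'. \<bar>g w - g w'\<bar> \<le> L * \<bar>w - w'\<bar>" and "\<And>w w'. \<bar>g' w - g' w'\<bar> \<le> L' * \<bar>w - w'\<bar>"
  shows "\<bar>expectation (\<lambda>\<omega>. g (\<Sum>j\<in>J. a j * \<eta> j \<omega>) * g' (\<Sum>j\<in>J. b j * \<eta> j \<omega>))
      - expectation (\<lambda>\<omega>. g (\<Sum>j\<in>J. a j * \<eta> j \<omega>)) * expectation (\<lambda>\<omega>. g' (\<Sum>j\<in>J. b j * \<eta> j \<omega>))\<bar>
     \<le> 2 * (L * L') * \<sigma>2 * (\<Sum>j\<in>J. \<bar>a j * b j\<bar>)"
  using assms
proof (induction J arbitrary: g g' rule: finite_induct)
  case empty
  then show ?case by (simp add: prob_space)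
next
  case (insert i J)
  note g = insert.prems(1) and g' = insert.prems(2)
  define S where "S \<omega> = (\<Sum>j\<in>J. a j * \<eta> j \<omega>)" for \<omega>
  define T where "T \<omega> = (\<Sum>j\<in>J. b j * \<eta> j \<omega>)" for \<omega>
  define F where "F = generated_sigma M borel J \<eta>"
  define \<nu> where "\<nu> = distr M borel (\<eta> i)"
  interpret N: prob_space \<nu> unfolding \<nu>_def by (rule prob_space_distr) simp
  have [measurable_cong]: "sets \<nu> = sets borel" by (simp add: \<nu>_def)
  have [measurable]: "g \<in> borel_measurable borel" "g' \<in> borel_measurable borel"
    by (rule lipschitz_borel_measurable, rule g) (rule lipschitz_borel_measurable, rule g')
  have sub: "subalgebra M F" unfolding F_def by (rule subalgebra_generated_sigma) simp
  have \<eta>F: "\<eta> j \<in> borel_measurable F" if "j \<in> J" for j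
    unfolding F_def by (rule generated_sigma_measurable) (use that in auto)
  have STF[measurable]: "S \<in> borel_measurable F" "T \<in> borel_measurable F"
    unfolding S_def[abs_def] T_def[abs_def] by (intro borel_measurable_sum borel_measurable_times borel_measurable_const \<eta>F; assumption)+
  have STM[measurable]: "S \<in> borel_measurable M" "T \<in> borel_measurable M"
    by (rule measurable_from_subalg[OF sub STF(1)], rule measurable_from_subalg[OF sub STF(2)])
  have ind: "indep_set (sets F) (sets (vimage_algebra (space M) (\<eta> i) borel))"
    unfolding F_def
    by (rule indep_set_mono[OF indep_set_generated_sigma[OF indep, of J "{i}"] order_refl sets_vimage_algebra_generated])
      (use insert.hyps in auto)
  have S2: "integrable M (\<lambda>\<omega>. (S \<omega>)\<^sup>2)" "integrable M (\<lambda>\<omega>. (T \<omega>)\<^sup>2)"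
    using linear_sum_square(1)[OF insert.hyps(1)] by (auto simp: S_def T_def)
  have sum_eq: "(\<Sum>j\<in>insert i J. a j * \<eta> j \<omega>) = S \<omega> + a i * \<eta> i \<omega>" "(\<Sum>j\<in>insert i J. b j * \<eta> j \<omega>) = T \<omega> + b i * \<eta> i \<omega>" for \<omega>
    using insert.hyps by (simp_all add: S_def T_def add.commute)
  have SS2: "integrable M (\<lambda>\<omega>. (S \<omega> + a i * \<eta> i \<omega>)\<^sup>2)" "integrable M (\<lambda>\<omega>. (T \<omega> + b i * \<eta> i \<omega>)\<^sup>2)"
    using linear_sum_square(1)[of "insert i J" a] linear_sum_square(1)[of "insert i J" b] insert.hyps(1) by (simp_all add: sum_eq)
  have y2: "integrable \<nu> (\<lambda>y. y\<^sup>2)" "N.expectation (\<lambda>y. y\<^sup>2) = \<sigma>2"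
    unfolding \<nu>_def using \<eta>_square[of i] by (simp_all add: integrable_distr_eq integral_distr)
  have gN2: "integrable \<nu> (\<lambda>y. (u (s + c * y))\<^sup>2)" if u: "\<And>w w'. \<bar>u w - u w'\<bar> \<le> K * \<bar>w - w'\<bar>" for u :: "real \<Rightarrow> real" and K s c
  proof (rule N.lipschitz_square_integrable[where L=K, OF _ _ u])
    show "integrable \<nu> (\<lambda>y. (s + c * y)\<^sup>2)"
      by (rule integrable_add_square) (use y2(1) in \<open>auto simp: power_mult_distrib\<close>)
  qed measurable
  have gN: "integrable \<nu> (\<lambda>y. u (s + c * y))" if u: "\<And>w w'. \<bar>u w - u w'\<bar> \<le> K * \<bar>w - w'\<bar>" for u :: "real \<Rightarrow> real" and K s c
  proof -
    have [measurable]: "u \<in> borel_measurable borel" using u by (rule lipschitz_borel_measurable)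
    show ?thesis by (rule N.square_integrable_imp_integrable[OF _ gN2[OF u]]) measurable
  qed
  define h where "h s = N.expectation (\<lambda>y. g (s + a i * y))" for s
  define h' where "h' s = N.expectation (\<lambda>y. g' (s + b i * y))" for s
  have lip: "\<bar>N.expectation (\<lambda>y. u (s + c * y)) - N.expectation (\<lambda>y. u (s' + c * y))\<bar> \<le> K * \<bar>s - s'\<bar>"
    if u: "\<And>w w'. \<bar>u w - u w'\<bar> \<le> K * \<bar>w - w'\<bar>" for u :: "real \<Rightarrow> real" and K s s' c
  proof -
    have "N.expectation (\<lambda>y. u (s + c * y)) - N.expectation (\<lambda>y. u (s' + c * y)) = N.expectation (\<lambda>y. u (s + c * y) - u (s' + c * y))"
      using gN[OF u] by simp
    then have "\<bar>N.expectation (\<lambda>y. u (s + c * y)) - N.expectation (\<lambda>y. u (s' + c * y))\<bar> \<le> N.expectation (\<lambda>y. \<bar>u (s + c * y) - u (s' + c * y)\<bar>)"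
      using integral_abs_bound[of \<nu> "\<lambda>y. u (s + c * y) - u (s' + c * y)"] by simp
    also have "\<dots> \<le> N.expectation (\<lambda>y. K * \<bar>s - s'\<bar>)"
    proof (rule integral_mono)
      show "integrable \<nu> (\<lambda>y. \<bar>u (s + c * y) - u (s' + c * y)\<bar>)" using gN[OF u] by simp
      show "\<bar>u (s + c * y) - u (s' + c * y)\<bar> \<le> K * \<bar>s - s'\<bar>" for y using u[of "s + c * y" "s' + c * y"] by simp
    qed simp
    finally show ?thesis by (simp add: N.prob_space)
  qed
  have hl: "\<bar>h w - h w'\<bar> \<le> L * \<bar>w - w'\<bar>" for w w' unfolding h_def by (rule lip[OF g])
  have hl': "\<bar>h' w - h' w'\<bar> \<le> L' * \<bar>w - w'\<bar>" for w w' unfolding h'_def by (rule lip[OF g'])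
  have [measurable]: "h \<in> borel_measurable borel" "h' \<in> borel_measurable borel"
    by (rule lipschitz_borel_measurable, rule hl) (rule lipschitz_borel_measurable, rule hl')
  have gM2: "integrable M (\<lambda>\<omega>. (g (S \<omega> + a i * \<eta> i \<omega>))\<^sup>2)" "integrable M (\<lambda>\<omega>. (g' (T \<omega> + b i * \<eta> i \<omega>))\<^sup>2)"
    "integrable M (\<lambda>\<omega>. (h (S \<omega>))\<^sup>2)" "integrable M (\<lambda>\<omega>. (h' (T \<omega>))\<^sup>2)"
    by (rule lipschitz_square_integrable[OF _ SS2(1) g]; measurable)
       (rule lipschitz_square_integrable[OF _ SS2(2) g'] lipschitz_square_integrable[OF _ S2(1) hl] lipschitz_square_integrable[OF _ S2(2) hl']; measurable)+
  have i1: "integrable M (\<lambda>\<omega>. g (S \<omega> + a i * \<eta> i \<omega>) * g' (T \<omega> + b i * \<eta> i \<omega>))"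
    by (rule integrable_mult_squares[OF _ _ gM2(1,2)]) measurable
  have ih: "integrable M (\<lambda>\<omega>. h (S \<omega>) * h' (T \<omega>))"
    by (rule integrable_mult_squares[OF _ _ gM2(3,4)]) measurable
  have ig: "integrable M (\<lambda>\<omega>. g (S \<omega> + a i * \<eta> i \<omega>))" "integrable M (\<lambda>\<omega>. g' (T \<omega> + b i * \<eta> i \<omega>))"
    by (rule square_integrable_imp_integrable[OF _ gM2(1)], measurable) (rule square_integrable_imp_integrable[OF _ gM2(2)], measurable)
  \<comment> \<open>The conditional mean of the product given the other variables; its difference
    from h (S) h' (T) is the conditional covariance.\<close>
  define c where "c \<omega> = N.expectation (\<lambda>y. g (S \<omega> + a i * y) * g' (T \<omega> + b i * y))" for \<omega>
  have E1: "expectation (\<lambda>\<omega>. g (S \<omega> + a i * \<eta> i \<omega>) * g' (T \<omega> + b i * \<eta> i \<omega>)) = expectation c"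
    unfolding c_def[abs_def] \<nu>_def
    using indep_integral[OF sub \<eta>_measurable ind, of "\<lambda>(\<omega>, y). g (S \<omega> + a i * y) * g' (T \<omega> + b i * y)"] i1 by simp
  have E2: "expectation (\<lambda>\<omega>. g (S \<omega> + a i * \<eta> i \<omega>)) = expectation (\<lambda>\<omega>. h (S \<omega>))"
    unfolding h_def \<nu>_def
    using indep_integral[OF sub \<eta>_measurable ind, of "\<lambda>(\<omega>, y). g (S \<omega> + a i * y)"] ig(1) by simp
  have E3: "expectation (\<lambda>\<omega>. g' (T \<omega> + b i * \<eta> i \<omega>)) = expectation (\<lambda>\<omega>. h' (T \<omega>))"
    unfolding h'_def \<nu>_def
    using indep_integral[OF sub \<eta>_measurable ind, of "\<lambda>(\<omega>, y). g' (T \<omega> + b i * y)"] ig(2) by simp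
  have LL: "0 \<le> L" "0 \<le> L'" using g[of 1 0] g'[of 1 0] by (auto simp: order_trans[OF abs_ge_zero])
  have cb: "\<bar>c \<omega> - h (S \<omega>) * h' (T \<omega>)\<bar> \<le> 2 * (L * L') * \<sigma>2 * \<bar>a i * b i\<bar>" for \<omega>
  proof -
    have l1: "\<bar>g (s + e * w) - g (s + e * w')\<bar> \<le> (L * \<bar>e\<bar>) * \<bar>w - w'\<bar>" for s e w w'
      using g[of "s + e * w" "s + e * w'"] by (simp add: abs_mult mult.assoc flip: right_diff_distrib)
    have l2: "\<bar>g' (s + e * w) - g' (s + e * w')\<bar> \<le> (L' * \<bar>e\<bar>) * \<bar>w - w'\<bar>" for s e w w'
      using g'[of "s + e * w" "s + e * w'"] by (simp add: abs_mult mult.assoc flip: right_diff_distrib)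
    have "\<bar>c \<omega> - h (S \<omega>) * h' (T \<omega>)\<bar> \<le> 2 * ((L * \<bar>a i\<bar>) * (L' * \<bar>b i\<bar>)) * N.expectation (\<lambda>y. y\<^sup>2)"
      unfolding c_def h_def h'_def
      using N.covariance_lipschitz[of "\<lambda>y. y" "\<lambda>y. g (S \<omega> + a i * y)" "L * \<bar>a i\<bar>" "\<lambda>y. g' (T \<omega> + b i * y)" "L' * \<bar>b i\<bar>", OF _ y2(1) l1 l2]
      by simp
    then show ?thesis unfolding y2(2) by (simp add: abs_mult mult_ac)
  qed
  have ic: "integrable M c"
  proof -
    have cm: "c \<in> borel_measurable M" unfolding c_def[abs_def] by measurable
    have "integrable M (\<lambda>\<omega>. c \<omega> - h (S \<omega>) * h' (T \<omega>))"
      by (rule integrable_const_bound[where B="2 * (L * L') * \<sigma>2 * \<bar>a i * b i\<bar>"]) (use cb cm in auto)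
    from Bochner_Integration.integrable_add[OF this ih] show ?thesis by simp
  qed
  have d1: "\<bar>expectation c - expectation (\<lambda>\<omega>. h (S \<omega>) * h' (T \<omega>))\<bar> \<le> 2 * (L * L') * \<sigma>2 * \<bar>a i * b i\<bar>"
  proof -
    have "\<bar>expectation c - expectation (\<lambda>\<omega>. h (S \<omega>) * h' (T \<omega>))\<bar> = \<bar>expectation (\<lambda>\<omega>. c \<omega> - h (S \<omega>) * h' (T \<omega>))\<bar>"
      using ic ih by simp
    also have "\<dots> \<le> expectation (\<lambda>\<omega>. \<bar>c \<omega> - h (S \<omega>) * h' (T \<omega>)\<bar>)" by (rule integral_abs_bound)
    also have "\<dots> \<le> expectation (\<lambda>\<omega>. 2 * (L * L') * \<sigma>2 * \<bar>a i * b i\<bar>)"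
      using ic ih cb by (intro integral_mono integrable_abs Bochner_Integration.integrable_diff) auto
    finally show ?thesis by (simp add: prob_space)
  qed
  have d2: "\<bar>expectation (\<lambda>\<omega>. h (S \<omega>) * h' (T \<omega>)) - expectation (\<lambda>\<omega>. h (S \<omega>)) * expectation (\<lambda>\<omega>. h' (T \<omega>))\<bar> \<le> 2 * (L * L') * \<sigma>2 * (\<Sum>j\<in>J. \<bar>a j * b j\<bar>)"
    unfolding S_def T_def by (rule insert.IH[OF hl hl'])
  have "(\<Sum>j\<in>insert i J. \<bar>a j * b j\<bar>) = \<bar>a i * b i\<bar> + (\<Sum>j\<in>J. \<bar>a j * b j\<bar>)" using insert.hyps by simp
  then show ?case unfolding sum_eq E1 E2 E3 using d1 d2 by (simp add: distrib_left)
qed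

end

section \<open>Linear processes as limits of finite moving averages\<close>

locale linear_process = noise +
  fixes c :: "nat \<Rightarrow> real" and U :: "int \<Rightarrow> 'a \<Rightarrow> real"
  assumes c2: "summable (\<lambda>k. (c k)\<^sup>2)"
    and U_measurable [measurable]: "\<And>i. U i \<in> borel_measurable M"
    and U_sums: "\<And>i. AE \<omega> in M. (\<lambda>k. c k * \<eta> (i - int k) \<omega>) sums U i \<omega>"
begin

definition "partial N i \<omega> = (\<Sum>k<N. c k * \<eta> (i - int k) \<omega>)"

lemma partial_measurable [measurable]: "partial N i \<in> borel_measurable M"
  unfolding partial_def[abs_def] by measurable

lemma sum_reindex: "(\<Sum>k\<in>A. f k * \<eta> (i - int k) \<omega>) = (\<Sum>j\<in>(\<lambda>k. i - int k) ` A. f (nat (i - j)) * \<eta> j \<omega>)"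
  by (subst sum.reindex) (auto simp: inj_on_def)

lemma increment_square:
  assumes "finite A"
  shows "integrable M (\<lambda>\<omega>. (\<Sum>k\<in>A. c k * \<eta> (i - int k) \<omega>)\<^sup>2)"
    and "expectation (\<lambda>\<omega>. (\<Sum>k\<in>A. c k * \<eta> (i - int k) \<omega>)\<^sup>2) = \<sigma>2 * (\<Sum>k\<in>A. (c k)\<^sup>2)"
proof -
  have "(\<Sum>j\<in>(\<lambda>k. i - int k) ` A. (c (nat (i - j)))\<^sup>2) = (\<Sum>k\<in>A. (c k)\<^sup>2)"
    by (subst sum.reindex) (auto simp: inj_on_def)
  then show "integrable M (\<lambda>\<omega>. (\<Sum>k\<in>A. c k * \<eta> (i - int k) \<omega>)\<^sup>2)"
    "expectation (\<lambda>\<omega>. (\<Sum>k\<in>A. c k * \<eta> (i - int k) \<omega>)\<^sup>2) = \<sigma>2 * (\<Sum>k\<in>A. (c k)\<^sup>2)"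
    unfolding sum_reindex using linear_sum_square[of "(\<lambda>k. i - int k) ` A" "\<lambda>j. c (nat (i - j))"] assms by simp_all
qed

definition "tail N = (\<Sum>k. (c (k + N))\<^sup>2)"

lemma tail_limit: "tail \<longlonglongrightarrow> 0"
  unfolding tail_def[abs_def] using suminf_exist_split2[OF c2] by simp

lemma tail_ge: "(\<Sum>k\<in>{N..<N'}. (c k)\<^sup>2) \<le> tail N"
proof (cases "N \<le> N'")
  case True
  have "(\<Sum>k\<in>{N..<N'}. (c k)\<^sup>2) = (\<Sum>k<N' - N. (c (k + N))\<^sup>2)"
    using True sum.shift_bounds_nat_ivl[of "\<lambda>k. (c k)\<^sup>2" 0 N "N' - N"] by (simp add: lessThan_atLeast0)
  also have "\<dots> \<le> tail N" unfolding tail_def by (rule sum_le_suminf) (use c2 summable_ignore_initial_segment[of "\<lambda>k. (c k)\<^sup>2" N] in auto)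
  finally show ?thesis .
qed (simp add: tail_def suminf_nonneg summable_ignore_initial_segment[OF c2])

text \<open>The series is known to converge almost surely only. Fatou's lemma along N' turns the
  bound between partial sums into a bound on the distance to the limit.\<close>

lemma partial_error:
  shows "integrable M (\<lambda>\<omega>. (partial N i \<omega> - U i \<omega>)\<^sup>2)"
    and "expectation (\<lambda>\<omega>. (partial N i \<omega> - U i \<omega>)\<^sup>2) \<le> \<sigma>2 * tail N"
proof -
  have t0: "0 \<le> tail N" using tail_ge[of N N] by simp
  let ?u = "\<lambda>N' \<omega>. ennreal ((partial N i \<omega> - partial N' i \<omega>)\<^sup>2)"
  have bd: "(\<integral>\<^sup>+\<omega>. ?u N' \<omega> \<partial>M) \<le> ennreal (\<sigma>2 * tail N)" if "N \<le> N'" for N'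
  proof -
    have eq: "(partial N i \<omega> - partial N' i \<omega>)\<^sup>2 = (\<Sum>k\<in>{N..<N'}. c k * \<eta> (i - int k) \<omega>)\<^sup>2" for \<omega>
    proof -
      have "partial N' i \<omega> = partial N i \<omega> + (\<Sum>k\<in>{N..<N'}. c k * \<eta> (i - int k) \<omega>)"
        unfolding partial_def lessThan_atLeast0 using that by (simp add: sum.atLeastLessThan_concat)
      then show ?thesis by (simp add: power2_commute)
    qed
    have "(\<integral>\<^sup>+\<omega>. ?u N' \<omega> \<partial>M) = ennreal (\<sigma>2 * (\<Sum>k\<in>{N..<N'}. (c k)\<^sup>2))"
      unfolding eq using increment_square[of "{N..<N'}" i] by (subst nn_integral_eq_integral) auto
    also have "\<dots> \<le> ennreal (\<sigma>2 * tail N)" using tail_ge \<sigma>2_nonneg by (intro ennreal_leI mult_left_mono)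
    finally show ?thesis .
  qed
  have "(\<integral>\<^sup>+\<omega>. ennreal ((partial N i \<omega> - U i \<omega>)\<^sup>2) \<partial>M) = (\<integral>\<^sup>+\<omega>. liminf (\<lambda>N'. ?u N' \<omega>) \<partial>M)"
  proof (rule nn_integral_cong_AE)
    show "AE \<omega> in M. ennreal ((partial N i \<omega> - U i \<omega>)\<^sup>2) = liminf (\<lambda>N'. ?u N' \<omega>)"
      using U_sums[of i]
    proof eventually_elim
      case (elim \<omega>)
      then have "(\<lambda>N'. partial N' i \<omega>) \<longlonglongrightarrow> U i \<omega>" by (simp add: sums_def partial_def)
      then have "(\<lambda>N'. ?u N' \<omega>) \<longlonglongrightarrow> ennreal ((partial N i \<omega> - U i \<omega>)\<^sup>2)"
        by (intro tendsto_ennrealI tendsto_power tendsto_diff tendsto_const)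
      then show ?case by (rule lim_imp_Liminf[OF sequentially_bot, symmetric])
    qed
  qed
  also have "\<dots> \<le> liminf (\<lambda>N'. \<integral>\<^sup>+\<omega>. ?u N' \<omega> \<partial>M)" by (rule nn_integral_liminf) measurable
  also have "\<dots> \<le> liminf (\<lambda>N'. ennreal (\<sigma>2 * tail N))"
    by (rule Liminf_mono, rule eventually_mono[OF eventually_ge_at_top[of N] bd])
  also have "\<dots> = ennreal (\<sigma>2 * tail N)" by (rule Liminf_const[OF sequentially_bot])
  finally have le: "(\<integral>\<^sup>+\<omega>. ennreal ((partial N i \<omega> - U i \<omega>)\<^sup>2) \<partial>M) \<le> ennreal (\<sigma>2 * tail N)" .
  show int: "integrable M (\<lambda>\<omega>. (partial N i \<omega> - U i \<omega>)\<^sup>2)"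
    using le by (intro integrableI_bounded) (auto intro: le_less_trans)
  then show "expectation (\<lambda>\<omega>. (partial N i \<omega> - U i \<omega>)\<^sup>2) \<le> \<sigma>2 * tail N"
    using le t0 \<sigma>2_nonneg by (subst (asm) nn_integral_eq_integral) auto
qed

lemma U_square: "integrable M (\<lambda>\<omega>. (U i \<omega>)\<^sup>2)"
proof -
  \<comment> \<open>The empty partial sum is 0, so its error is the process itself up to
    sign.\<close>
  have "integrable M (\<lambda>\<omega>. (- (partial 0 i \<omega> - U i \<omega>))\<^sup>2)" unfolding power2_minus by (rule partial_error(1))
  then show ?thesis by (simp add: partial_def)
qed

lemma lipschitz_partial_error:
  assumes g: "\<And>w w'. \<bar>g w - g w'\<bar> \<le> L * \<bar>w - w'\<bar>"
  shows "integrable M (\<lambda>\<omega>. (g (partial N i \<omega>) - g (U i \<omega>))\<^sup>2)"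
    and "(\<lambda>N. expectation (\<lambda>\<omega>. (g (partial N i \<omega>) - g (U i \<omega>))\<^sup>2)) \<longlonglongrightarrow> 0"
proof -
  have [measurable]: "g \<in> borel_measurable borel" using g by (rule lipschitz_borel_measurable)
  have le: "(g (partial N i \<omega>) - g (U i \<omega>))\<^sup>2 \<le> L\<^sup>2 * (partial N i \<omega> - U i \<omega>)\<^sup>2" for N \<omega>
    using power_mono[OF g[of "partial N i \<omega>" "U i \<omega>"], of 2] by (simp add: power_mult_distrib)
  show int: "integrable M (\<lambda>\<omega>. (g (partial N i \<omega>) - g (U i \<omega>))\<^sup>2)" for N
    by (rule Bochner_Integration.integrable_bound[OF integrable_mult_right[OF partial_error(1)[of N i], of "L\<^sup>2"]])
      (use le in \<open>auto intro!: AE_I2 order_trans[OF le]\<close>)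
  show "(\<lambda>N. expectation (\<lambda>\<omega>. (g (partial N i \<omega>) - g (U i \<omega>))\<^sup>2)) \<longlonglongrightarrow> 0"
  proof (rule tendsto_sandwich[OF _ _ tendsto_const])
    show "(\<lambda>N. L\<^sup>2 * (\<sigma>2 * tail N)) \<longlonglongrightarrow> 0" by (intro tendsto_mult_right_zero tail_limit)
    show "\<forall>\<^sub>F N in sequentially. expectation (\<lambda>\<omega>. (g (partial N i \<omega>) - g (U i \<omega>))\<^sup>2) \<le> L\<^sup>2 * (\<sigma>2 * tail N)"
    proof (rule always_eventually, rule allI)
      fix N
      have "expectation (\<lambda>\<omega>. (g (partial N i \<omega>) - g (U i \<omega>))\<^sup>2) \<le> expectation (\<lambda>\<omega>. L\<^sup>2 * (partial N i \<omega> - U i \<omega>)\<^sup>2)"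
        using int partial_error(1) le by (intro integral_mono) auto
      also have "\<dots> \<le> L\<^sup>2 * (\<sigma>2 * tail N)" using partial_error(2)[of N i] by (simp add: mult_left_mono)
      finally show "expectation (\<lambda>\<omega>. (g (partial N i \<omega>) - g (U i \<omega>))\<^sup>2) \<le> L\<^sup>2 * (\<sigma>2 * tail N)" .
    qed
  qed simp
qed

text \<open>A majorant of the autocovariance up to the noise variance. The absolute values are those
  of the covariance bound for Lipschitz functionals, where signs of the coefficients cannot
  cancel.\<close>

definition "acov k = (\<Sum>l. \<bar>c l\<bar> * \<bar>c (l + k)\<bar>)"

lemma acov_summable: "summable (\<lambda>l. \<bar>c l\<bar> * \<bar>c (l + k)\<bar>)"
proof (rule summable_comparison_test')
  show "summable (\<lambda>l. (c l)\<^sup>2 + (c (l + k))\<^sup>2)"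
    by (intro summable_add c2 summable_ignore_initial_segment[OF c2])
  show "norm (\<bar>c l\<bar> * \<bar>c (l + k)\<bar>) \<le> (c l)\<^sup>2 + (c (l + k))\<^sup>2" for l
    using abs_mult_le_squares[of "c l" "c (l + k)"] by (simp add: abs_mult)
qed

lemma acov_nonneg: "0 \<le> acov k"
  unfolding acov_def by (rule suminf_nonneg[OF acov_summable]) simp

text \<open>Both partial sums are put on one index set by padding the coefficients with zeros. Only
  noise variables in both windows contribute, and for these the two lags differ by j - i.\<close>

lemma partial_covariance:
  assumes g: "\<And>w w'. \<bar>g w - g w'\<bar> \<le> L * \<bar>w - w'\<bar>" and g': "\<And>w w'. \<bar>g' w - g' w'\<bar> \<le> L' * \<bar>w - w'\<bar>" and ij: "i \<le> j"
  shows "\<bar>expectation (\<lambda>\<omega>. g (partial N i \<omega>) * g' (partial N j \<omega>)) - expectation (\<lambda>\<omega>. g (partial N i \<omega>)) * expectation (\<lambda>\<omega>. g' (partial N j \<omega>))\<bar>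
     \<le> 2 * (L * L') * \<sigma>2 * acov (nat (j - i))"
proof -
  let ?I = "(\<lambda>k. i - int k) ` {..<N}" and ?J = "(\<lambda>k. j - int k) ` {..<N}"
  define a where "a l = (if l \<in> ?I then c (nat (i - l)) else 0)" for l
  define b where "b l = (if l \<in> ?J then c (nat (j - l)) else 0)" for l
  have p: "partial N i \<omega> = (\<Sum>l\<in>?I \<union> ?J. a l * \<eta> l \<omega>)" "partial N j \<omega> = (\<Sum>l\<in>?I \<union> ?J. b l * \<eta> l \<omega>)" for \<omega>
  proof -
    have "(\<Sum>l\<in>?I \<union> ?J. a l * \<eta> l \<omega>) = (\<Sum>l\<in>?I. a l * \<eta> l \<omega>)"
      by (rule sum.mono_neutral_right) (auto simp: a_def)
    also have "\<dots> = partial N i \<omega>" unfolding partial_def sum_reindex by (intro sum.cong refl) (simp add: a_def)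
    finally show "partial N i \<omega> = (\<Sum>l\<in>?I \<union> ?J. a l * \<eta> l \<omega>)" ..
    have "(\<Sum>l\<in>?I \<union> ?J. b l * \<eta> l \<omega>) = (\<Sum>l\<in>?J. b l * \<eta> l \<omega>)"
      by (rule sum.mono_neutral_right) (auto simp: b_def)
    also have "\<dots> = partial N j \<omega>" unfolding partial_def sum_reindex by (intro sum.cong refl) (simp add: b_def)
    finally show "partial N j \<omega> = (\<Sum>l\<in>?I \<union> ?J. b l * \<eta> l \<omega>)" ..
  qed
  have "(\<Sum>l\<in>?I \<union> ?J. \<bar>a l * b l\<bar>) = (\<Sum>l\<in>?I. \<bar>a l * b l\<bar>)"
    by (rule sum.mono_neutral_right) (auto simp: a_def)
  also have "\<dots> = (\<Sum>k<N. \<bar>a (i - int k) * b (i - int k)\<bar>)"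
    by (subst sum.reindex) (auto simp: inj_on_def)
  also have "\<dots> \<le> (\<Sum>k<N. \<bar>c k\<bar> * \<bar>c (k + nat (j - i))\<bar>)"
  proof (rule sum_mono)
    fix k assume "k \<in> {..<N}"
    have "\<bar>a (i - int k)\<bar> \<le> \<bar>c k\<bar>" by (simp add: a_def)
    moreover have "\<bar>b (i - int k)\<bar> \<le> \<bar>c (k + nat (j - i))\<bar>"
    proof -
      have "nat (j - (i - int k)) = k + nat (j - i)" using ij by simp
      then show ?thesis by (simp add: b_def)
    qed
    ultimately show "\<bar>a (i - int k) * b (i - int k)\<bar> \<le> \<bar>c k\<bar> * \<bar>c (k + nat (j - i))\<bar>"
      unfolding abs_mult by (intro mult_mono) auto
  qed
  also have "\<dots> \<le> acov (nat (j - i))" unfolding acov_def by (rule sum_le_suminf[OF acov_summable]) auto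
  finally have ab: "(\<Sum>l\<in>?I \<union> ?J. \<bar>a l * b l\<bar>) \<le> acov (nat (j - i))" .
  have LL: "0 \<le> L" "0 \<le> L'" using g[of 1 0] g'[of 1 0] by (auto simp: order_trans[OF abs_ge_zero])
  have "\<bar>expectation (\<lambda>\<omega>. g (partial N i \<omega>) * g' (partial N j \<omega>)) - expectation (\<lambda>\<omega>. g (partial N i \<omega>)) * expectation (\<lambda>\<omega>. g' (partial N j \<omega>))\<bar>
     \<le> 2 * (L * L') * \<sigma>2 * (\<Sum>l\<in>?I \<union> ?J. \<bar>a l * b l\<bar>)"
    unfolding p by (rule covariance_finite[OF _ g g']) auto
  also have "\<dots> \<le> 2 * (L * L') * \<sigma>2 * acov (nat (j - i))"
    using ab LL \<sigma>2_nonneg by (intro mult_left_mono) auto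
  finally show ?thesis .
qed

lemma covariance_ordered:
  fixes g g' :: "real \<Rightarrow> real"
  assumes g: "\<And>w w'. \<bar>g w - g w'\<bar> \<le> L * \<bar>w - w'\<bar>" and g': "\<And>w w'. \<bar>g' w - g' w'\<bar> \<le> L' * \<bar>w - w'\<bar>" and ij: "i \<le> j"
  shows "\<bar>expectation (\<lambda>\<omega>. g (U i \<omega>) * g' (U j \<omega>)) - expectation (\<lambda>\<omega>. g (U i \<omega>)) * expectation (\<lambda>\<omega>. g' (U j \<omega>))\<bar>
     \<le> 2 * (L * L') * \<sigma>2 * acov (nat (j - i))"
proof (rule LIMSEQ_le_const2)
  have [measurable]: "g \<in> borel_measurable borel" "g' \<in> borel_measurable borel"
    by (rule lipschitz_borel_measurable, rule g) (rule lipschitz_borel_measurable, rule g')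
  note G = lipschitz_square_integrable[OF U_measurable U_square g] lipschitz_square_integrable[OF U_measurable U_square g']
  have "(\<lambda>N. expectation (\<lambda>\<omega>. g (partial N i \<omega>) * g' (partial N j \<omega>))) \<longlonglongrightarrow> expectation (\<lambda>\<omega>. g (U i \<omega>) * g' (U j \<omega>))"
    by (rule product_L2_limit) (simp_all add: G lipschitz_partial_error[OF g] lipschitz_partial_error[OF g'])
  moreover have "(\<lambda>N. expectation (\<lambda>\<omega>. g (partial N i \<omega>) * 1)) \<longlonglongrightarrow> expectation (\<lambda>\<omega>. g (U i \<omega>) * 1)"
    by (rule product_L2_limit) (simp_all add: G lipschitz_partial_error[OF g])
  moreover have "(\<lambda>N. expectation (\<lambda>\<omega>. g' (partial N j \<omega>) * 1)) \<longlonglongrightarrow> expectation (\<lambda>\<omega>. g' (U j \<omega>) * 1)"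
    by (rule product_L2_limit) (simp_all add: G lipschitz_partial_error[OF g'])
  ultimately show "(\<lambda>N. \<bar>expectation (\<lambda>\<omega>. g (partial N i \<omega>) * g' (partial N j \<omega>)) - expectation (\<lambda>\<omega>. g (partial N i \<omega>)) * expectation (\<lambda>\<omega>. g' (partial N j \<omega>))\<bar>)
    \<longlonglongrightarrow> \<bar>expectation (\<lambda>\<omega>. g (U i \<omega>) * g' (U j \<omega>)) - expectation (\<lambda>\<omega>. g (U i \<omega>)) * expectation (\<lambda>\<omega>. g' (U j \<omega>))\<bar>"
    unfolding mult_1_right by (intro tendsto_rabs tendsto_diff tendsto_mult)
  show "\<exists>N0. \<forall>N\<ge>N0. \<bar>expectation (\<lambda>\<omega>. g (partial N i \<omega>) * g' (partial N j \<omega>)) - expectation (\<lambda>\<omega>. g (partial N i \<omega>)) * expectation (\<lambda>\<omega>. g' (partial N j \<omega>))\<bar>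
     \<le> 2 * (L * L') * \<sigma>2 * acov (nat (j - i))"
    using partial_covariance[OF g g' ij] by blast
qed

theorem covariance:
  fixes g g' :: "real \<Rightarrow> real"
  assumes g: "\<And>w w'. \<bar>g w - g w'\<bar> \<le> L * \<bar>w - w'\<bar>" and g': "\<And>w w'. \<bar>g' w - g' w'\<bar> \<le> L' * \<bar>w - w'\<bar>"
  shows "\<bar>expectation (\<lambda>\<omega>. g (U i \<omega>) * g' (U j \<omega>)) - expectation (\<lambda>\<omega>. g (U i \<omega>)) * expectation (\<lambda>\<omega>. g' (U j \<omega>))\<bar>
     \<le> 2 * (L * L') * \<sigma>2 * acov (nat \<bar>j - i\<bar>)"
proof (cases "i \<le> j")
  case True
  then show ?thesis using covariance_ordered[OF g g'] by simp
next
  case False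
  then show ?thesis using covariance_ordered[OF g' g, of j i] by (simp add: mult.commute)
qed

end

section \<open>Long memory\<close>

lemma powr_increment:
  fixes \<beta> :: real
  assumes \<beta>: "0 \<le> \<beta>" "\<beta> < 1" and l: "1 \<le> l"
  shows "(1 - \<beta>) * real l powr (- \<beta>) \<le> real l powr (1 - \<beta>) - real (l - 1) powr (1 - \<beta>)"
\<comment> \<open>At l = 1 the left end point is 0, where the power has no derivative to apply; the
  claim is then immediate. Otherwise this is one step of comparing a sum with an integral, and the
  right-hand sides telescope.\<close>
proof (cases "l = 1")
  case True
  then show ?thesis using \<beta> by simp
next
  case False
  then have l2: "0 < real (l - 1)" "real (l - 1) < real l" using l by auto
  have "\<exists>z>real (l - 1). z < real l \<and> real l powr (1 - \<beta>) - real (l - 1) powr (1 - \<beta>) = (real l - real (l - 1)) * ((1 - \<beta>) * z powr (- \<beta>))"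
  proof (rule MVT2[OF l2(2)])
    fix y assume "real (l - 1) \<le> y" "y \<le> real l"
    then have "y > 0" using l2 by linarith
    then show "((\<lambda>y. y powr (1 - \<beta>)) has_real_derivative (1 - \<beta>) * y powr (- \<beta>)) (at y)"
      using has_real_derivative_powr[of y "1 - \<beta>"] by simp
  qed
  then obtain z where z: "real (l - 1) < z" "z < real l" "real l powr (1 - \<beta>) - real (l - 1) powr (1 - \<beta>) = (1 - \<beta>) * z powr (- \<beta>)"
    using l by (auto simp: of_nat_diff)
  have "real l powr (- \<beta>) \<le> z powr (- \<beta>)" using z l2 \<beta> by (intro powr_mono2') auto
  then show ?thesis unfolding z(3) using \<beta> by (intro mult_left_mono) auto
qed

lemma sum_powr_le:
  fixes \<beta> :: real
  assumes "0 \<le> \<beta>" "\<beta> < 1"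
  shows "(\<Sum>l=1..k. real l powr (- \<beta>)) \<le> real k powr (1 - \<beta>) / (1 - \<beta>)"
proof -
  have "(1 - \<beta>) * (\<Sum>l=1..k. real l powr (- \<beta>)) \<le> (\<Sum>l=1..k. real l powr (1 - \<beta>) - real (l - 1) powr (1 - \<beta>))"
    unfolding sum_distrib_left using powr_increment[OF assms] by (intro sum_mono) auto
  also have "\<dots> = real k powr (1 - \<beta>)"
    by (induction k) (use assms in auto)
  finally show ?thesis using assms by (simp add: field_simps)
qed

lemma sum_powr_tail_le:
  fixes \<alpha> :: real
  assumes \<alpha>: "0 < \<alpha>" and k: "1 \<le> k"
  shows "(\<Sum>l=k+1..k+N. real l powr (- 1 - \<alpha>)) \<le> real k powr (- \<alpha>) / \<alpha>"
proof -
  have step: "\<alpha> * real (Suc l) powr (- 1 - \<alpha>) \<le> real l powr (- \<alpha>) - real (Suc l) powr (- \<alpha>)" if l: "1 \<le> l" for l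
  proof -
    have e: "- \<alpha> - 1 = - 1 - \<alpha>" by simp
    have "\<exists>z>real l. z < real (Suc l) \<and> real (Suc l) powr (- \<alpha>) - real l powr (- \<alpha>) = (real (Suc l) - real l) * (- \<alpha> * z powr (- 1 - \<alpha>))"
    proof (rule MVT2)
      fix y assume "real l \<le> y"
      then have "y > 0" using l by linarith
      then show "((\<lambda>y. y powr (- \<alpha>)) has_real_derivative - \<alpha> * y powr (- 1 - \<alpha>)) (at y)"
        using has_real_derivative_powr[of y "- \<alpha>"] unfolding e by simp
    qed simp
    then obtain z where z: "real l < z" "z < real (Suc l)" "real (Suc l) powr (- \<alpha>) - real l powr (- \<alpha>) = - \<alpha> * z powr (- 1 - \<alpha>)"
      by auto
    have "real (Suc l) powr (- 1 - \<alpha>) \<le> z powr (- 1 - \<alpha>)" using z l \<alpha> by (intro powr_mono2') auto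
    then have "\<alpha> * real (Suc l) powr (- 1 - \<alpha>) \<le> \<alpha> * z powr (- 1 - \<alpha>)" using \<alpha> by (intro mult_left_mono) auto
    then show ?thesis using z(3) by simp
  qed
  have "\<alpha> * (\<Sum>l=k+1..k+N. real l powr (- 1 - \<alpha>)) \<le> real k powr (- \<alpha>) - real (k + N) powr (- \<alpha>)"
  proof (induction N)
    case (Suc N)
    then show ?case using step[of "k + N"] k by (simp add: distrib_left)
  qed simp
  also have "\<dots> \<le> real k powr (- \<alpha>)" by simp
  finally show ?thesis using \<alpha> by (simp add: field_simps)
qed

text \<open>Within a row every lag occurs at most twice, once on each side of the diagonal.\<close>

lemma double_sum_le:
  fixes f :: "nat \<Rightarrow> real"
  assumes f: "\<And>k. 0 \<le> f k"
  shows "(\<Sum>i<n. \<Sum>j<n. f (nat \<bar>int j - int i\<bar>)) \<le> 2 * real n * (\<Sum>k<n. f k)"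
proof -
  have row: "(\<Sum>j<n. f (nat \<bar>int j - int i\<bar>)) \<le> 2 * (\<Sum>k<n. f k)" if i: "i < n" for i
  proof -
    have "(\<Sum>j<n. f (nat \<bar>int j - int i\<bar>)) = (\<Sum>j\<in>{..i}. f (nat \<bar>int j - int i\<bar>)) + (\<Sum>j\<in>{i<..<n}. f (nat \<bar>int j - int i\<bar>))"
      using i by (subst sum.union_disjoint[symmetric]) (auto intro!: sum.cong)
    also have "(\<Sum>j\<in>{..i}. f (nat \<bar>int j - int i\<bar>)) = sum f ((\<lambda>j. i - j) ` {..i})"
      by (subst sum.reindex) (auto simp: inj_on_def intro!: sum.cong arg_cong[where f=f])
    also have "\<dots> \<le> sum f {..<n}" using i f by (intro sum_mono2) auto
    also have "(\<Sum>j\<in>{i<..<n}. f (nat \<bar>int j - int i\<bar>)) = sum f ((\<lambda>j. j - i) ` {i<..<n})"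
      by (subst sum.reindex) (auto simp: inj_on_def intro!: sum.cong arg_cong[where f=f])
    also have "\<dots> \<le> sum f {..<n}" using i f by (intro sum_mono2) auto
    finally show ?thesis by simp
  qed
  have "(\<Sum>i<n. \<Sum>j<n. f (nat \<bar>int j - int i\<bar>)) \<le> (\<Sum>i<n. 2 * (\<Sum>k<n. f k))"
    using row by (intro sum_mono) auto
  then show ?thesis by simp
qed

lemma summable_square_powr:
  fixes c :: "nat \<Rightarrow> real"
  assumes \<alpha>: "0 < \<alpha>" and c: "\<And>k. 1 \<le> k \<Longrightarrow> \<bar>c k\<bar> \<le> C * real k powr (- (\<alpha> + 1) / 2)"
  shows "summable (\<lambda>k. (c k)\<^sup>2)"
proof (rule summable_comparison_test_ev)
  show "summable (\<lambda>k. C\<^sup>2 * real k powr (- \<alpha> - 1))"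
    by (rule summable_mult) (use \<alpha> summable_real_powr_iff[of "- \<alpha> - 1"] in simp)
  show "\<forall>\<^sub>F k in sequentially. norm ((c k)\<^sup>2) \<le> C\<^sup>2 * real k powr (- \<alpha> - 1)"
    using eventually_ge_at_top[of 1]
  proof eventually_elim
    case (elim k)
    have "(c k)\<^sup>2 \<le> (C * real k powr (- (\<alpha> + 1) / 2))\<^sup>2" using power_mono[OF c[OF elim], of 2] by simp
    also have "\<dots> = C\<^sup>2 * real k powr (- \<alpha> - 1)"
    proof -
      have "- (\<alpha> + 1) / 2 + - (\<alpha> + 1) / 2 = - \<alpha> - 1" by (simp add: field_simps)
      then show ?thesis unfolding power_mult_distrib power2_eq_square[of "_ powr _"] powr_add[symmetric] by simp
    qed
    finally show ?case by simp
  qed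
qed

context linear_process begin

text \<open>The coefficients decay like l^(-\<beta>) with 2 \<beta> = \<alpha> + 1, and the sum is
  split at l = k. Up to \<open>k\<close> the shifted factor is of size k^(-\<beta>) while the other
  sums to order k^(1-\<beta>). Beyond \<open>k\<close> both factors are bounded by l^(-\<beta>), and
  the tail of l^(-1-\<alpha>) is of order k^(-\<alpha>). The term l = 0 fits in because \<alpha> <=
  \<beta>.\<close>

lemma acov_le:
  assumes \<alpha>: "0 < \<alpha>" "\<alpha> < 1" and c: "\<And>k. 1 \<le> k \<Longrightarrow> \<bar>c k\<bar> \<le> C * real k powr (- (\<alpha> + 1) / 2)" and k: "1 \<le> k"
  shows "acov k \<le> (\<bar>c 0\<bar> * C + C\<^sup>2 / (1 - (\<alpha> + 1) / 2) + C\<^sup>2 / \<alpha>) * real k powr (- \<alpha>)"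
  unfolding acov_def
proof (rule suminf_le_const[OF acov_summable])
  fix N
  define \<beta> where "\<beta> = (\<alpha> + 1) / 2"
  have \<beta>: "0 < \<beta>" "\<beta> < 1" "\<alpha> \<le> \<beta>" "2 * \<beta> = \<alpha> + 1" using \<alpha> by (auto simp: \<beta>_def)
  have C0: "0 \<le> C" using c[of 1] by simp
  have c': "\<bar>c l\<bar> \<le> C * real l powr (- \<beta>)" if "1 \<le> l" for l using c[OF that] by (simp add: \<beta>_def minus_divide_left)
  let ?t = "\<lambda>l. \<bar>c l\<bar> * \<bar>c (l + k)\<bar>"
  have pos: "0 < real k" using k by simp
  have "(\<Sum>l<N. ?t l) \<le> (\<Sum>l\<in>{0} \<union> ({1..k} \<union> {k+1..k+N}). ?t l)"
    by (rule sum_mono2) auto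
  also have "\<dots> = ?t 0 + (\<Sum>l=1..k. ?t l) + (\<Sum>l=k+1..k+N. ?t l)"
    by (subst sum.union_disjoint) (auto simp: sum.union_disjoint)
  also have "\<dots> \<le> \<bar>c 0\<bar> * C * real k powr (- \<alpha>) + C\<^sup>2 / (1 - \<beta>) * real k powr (- \<alpha>) + C\<^sup>2 / \<alpha> * real k powr (- \<alpha>)"
  proof (intro add_mono)
    have "real k powr (- \<beta>) \<le> real k powr (- \<alpha>)" using k \<beta> by (intro powr_mono) auto
    then have "\<bar>c k\<bar> \<le> C * real k powr (- \<alpha>)" using order_trans[OF c'[OF k] mult_left_mono[OF _ C0]] by blast
    then show "?t 0 \<le> \<bar>c 0\<bar> * C * real k powr (- \<alpha>)" by (simp add: mult.assoc mult_left_mono)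
    have "(\<Sum>l=1..k. ?t l) \<le> (\<Sum>l=1..k. C\<^sup>2 * real k powr (- \<beta>) * real l powr (- \<beta>))"
    proof (rule sum_mono)
      fix l assume l: "l \<in> {1..k}"
      have "real (l + k) powr (- \<beta>) \<le> real k powr (- \<beta>)" using pos \<beta> by (intro powr_mono2') auto
      then have "\<bar>c (l + k)\<bar> \<le> C * real k powr (- \<beta>)" using order_trans[OF c'[of "l + k"] mult_left_mono[OF _ C0]] k by simp
      then have "?t l \<le> (C * real l powr (- \<beta>)) * (C * real k powr (- \<beta>))" using c'[of l] l C0 by (intro mult_mono) auto
      then show "?t l \<le> C\<^sup>2 * real k powr (- \<beta>) * real l powr (- \<beta>)" by (simp add: power2_eq_square mult_ac)
    qed
    also have "\<dots> \<le> C\<^sup>2 * real k powr (- \<beta>) * (real k powr (1 - \<beta>) / (1 - \<beta>))"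
      unfolding sum_distrib_left[symmetric] using sum_powr_le[of \<beta> k] \<beta> by (intro mult_left_mono) auto
    also have "\<dots> = C\<^sup>2 / (1 - \<beta>) * (real k powr (- \<beta>) * real k powr (1 - \<beta>))" by simp
    also have "real k powr (- \<beta>) * real k powr (1 - \<beta>) = real k powr (- \<alpha>)"
      unfolding powr_add[symmetric] using \<beta>(4) by (intro arg_cong[where f="\<lambda>e. real k powr e"]) linarith
    finally show "(\<Sum>l=1..k. ?t l) \<le> C\<^sup>2 / (1 - \<beta>) * real k powr (- \<alpha>)" .
    have "(\<Sum>l=k+1..k+N. ?t l) \<le> (\<Sum>l=k+1..k+N. C\<^sup>2 * real l powr (- 1 - \<alpha>))"
    proof (rule sum_mono)
      fix l assume l: "l \<in> {k+1..k+N}"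
      have "real (l + k) powr (- \<beta>) \<le> real l powr (- \<beta>)" using l \<beta> by (intro powr_mono2') auto
      then have "\<bar>c (l + k)\<bar> \<le> C * real l powr (- \<beta>)" using order_trans[OF c'[of "l + k"] mult_left_mono[OF _ C0]] k by simp
      then have "?t l \<le> (C * real l powr (- \<beta>)) * (C * real l powr (- \<beta>))" using c'[of l] l C0 by (intro mult_mono) auto
      also have "\<dots> = C\<^sup>2 * (real l powr (- \<beta>) * real l powr (- \<beta>))" by (simp add: power2_eq_square mult_ac)
      also have "real l powr (- \<beta>) * real l powr (- \<beta>) = real l powr (- 1 - \<alpha>)"
        unfolding powr_add[symmetric] using \<beta>(4) by (intro arg_cong[where f="\<lambda>e. real l powr e"]) linarith
      finally show "?t l \<le> C\<^sup>2 * real l powr (- 1 - \<alpha>)" .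
    qed
    also have "\<dots> \<le> C\<^sup>2 * (real k powr (- \<alpha>) / \<alpha>)"
      unfolding sum_distrib_left[symmetric] using sum_powr_tail_le[OF \<alpha>(1) k, of N] by (intro mult_left_mono) auto
    finally show "(\<Sum>l=k+1..k+N. ?t l) \<le> C\<^sup>2 / \<alpha> * real k powr (- \<alpha>)" by simp
  qed
  also have "\<dots> = (\<bar>c 0\<bar> * C + C\<^sup>2 / (1 - (\<alpha> + 1) / 2) + C\<^sup>2 / \<alpha>) * real k powr (- \<alpha>)"
    unfolding \<beta>_def[symmetric] by (simp only: distrib_right)
  finally show "(\<Sum>l<N. ?t l) \<le> (\<bar>c 0\<bar> * C + C\<^sup>2 / (1 - (\<alpha> + 1) / 2) + C\<^sup>2 / \<alpha>) * real k powr (- \<alpha>)" .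
qed

text \<open>The lags of one row add up to order n^(1-\<alpha>) and there are n rows; lag 0 is
  absorbed because n^(1-\<alpha>) is at least 1.\<close>

lemma acov_double_sum_le:
  assumes \<alpha>: "0 < \<alpha>" "\<alpha> < 1" and c: "\<And>k. 1 \<le> k \<Longrightarrow> \<bar>c k\<bar> \<le> C * real k powr (- (\<alpha> + 1) / 2)"
  obtains D where "0 \<le> D" "\<And>n. (\<Sum>i<n. \<Sum>j<n. acov (nat \<bar>int j - int i\<bar>)) \<le> D * real n powr (2 - \<alpha>)"
proof -
  define B where "B = \<bar>c 0\<bar> * C + C\<^sup>2 / (1 - (\<alpha> + 1) / 2) + C\<^sup>2 / \<alpha>"
  have C0: "0 \<le> C" using c[of 1] by simp
  have B: "0 \<le> B" unfolding B_def using C0 \<alpha> by (intro add_nonneg_nonneg mult_nonneg_nonneg divide_nonneg_nonneg) auto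
  define D where "D = 2 * (acov 0 + B / (1 - \<alpha>))"
  have D: "0 \<le> D" unfolding D_def using B \<alpha> acov_nonneg by simp
  have "(\<Sum>i<n. \<Sum>j<n. acov (nat \<bar>int j - int i\<bar>)) \<le> D * real n powr (2 - \<alpha>)" for n
  proof (cases "n = 0")
    case False
    then have n: "1 \<le> n" by simp
    have "(\<Sum>k<n. acov k) \<le> acov 0 + (\<Sum>k=1..n. acov k)"
    proof -
      have "(\<Sum>k<n. acov k) \<le> (\<Sum>k\<in>{0} \<union> {1..n}. acov k)" by (rule sum_mono2) (auto simp: acov_nonneg)
      then show ?thesis by (simp add: sum.union_disjoint)
    qed
    also have "(\<Sum>k=1..n. acov k) \<le> (\<Sum>k=1..n. B * real k powr (- \<alpha>))"
      using acov_le[OF \<alpha> c] unfolding B_def by (intro sum_mono) auto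
    also have "\<dots> \<le> B * (real n powr (1 - \<alpha>) / (1 - \<alpha>))"
      unfolding sum_distrib_left[symmetric] using sum_powr_le[of \<alpha> n] \<alpha> B by (intro mult_left_mono) auto
    also have "acov 0 \<le> acov 0 * real n powr (1 - \<alpha>)"
      using mult_left_mono[OF ge_one_powr_ge_zero[of "real n" "1 - \<alpha>"], of "acov 0"] n \<alpha> acov_nonneg by simp
    finally have "(\<Sum>k<n. acov k) \<le> (acov 0 + B / (1 - \<alpha>)) * real n powr (1 - \<alpha>)" by (simp add: distrib_right)
    then have "2 * real n * (\<Sum>k<n. acov k) \<le> 2 * real n * ((acov 0 + B / (1 - \<alpha>)) * real n powr (1 - \<alpha>))"
      by (intro mult_left_mono) auto
    also have "\<dots> = D * (real n powr 1 * real n powr (1 - \<alpha>))" using n by (simp add: D_def)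
    also have "real n powr 1 * real n powr (1 - \<alpha>) = real n powr (2 - \<alpha>)" unfolding powr_add[symmetric] by simp
    finally show ?thesis using order_trans[OF double_sum_le[of acov n]] acov_nonneg by blast
  qed simp
  with D that show thesis by blast
qed

text \<open>For an asymptotic constant 0: equivalence to 0 forces the coefficients to vanish
  eventually, and the process is a finite moving average.\<close>

lemma acov_double_sum_le_finite:
  assumes c: "\<And>k. k \<ge> k0 \<Longrightarrow> c k = 0"
  shows "(\<Sum>i<n. \<Sum>j<n. acov (nat \<bar>int j - int i\<bar>)) \<le> 2 * real n * (\<Sum>k<k0. acov k)"
proof -
  have z: "acov k = 0" if "k \<ge> k0" for k unfolding acov_def using that c by simp
  have "(\<Sum>k<n. acov k) \<le> (\<Sum>k<k0. acov k)"
  proof -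
    have "(\<Sum>k<n. acov k) \<le> (\<Sum>k\<in>{..<n} \<union> {..<k0}. acov k)" by (rule sum_mono2) (auto simp: acov_nonneg)
    also have "\<dots> = (\<Sum>k<k0. acov k)" by (rule sum.mono_neutral_right) (auto simp: z)
    finally show ?thesis .
  qed
  then have "2 * real n * (\<Sum>k<n. acov k) \<le> 2 * real n * (\<Sum>k<k0. acov k)" by (intro mult_left_mono) auto
  then show ?thesis using order_trans[OF double_sum_le[of acov n]] acov_nonneg by blast
qed

section \<open>From a negligible error sum to the bandwidth\<close>

lemma char_decay:
  assumes \<sigma>: "0 < \<sigma>2" and i3: "integrable M (\<lambda>\<omega>. \<bar>\<eta> 0 \<omega>\<bar> ^ 3)"
  obtains u0 where "0 < u0" "\<And>u. \<bar>u\<bar> \<le> u0 \<Longrightarrow> norm (char (distr M borel (\<eta> 0)) u) \<le> exp (- (\<sigma>2 * u\<^sup>2 / 4))"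
proof -
  define R where "R = expectation (\<lambda>\<omega>. \<bar>\<eta> 0 \<omega>\<bar> ^ 3)"
  have R: "0 \<le> R" unfolding R_def by simp
  \<comment> \<open>The bounds 1 and 1 / \<sigma>2 give u^2 \<sigma>2 <= 1, so the quadratic
    approximation is positive and equals its modulus. The bound \<sigma>2 / (R + 1) makes the cubic
    error at most u^2 \<sigma>2 / 6. What is left, 1/2 - 1/6, exceeds the claimed 1/4.\<close>
  define u0 where "u0 = min 1 (min (1 / \<sigma>2) (\<sigma>2 / (R + 1)))"
  have u0: "0 < u0" unfolding u0_def using \<sigma> R by simp
  have "norm (char (distr M borel (\<eta> 0)) u) \<le> exp (- (\<sigma>2 * u\<^sup>2 / 4))" if u: "\<bar>u\<bar> \<le> u0" for u
  proof -
    have v: "variance (\<eta> 0) = \<sigma>2" by (simp add: \<sigma>2_def \<eta>0_mean)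
    have "norm (char (distr M borel (\<eta> 0)) u - (1 - u\<^sup>2 * \<sigma>2 / 2)) \<le> (u\<^sup>2 / 6) * expectation (\<lambda>\<omega>. min (6 * (\<eta> 0 \<omega>)\<^sup>2) (\<bar>u\<bar> * \<bar>\<eta> 0 \<omega>\<bar> ^ 3))"
      by (rule char_approx3'[OF _ \<eta>_integrable \<eta>0_square \<eta>0_mean v refl]) simp
    also have "\<dots> \<le> (u\<^sup>2 / 6) * (\<bar>u\<bar> * R)"
    proof (intro mult_left_mono)
      have "expectation (\<lambda>\<omega>. min (6 * (\<eta> 0 \<omega>)\<^sup>2) (\<bar>u\<bar> * \<bar>\<eta> 0 \<omega>\<bar> ^ 3)) \<le> expectation (\<lambda>\<omega>. \<bar>u\<bar> * \<bar>\<eta> 0 \<omega>\<bar> ^ 3)"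
        by (rule integral_mono') (use i3 in auto)
      then show "expectation (\<lambda>\<omega>. min (6 * (\<eta> 0 \<omega>)\<^sup>2) (\<bar>u\<bar> * \<bar>\<eta> 0 \<omega>\<bar> ^ 3)) \<le> \<bar>u\<bar> * R" by (simp add: R_def)
    qed simp
    also have "\<dots> \<le> (u\<^sup>2 / 6) * \<sigma>2"
    proof (intro mult_left_mono)
      have "\<bar>u\<bar> * (R + 1) \<le> \<sigma>2" using u R unfolding u0_def by (simp add: field_simps)
      then show "\<bar>u\<bar> * R \<le> \<sigma>2" by (simp add: algebra_simps)
    qed simp
    finally have 1: "norm (char (distr M borel (\<eta> 0)) u - complex_of_real (1 - u\<^sup>2 * \<sigma>2 / 2)) \<le> u\<^sup>2 * \<sigma>2 / 6" by simp
    have "u\<^sup>2 * \<sigma>2 \<le> 1"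
    proof -
      have "u\<^sup>2 \<le> \<bar>u\<bar>" using u unfolding u0_def power2_eq_square by (metis abs_ge_zero abs_mult_self_eq min.boundedE mult_left_le)
      also have "\<dots> \<le> 1 / \<sigma>2" using u by (simp add: u0_def)
      finally show ?thesis using \<sigma> by (simp add: field_simps)
    qed
    then have "norm (complex_of_real (1 - u\<^sup>2 * \<sigma>2 / 2)) = 1 - u\<^sup>2 * \<sigma>2 / 2" unfolding norm_of_real by simp
    then have "norm (char (distr M borel (\<eta> 0)) u) \<le> 1 - u\<^sup>2 * \<sigma>2 / 2 + u\<^sup>2 * \<sigma>2 / 6"
      using 1 norm_triangle_sub[of "char (distr M borel (\<eta> 0)) u" "complex_of_real (1 - u\<^sup>2 * \<sigma>2 / 2)"] by linarith
    also have "\<dots> \<le> 1 + (- (\<sigma>2 * u\<^sup>2 / 4))" using \<sigma> by (simp add: field_simps)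
    also have "\<dots> \<le> exp (- (\<sigma>2 * u\<^sup>2 / 4))" by (rule exp_ge_add_one_self)
    finally show ?thesis .
  qed
  with u0 that show thesis by blast
qed

text \<open>Every factor of the product of characteristic functions has modulus at most 1, so decay
  has to be known only on a convenient block \<open>I\<close> of noise variables.\<close>

lemma norm_char_linear:
  assumes J: "finite J" and I: "I \<subseteq> J" and d: "\<And>j. j \<in> I \<Longrightarrow> norm (char (distr M borel (\<eta> 0)) (\<theta> * b j)) \<le> exp (- d j)"
  shows "norm (\<integral>\<omega>. iexp (\<theta> * (\<Sum>j\<in>J. b j * \<eta> j \<omega>)) \<partial>M) \<le> exp (- (\<Sum>j\<in>I. d j))"
proof -
  interpret D: real_distribution "distr M borel (\<eta> 0)" by (rule real_distribution_distr) simp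
  have fI: "finite I" using J I by (rule finite_subset[rotated])
  have ind: "indep_vars (\<lambda>_. borel) (\<lambda>j \<omega>. b j * \<eta> j \<omega>) J"
    using indep_vars_compose2[OF indep_vars_subset[OF indep, of J], of "\<lambda>j y. b j * y" "\<lambda>_. borel"] by simp
  have ch: "char (distr M borel (\<lambda>\<omega>. b j * \<eta> j \<omega>)) \<theta> = char (distr M borel (\<eta> 0)) (\<theta> * b j)" for j
  proof -
    have "char (distr M borel (\<lambda>\<omega>. b j * \<eta> j \<omega>)) \<theta> = (\<integral>\<omega>. iexp (\<theta> * (b j * \<eta> j \<omega>)) \<partial>M)"
      unfolding char_def by (subst integral_distr) auto
    also have "\<dots> = char (distr M borel (\<eta> j)) (\<theta> * b j)"
      unfolding char_def by (subst integral_distr) (auto simp: mult.assoc)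
    finally show ?thesis using identical[of j 0] by simp
  qed
  have "(\<integral>\<omega>. iexp (\<theta> * (\<Sum>j\<in>J. b j * \<eta> j \<omega>)) \<partial>M) = char (distr M borel (\<lambda>\<omega>. \<Sum>j\<in>J. b j * \<eta> j \<omega>)) \<theta>"
    unfolding char_def by (subst integral_distr) auto
  also have "\<dots> = (\<Prod>j\<in>J. char (distr M borel (\<eta> 0)) (\<theta> * b j))"
    unfolding char_distr_sum[OF ind] ch ..
  finally have "norm (\<integral>\<omega>. iexp (\<theta> * (\<Sum>j\<in>J. b j * \<eta> j \<omega>)) \<partial>M) = (\<Prod>j\<in>J. norm (char (distr M borel (\<eta> 0)) (\<theta> * b j)))"
    by (simp add: prod_norm)
  also have "\<dots> = (\<Prod>j\<in>J - I. norm (char (distr M borel (\<eta> 0)) (\<theta> * b j))) * (\<Prod>j\<in>I. norm (char (distr M borel (\<eta> 0)) (\<theta> * b j)))"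
    by (rule prod.subset_diff[OF I J])
  also have "\<dots> \<le> 1 * (\<Prod>j\<in>I. exp (- d j))"
    using d D.cmod_char_le_1 by (intro mult_mono prod_le_1 prod_mono) (auto intro!: prod_nonneg)
  also have "\<dots> = exp (- (\<Sum>j\<in>I. d j))" using fI by (simp add: exp_sum sum_negf[symmetric])
  finally show ?thesis .
qed

text \<open>The weight of noise variable \<open>j\<close> in the sum of n truncated processes; the
  condition keeps the lag inside the truncation window.\<close>

definition "coef n N j = (\<Sum>i<n. if j \<le> int i + 1 \<and> int i + 1 - j < int N then c (nat (int i + 1 - j)) else 0)"

lemma sum_partial: "(\<Sum>i<n. partial N (int i + 1) \<omega>) = (\<Sum>j\<in>{- int N..int n}. coef n N j * \<eta> j \<omega>)"
proof -
  have "partial N (int i + 1) \<omega> = (\<Sum>j\<in>{- int N..int n}. (if j \<le> int i + 1 \<and> int i + 1 - j < int N then c (nat (int i + 1 - j)) else 0) * \<eta> j \<omega>)" if "i < n" for i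
  proof -
    have "(\<Sum>j\<in>{- int N..int n}. (if j \<le> int i + 1 \<and> int i + 1 - j < int N then c (nat (int i + 1 - j)) else 0) * \<eta> j \<omega>)
       = (\<Sum>j\<in>(\<lambda>k. int i + 1 - int k) ` {..<N}. (if j \<le> int i + 1 \<and> int i + 1 - j < int N then c (nat (int i + 1 - j)) else 0) * \<eta> j \<omega>)"
    proof (rule sum.mono_neutral_right)
      show "(\<lambda>k. int i + 1 - int k) ` {..<N} \<subseteq> {- int N..int n}" using that by auto
      show "\<forall>j\<in>{- int N..int n} - (\<lambda>k. int i + 1 - int k) ` {..<N}. (if j \<le> int i + 1 \<and> int i + 1 - j < int N then c (nat (int i + 1 - j)) else 0) * \<eta> j \<omega> = 0"
      proof
        fix j assume j: "j \<in> {- int N..int n} - (\<lambda>k. int i + 1 - int k) ` {..<N}"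
        have nj: "\<not> (j \<le> int i + 1 \<and> int i + 1 - j < int N)"
        proof
          assume a: "j \<le> int i + 1 \<and> int i + 1 - j < int N"
          then have "j = int i + 1 - int (nat (int i + 1 - j))" "nat (int i + 1 - j) \<in> {..<N}" by auto
          then show False using j by blast
        qed
        show "(if j \<le> int i + 1 \<and> int i + 1 - j < int N then c (nat (int i + 1 - j)) else 0) * \<eta> j \<omega> = 0"
          unfolding if_not_P[OF nj] by simp
      qed
    qed simp
    also have "\<dots> = partial N (int i + 1) \<omega>"
      unfolding partial_def sum_reindex by (intro sum.cong refl) auto
    finally show ?thesis ..
  qed
  then have "(\<Sum>i<n. partial N (int i + 1) \<omega>) = (\<Sum>i<n. \<Sum>j\<in>{- int N..int n}. (if j \<le> int i + 1 \<and> int i + 1 - j < int N then c (nat (int i + 1 - j)) else 0) * \<eta> j \<omega>)"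
    by (intro sum.cong) auto
  also have "\<dots> = (\<Sum>j\<in>{- int N..int n}. coef n N j * \<eta> j \<omega>)"
    unfolding coef_def sum_distrib_right by (rule sum.swap)
  finally show ?thesis .
qed

text \<open>The chosen block of noise times has n members, and their lags to the times 1, ..., n lie
  between n and 3n, where the asymptotic form of the coefficients is effective. Truncation beyond 3n
  leaves their weights complete.\<close>

lemma norm_char_sum:
  assumes d: "\<And>j. j \<in> {- 2 * int n..< - int n} \<Longrightarrow> norm (char (distr M borel (\<eta> 0)) (\<theta> * (\<Sum>i<n. c (nat (int i + 1 - j))))) \<le> exp (- d)"
  shows "norm (\<integral>\<omega>. iexp (\<theta> * (\<Sum>i<n. U (int i + 1) \<omega>)) \<partial>M) \<le> exp (- (real n * d))"
proof (rule LIMSEQ_le_const2)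
  have "(\<lambda>N. \<integral>\<omega>. iexp (\<theta> * (\<Sum>i<n. partial N (int i + 1) \<omega>)) \<partial>M) \<longlonglongrightarrow> (\<integral>\<omega>. iexp (\<theta> * (\<Sum>i<n. U (int i + 1) \<omega>)) \<partial>M)"
  proof (rule integral_dominated_convergence[where w="\<lambda>_. 1"])
    have "AE \<omega> in M. \<forall>i\<in>{..<n}. (\<lambda>k. c k * \<eta> ((int i + 1) - int k) \<omega>) sums U (int i + 1) \<omega>"
      by (rule AE_finite_allI) (auto intro: U_sums)
    then show "AE \<omega> in M. (\<lambda>N. iexp (\<theta> * (\<Sum>i<n. partial N (int i + 1) \<omega>))) \<longlonglongrightarrow> iexp (\<theta> * (\<Sum>i<n. U (int i + 1) \<omega>))"
    proof eventually_elim
      case (elim \<omega>)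
      then have "(\<lambda>N. \<Sum>i<n. partial N (int i + 1) \<omega>) \<longlonglongrightarrow> (\<Sum>i<n. U (int i + 1) \<omega>)"
        by (intro tendsto_sum) (auto simp: sums_def partial_def)
      then show ?case by (intro tendsto_exp tendsto_mult tendsto_const tendsto_of_real)
    qed
  qed auto
  then show "(\<lambda>N. norm (\<integral>\<omega>. iexp (\<theta> * (\<Sum>i<n. partial N (int i + 1) \<omega>)) \<partial>M)) \<longlonglongrightarrow> norm (\<integral>\<omega>. iexp (\<theta> * (\<Sum>i<n. U (int i + 1) \<omega>)) \<partial>M)"
    by (rule tendsto_norm)
  show "\<exists>N0. \<forall>N\<ge>N0. norm (\<integral>\<omega>. iexp (\<theta> * (\<Sum>i<n. partial N (int i + 1) \<omega>)) \<partial>M) \<le> exp (- (real n * d))"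
  proof (intro exI[of _ "3 * n + 1"] allI impI)
    fix N assume N: "3 * n + 1 \<le> N"
    let ?I = "{- 2 * int n..< - int n}"
    have co: "coef n N j = (\<Sum>i<n. c (nat (int i + 1 - j)))" if "j \<in> ?I" for j
      unfolding coef_def using that N by (intro sum.cong) auto
    have "norm (\<integral>\<omega>. iexp (\<theta> * (\<Sum>i<n. partial N (int i + 1) \<omega>)) \<partial>M) \<le> exp (- (\<Sum>j\<in>?I. d))"
      unfolding sum_partial
    proof (rule norm_char_linear)
      show "?I \<subseteq> {- int N..int n}" using N by auto
      show "norm (char (distr M borel (\<eta> 0)) (\<theta> * coef n N j)) \<le> exp (- d)" if "j \<in> ?I" for j
        unfolding co[OF that] by (rule d[OF that])
    qed simp
    then show "norm (\<integral>\<omega>. iexp (\<theta> * (\<Sum>i<n. partial N (int i + 1) \<omega>)) \<partial>M) \<le> exp (- (real n * d))" by simp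
  qed
qed

text \<open>Far in the past the coefficients of \<open>\<Sum>i<n. U i\<close> in the noise variables are comparable to
  \<open>n powr (1 - (\<alpha> + 1) / 2)\<close>, so the characteristic function of the normalized sum decays like a
  Gaussian one with variance of the order of \<open>h n * n powr (1 - \<alpha>)\<close>, while it tends to \<open>1\<close>.\<close>

theorem bandwidth_from_negligible_sum:
  fixes h :: "nat \<Rightarrow> real"
  assumes \<alpha>: "0 < \<alpha>" and \<sigma>: "0 < \<sigma>2" and i3: "integrable M (\<lambda>\<omega>. \<bar>\<eta> 0 \<omega>\<bar> ^ 3)"
    and c: "c \<sim>[sequentially] (\<lambda>k. C * real k powr (- (\<alpha> + 1) / 2))" and C: "C \<noteq> 0"
    and h0: "h \<longlonglongrightarrow> 0" and hpos: "\<forall>\<^sub>F n in sequentially. h n > 0"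
    and small: "small_oP M (\<lambda>n \<omega>. sqrt (real n * h n) / real n * (\<Sum>i<n. U (int i + 1) \<omega>))"
  shows "(\<lambda>n. h n * real n powr (1 - \<alpha>)) \<longlonglongrightarrow> 0"
proof -
  define \<beta> where "\<beta> = (\<alpha> + 1) / 2"
  have \<beta>: "1/2 < \<beta>" "2 * \<beta> = \<alpha> + 1" using \<alpha> by (auto simp: \<beta>_def)
  have c': "c \<sim>[sequentially] (\<lambda>k. C * real k powr (- \<beta>))" using c by (simp add: \<beta>_def minus_divide_left)
  obtain u0 where u0: "0 < u0" and dec: "\<And>u. \<bar>u\<bar> \<le> u0 \<Longrightarrow> norm (char (distr M borel (\<eta> 0)) u) \<le> exp (- (\<sigma>2 * u\<^sup>2 / 4))"
    using char_decay[OF \<sigma> i3] by blast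
  \<comment> \<open>Asymptotic equivalence counts 0/0 as 1; for k >= 1 and nonzero \<open>C\<close>
    this case does not arise.\<close>
  have L: "((\<lambda>k. if c k = 0 \<and> C * real k powr (- \<beta>) = 0 then 1 else c k / (C * real k powr (- \<beta>))) \<longlongrightarrow> 1) sequentially"
    using c' by (rule asymp_equivD)
  have "\<forall>\<^sub>F k in sequentially. 1/2 < (if c k = 0 \<and> C * real k powr (- \<beta>) = 0 then 1 else c k / (C * real k powr (- \<beta>)))
     \<and> (if c k = 0 \<and> C * real k powr (- \<beta>) = 0 then 1 else c k / (C * real k powr (- \<beta>))) < 2"
    by (intro eventually_conj order_tendstoD(1)[OF L] order_tendstoD(2)[OF L]) simp_all
  \<comment> \<open>Division by \<open>C\<close> makes the coefficients eventually positive, so sums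
    over a range of large lags cannot cancel.\<close>
  then have "\<forall>\<^sub>F k in sequentially. 1 \<le> k \<and> real k powr (- \<beta>) / 2 \<le> c k / C \<and> c k / C \<le> 2 * real k powr (- \<beta>)"
    using eventually_ge_at_top[of 1]
  proof eventually_elim
    case (elim k)
    then have p: "0 < real k powr (- \<beta>)" by simp
    then have "1/2 < c k / (C * real k powr (- \<beta>))" "c k / (C * real k powr (- \<beta>)) < 2" using elim C by auto
    then have "1/2 < (c k / C) / real k powr (- \<beta>)" "(c k / C) / real k powr (- \<beta>) < 2"
      unfolding divide_divide_eq_left .
    then have "1/2 * real k powr (- \<beta>) < c k / C" "c k / C < 2 * real k powr (- \<beta>)"
      by (simp_all only: pos_less_divide_eq[OF p] pos_divide_less_eq[OF p])
    then show ?case using elim(2) by linarith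
  qed
  then obtain k0 where k0: "\<And>k. k \<ge> k0 \<Longrightarrow> 1 \<le> k \<and> real k powr (- \<beta>) / 2 \<le> c k / C \<and> c k / C \<le> 2 * real k powr (- \<beta>)"
    unfolding eventually_sequentially by blast
  let ?S = "\<lambda>n \<omega>. \<Sum>i<n. U (int i + 1) \<omega>" and ?\<theta> = "\<lambda>n. sqrt (real n * h n) / real n"
  \<comment> \<open>A negligible sum has the same limit as the constant 0, whose characteristic
    function is 1.\<close>
  have "(\<lambda>n. \<integral>\<omega>. iexp (1 * (?\<theta> n * ?S n \<omega>)) \<partial>M) \<longlonglongrightarrow> 1"
  proof (rule small_oP_char[where A="\<lambda>_ _. 0"])
    show "small_oP M (\<lambda>n \<omega>. ?\<theta> n * ?S n \<omega> - 0)" using small by simp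
  qed (auto simp: prob_space)
  then have lim: "(\<lambda>n. norm (\<integral>\<omega>. iexp (?\<theta> n * ?S n \<omega>) \<partial>M)) \<longlonglongrightarrow> 1"
    using tendsto_norm by fastforce
  then have lnlim: "(\<lambda>n. - ln (norm (\<integral>\<omega>. iexp (?\<theta> n * ?S n \<omega>) \<partial>M))) \<longlonglongrightarrow> 0"
    using tendsto_minus[OF tendsto_ln[OF lim]] by simp
  \<comment> \<open>\<sigma>2 / 4 comes from \<open>char_decay\<close>; the other factor is the
    square of |C| (3n)^(-\<beta>) / 2, the lower bound for a coefficient, with its power of n
    removed.\<close>
  define Q where "Q = \<sigma>2 / 4 * (C\<^sup>2 / 4 * 3 powr (- (2 * \<beta>)))"
  have Q: "0 < Q" unfolding Q_def using \<sigma> C by simp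
  \<comment> \<open>The arguments of the characteristic functions are at most 2 |C| sqrt (h n),
    because n^(1-\<beta>) <= sqrt n, and must stay in the range of
    \<open>char_decay\<close>.\<close>
  have "(\<lambda>n. 2 * \<bar>C\<bar> * sqrt (h n)) \<longlonglongrightarrow> 0" using tendsto_mult_right_zero[OF tendsto_real_sqrt[OF h0, simplified]] .
  from order_tendstoD(2)[OF this u0]
  have evu: "\<forall>\<^sub>F n in sequentially. 2 * \<bar>C\<bar> * sqrt (h n) < u0" .
  have evn: "\<forall>\<^sub>F n in sequentially. 0 < norm (\<integral>\<omega>. iexp (?\<theta> n * ?S n \<omega>) \<partial>M)"
    using order_tendstoD(1)[OF lim, of 0] by simp
  have le: "\<forall>\<^sub>F n in sequentially. Q * (h n * real n powr (1 - \<alpha>)) \<le> - ln (norm (\<integral>\<omega>. iexp (?\<theta> n * ?S n \<omega>) \<partial>M))"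
    using evu evn hpos eventually_ge_at_top[of "max 1 k0"]
  proof eventually_elim
    case (elim n)
    then have n: "1 \<le> n" "k0 \<le> n" "0 < real n" by auto
    define d where "d = \<sigma>2 * (?\<theta> n)\<^sup>2 * (\<bar>C\<bar> * (real n * ((3 * real n) powr (- \<beta>) / 2)))\<^sup>2 / 4"
    have "norm (char (distr M borel (\<eta> 0)) (?\<theta> n * (\<Sum>i<n. c (nat (int i + 1 - j))))) \<le> exp (- d)" if j: "j \<in> {- 2 * int n..< - int n}" for j
    proof -
      let ?b = "\<Sum>i<n. c (nat (int i + 1 - j)) / C"
      have bnd: "(3 * real n) powr (- \<beta>) / 2 \<le> c (nat (int i + 1 - j)) / C" "c (nat (int i + 1 - j)) / C \<le> 2 * real n powr (- \<beta>)" if "i < n" for i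
      proof -
        let ?k = "nat (int i + 1 - j)"
        have k: "k0 \<le> ?k" "real n \<le> real ?k" "real ?k \<le> 3 * real n" using j that n by auto
        have "(3 * real n) powr (- \<beta>) \<le> real ?k powr (- \<beta>)" using k n \<beta> by (intro powr_mono2') auto
        moreover have "real ?k powr (- \<beta>) \<le> real n powr (- \<beta>)" using k n \<beta> by (intro powr_mono2') auto
        ultimately show "(3 * real n) powr (- \<beta>) / 2 \<le> c ?k / C" "c ?k / C \<le> 2 * real n powr (- \<beta>)"
          using k0[OF k(1)] by auto
      qed
      have b1: "real n * ((3 * real n) powr (- \<beta>) / 2) \<le> ?b"
        using sum_mono[of "{..<n}" "\<lambda>_. (3 * real n) powr (- \<beta>) / 2", OF bnd(1)] by simp
      have b2: "?b \<le> real n * (2 * real n powr (- \<beta>))"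
        using sum_mono[of "{..<n}" _ "\<lambda>_. 2 * real n powr (- \<beta>)", OF bnd(2)] by simp
      have b0: "0 \<le> ?b" using order_trans[OF _ b1] by simp
      have sum: "(\<Sum>i<n. c (nat (int i + 1 - j))) = C * ?b" using C by (simp add: sum_distrib_left)
      have th: "?\<theta> n * (real n * real n powr (- \<beta>)) \<le> sqrt (h n)"
      proof -
        have "real n * real n powr (- \<beta>) = real n powr (1 - \<beta>)" using n powr_add[of "real n" 1 "- \<beta>"] by simp
        also have "\<dots> \<le> real n powr (1/2)" using n \<beta> by (intro powr_mono) auto
        also have "\<dots> = sqrt (real n)" using n by (simp add: powr_half_sqrt)
        finally have "?\<theta> n * (real n * real n powr (- \<beta>)) \<le> ?\<theta> n * sqrt (real n)" using elim by (intro mult_left_mono) auto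
        also have "\<dots> = sqrt (h n) * (sqrt (real n) * sqrt (real n)) / real n" by (simp only: real_sqrt_mult times_divide_eq_left times_divide_eq_right mult_ac)
        also have "\<dots> = sqrt (h n)" using n by simp
        finally show ?thesis .
      qed
      have "\<bar>?\<theta> n * (C * ?b)\<bar> = \<bar>C\<bar> * (?\<theta> n * ?b)" using b0 elim by (simp add: abs_mult)
      also have "\<dots> \<le> \<bar>C\<bar> * (?\<theta> n * (real n * (2 * real n powr (- \<beta>))))" using b2 elim by (intro mult_left_mono) auto
      also have "\<dots> = 2 * \<bar>C\<bar> * (?\<theta> n * (real n * real n powr (- \<beta>)))" by simp
      also have "\<dots> \<le> 2 * \<bar>C\<bar> * sqrt (h n)" using th by (intro mult_left_mono) auto
      finally have u: "\<bar>?\<theta> n * (C * ?b)\<bar> \<le> u0" using elim by linarith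
      have "(\<bar>C\<bar> * (real n * ((3 * real n) powr (- \<beta>) / 2)))\<^sup>2 \<le> (\<bar>C\<bar> * ?b)\<^sup>2"
        using b1 by (intro power_mono mult_left_mono) auto
      also have "(\<bar>C\<bar> * ?b)\<^sup>2 = (C * ?b)\<^sup>2" by (simp add: power_mult_distrib)
      finally have "d \<le> \<sigma>2 * (?\<theta> n)\<^sup>2 * (C * ?b)\<^sup>2 / 4"
        unfolding d_def using \<sigma>2_nonneg by (intro divide_right_mono mult_left_mono) auto
      also have "\<dots> = \<sigma>2 * (?\<theta> n * (C * ?b))\<^sup>2 / 4" by (simp only: power_mult_distrib mult.assoc)
      finally have "exp (- (\<sigma>2 * (?\<theta> n * (C * ?b))\<^sup>2 / 4)) \<le> exp (- d)" by simp
      then show ?thesis unfolding sum using dec[OF u] by linarith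
    qed
    from norm_char_sum[OF this]
    have "norm (\<integral>\<omega>. iexp (?\<theta> n * ?S n \<omega>) \<partial>M) \<le> exp (- (real n * d))" .
    then have "ln (norm (\<integral>\<omega>. iexp (?\<theta> n * ?S n \<omega>) \<partial>M)) \<le> - (real n * d)"
      using elim(2) ln_le_cancel_iff[of "norm (\<integral>\<omega>. iexp (?\<theta> n * ?S n \<omega>) \<partial>M)" "exp (- (real n * d))"] by simp
    moreover have "real n * d = Q * (h n * real n powr (1 - \<alpha>))"
    proof -
      have t2: "(?\<theta> n)\<^sup>2 = h n / real n" using n elim by (simp add: power_divide power2_eq_square)
      have p2: "((3 * real n) powr (- \<beta>))\<^sup>2 = 3 powr (- (2 * \<beta>)) * real n powr (- (2 * \<beta>))"
      proof -
        have "((3 * real n) powr (- \<beta>))\<^sup>2 = (3 * real n) powr (- (2 * \<beta>))"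
          unfolding power2_eq_square powr_add[symmetric] by simp
        also have "\<dots> = 3 powr (- (2 * \<beta>)) * real n powr (- (2 * \<beta>))" by (rule powr_mult)
        finally show ?thesis .
      qed
      have "real n powr (1 - \<alpha>) = (real n)\<^sup>2 * real n powr (- (2 * \<beta>))"
        using n \<beta>(2) powr_add[of "real n" 2 "- (2 * \<beta>)"] by (simp add: powr_numeral)
      then show ?thesis unfolding d_def Q_def t2 power_mult_distrib power_divide p2
        using n elim(3) by (simp add: power2_eq_square abs_mult)
    qed
    ultimately show ?case by linarith
  qed
  have "(\<lambda>n. Q * (h n * real n powr (1 - \<alpha>))) \<longlonglongrightarrow> 0"
  proof (rule tendsto_sandwich[OF _ le tendsto_const lnlim])
    show "\<forall>\<^sub>F n in sequentially. 0 \<le> Q * (h n * real n powr (1 - \<alpha>))"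
      using hpos by eventually_elim (use Q in simp)
  qed
  from tendsto_mult_right_zero[OF this, of "1 / Q"] show ?thesis using Q by simp
qed

end

section \<open>Decoupling regressors and errors\<close>

context prob_space begin

lemma prob_space_pair: "prob_space (M \<Otimes>\<^sub>M M)"
proof -
  interpret P: pair_prob_space M M ..
  show ?thesis by (rule P.prob_space_axioms)
qed

lemma distr_fst: "f \<in> measurable M N \<Longrightarrow> distr (M \<Otimes>\<^sub>M M) N (\<lambda>q. f (fst q)) = distr M N f"
  using distr_distr[of f M N fst "M \<Otimes>\<^sub>M M"] distr_pair_fst[of M] by (simp add: comp_def)

lemma distr_pair_snd: "distr (M \<Otimes>\<^sub>M M) M snd = M"
proof (rule measure_eqI)
  fix A assume A: "A \<in> sets (distr (M \<Otimes>\<^sub>M M) M snd)"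
  then have "emeasure (distr (M \<Otimes>\<^sub>M M) M snd) A = emeasure (M \<Otimes>\<^sub>M M) (space M \<times> A)"
    by (auto simp: emeasure_distr space_pair_measure dest: sets.sets_into_space intro!: arg_cong[where f="emeasure (M \<Otimes>\<^sub>M M)"])
  also have "\<dots> = emeasure M A" using A by (simp add: emeasure_pair_measure_Times emeasure_space_1)
  finally show "emeasure (distr (M \<Otimes>\<^sub>M M) M snd) A = emeasure M A" .
qed simp

lemma distr_snd: "f \<in> measurable M N \<Longrightarrow> distr (M \<Otimes>\<^sub>M M) N (\<lambda>q. f (snd q)) = distr M N f"
  using distr_distr[of f M N snd "M \<Otimes>\<^sub>M M"] distr_pair_snd by (simp add: comp_def)

lemma integral_fst_pair:
  fixes f :: "'a \<Rightarrow> real"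
  assumes [measurable]: "f \<in> borel_measurable M"
  shows "(\<integral>q. f (fst q) \<partial>(M \<Otimes>\<^sub>M M)) = expectation f" and "integrable (M \<Otimes>\<^sub>M M) (\<lambda>q. f (fst q)) \<longleftrightarrow> integrable M f"
proof -
  have "(\<integral>q. f (fst q) \<partial>(M \<Otimes>\<^sub>M M)) = integral\<^sup>L (distr (M \<Otimes>\<^sub>M M) M fst) f" by (subst integral_distr) auto
  then show "(\<integral>q. f (fst q) \<partial>(M \<Otimes>\<^sub>M M)) = expectation f" by (simp add: distr_pair_fst)
  have "integrable (M \<Otimes>\<^sub>M M) (\<lambda>q. f (fst q)) \<longleftrightarrow> integrable (distr (M \<Otimes>\<^sub>M M) M fst) f" by (subst integrable_distr_eq) auto
  then show "integrable (M \<Otimes>\<^sub>M M) (\<lambda>q. f (fst q)) \<longleftrightarrow> integrable M f" by (simp add: distr_pair_fst)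
qed

lemma integral_snd_pair:
  fixes f :: "'a \<Rightarrow> real"
  assumes [measurable]: "f \<in> borel_measurable M"
  shows "(\<integral>q. f (snd q) \<partial>(M \<Otimes>\<^sub>M M)) = expectation f" and "integrable (M \<Otimes>\<^sub>M M) (\<lambda>q. f (snd q)) \<longleftrightarrow> integrable M f"
proof -
  have "(\<integral>q. f (snd q) \<partial>(M \<Otimes>\<^sub>M M)) = integral\<^sup>L (distr (M \<Otimes>\<^sub>M M) M snd) f" by (subst integral_distr) auto
  then show "(\<integral>q. f (snd q) \<partial>(M \<Otimes>\<^sub>M M)) = expectation f" by (simp add: distr_pair_snd)
  have "integrable (M \<Otimes>\<^sub>M M) (\<lambda>q. f (snd q)) \<longleftrightarrow> integrable (distr (M \<Otimes>\<^sub>M M) M snd) f" by (subst integrable_distr_eq) auto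
  then show "integrable (M \<Otimes>\<^sub>M M) (\<lambda>q. f (snd q)) \<longleftrightarrow> integrable M f" by (simp add: distr_pair_snd)
qed

lemma distr_product:
  assumes f: "f \<in> measurable M S" and g: "g \<in> measurable M T"
  shows "distr (M \<Otimes>\<^sub>M M) (S \<Otimes>\<^sub>M T) (\<lambda>q. (f (fst q), g (snd q))) = distr M S f \<Otimes>\<^sub>M distr M T g"
proof -
  interpret g: prob_space "distr M T g" by (rule prob_space_distr[OF g])
  have "sigma_finite_measure (distr M T g)" by unfold_locales
  from pair_measure_distr[OF f g this] show ?thesis by (simp add: case_prod_beta')
qed

end

text \<open>The second coordinate joins the past as a whole. Independence of the innovation is
  checked on rectangles, which generate the enlarged past and are stable under intersection.\<close>

lemma (in innovation) product_innovation: "innovation (M \<Otimes>\<^sub>M M) (F \<Otimes>\<^sub>M M) (\<lambda>q. \<xi> (fst q)) (\<lambda>q. W (fst q)) p"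
proof -
  interpret P: prob_space "M \<Otimes>\<^sub>M M" by (rule prob_space_pair)
  note [measurable] = \<xi>_meas W_meas
  have sp: "space F = space M" using sub by (simp add: subalgebra_def)
  have sF: "sets F \<subseteq> sets M" using sub by (simp add: subalgebra_def)
  let ?A = "{a \<times> b | a b. a \<in> sets F \<and> b \<in> sets M}"
  let ?B = "{(\<lambda>q. \<xi> (fst q)) -` D \<inter> space (M \<Otimes>\<^sub>M M) | D. D \<in> sets (borel :: real measure)}"
  have FM: "sets (F \<Otimes>\<^sub>M M) = sigma_sets (space (M \<Otimes>\<^sub>M M)) ?A"
    by (simp add: sets_pair_measure space_pair_measure sp)
  have BV: "sets (vimage_algebra (space (M \<Otimes>\<^sub>M M)) (\<lambda>q. \<xi> (fst q)) borel) = sigma_sets (space (M \<Otimes>\<^sub>M M)) ?B"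
    by (rule sets_vimage_algebra)
  have ind: "P.indep_set ?A ?B"
  proof (rule P.indep_setI)
    show "?A \<subseteq> P.events" using sF by (auto intro!: pair_measureI)
    show "?B \<subseteq> P.events" by auto
    fix A B assume "A \<in> ?A" "B \<in> ?B"
    then obtain a b D where AB: "A = a \<times> b" "a \<in> sets F" "b \<in> sets M" "B = (\<lambda>q. \<xi> (fst q)) -` D \<inter> space (M \<Otimes>\<^sub>M M)" "D \<in> sets borel"
      by auto
    have a: "a \<in> sets M" using AB sF by auto
    let ?D = "\<xi> -` D \<inter> space M"
    have Dm: "?D \<in> sets M" using AB(5) by measurable
    have times: "P.prob (u \<times> v) = prob u * prob v" if "u \<in> sets M" "v \<in> sets M" for u v
      using that by (simp add: measure_def emeasure_pair_measure_Times enn2real_mult)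
    have "A \<inter> B = (a \<inter> ?D) \<times> b"
      unfolding AB using sets.sets_into_space[OF a] sets.sets_into_space[OF AB(3)] by (auto simp: space_pair_measure)
    then have "P.prob (A \<inter> B) = prob (a \<inter> ?D) * prob b" using times a Dm AB(3) by simp
    also have "prob (a \<inter> ?D) = prob a * prob ?D"
      by (rule indep_setD[OF ind AB(2) in_vimage_algebra[OF AB(5)]])
    also have "prob a * prob ?D * prob b = P.prob (a \<times> b) * P.prob (?D \<times> space M)"
      using times a AB(3) Dm by (simp add: prob_space)
    also have "?D \<times> space M = B" unfolding AB by (auto simp: space_pair_measure)
    finally show "P.prob (A \<inter> B) = P.prob A * P.prob B" unfolding AB by simp
  qed
  show ?thesis
  proof
    show "subalgebra (M \<Otimes>\<^sub>M M) (F \<Otimes>\<^sub>M M)"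
      unfolding subalgebra_def
    proof
      have "?A \<subseteq> sets (M \<Otimes>\<^sub>M M)" using sF by (auto intro!: pair_measureI)
      then show "sets (F \<Otimes>\<^sub>M M) \<subseteq> sets (M \<Otimes>\<^sub>M M)" unfolding FM by (rule sets.sigma_sets_subset)
    qed (simp add: space_pair_measure sp)
    show "(\<lambda>q. \<xi> (fst q)) \<in> borel_measurable (M \<Otimes>\<^sub>M M)" "(\<lambda>q. W (fst q)) \<in> borel_measurable (F \<Otimes>\<^sub>M M)" by measurable
    show "P.indep_set (sets (F \<Otimes>\<^sub>M M)) (sets (vimage_algebra (space (M \<Otimes>\<^sub>M M)) (\<lambda>q. \<xi> (fst q)) borel))"
      unfolding FM BV
    proof (rule P.indep_set_sigma_sets[OF ind])
      show "Int_stable ?A" by (rule Int_stable_pair_measure_generator)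
      show "Int_stable ?B"
      proof (rule Int_stableI)
        fix u v assume "u \<in> ?B" "v \<in> ?B"
        then obtain D E where "u = (\<lambda>q. \<xi> (fst q)) -` D \<inter> space (M \<Otimes>\<^sub>M M)" "D \<in> sets borel" "v = (\<lambda>q. \<xi> (fst q)) -` E \<inter> space (M \<Otimes>\<^sub>M M)" "E \<in> sets borel" by auto
        then show "u \<inter> v \<in> ?B" by (intro CollectI exI[of _ "D \<inter> E"]) auto
      qed
    qed
    show "distr (M \<Otimes>\<^sub>M M) borel (\<lambda>q. \<xi> (fst q)) = density lborel (\<lambda>y. ennreal (p y))"
      using dens by (simp add: distr_fst)
  qed (use p_nonneg p_meas in auto)
qed

lemma (in innovations) product_innovations:
  "innovations (M \<Otimes>\<^sub>M M) (\<lambda>i. F i \<Otimes>\<^sub>M M) (\<lambda>i q. \<xi> i (fst q)) (\<lambda>i q. W i (fst q)) p"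
proof -
  interpret P: prob_space "M \<Otimes>\<^sub>M M" by (rule prob_space_pair)
  show ?thesis
  proof (intro innovations.intro innovations_axioms.intro)
    show "prob_space (M \<Otimes>\<^sub>M M)" by (rule prob_space_pair)
    show "innovation (M \<Otimes>\<^sub>M M) (F i \<Otimes>\<^sub>M M) (\<lambda>q. \<xi> i (fst q)) (\<lambda>q. W i (fst q)) p" for i
      by (rule innovation.product_innovation[OF inn])
    show "sets (F i \<Otimes>\<^sub>M M) \<subseteq> sets (F j \<Otimes>\<^sub>M M)" if "i \<le> j" for i j
    proof -
      have "space (F i) = space (F j)" using innD(1)[of i] innD(1)[of j] by (simp add: subalgebra_def)
      then show ?thesis unfolding sets_pair_measure using mono[OF that] by (simp only:) (intro sigma_sets_mono', blast)
    qed
    show "(\<lambda>q. \<xi> i (fst q)) \<in> borel_measurable (F (Suc i) \<Otimes>\<^sub>M M)" for i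
      using adapted[of i] by measurable
  qed
qed

text \<open>The hypotheses of \<open>nw_model\<close> as they are available on the original space:
  the errors are random variables there, with no stated relation to \<open>F 0\<close> or to the
  \<open>W i\<close>.\<close>

locale nw_setting = innovations M F \<xi> W p + smoothing K p m BK Bp Bm m1 x
  for M :: "'a measure" and F \<xi> W p K m BK Bp Bm m1 x +
  fixes h :: "nat \<Rightarrow> real" and \<epsilon> :: "nat \<Rightarrow> 'a \<Rightarrow> real" and \<gamma> :: "nat \<Rightarrow> nat \<Rightarrow> real"
  assumes h0: "h \<longlonglongrightarrow> 0" and nh: "filterlim (\<lambda>n. real n * h n) at_top sequentially"
    and \<epsilon>_meas [measurable]: "\<And>i. \<epsilon> i \<in> borel_measurable M"
    and \<epsilon>_distr: "\<And>i. distr M borel (\<epsilon> i) = distr M borel (\<epsilon> 0)"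
    and \<epsilon>_int: "integrable M (\<lambda>\<omega>. (\<epsilon> 0 \<omega>)\<^sup>2)" and \<epsilon>_var: "expectation (\<lambda>\<omega>. (\<epsilon> 0 \<omega>)\<^sup>2) = 1"
    and W_distr: "\<And>i. distr M borel (W i) = distr M borel (W 0)"
    and W_cov: "\<And>g L i j. (\<And>w w'. \<bar>g w - g w'\<bar> \<le> L * \<bar>w - w'\<bar>) \<Longrightarrow> expectation (\<lambda>\<omega>. g (W 0 \<omega>)) = 0 \<Longrightarrow>
        integrable M (\<lambda>\<omega>. g (W i \<omega>) * g (W j \<omega>)) \<and> \<bar>expectation (\<lambda>\<omega>. g (W i \<omega>) * g (W j \<omega>))\<bar> \<le> L\<^sup>2 * \<gamma> i j"
    and \<gamma>_nonneg: "\<And>i j. 0 \<le> \<gamma> i j"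
    and lln: "\<And>B. (\<lambda>n. expectation (\<lambda>\<omega>. \<bar>1 / real n * (\<Sum>i<n. (trunc B (\<epsilon> i \<omega>))\<^sup>2) - expectation (\<lambda>\<omega>. (trunc B (\<epsilon> 0 \<omega>))\<^sup>2)\<bar>)) \<longlonglongrightarrow> 0"
    and sum_\<epsilon>: "small_oP M (\<lambda>n \<omega>. sqrt (real n * h n) / real n * (\<Sum>i<n. \<epsilon> i \<omega>))"
    and \<gamma>_bias: "(\<lambda>n. h n ^ 5 / real n * (\<Sum>i<n. \<Sum>j<n. \<gamma> i j)) \<longlonglongrightarrow> 0"
    and \<gamma>_mean: "(\<lambda>n. 1 / (real n)\<^sup>2 * (\<Sum>i<n. \<Sum>j<n. \<gamma> i j)) \<longlonglongrightarrow> 0"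
    and \<gamma>_cross: "(\<lambda>n. h n / real n * (\<Sum>i<n. \<Sum>j<n. \<gamma> i j * \<bar>expectation (\<lambda>\<omega>. \<epsilon> i \<omega> * \<epsilon> j \<omega>)\<bar>)) \<longlonglongrightarrow> 0"
    and dens_pos: "expectation (\<lambda>\<omega>. p (x - W 0 \<omega>)) > 0"
    and \<kappa>1_pos: "\<kappa>1 > 0"
begin

lemmas [measurable] = innD(2,4)

text \<open>Only the joint law of regressors and errors matters. On the square of the probability space
  it can be realised with the whole past of the regressors independent of the errors; the
  innovations behind the regressors are not assumed to be independent of the errors on \<open>M\<close> itself.\<close>

lemma product_model:
  "nw_model (M \<Otimes>\<^sub>M M) (\<lambda>i. F i \<Otimes>\<^sub>M M) (\<lambda>i q. \<xi> i (fst q)) (\<lambda>i q. W i (fst q)) p K m BK Bp Bm m1 x h (\<lambda>i q. \<epsilon> i (snd q)) \<gamma>"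
proof -
  interpret P: innovations "M \<Otimes>\<^sub>M M" "\<lambda>i. F i \<Otimes>\<^sub>M M" "\<lambda>i q. \<xi> i (fst q)" "\<lambda>i q. W i (fst q)" p by (rule product_innovations)
  show ?thesis
  proof
    show "(\<lambda>q. \<epsilon> i (snd q)) \<in> borel_measurable (F 0 \<Otimes>\<^sub>M M)" for i by measurable
    show "distr (M \<Otimes>\<^sub>M M) borel (\<lambda>q. \<epsilon> i (snd q)) = distr (M \<Otimes>\<^sub>M M) borel (\<lambda>q. \<epsilon> 0 (snd q))" for i
      using \<epsilon>_distr[of i] by (simp add: distr_snd)
    show "distr (M \<Otimes>\<^sub>M M) borel (\<lambda>q. W i (fst q)) = distr (M \<Otimes>\<^sub>M M) borel (\<lambda>q. W 0 (fst q))" for i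
      using W_distr[of i] by (simp add: distr_fst)
    show "integrable (M \<Otimes>\<^sub>M M) (\<lambda>q. (\<epsilon> 0 (snd q))\<^sup>2)" "(\<integral>q. (\<epsilon> 0 (snd q))\<^sup>2 \<partial>(M \<Otimes>\<^sub>M M)) = 1"
      using integral_snd_pair[of "\<lambda>\<omega>. (\<epsilon> 0 \<omega>)\<^sup>2"] \<epsilon>_int \<epsilon>_var by simp_all
    show "integrable (M \<Otimes>\<^sub>M M) (\<lambda>q. g (W i (fst q)) * g (W j (fst q))) \<and> \<bar>\<integral>q. g (W i (fst q)) * g (W j (fst q)) \<partial>(M \<Otimes>\<^sub>M M)\<bar> \<le> L\<^sup>2 * \<gamma> i j"
      if g: "\<And>w w'. \<bar>g w - g w'\<bar> \<le> L * \<bar>w - w'\<bar>" and z: "(\<integral>q. g (W 0 (fst q)) \<partial>(M \<Otimes>\<^sub>M M)) = 0" for g :: "real \<Rightarrow> real" and L i j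
    proof -
      have [measurable]: "g \<in> borel_measurable borel" using g by (rule lipschitz_borel_measurable)
      have "expectation (\<lambda>\<omega>. g (W 0 \<omega>)) = 0" using z integral_fst_pair(1)[of "\<lambda>\<omega>. g (W 0 \<omega>)"] by simp
      from W_cov[OF g this, of i j] show ?thesis using integral_fst_pair[of "\<lambda>\<omega>. g (W i \<omega>) * g (W j \<omega>)"] by simp
    qed
    show "P.indep_var (borel \<Otimes>\<^sub>M borel) (\<lambda>q. (W i (fst q), W j (fst q))) (borel \<Otimes>\<^sub>M borel) (\<lambda>q. (\<epsilon> i (snd q), \<epsilon> j (snd q)))" for i j
    proof -
      have m: "(\<lambda>\<omega>. (W i \<omega>, W j \<omega>)) \<in> measurable M (borel \<Otimes>\<^sub>M borel)" "(\<lambda>\<omega>. (\<epsilon> i \<omega>, \<epsilon> j \<omega>)) \<in> measurable M (borel \<Otimes>\<^sub>M borel)"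
        by measurable
      show ?thesis
        unfolding P.indep_var_distribution_eq
        using distr_product[OF m] distr_fst[OF m(1)] distr_snd[OF m(2)] by auto
    qed
    show "(\<lambda>n. \<integral>q. \<bar>1 / real n * (\<Sum>i<n. (trunc B (\<epsilon> i (snd q)))\<^sup>2) - (\<integral>q. (trunc B (\<epsilon> 0 (snd q)))\<^sup>2 \<partial>(M \<Otimes>\<^sub>M M))\<bar> \<partial>(M \<Otimes>\<^sub>M M)) \<longlonglongrightarrow> 0" for B
    proof -
      have e: "(\<integral>q. (trunc B (\<epsilon> 0 (snd q)))\<^sup>2 \<partial>(M \<Otimes>\<^sub>M M)) = expectation (\<lambda>\<omega>. (trunc B (\<epsilon> 0 \<omega>))\<^sup>2)"
        by (rule integral_snd_pair(1)) measurable
      have "(\<integral>q. \<bar>1 / real n * (\<Sum>i<n. (trunc B (\<epsilon> i (snd q)))\<^sup>2) - C\<bar> \<partial>(M \<Otimes>\<^sub>M M)) = expectation (\<lambda>\<omega>. \<bar>1 / real n * (\<Sum>i<n. (trunc B (\<epsilon> i \<omega>))\<^sup>2) - C\<bar>)" for n C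
        by (rule integral_snd_pair(1)[of "\<lambda>\<omega>. \<bar>1 / real n * (\<Sum>i<n. (trunc B (\<epsilon> i \<omega>))\<^sup>2) - C\<bar>"]) measurable
      then show ?thesis unfolding e using lln[of B] by simp
    qed
    show "small_oP (M \<Otimes>\<^sub>M M) (\<lambda>n q. sqrt (real n * h n) / real n * (\<Sum>i<n. \<epsilon> i (snd q)))"
      unfolding small_oP_def
    proof safe
      fix e :: real assume e: "e > 0"
      have "measure (M \<Otimes>\<^sub>M M) {q \<in> space (M \<Otimes>\<^sub>M M). \<bar>sqrt (real n * h n) / real n * (\<Sum>i<n. \<epsilon> i (snd q))\<bar> > e}
        = prob {\<omega> \<in> space M. \<bar>sqrt (real n * h n) / real n * (\<Sum>i<n. \<epsilon> i \<omega>)\<bar> > e}" for n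
      proof -
        have "prob {\<omega> \<in> space M. \<bar>sqrt (real n * h n) / real n * (\<Sum>i<n. \<epsilon> i \<omega>)\<bar> > e}
          = measure (distr (M \<Otimes>\<^sub>M M) M snd) {\<omega> \<in> space M. \<bar>sqrt (real n * h n) / real n * (\<Sum>i<n. \<epsilon> i \<omega>)\<bar> > e}"
          by (simp add: distr_pair_snd)
        also have "\<dots> = measure (M \<Otimes>\<^sub>M M) {q \<in> space (M \<Otimes>\<^sub>M M). \<bar>sqrt (real n * h n) / real n * (\<Sum>i<n. \<epsilon> i (snd q))\<bar> > e}"
          by (subst measure_distr) (auto simp: space_pair_measure intro!: arg_cong[where f="measure (M \<Otimes>\<^sub>M M)"])
        finally show ?thesis ..
      qed
      then show "(\<lambda>n. measure (M \<Otimes>\<^sub>M M) {q \<in> space (M \<Otimes>\<^sub>M M). \<bar>sqrt (real n * h n) / real n * (\<Sum>i<n. \<epsilon> i (snd q))\<bar> > e}) \<longlonglongrightarrow> 0"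
        using sum_\<epsilon> e unfolding small_oP_def by simp
    qed
    show "(\<lambda>n. h n / real n * (\<Sum>i<n. \<Sum>j<n. \<gamma> i j * \<bar>\<integral>q. \<epsilon> i (snd q) * \<epsilon> j (snd q) \<partial>(M \<Otimes>\<^sub>M M)\<bar>)) \<longlonglongrightarrow> 0"
      using \<gamma>_cross integral_snd_pair(1)[of "\<lambda>\<omega>. \<epsilon> _ \<omega> * \<epsilon> _ \<omega>"] by simp
    show "(\<integral>q. p (x - W 0 (fst q)) \<partial>(M \<Otimes>\<^sub>M M)) > 0"
      using dens_pos integral_fst_pair(1)[of "\<lambda>\<omega>. p (x - W 0 \<omega>)"] by simp
  qed (use h0 nh \<gamma>_nonneg \<gamma>_bias \<gamma>_mean \<kappa>1_pos in auto)
qed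

text \<open>The statistic is one function \<open>H\<close> of the two sample vectors. As regressors
  and errors are independent, its law depends on the two marginal laws only, and the product space
  realises the same marginals. Levy's continuity theorem then turns the limit of characteristic
  functions into weak convergence.\<close>

lemma NW_asymp_normal_transfer:
  fixes X' Y' \<epsilon>' :: "nat \<Rightarrow> 'a \<Rightarrow> real"
  assumes ind: "indep_families M borel {1..} X' borel {1..} \<epsilon>'"
    and X': "\<And>i. AE \<omega> in M. X' (Suc i) \<omega> = W i \<omega> + \<xi> i \<omega>"
    and \<epsilon>': "\<And>i. AE \<omega> in M. \<epsilon>' (Suc i) \<omega> = \<epsilon> i \<omega>"
    and Y': "\<And>i \<omega>. i \<ge> 1 \<Longrightarrow> \<omega> \<in> space M \<Longrightarrow> Y' i \<omega> = m (X' i \<omega>) + \<epsilon>' i \<omega>"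
  shows "NW_asymp_normal M K h X' Y' m x"
proof -
  interpret P: nw_model "M \<Otimes>\<^sub>M M" "\<lambda>i. F i \<Otimes>\<^sub>M M" "\<lambda>i q. \<xi> i (fst q)" "\<lambda>i q. W i (fst q)" p K m BK Bp Bm m1 x h "\<lambda>i q. \<epsilon> i (snd q)" \<gamma>
    by (rule product_model)
  have Xm[measurable]: "X' i \<in> borel_measurable M" if "i \<ge> 1" for i using ind that by (auto simp: indep_families_def)
  have em[measurable]: "\<epsilon>' i \<in> borel_measurable M" if "i \<ge> 1" for i using ind that by (auto simp: indep_families_def)
  \<comment> \<open>The samples are numbered from 1 and the model from 0, hence \<open>Suc\<close>;
    restriction to n indices makes the vectors points of a product space.\<close>
  define XX where "XX n \<omega> = (\<lambda>i\<in>{..<n}. X' (Suc i) \<omega>)" for n :: nat and \<omega>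
  define EE where "EE n \<omega> = (\<lambda>i\<in>{..<n}. \<epsilon>' (Suc i) \<omega>)" for n :: nat and \<omega>
  define XN where "XN n \<omega> = (\<lambda>i\<in>{..<n}. X i \<omega>)" for n :: nat and \<omega>
  define EN where "EN n \<omega> = (\<lambda>i\<in>{..<n}. \<epsilon> i \<omega>)" for n :: nat and \<omega>
  let ?V = "\<lambda>n. PiM {..<n} (\<lambda>_. borel :: real measure)"
  have [measurable]: "XX n \<in> measurable M (?V n)" "EE n \<in> measurable M (?V n)" "XN n \<in> measurable M (?V n)" "EN n \<in> measurable M (?V n)" for n
    unfolding XX_def[abs_def] EE_def[abs_def] XN_def[abs_def] EN_def[abs_def]
    by (intro measurable_restrict; simp)+
  define H where "H n q = 1 / sqrt (\<kappa>1 * (1 / (real n * h n) * (\<Sum>i<n. Kh (h n) (fst q i))))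
     * (P.s n * (\<Sum>i<n. Kh (h n) (fst q i) * (m (fst q i) + snd q i - P.c n)))" for n :: nat and q :: "(nat \<Rightarrow> real) \<times> (nat \<Rightarrow> real)"
  have Hm[measurable]: "H n \<in> borel_measurable (?V n \<Otimes>\<^sub>M ?V n)" for n
  proof -
    have [measurable]: "(\<lambda>q. fst q i) \<in> borel_measurable (?V n \<Otimes>\<^sub>M ?V n)" "(\<lambda>q. snd q i) \<in> borel_measurable (?V n \<Otimes>\<^sub>M ?V n)" if "i < n" for i
      using that by (auto intro: measurable_compose[OF measurable_fst measurable_component_singleton]
          measurable_compose[OF measurable_snd measurable_component_singleton])
    show ?thesis unfolding H_def[abs_def] by measurable
  qed
  have joint: "distr M (?V n \<Otimes>\<^sub>M ?V n) (\<lambda>\<omega>. (XX n \<omega>, EE n \<omega>)) = distr (M \<Otimes>\<^sub>M M) (?V n \<Otimes>\<^sub>M ?V n) (\<lambda>q. (XN n (fst q), EN n (snd q)))" for n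
  proof -
    have gen: "sigma_sets (space M) {(\<lambda>\<omega>. \<lambda>i\<in>{..<n}. Z (Suc i) \<omega>) -` A \<inter> space M | A. A \<in> sets (?V n)} \<subseteq> sets (generated_sigma M borel {1..} Z)"
      if Z: "\<And>i. i \<ge> 1 \<Longrightarrow> Z i \<in> borel_measurable M" for Z :: "nat \<Rightarrow> 'a \<Rightarrow> real"
    proof -
      let ?G = "generated_sigma M borel {1..} Z"
      have "(\<lambda>\<omega>. \<lambda>i\<in>{..<n}. Z (Suc i) \<omega>) \<in> measurable ?G (?V n)"
        by (intro measurable_restrict generated_sigma_measurable) (use Z in auto)
      note m = measurable_sets[OF this, unfolded space_generated_sigma]
      have "{(\<lambda>\<omega>. \<lambda>i\<in>{..<n}. Z (Suc i) \<omega>) -` A \<inter> space M | A. A \<in> sets (?V n)} \<subseteq> sets ?G"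
        by (intro subsetI, elim CollectE exE conjE) (simp only: m)
      from sets.sigma_sets_subset[OF this] show ?thesis by simp
    qed
    have "indep_set (sigma_sets (space M) {XX n -` A \<inter> space M | A. A \<in> sets (?V n)}) (sigma_sets (space M) {EE n -` A \<inter> space M | A. A \<in> sets (?V n)})"
    proof (rule indep_set_mono)
      show "indep_set (sets (generated_sigma M borel {1..} X')) (sets (generated_sigma M borel {1..} \<epsilon>'))"
        using ind unfolding indep_families_def by blast
      show "sigma_sets (space M) {XX n -` A \<inter> space M | A. A \<in> sets (?V n)} \<subseteq> sets (generated_sigma M borel {1..} X')"
        unfolding XX_def[abs_def] by (rule gen) (rule Xm)
      show "sigma_sets (space M) {EE n -` A \<inter> space M | A. A \<in> sets (?V n)} \<subseteq> sets (generated_sigma M borel {1..} \<epsilon>')"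
        unfolding EE_def[abs_def] by (rule gen) (rule em)
    qed
    then have "indep_var (?V n) (XX n) (?V n) (EE n)" unfolding indep_var_eq by auto
    then have "distr M (?V n \<Otimes>\<^sub>M ?V n) (\<lambda>\<omega>. (XX n \<omega>, EE n \<omega>)) = distr M (?V n) (XX n) \<Otimes>\<^sub>M distr M (?V n) (EE n)"
      unfolding indep_var_distribution_eq by auto
    also have "distr M (?V n) (XX n) = distr M (?V n) (XN n)"
    proof (rule distr_cong_AE)
      have "AE \<omega> in M. \<forall>i\<in>{..<n}. X' (Suc i) \<omega> = X i \<omega>" by (rule AE_finite_allI) (auto intro: X')
      then show "AE \<omega> in M. XX n \<omega> = XN n \<omega>" by eventually_elim (auto simp: XX_def XN_def)
    qed simp_all
    also have "distr M (?V n) (EE n) = distr M (?V n) (EN n)"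
    proof (rule distr_cong_AE)
      have "AE \<omega> in M. \<forall>i\<in>{..<n}. \<epsilon>' (Suc i) \<omega> = \<epsilon> i \<omega>" by (rule AE_finite_allI) (auto intro: \<epsilon>')
      then show "AE \<omega> in M. EE n \<omega> = EN n \<omega>" by eventually_elim (auto simp: EE_def EN_def)
    qed simp_all
    finally show ?thesis by (simp add: distr_product)
  qed
  have center: "NW_center M K (h n) X' m x = P.c n" for n
  proof -
    have 1: "expectation (\<lambda>\<omega>. g (X' 1 \<omega>)) = (\<integral>q. g (W 0 (fst q) + \<xi> 0 (fst q)) \<partial>(M \<Otimes>\<^sub>M M))" if [measurable]: "g \<in> borel_measurable borel" for g :: "real \<Rightarrow> real"
    proof -
      have "expectation (\<lambda>\<omega>. g (X' 1 \<omega>)) = expectation (\<lambda>\<omega>. g (X 0 \<omega>))"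
      proof (rule integral_cong_AE)
        show "AE \<omega> in M. g (X' 1 \<omega>) = g (X 0 \<omega>)" using X'[of 0] by eventually_elim simp
      qed measurable
      also have "\<dots> = (\<integral>q. g (W 0 (fst q) + \<xi> 0 (fst q)) \<partial>(M \<Otimes>\<^sub>M M))"
        by (rule integral_fst_pair(1)[of "\<lambda>\<omega>. g (X 0 \<omega>)", symmetric]) measurable
      finally show ?thesis .
    qed
    show ?thesis
      unfolding NW_center_def P.c_def using 1[of "\<lambda>z. Kh (h n) z * m z"] 1[of "Kh (h n)"] by simp
  qed
  have sumY: "(\<Sum>i=1..n. f (X' i \<omega>) (Y' i \<omega>)) = (\<Sum>i<n. f (XX n \<omega> i) (m (XX n \<omega> i) + EE n \<omega> i))" if "\<omega> \<in> space M" for f :: "real \<Rightarrow> real \<Rightarrow> real" and n \<omega>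
    unfolding One_nat_def sum.atLeast1_atMost_eq using Y'[OF _ that] by (intro sum.cong) (auto simp: XX_def EE_def)
  let ?T = "\<lambda>n \<omega>. sqrt (real n * h n / kernel_L2 K) * sqrt (density_est K (h n) X' n x \<omega>) * (NW_est K (h n) X' Y' n x \<omega> - NW_center M K (h n) X' m x)"
  have \<kappa>L: "kernel_L2 K = \<kappa>1" by (simp add: kernel_L2_def \<kappa>1_def)
  have TH: "?T n \<omega> = H n (XX n \<omega>, EE n \<omega>)" if "\<omega> \<in> space M" "0 < n" "0 < h n" for n \<omega>
  proof -
    define y where "y = real n * h n"
    define f where "f = 1 / y * (\<Sum>i<n. Kh (h n) (XX n \<omega> i))"
    define N where "N = (\<Sum>i<n. Kh (h n) (XX n \<omega> i) * (m (XX n \<omega> i) + EE n \<omega> i))"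
    have y: "y > 0" using that by (simp add: y_def)
    have f0: "f \<ge> 0" unfolding f_def using y K_nonneg by (intro mult_nonneg_nonneg sum_nonneg) auto
    have de: "density_est K (h n) X' n x \<omega> = f"
      unfolding density_est_def f_def y_def using sumY[OF that(1), of "\<lambda>u _. K ((x - u) / h n)" n] by simp
    have nw: "NW_est K (h n) X' Y' n x \<omega> = 1 / (y * f) * N"
      unfolding NW_est_def de N_def y_def[symmetric] using sumY[OF that(1), of "\<lambda>u v. v * K ((x - u) / h n)" n] by (simp add: mult.commute)
    have Hs: "H n (XX n \<omega>, EE n \<omega>) = 1 / sqrt (\<kappa>1 * f) * (1 / sqrt y * (N - P.c n * (y * f)))"
    proof -
      have "(\<Sum>i<n. Kh (h n) (XX n \<omega> i) * (m (XX n \<omega> i) + EE n \<omega> i - P.c n)) = N - P.c n * (\<Sum>i<n. Kh (h n) (XX n \<omega> i))"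
        unfolding N_def sum_distrib_left sum_subtractf[symmetric] by (intro sum.cong refl) (simp add: algebra_simps)
      also have "(\<Sum>i<n. Kh (h n) (XX n \<omega> i)) = y * f" using y by (simp add: f_def)
      finally show ?thesis unfolding H_def fst_conv snd_conv P.s_def y_def[symmetric] f_def[symmetric] by simp
    qed
    show ?thesis
    \<comment> \<open>Where the density estimate vanishes both sides are 0, the left through the
      factor sqrt f and the right because 1 / sqrt 0 = 0.\<close>
    proof (cases "f = 0")
      case True
      then show ?thesis unfolding Hs de by simp
    next
      case False
      then have fp: "f > 0" using f0 by simp
      have sq: "sqrt (y / \<kappa>1) * sqrt f * (1 / (y * f)) = 1 / sqrt (\<kappa>1 * f) * (1 / sqrt y)"
      proof -
        have "sqrt y * sqrt y = y" "sqrt f * sqrt f = f" using y fp by simp_all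
        then have "1 / (y * f) = 1 / ((sqrt y * sqrt y) * (sqrt f * sqrt f))" by simp
        also have "\<dots> = (1 / (sqrt y * sqrt f)) * (1 / (sqrt y * sqrt f))" by (simp only: times_divide_times_eq mult_1 mult_ac)
        finally have "1 / (y * f) = (1 / (sqrt y * sqrt f)) * (1 / (sqrt y * sqrt f))" .
        then have "sqrt (y / \<kappa>1) * sqrt f * (1 / (y * f)) = (sqrt y / sqrt \<kappa>1) * sqrt f * ((1 / (sqrt y * sqrt f)) * (1 / (sqrt y * sqrt f)))"
          by (simp add: real_sqrt_divide)
        also have "\<dots> = 1 / sqrt (\<kappa>1 * f) * (1 / sqrt y)" using y fp by (simp add: real_sqrt_mult)
        finally show ?thesis .
      qed
      have "1 / (y * f) * N - P.c n = 1 / (y * f) * (N - P.c n * (y * f))" using y fp by (simp add: field_simps)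
      then have "?T n \<omega> = (sqrt (y / \<kappa>1) * sqrt f * (1 / (y * f))) * (N - P.c n * (y * f))"
        unfolding de nw center \<kappa>L y_def[symmetric] by (simp only: mult.assoc)
      then show ?thesis unfolding sq Hs by (simp only: mult.assoc)
    qed
  qed
  have Tm: "?T n \<in> borel_measurable M" for n
  proof -
    have Ym: "Y' i \<in> borel_measurable M" if "i \<ge> 1" for i
    proof (subst measurable_cong)
      show "Y' i \<omega> = m (X' i \<omega>) + \<epsilon>' i \<omega>" if "\<omega> \<in> space M" for \<omega> by (rule Y'[OF \<open>i \<ge> 1\<close> that])
      show "(\<lambda>\<omega>. m (X' i \<omega>) + \<epsilon>' i \<omega>) \<in> borel_measurable M" using that by measurable
    qed
    have s1: "(\<lambda>\<omega>. \<Sum>i=1..n. K ((x - X' i \<omega>) / h n)) \<in> borel_measurable M"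
    proof (intro borel_measurable_sum)
      fix i assume "i \<in> {1..n}"
      then have [measurable]: "X' i \<in> borel_measurable M" by (intro Xm) simp
      show "(\<lambda>\<omega>. K ((x - X' i \<omega>) / h n)) \<in> borel_measurable M" by measurable
    qed
    have s2: "(\<lambda>\<omega>. \<Sum>i=1..n. Y' i \<omega> * K ((x - X' i \<omega>) / h n)) \<in> borel_measurable M"
    proof (intro borel_measurable_sum)
      fix i assume i: "i \<in> {1..n}"
      then have [measurable]: "X' i \<in> borel_measurable M" by (intro Xm) simp
      have [measurable]: "Y' i \<in> borel_measurable M" using i by (intro Ym) simp
      show "(\<lambda>\<omega>. Y' i \<omega> * K ((x - X' i \<omega>) / h n)) \<in> borel_measurable M" by measurable
    qed
    show ?thesis unfolding density_est_def NW_est_def using s1 s2 by measurable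
  qed
  have char_eq: "char (distr M borel (?T n)) t = (\<integral>q. iexp (t * P.stat n q) \<partial>(M \<Otimes>\<^sub>M M))" if "0 < n" "0 < h n" for n t
  proof -
    have "char (distr M borel (?T n)) t = (\<integral>\<omega>. iexp (t * ?T n \<omega>) \<partial>M)"
      unfolding char_def by (subst integral_distr[OF Tm]) auto
    also have "\<dots> = (\<integral>\<omega>. iexp (t * H n (XX n \<omega>, EE n \<omega>)) \<partial>M)"
      using TH[OF _ that] by (intro Bochner_Integration.integral_cong refl) simp
    also have "\<dots> = (\<integral>q. iexp (t * H n q) \<partial>distr M (?V n \<Otimes>\<^sub>M ?V n) (\<lambda>\<omega>. (XX n \<omega>, EE n \<omega>)))"
      by (subst integral_distr) auto
    also have "\<dots> = (\<integral>q. iexp (t * H n (XN n (fst q), EN n (snd q))) \<partial>(M \<Otimes>\<^sub>M M))"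
      unfolding joint by (subst integral_distr) auto
    also have "\<dots> = (\<integral>q. iexp (t * P.stat n q) \<partial>(M \<Otimes>\<^sub>M M))"
      by (simp add: H_def P.stat_def P.fhat_def XN_def EN_def)
    finally show ?thesis .
  qed
  show ?thesis
    unfolding NW_asymp_normal_def
  proof (rule levy_continuity)
    show "real_distribution (distr M borel (?T n))" for n by (rule real_distribution_distr[OF Tm])
    show "real_distribution std_normal_distribution" by (rule real_dist_normal_dist)
    fix t
    have "\<forall>\<^sub>F n in sequentially. char (distr M borel (?T n)) t = (\<integral>q. iexp (t * P.stat n q) \<partial>(M \<Otimes>\<^sub>M M))"
      using P.evn by eventually_elim (rule char_eq, auto)
    moreover have "(\<lambda>n. \<integral>q. iexp (t * P.stat n q) \<partial>(M \<Otimes>\<^sub>M M)) \<longlonglongrightarrow> char std_normal_distribution t"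
      unfolding char_std_normal_distribution using P.stat_char[of t] by (simp add: exp_of_real)
    ultimately show "(\<lambda>n. char (distr M borel (?T n)) t) \<longlonglongrightarrow> char std_normal_distribution t"
      by (subst tendsto_cong)
  qed
qed

end

section \<open>The two designs\<close>

text \<open>Bounded derivatives are used in integrated form only. Each estimate is a mean value
  inequality: for \<open>g\<close>, for y |-> g (y - w) - g (y - w'), and for \<open>g\<close> minus
  its tangent.\<close>

lemma twice_differentiable_boundedE:
  assumes "twice_differentiable_bounded g"
  obtains B g' where "\<And>y y'. \<bar>g y - g y'\<bar> \<le> B * \<bar>y - y'\<bar>"
    and "\<And>y y' w w'. \<bar>(g (y - w) - g (y - w')) - (g (y' - w) - g (y' - w'))\<bar> \<le> B * \<bar>y - y'\<bar> * \<bar>w - w'\<bar>"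
    and "\<And>y z. \<bar>g y - g z - g' z * (y - z)\<bar> \<le> B * (y - z)\<^sup>2"
    and "g \<in> borel_measurable borel" and "0 \<le> B"
proof -
  obtain g' g'' where d: "\<And>y. (g has_real_derivative g' y) (at y)" "\<And>y. (g' has_real_derivative g'' y) (at y)"
    and b: "bounded (range g')" "bounded (range g'')"
    using assms unfolding twice_differentiable_bounded_def by auto
  from b obtain B1 B2 where B1: "\<And>y. \<bar>g' y\<bar> \<le> B1" and B2: "\<And>y. \<bar>g'' y\<bar> \<le> B2"
    unfolding bounded_iff by auto
  define B where "B = max B1 B2"
  have B: "\<bar>g' y\<bar> \<le> B" "\<bar>g'' y\<bar> \<le> B" for y using B1[of y] B2[of y] by (auto simp: B_def)
  have B0: "0 \<le> B" using B(1)[of 0] by simp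
  have l: "\<bar>g y - g y'\<bar> \<le> B * \<bar>y - y'\<bar>" for y y'
    using field_differentiable_bound[of UNIV g g' B y y'] d(1) B(1) by simp
  have l': "\<bar>g' y - g' y'\<bar> \<le> B * \<bar>y - y'\<bar>" for y y'
    using field_differentiable_bound[of UNIV g' g'' B y y'] d(2) B(2) by simp
  have l2: "\<bar>(g (y - w) - g (y - w')) - (g (y' - w) - g (y' - w'))\<bar> \<le> B * \<bar>y - y'\<bar> * \<bar>w - w'\<bar>" for y y' w w'
  proof -
    have der: "((\<lambda>y. g (y - w) - g (y - w')) has_real_derivative g' (z - w) - g' (z - w')) (at z)" for z
    proof -
      have "((\<lambda>y. g (y - v)) has_real_derivative g' (z - v)) (at z)" for v
      proof -
        have "((\<lambda>y. y - v) has_real_derivative 1) (at z)" by (auto intro!: derivative_eq_intros)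
        from DERIV_chain2[OF d(1)[of "z - v"] this] show ?thesis by simp
      qed
      then show ?thesis by (intro DERIV_diff)
    qed
    have "\<bar>g' (z - w) - g' (z - w')\<bar> \<le> B * \<bar>w - w'\<bar>" for z
      using l'[of "z - w" "z - w'"] by (simp add: abs_minus_commute)
    then show ?thesis
      using field_differentiable_bound[of UNIV "\<lambda>y. g (y - w) - g (y - w')" "\<lambda>z. g' (z - w) - g' (z - w')" "B * \<bar>w - w'\<bar>" y y'] der
      by (simp add: mult_ac)
  qed
  have t: "\<bar>g y - g z - g' z * (y - z)\<bar> \<le> B * (y - z)\<^sup>2" for y z
  proof -
    let ?S = "{min y z..max y z}"
    have der: "((\<lambda>u. g u - g z - g' z * (u - z)) has_real_derivative g' u - g' z) (at u within ?S)" for u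
      using DERIV_diff[OF DERIV_diff[OF d(1)[of u] DERIV_const[of "g z"]]
          DERIV_cmult[OF DERIV_diff[OF DERIV_ident DERIV_const[of z]], of "g' z"]]
      by (simp add: has_field_derivative_at_within)
    have n: "norm (g' u - g' z) \<le> B * \<bar>y - z\<bar>" if "u \<in> ?S" for u
      unfolding real_norm_def by (rule order_trans[OF l' mult_left_mono]) (use that B0 in auto)
    have "norm ((g y - g z - g' z * (y - z)) - (g z - g z - g' z * (z - z))) \<le> B * \<bar>y - z\<bar> * norm (y - z)"
      by (rule field_differentiable_bound[OF _ der n]) auto
    then show ?thesis by (simp add: power2_eq_square mult.assoc)
  qed
  have "g \<in> borel_measurable borel" using l by (rule lipschitz_borel_measurable)
  from that[OF l l2 t this B0] show thesis .
qed

text \<open>On the unit interval to the right of \<open>y\<close> the density is at least p y - B,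
  and its integral there is at most 1.\<close>

lemma lipschitz_density_bounded:
  fixes p :: "real \<Rightarrow> real"
  assumes p: "integrable lborel p" "(\<integral>y. p y \<partial>lborel) = 1" "\<And>y. 0 \<le> p y"
    and lip: "\<And>y y'. \<bar>p y - p y'\<bar> \<le> B * \<bar>y - y'\<bar>" and B: "0 \<le> B"
  shows "p y \<le> 1 + B"
proof -
  have "(p y - B) * 1 = (\<integral>z. (p y - B) * indicator {y..y+1} z \<partial>lborel)"
    by simp
  also have "\<dots> \<le> (\<integral>z. p z \<partial>lborel)"
  proof (rule integral_mono)
    show "integrable lborel (\<lambda>z. (p y - B) * indicator {y..y+1} z)" by simp
    show "(p y - B) * indicator {y..y+1} z \<le> p z" for z
    proof (cases "z \<in> {y..y+1}")
      case True
      then have "B * \<bar>y - z\<bar> \<le> B * 1" using B by (intro mult_left_mono) auto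
      then show ?thesis using lip[of y z] True by (simp add: abs_le_iff)
    qed (use p(3) in simp)
  qed (rule p(1))
  finally show ?thesis using p(2) by simp
qed

lemma smoothing_exists:
  assumes K: "\<forall>u. K u \<ge> 0" "bounded (range K)" "has_bochner_integral lborel K 1"
      "has_bochner_integral lborel (\<lambda>u. u * K u) 0" "integrable lborel (\<lambda>u. u\<^sup>2 * K u)"
    and p: "integrable lborel p" "(\<integral>y. p y \<partial>lborel) = 1" "\<And>y. 0 \<le> p y" "twice_differentiable_bounded p"
    and m: "twice_differentiable_bounded m"
  obtains BK Bp Bm m1 where "smoothing K p m BK Bp Bm m1 x"
proof -
  obtain Bp p' where P: "\<And>y y'. \<bar>p y - p y'\<bar> \<le> Bp * \<bar>y - y'\<bar>"
      "\<And>y y' w w'. \<bar>(p (y - w) - p (y - w')) - (p (y' - w) - p (y' - w'))\<bar> \<le> Bp * \<bar>y - y'\<bar> * \<bar>w - w'\<bar>"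
      "p \<in> borel_measurable borel" "0 \<le> Bp"
    using twice_differentiable_boundedE[OF p(4)] by metis
  obtain Bm m' where Mm: "\<And>y y'. \<bar>m y - m y'\<bar> \<le> Bm * \<bar>y - y'\<bar>"
      "\<And>y z. \<bar>m y - m z - m' z * (y - z)\<bar> \<le> Bm * (y - z)\<^sup>2" "m \<in> borel_measurable borel"
    using twice_differentiable_boundedE[OF m] by metis
  obtain BK where BK: "\<And>u. \<bar>K u\<bar> \<le> BK" using K(2) unfolding bounded_iff by auto
  \<comment> \<open>1 + Bp bounds the density as well as its differences, so one constant serves all
    three conditions.\<close>
  have "smoothing K p m BK (1 + Bp) Bm (m' x) x"
  proof
    show "K u \<le> BK" for u using BK[of u] by simp
    show "p y \<le> 1 + Bp" for y by (rule lipschitz_density_bounded[OF p(1-3) P(1,4)])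
    show "\<bar>p y - p y'\<bar> \<le> (1 + Bp) * \<bar>y - y'\<bar>" for y y'
      using P(1)[of y y'] by (simp add: distrib_right add_increasing)
    show "\<bar>(p (y - w) - p (y - w')) - (p (y' - w) - p (y' - w'))\<bar> \<le> (1 + Bp) * \<bar>y - y'\<bar> * \<bar>w - w'\<bar>" for y y' w w'
      using P(2)[of y w w' y'] by (simp add: distrib_right add_increasing)
  qed (use K p(3) P(3) Mm in \<open>auto simp: has_bochner_integral_iff\<close>)
  then show thesis by (rule that)
qed

text \<open>In the long memory design this is the density of the innovation. The derivatives contain
  y p(y) and y^2 p(y), which are bounded through t exp (-t) <= 1.\<close>

lemma twice_differentiable_bounded_normal:
  assumes \<sigma>: "\<sigma> > 0"
  shows "twice_differentiable_bounded (normal_density 0 \<sigma>)"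
proof -
  define C where "C = 1 / sqrt (2 * pi * \<sigma>\<^sup>2)"
  define p where "p y = C * exp (- y\<^sup>2 / (2 * \<sigma>\<^sup>2))" for y :: real
  have np: "normal_density 0 \<sigma> = p" by (simp add: fun_eq_iff normal_density_def p_def C_def)
  have C: "0 < C" unfolding C_def using \<sigma> by simp
  have p0: "0 \<le> p y" "p y \<le> C" for y unfolding p_def using C \<sigma> by (auto simp: mult_le_cancel_left2)
  have d1: "(p has_real_derivative (- y / \<sigma>\<^sup>2 * p y)) (at y)" for y
    unfolding p_def[abs_def] using \<sigma> by (auto intro!: derivative_eq_intros simp: power2_eq_square field_simps)
  have d2: "((\<lambda>y. - y / \<sigma>\<^sup>2 * p y) has_real_derivative (- 1 / \<sigma>\<^sup>2 * p y + (- y / \<sigma>\<^sup>2) * (- y / \<sigma>\<^sup>2 * p y))) (at y)" for y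
  proof -
    have "((\<lambda>y. - y / \<sigma>\<^sup>2) has_real_derivative - 1 / \<sigma>\<^sup>2) (at y)"
      by (rule DERIV_cdivide[OF DERIV_minus[OF DERIV_ident]])
    from DERIV_mult'[OF this d1[of y]] show ?thesis by (simp only: add.commute)
  qed
  have y2: "y\<^sup>2 * p y \<le> 2 * \<sigma>\<^sup>2 * C" for y
  proof -
    let ?t = "y\<^sup>2 / (2 * \<sigma>\<^sup>2)"
    have "?t \<le> exp ?t" using exp_ge_add_one_self[of ?t] by linarith
    then have "?t * exp (- ?t) \<le> 1" using mult_right_mono[of ?t "exp ?t" "exp (- ?t)"] by (simp flip: exp_add)
    then have "2 * \<sigma>\<^sup>2 * C * (?t * exp (- ?t)) \<le> 2 * \<sigma>\<^sup>2 * C * 1" using C by (intro mult_left_mono) auto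
    moreover have "2 * \<sigma>\<^sup>2 * C * (?t * exp (- ?t)) = y\<^sup>2 * p y" using \<sigma> by (simp add: p_def)
    ultimately show ?thesis by simp
  qed
  have b1: "bounded (range (\<lambda>y. - y / \<sigma>\<^sup>2 * p y))"
  proof (rule boundedI, safe)
    fix y :: real
    have "\<bar>y\<bar> \<le> 1 + y\<^sup>2" using zero_le_power2[of "\<bar>y\<bar> - 1"] by (simp add: power2_diff)
    then have "\<bar>y\<bar> * p y \<le> p y + y\<^sup>2 * p y" using mult_right_mono[of "\<bar>y\<bar>" "1 + y\<^sup>2" "p y"] p0 by (simp add: distrib_right)
    also have "\<dots> \<le> C + 2 * \<sigma>\<^sup>2 * C" using p0 y2 by (intro add_mono) auto
    finally have "\<bar>y\<bar> * p y / \<sigma>\<^sup>2 \<le> (C + 2 * \<sigma>\<^sup>2 * C) / \<sigma>\<^sup>2" by (intro divide_right_mono) auto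
    then show "norm (- y / \<sigma>\<^sup>2 * p y) \<le> (C + 2 * \<sigma>\<^sup>2 * C) / \<sigma>\<^sup>2" using p0 by (simp add: abs_mult)
  qed
  have b2: "bounded (range (\<lambda>y. - 1 / \<sigma>\<^sup>2 * p y + (- y / \<sigma>\<^sup>2) * (- y / \<sigma>\<^sup>2 * p y)))"
  proof (rule boundedI, safe)
    fix y :: real
    have e: "(- y / \<sigma>\<^sup>2) * (- y / \<sigma>\<^sup>2 * p y) = (y\<^sup>2 * p y) / (\<sigma>\<^sup>2 * \<sigma>\<^sup>2)" by (simp add: power2_eq_square)
    have "\<bar>- 1 / \<sigma>\<^sup>2 * p y\<bar> \<le> C / \<sigma>\<^sup>2" using p0[of y] \<sigma> by (simp add: abs_mult divide_right_mono)
    moreover have "\<bar>(y\<^sup>2 * p y) / (\<sigma>\<^sup>2 * \<sigma>\<^sup>2)\<bar> \<le> 2 * \<sigma>\<^sup>2 * C / (\<sigma>\<^sup>2 * \<sigma>\<^sup>2)"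
      using y2[of y] p0[of y] by (simp add: divide_right_mono)
    ultimately show "norm (- 1 / \<sigma>\<^sup>2 * p y + (- y / \<sigma>\<^sup>2) * (- y / \<sigma>\<^sup>2 * p y)) \<le> C / \<sigma>\<^sup>2 + 2 * \<sigma>\<^sup>2 * C / (\<sigma>\<^sup>2 * \<sigma>\<^sup>2)"
      unfolding e real_norm_def by (intro order_trans[OF abs_triangle_ineq] add_mono)
  qed
  show ?thesis
    unfolding np twice_differentiable_bounded_def
    by (intro exI[of _ "\<lambda>y. - y / \<sigma>\<^sup>2 * p y"] exI[of _ "\<lambda>y. - 1 / \<sigma>\<^sup>2 * p y + (- y / \<sigma>\<^sup>2) * (- y / \<sigma>\<^sup>2 * p y)"] conjI allI d1 d2 b1 b2)
qed

section \<open>Error sums, stationarity and coefficient bounds\<close>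

lemma (in prob_space) small_oP_cong_AE:
  assumes [measurable]: "\<And>n. Z n \<in> borel_measurable M" "\<And>n. X n \<in> borel_measurable M"
    and eq: "\<And>n. AE \<omega> in M. Z n \<omega> = X n \<omega>" and X: "small_oP M X"
  shows "small_oP M Z"
  unfolding small_oP_def
proof safe
  fix e :: real assume e: "e > 0"
  have "prob {\<omega> \<in> space M. \<bar>Z n \<omega>\<bar> > e} = prob {\<omega> \<in> space M. \<bar>X n \<omega>\<bar> > e}" for n
    by (rule measure_eq_AE) (use eq[of n] in \<open>auto elim!: eventually_mono\<close>)
  then show "(\<lambda>n. prob {\<omega> \<in> space M. \<bar>Z n \<omega>\<bar> > e}) \<longlonglongrightarrow> 0"
    using X e unfolding small_oP_def by simp
qed

text \<open>Subtracting the first sum from the second eliminates the conditional expectations, here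
  \<open>E\<close>, and leaves the errors.\<close>

lemma (in prob_space) small_oP_sum_errors:
  fixes e :: "nat \<Rightarrow> 'a \<Rightarrow> real" and E :: "nat \<Rightarrow> 'a \<Rightarrow> real"
  assumes [measurable]: "\<And>i. e i \<in> borel_measurable M" and Em: "\<And>i. E i \<in> borel_measurable M"
    and e'm: "\<And>i. i \<ge> 1 \<Longrightarrow> e' i \<in> borel_measurable M"
    and e': "\<And>i. AE \<omega> in M. e' (Suc i) \<omega> = e i \<omega>"
    and 1: "small_oP M (\<lambda>n \<omega>. c n * (\<Sum>i=1..n. E i \<omega> - e' i \<omega>))" and 2: "small_oP M (\<lambda>n \<omega>. c n * (\<Sum>i=1..n. E i \<omega>))"
  shows "small_oP M (\<lambda>n \<omega>. c n * (\<Sum>i<n. e i \<omega>))"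
proof (rule small_oP_cong_AE)
  have m1: "(\<lambda>\<omega>. c n * (\<Sum>i=1..n. E i \<omega> - e' i \<omega>)) \<in> borel_measurable M" and m2: "(\<lambda>\<omega>. c n * (\<Sum>i=1..n. E i \<omega>)) \<in> borel_measurable M" for n
    by (intro borel_measurable_times borel_measurable_const borel_measurable_sum borel_measurable_diff Em e'm; simp)+
  have m1': "(\<lambda>\<omega>. (- 1) * (c n * (\<Sum>i=1..n. E i \<omega> - e' i \<omega>))) \<in> borel_measurable M" for n by (rule borel_measurable_times[OF borel_measurable_const m1])
  show "small_oP M (\<lambda>n \<omega>. (- 1) * (c n * (\<Sum>i=1..n. E i \<omega> - e' i \<omega>)) + c n * (\<Sum>i=1..n. E i \<omega>))"
    by (rule small_oP_add[OF m1' m2 small_oP_bounded_mult[OF m1 1, of "\<lambda>_. -1" 1] 2]) simp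
  show "(\<lambda>\<omega>. (- 1) * (c n * (\<Sum>i=1..n. E i \<omega> - e' i \<omega>)) + c n * (\<Sum>i=1..n. E i \<omega>)) \<in> borel_measurable M" for n
    by (rule borel_measurable_add[OF m1' m2])
  fix n
  have "AE \<omega> in M. \<forall>i\<in>{..<n}. e' (Suc i) \<omega> = e i \<omega>" by (rule AE_finite_allI) (auto intro: e')
  then show "AE \<omega> in M. c n * (\<Sum>i<n. e i \<omega>) = (- 1) * (c n * (\<Sum>i=1..n. E i \<omega> - e' i \<omega>)) + c n * (\<Sum>i=1..n. E i \<omega>)"
  proof eventually_elim
    case (elim \<omega>)
    have "(\<Sum>i<n. e i \<omega>) = (\<Sum>i=1..n. e' i \<omega>)"
      unfolding One_nat_def sum.atLeast1_atMost_eq using elim by (intro sum.cong) auto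
    then show ?case by (simp add: sum_subtractf algebra_simps)
  qed
qed measurable

context iid_seq begin

lemma functional_distr:
  fixes G :: "(nat \<Rightarrow> 's) \<Rightarrow> real"
  assumes [measurable]: "G \<in> borel_measurable PS"
  shows "distr M borel (\<lambda>\<omega>. G (past i \<omega>)) = distr law borel G"
  using distr_distr[of G PS borel "past i" M] distr_past[of i] by (simp add: comp_def)

lemma functional_lln:
  fixes G :: "(nat \<Rightarrow> 's) \<Rightarrow> real"
  assumes [measurable]: "G \<in> borel_measurable PS"
  shows "(\<lambda>n. expectation (\<lambda>\<omega>. \<bar>1 / real n * (\<Sum>i<n. (trunc B (G (past (int i + 1) \<omega>)))\<^sup>2)
      - expectation (\<lambda>\<omega>. (trunc B (G (past (int 0 + 1) \<omega>)))\<^sup>2)\<bar>)) \<longlonglongrightarrow> 0"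
proof -
  interpret L: prob_space law by (rule prob_space_law)
  have m: "(\<lambda>z. (trunc B (G z))\<^sup>2) \<in> borel_measurable PS" by measurable
  have "integrable law (\<lambda>z. (trunc B (G z))\<^sup>2)"
  proof (rule L.integrable_const_bound[where B="B\<^sup>2"])
    have "(trunc B y)\<^sup>2 \<le> B\<^sup>2" for y using power_mono[of "\<bar>y\<bar>" B 2] by (simp add: trunc_def)
    then show "AE z in law. norm ((trunc B (G z))\<^sup>2) \<le> B\<^sup>2" by simp
  qed measurable
  from lln[OF this] show ?thesis
    unfolding lln_holds_def avg_def using past_integrable(2)[OF m, of "int 0 + 1"] by simp
qed

end

context noise begin

text \<open>Convergence is an event of the past, and all pasts have one law; so almost sure
  convergence at a single time \<open>j\<close> gives it at every integer time, including those
  before the observations begin.\<close>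

lemma linear_sums_stationary:
  fixes c :: "nat \<Rightarrow> real"
  assumes "AE \<omega> in M. summable (\<lambda>k. c k * \<eta> (j - int k) \<omega>)"
  shows "AE \<omega> in M. (\<lambda>k. c k * \<eta> (i - int k) \<omega>) sums (\<Sum>k. c k * \<eta> (i - int k) \<omega>)"
proof -
  \<comment> \<open>Convergence spelled out with countably many conditions, which makes it a
    measurable predicate on sequences.\<close>
  let ?A = "\<lambda>z :: nat \<Rightarrow> real. \<forall>r. \<exists>N. \<forall>n\<ge>N. \<bar>(\<Sum>k<n. c k * z k) - (\<Sum>k. c k * z k)\<bar> < 1 / real (Suc r)"
  have [measurable]: "(\<lambda>z. z k) \<in> borel_measurable PS" for k :: nat by (rule measurable_component_singleton) simp
  have pm: "Measurable.pred PS ?A" by measurable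
  have A: "?A z \<longleftrightarrow> (\<lambda>k. c k * z k) sums (\<Sum>k. c k * z k)" for z
  proof
    assume a: "?A z"
    show "(\<lambda>k. c k * z k) sums (\<Sum>k. c k * z k)"
      unfolding sums_def
    proof (rule LIMSEQ_I)
      fix r :: real assume "r > 0"
      then obtain s where s: "1 / real (Suc s) < r" using nat_approx_posE by blast
      obtain N where "\<forall>n\<ge>N. \<bar>(\<Sum>k<n. c k * z k) - (\<Sum>k. c k * z k)\<bar> < 1 / real (Suc s)" using a by blast
      then show "\<exists>no. \<forall>n\<ge>no. norm ((\<Sum>k<n. c k * z k) - (\<Sum>k. c k * z k)) < r" using s by (intro exI[of _ N]) force
    qed
  next
    assume a: "(\<lambda>k. c k * z k) sums (\<Sum>k. c k * z k)"
    show "?A z"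
    proof
      fix r
      show "\<exists>N. \<forall>n\<ge>N. \<bar>(\<Sum>k<n. c k * z k) - (\<Sum>k. c k * z k)\<bar> < 1 / real (Suc r)"
        using LIMSEQ_D[OF a[unfolded sums_def], of "1 / real (Suc r)"] by simp
    qed
  qed
  have "AE \<omega> in M. ?A (past j \<omega>)"
    using assms unfolding A by eventually_elim (simp add: past_def summable_sums)
  then have "AE z in law. ?A z"
    unfolding distr_past[of j, symmetric] by (subst AE_distr_iff) (use pm in auto)
  then have "AE \<omega> in M. ?A (past i \<omega>)"
    unfolding distr_past[of i, symmetric] by (subst (asm) AE_distr_iff) (use pm in auto)
  then show ?thesis unfolding A by (simp add: past_def)
qed

lemma linear_processI:
  assumes "summable (\<lambda>k. (c k)\<^sup>2)" "AE \<omega> in M. summable (\<lambda>k. c k * \<eta> (j - int k) \<omega>)"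
  shows "linear_process M \<eta> c (\<lambda>i \<omega>. \<Sum>k. c k * \<eta> (i - int k) \<omega>)"
  by (intro linear_process.intro noise_axioms linear_process_axioms.intro assms(1) linear_sums_stationary[OF assms(2)]) measurable

end

context linear_process begin

lemma U_mean: "expectation (U i) = 0"
proof -
  have l: "\<And>w w'. \<bar>w - w'\<bar> \<le> 1 * \<bar>w - w' :: real\<bar>" by simp
  have lim: "(\<lambda>N. expectation (\<lambda>\<omega>. partial N i \<omega> * 1)) \<longlonglongrightarrow> expectation (\<lambda>\<omega>. U i \<omega> * 1)"
    by (rule product_L2_limit) (simp_all add: U_square lipschitz_partial_error[OF l])
  have "expectation (partial N i) = 0" for N
    unfolding partial_def[abs_def]
    by (subst Bochner_Integration.integral_sum) (simp_all add: \<eta>_integrable \<eta>_mean)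
  with lim have "(\<lambda>N :: nat. 0 :: real) \<longlonglongrightarrow> expectation (U i)" by simp
  from LIMSEQ_unique[OF tendsto_const this] show ?thesis by simp
qed

lemma U_covariance: "\<bar>expectation (\<lambda>\<omega>. U i \<omega> * U j \<omega>)\<bar> \<le> 2 * \<sigma>2 * acov (nat \<bar>j - i\<bar>)"
  using covariance[of "\<lambda>y. y" 1 "\<lambda>y. y" 1 i j] by (simp add: U_mean)

text \<open>A bound uniform in the lag: in the cross term the regressor covariances are treated as
  constants, and the decay comes from the error covariances.\<close>

lemma acov_bounded: "acov k \<le> 2 * tail 0"
proof -
  have s: "summable (\<lambda>l. (c (l + k))\<^sup>2)" by (rule summable_ignore_initial_segment[OF c2])
  have "acov k \<le> (\<Sum>l. (c l)\<^sup>2 + (c (l + k))\<^sup>2)"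
    unfolding acov_def
  proof (rule suminf_le[OF _ acov_summable])
    show "\<bar>c l\<bar> * \<bar>c (l + k)\<bar> \<le> (c l)\<^sup>2 + (c (l + k))\<^sup>2" for l
      using abs_mult_le_squares[of "c l" "c (l + k)"] by (simp add: abs_mult)
    show "summable (\<lambda>l. (c l)\<^sup>2 + (c (l + k))\<^sup>2)" by (rule summable_add[OF c2 s])
  qed
  also have "\<dots> = tail 0 + tail k" unfolding tail_def using suminf_add[OF c2 s] by simp
  also have "tail k \<le> tail 0"
    unfolding tail_def using suminf_split_initial_segment[OF c2, of k] sum_nonneg[of "{..<k}" "\<lambda>i. (c i)\<^sup>2"] by simp
  finally show ?thesis by simp
qed

lemma \<sigma>2_pos: "expectation (\<lambda>\<omega>. (U i \<omega>)\<^sup>2) \<noteq> 0 \<Longrightarrow> 0 < \<sigma>2"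
proof (rule ccontr)
  assume nz: "expectation (\<lambda>\<omega>. (U i \<omega>)\<^sup>2) \<noteq> 0" and "\<not> 0 < \<sigma>2"
  then have z: "\<sigma>2 = 0" using \<sigma>2_nonneg by simp
  have "expectation (\<lambda>\<omega>. (U i \<omega>)\<^sup>2) \<le> 0" using partial_error(2)[of 0 i] by (simp add: z partial_def)
  moreover have "0 \<le> expectation (\<lambda>\<omega>. (U i \<omega>)\<^sup>2)" by simp
  ultimately show False using nz by simp
qed

end

lemma asymp_equiv_powr_bound:
  fixes c :: "nat \<Rightarrow> real"
  assumes "c \<sim>[sequentially] (\<lambda>k. C * real k powr (- \<beta>))"
  obtains D where "0 \<le> D" "\<And>k. 1 \<le> k \<Longrightarrow> \<bar>c k\<bar> \<le> D * real k powr (- \<beta>)"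
proof -
  have "c \<in> O(\<lambda>k. C * real k powr (- \<beta>))" using assms by (rule asymp_equiv_imp_bigo)
  then obtain A where A: "A > 0" "\<forall>\<^sub>F k in sequentially. norm (c k) \<le> A * norm (C * real k powr (- \<beta>))"
    by (rule landau_o.bigE)
  then obtain k0 where k0: "\<And>k. k \<ge> k0 \<Longrightarrow> \<bar>c k\<bar> \<le> A * \<bar>C\<bar> * real k powr (- \<beta>)"
    unfolding eventually_sequentially by (auto simp: abs_mult mult.assoc)
  \<comment> \<open>The finitely many indices below \<open>k0\<close> are paid for by adding their
    normalized sizes.\<close>
  define D where "D = A * \<bar>C\<bar> + (\<Sum>k<k0. \<bar>c k\<bar> * real k powr \<beta>)"
  have S: "0 \<le> (\<Sum>k<k0. \<bar>c k\<bar> * real k powr \<beta>)" by (intro sum_nonneg) auto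
  have "\<bar>c k\<bar> \<le> D * real k powr (- \<beta>)" if k: "1 \<le> k" for k
  proof (cases "k < k0")
    case False
    then have "\<bar>c k\<bar> \<le> A * \<bar>C\<bar> * real k powr (- \<beta>)" using k0 by simp
    also have "\<dots> \<le> D * real k powr (- \<beta>)" unfolding D_def using S by (intro mult_right_mono) auto
    finally show ?thesis .
  next
    case True
    have "\<bar>c k\<bar> = (\<bar>c k\<bar> * real k powr \<beta>) * real k powr (- \<beta>)" using k by (simp add: mult.assoc flip: powr_add)
    also have "\<dots> \<le> D * real k powr (- \<beta>)"
    proof (intro mult_right_mono)
      have "\<bar>c k\<bar> * real k powr \<beta> \<le> (\<Sum>k<k0. \<bar>c k\<bar> * real k powr \<beta>)" using True by (intro member_le_sum) auto
      then show "\<bar>c k\<bar> * real k powr \<beta> \<le> D" unfolding D_def using A(1) by (simp add: add_increasing)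
    qed simp
    finally show ?thesis .
  qed
  moreover have "0 \<le> D" unfolding D_def using A(1) S by simp
  ultimately show thesis using that by blast
qed

lemma scaled_bound_tendsto_0:
  fixes b S :: "nat \<Rightarrow> real"
  assumes S: "\<And>n. 0 \<le> S n" "\<And>n. S n \<le> D * real n powr r" and b: "(\<lambda>n. b n * real n powr r) \<longlonglongrightarrow> 0"
  shows "(\<lambda>n. b n * S n) \<longlonglongrightarrow> 0"
proof (rule Lim_null_comparison)
  show "\<forall>\<^sub>F n in sequentially. norm (b n * S n) \<le> \<bar>D\<bar> * \<bar>b n * real n powr r\<bar>"
  proof (rule always_eventually, rule allI)
    fix n
    have "S n \<le> \<bar>D\<bar> * real n powr r" by (rule order_trans[OF S(2)]) (intro mult_right_mono, auto)
    then have "\<bar>b n\<bar> * S n \<le> \<bar>b n\<bar> * (\<bar>D\<bar> * real n powr r)" by (intro mult_left_mono) auto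
    then show "norm (b n * S n) \<le> \<bar>D\<bar> * \<bar>b n * real n powr r\<bar>" using S(1)[of n] by (simp add: abs_mult mult_ac)
  qed
  show "(\<lambda>n. \<bar>D\<bar> * \<bar>b n * real n powr r\<bar>) \<longlonglongrightarrow> 0" using b by (intro tendsto_mult_right_zero tendsto_rabs_zero)
qed

context noise begin

lemma linear_functional_measurable: "(\<lambda>z. \<Sum>k. c k * z k) \<in> borel_measurable PS" for c :: "nat \<Rightarrow> real"
proof -
  have [measurable]: "(\<lambda>z. z k) \<in> borel_measurable PS" for k :: nat by (rule measurable_component_singleton) simp
  show ?thesis by measurable
qed

lemma linear_distr:
  fixes c :: "nat \<Rightarrow> real"
  shows "distr M borel (\<lambda>\<omega>. \<Sum>k. c k * \<eta> (i - int k) \<omega>) = distr M borel (\<lambda>\<omega>. \<Sum>k. c k * \<eta> (j - int k) \<omega>)"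
  using functional_distr[OF linear_functional_measurable, of c i] functional_distr[OF linear_functional_measurable, of c j]
  by (simp add: past_def)

lemma linear_lln:
  fixes c :: "nat \<Rightarrow> real"
  shows "(\<lambda>n. expectation (\<lambda>\<omega>. \<bar>1 / real n * (\<Sum>i<n. (trunc B (\<Sum>k. c k * \<eta> (int i + 1 - int k) \<omega>))\<^sup>2)
      - expectation (\<lambda>\<omega>. (trunc B (\<Sum>k. c k * \<eta> (int 0 + 1 - int k) \<omega>))\<^sup>2)\<bar>)) \<longlonglongrightarrow> 0"
  using functional_lln[OF linear_functional_measurable, of B c] by (simp only: past_def)

text \<open>Because a 0 = 0, the sum at time i + 1 uses the noise up to time i and is
  predictable.\<close>

lemma linear_innovations:
  fixes a :: "nat \<Rightarrow> real" and p :: "real \<Rightarrow> real"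
  assumes a0: "a 0 = 0" and dens: "\<And>j. distr M borel (\<eta> j) = density lborel (\<lambda>y. ennreal (p y))"
    and p: "\<And>y. 0 \<le> p y" "p \<in> borel_measurable borel"
  shows "innovations M (\<lambda>i. generated_sigma M borel {..int i} \<eta>) (\<lambda>i. \<eta> (int i + 1))
      (\<lambda>i \<omega>. \<Sum>k. a k * \<eta> (int i + 1 - int k) \<omega>) p"
proof (intro innovations.intro innovations_axioms.intro prob_space_axioms)
  fix i :: nat
  let ?F = "generated_sigma M borel {..int i} \<eta>"
  show "innovation M ?F (\<eta> (int i + 1)) (\<lambda>\<omega>. \<Sum>k. a k * \<eta> (int i + 1 - int k) \<omega>) p"
  proof (intro innovation.intro innovation_axioms.intro prob_space_axioms)
    show "subalgebra M ?F" by (rule subalgebra_generated_sigma) simp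
    have [measurable]: "(\<lambda>\<omega>. a k * \<eta> (int i + 1 - int k) \<omega>) \<in> borel_measurable ?F" for k
    proof (cases k)
      case (Suc l)
      have [measurable]: "\<eta> (int i + 1 - int k) \<in> borel_measurable ?F" by (rule generated_sigma_measurable) (auto simp: Suc)
      show ?thesis by measurable
    qed (simp add: a0)
    show "(\<lambda>\<omega>. \<Sum>k. a k * \<eta> (int i + 1 - int k) \<omega>) \<in> borel_measurable ?F" by measurable
    show "indep_set (sets ?F) (sets (vimage_algebra (space M) (\<eta> (int i + 1)) borel))"
      by (rule indep_set_mono[OF indep_set_generated_sigma[OF indep, of "{..int i}" "{int i + 1}"] order_refl sets_vimage_algebra_generated]) auto
  qed (use dens p in simp_all)
  show "\<eta> (int i + 1) \<in> borel_measurable (generated_sigma M borel {..int (Suc i)} \<eta>)"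
    by (rule generated_sigma_measurable) auto
next
  show "sets (generated_sigma M borel {..int i} \<eta>) \<subseteq> sets (generated_sigma M borel {..int j} \<eta>)" if "i \<le> j" for i j
    by (rule sets_generated_sigma_mono) (use that in auto)
qed

end

lemma (in linear_process) stationary_covariance:
  assumes g: "\<And>w w'. \<bar>g w - g w'\<bar> \<le> L * \<bar>w - w'\<bar>" and mean: "expectation (\<lambda>\<omega>. g (U l \<omega>)) = 0"
    and stationary: "\<And>i. distr M borel (U i) = distr M borel (U l)"
  shows "integrable M (\<lambda>\<omega>. g (U i \<omega>) * g (U j \<omega>)) \<and>
    \<bar>expectation (\<lambda>\<omega>. g (U i \<omega>) * g (U j \<omega>))\<bar> \<le> L\<^sup>2 * (2 * \<sigma>2 * acov (nat \<bar>j - i\<bar>))"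
proof
  have [measurable]: "g \<in> borel_measurable borel" using g by (rule lipschitz_borel_measurable)
  have "expectation (\<lambda>\<omega>. g (U i \<omega>)) = 0" for i
    using integral_distr[of "U i" M borel g] integral_distr[of "U l" M borel g] stationary[of i] mean by simp
  then show "\<bar>expectation (\<lambda>\<omega>. g (U i \<omega>) * g (U j \<omega>))\<bar> \<le> L\<^sup>2 * (2 * \<sigma>2 * acov (nat \<bar>j - i\<bar>))"
    using covariance[OF g g, of i j] by (simp add: power2_eq_square mult_ac)
  show "integrable M (\<lambda>\<omega>. g (U i \<omega>) * g (U j \<omega>))"
    by (intro integrable_mult_squares lipschitz_square_integrable[OF U_measurable U_square g]) measurable
qed

section \<open>Verification of the setting for both designs\<close>

locale regression_setup = prob_space M for M :: "'a measure" +
  fixes K m :: "real \<Rightarrow> real" and h :: "nat \<Rightarrow> real" and x :: real and X Y \<epsilon> :: "nat \<Rightarrow> 'a \<Rightarrow> real"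
  assumes K: "\<forall>u. K u \<ge> 0" "bounded (range K)" "has_bochner_integral lborel K 1"
      "has_bochner_integral lborel (\<lambda>u. u * K u) 0" "integrable lborel (\<lambda>u. u\<^sup>2 * K u)" "kernel_L2 K \<noteq> 0"
    and h: "h \<longlonglongrightarrow> 0" "filterlim (\<lambda>n. real n * h n) at_top sequentially"
    and m: "twice_differentiable_bounded m"
    and X\<epsilon>: "indep_families M borel {1..} X borel {1..} \<epsilon>"
    and Y: "\<forall>i\<ge>1. \<forall>\<omega>\<in>space M. Y i \<omega> = m (X i \<omega>) + \<epsilon> i \<omega>"
begin

lemma X_measurable: "i \<ge> 1 \<Longrightarrow> X i \<in> borel_measurable M" and \<epsilon>_measurable: "i \<ge> 1 \<Longrightarrow> \<epsilon> i \<in> borel_measurable M"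
  using X\<epsilon> by (auto simp: indep_families_def)

lemma density_total:
  assumes D: "distributed M lborel Z (\<lambda>y. ennreal (p y))" and p: "\<And>y. 0 \<le> p y" "p \<in> borel_measurable borel"
  shows "integrable lborel p" "(\<integral>y. p y \<partial>lborel) = 1" "distr M borel Z = density lborel (\<lambda>y. ennreal (p y))"
proof -
  show "integrable lborel p"
    using distributed_integrable[OF D, of "\<lambda>_. 1 :: real"] p by simp
  show "(\<integral>y. p y \<partial>lborel) = 1"
    using distributed_integral[OF D, of "\<lambda>_. 1 :: real"] p by (simp add: prob_space)
  have "distr M borel Z = distr M lborel Z" by (rule distr_cong) simp_all
  then show "distr M borel Z = density lborel (\<lambda>y. ennreal (p y))" using distributed_distr_eq_density[OF D] by simp
qed

lemma kernel_L2_pos: "kernel_L2 K > 0"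
proof -
  have "0 \<le> kernel_L2 K" unfolding kernel_L2_def by simp
  then show ?thesis using K(6) by simp
qed

lemma bandwidth_pos: "\<forall>\<^sub>F n in sequentially. h n > 0"
  using filterlim_at_top_dense[THEN iffD1, OF h(2), rule_format, of 0]
  by eventually_elim (auto simp: zero_less_mult_iff)

text \<open>The predictable part is 0, so a functional of mean zero vanishes along it, and \<gamma>
  = 0 satisfies every covariance condition; the smooth density is \<open>f\<close> itself.\<close>

lemma independent_design:
  fixes S :: "'b measure" and \<eta> :: "int \<Rightarrow> 'a \<Rightarrow> 'b"
  assumes f: "distributed M lborel (X 1) (\<lambda>y. ennreal (f y))" "\<forall>y. f y > 0" "twice_differentiable_bounded f"
    and X: "iid_family M borel {1..} X" and \<eta>: "iid_family M S UNIV \<eta>"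
    and G: "G \<in> borel_measurable (PiM UNIV (\<lambda>_. S))"
    and \<epsilon>G: "\<forall>i\<ge>1. \<forall>\<omega>\<in>space M. \<epsilon> i \<omega> = G (\<lambda>k. \<eta> (int i - int k) \<omega>)"
    and sq: "integrable M (\<lambda>\<omega>. (\<epsilon> 1 \<omega>)\<^sup>2)" "expectation (\<lambda>\<omega>. (\<epsilon> 1 \<omega>)\<^sup>2) = 1"
    and small: "small_oP M (\<lambda>n \<omega>. sqrt (real n * h n) / real n *
              (\<Sum>i=1..n. real_cond_exp M (past_sigma M S \<eta> (int i - 1)) (\<epsilon> i) \<omega> - \<epsilon> i \<omega>))"
      "small_oP M (\<lambda>n \<omega>. sqrt (real n * h n) / real n *
              (\<Sum>i=1..n. real_cond_exp M (past_sigma M S \<eta> (int i - 1)) (\<epsilon> i) \<omega>))"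
  shows "NW_asymp_normal M K h X Y m x"
proof -
  interpret N: iid_seq M S \<eta> using \<eta> by unfold_locales (auto simp: iid_family_def)
  define e where "e i \<omega> = G (N.past (int i + 1) \<omega>)" for i :: nat and \<omega>
  have em[measurable]: "e i \<in> borel_measurable M" for i
    unfolding e_def[abs_def] by (rule measurable_compose[OF N.past_measurable G])
  have \<epsilon>e: "\<epsilon> (Suc i) \<omega> = e i \<omega>" if "\<omega> \<in> space M" for i \<omega>
    using \<epsilon>G that by (simp add: e_def N.past_def add.commute)
  have \<epsilon>e': "AE \<omega> in M. \<epsilon> (Suc i) \<omega> = e i \<omega>" for i using \<epsilon>e by (intro AE_I2)
  have fm: "f \<in> borel_measurable borel" using twice_differentiable_boundedE[OF f(3)] by metis
  have f0: "0 \<le> f y" for y using f(2) by (simp add: less_imp_le)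
  note ft = density_total[OF f(1) f0 fm]
  obtain BK Bp Bm m1 where sm: "smoothing K f m BK Bp Bm m1 x"
    using smoothing_exists[OF K(1-5) ft(1,2) f0 f(3) m] by blast
  have Xind: "indep_vars (\<lambda>_. borel) X {1..}" and Xid: "distr M borel (X (Suc i)) = distr M borel (X 1)" for i
    using X by (auto simp: iid_family_def)
  have inn: "innovations M (\<lambda>i. generated_sigma M borel {1..i} X) (\<lambda>i. X (Suc i)) (\<lambda>_ _. 0) f"
  proof (intro innovations.intro innovations_axioms.intro prob_space_axioms)
    fix i :: nat
    show "innovation M (generated_sigma M borel {1..i} X) (X (Suc i)) (\<lambda>_. 0) f"
    proof (intro innovation.intro innovation_axioms.intro prob_space_axioms)
      show "subalgebra M (generated_sigma M borel {1..i} X)" by (rule subalgebra_generated_sigma) (simp add: X_measurable)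
      show "indep_set (sets (generated_sigma M borel {1..i} X)) (sets (vimage_algebra (space M) (X (Suc i)) borel))"
        by (rule indep_set_mono[OF indep_set_generated_sigma[OF Xind, of "{1..i}" "{Suc i}"] order_refl sets_vimage_algebra_generated]) auto
      show "distr M borel (X (Suc i)) = density lborel (\<lambda>y. ennreal (f y))" unfolding Xid by (rule ft(3))
    qed (use f0 fm in \<open>simp_all add: X_measurable\<close>)
    show "X (Suc i) \<in> borel_measurable (generated_sigma M borel {1..Suc i} X)"
      by (rule generated_sigma_measurable) (auto intro: X_measurable)
  next
    show "sets (generated_sigma M borel {1..i} X) \<subseteq> sets (generated_sigma M borel {1..j} X)" if "i \<le> j" for i j
      by (rule sets_generated_sigma_mono) (use that in auto)
  qed
  have e2: "integrable M (\<lambda>\<omega>. (e 0 \<omega>)\<^sup>2)" "expectation (\<lambda>\<omega>. (e 0 \<omega>)\<^sup>2) = 1"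
  proof -
    have "(\<epsilon> 1 \<omega>)\<^sup>2 = (e 0 \<omega>)\<^sup>2" if "\<omega> \<in> space M" for \<omega> using \<epsilon>e[OF that, of 0] by simp
    then show "integrable M (\<lambda>\<omega>. (e 0 \<omega>)\<^sup>2)" "expectation (\<lambda>\<omega>. (e 0 \<omega>)\<^sup>2) = 1"
      using sq Bochner_Integration.integrable_cong[OF refl, of M "\<lambda>\<omega>. (\<epsilon> 1 \<omega>)\<^sup>2" "\<lambda>\<omega>. (e 0 \<omega>)\<^sup>2"]
        Bochner_Integration.integral_cong[OF refl, of M "\<lambda>\<omega>. (\<epsilon> 1 \<omega>)\<^sup>2" "\<lambda>\<omega>. (e 0 \<omega>)\<^sup>2"] by simp_all
  qed
  have "nw_setting M (\<lambda>i. generated_sigma M borel {1..i} X) (\<lambda>i. X (Suc i)) (\<lambda>_ _. 0) f K m BK Bp Bm m1 x h e (\<lambda>_ _. 0)"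
  proof (intro nw_setting.intro nw_setting_axioms.intro inn sm h em e2)
    show "distr M borel (e i) = distr M borel (e 0)" for i
      using N.functional_distr[OF G] by (simp add: e_def[abs_def])
    show "(\<lambda>n. expectation (\<lambda>\<omega>. \<bar>1 / real n * (\<Sum>i<n. (trunc B (e i \<omega>))\<^sup>2) - expectation (\<lambda>\<omega>. (trunc B (e 0 \<omega>))\<^sup>2)\<bar>)) \<longlonglongrightarrow> 0" for B
      unfolding e_def by (rule N.functional_lln[OF G])
    show "small_oP M (\<lambda>n \<omega>. sqrt (real n * h n) / real n * (\<Sum>i<n. e i \<omega>))"
      by (rule small_oP_sum_errors[OF em borel_measurable_cond_exp2 \<epsilon>_measurable \<epsilon>e' small])
    show "0 < smoothing.\<kappa>1 K" using kernel_L2_pos by (simp add: smoothing.\<kappa>1_def[OF sm] kernel_L2_def)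
  qed (use f(2) in \<open>simp_all add: prob_space\<close>)
  then show ?thesis
    by (rule nw_setting.NW_asymp_normal_transfer[OF _ X\<epsilon> _ \<epsilon>e']) (use Y in auto)
qed


text \<open>Splitting off the current Gaussian innovation leaves a predictable linear process with
  the same power decay, and the Gaussian density supplies the smoothness. The bias condition is the
  hypothesis on h^5, while the cross condition is extracted from the negligible error sum.\<close>

lemma long_memory_design:
  fixes a c :: "nat \<Rightarrow> real" and \<zeta> \<eta> :: "int \<Rightarrow> 'a \<Rightarrow> real"
  assumes a: "a 0 = 1" "0 < \<alpha>X" "\<alpha>X < 1" "\<forall>k\<ge>1. a k = A0 * real k powr (- (\<alpha>X + 1) / 2)"
    and \<zeta>: "iid_family M borel UNIV \<zeta>" "\<sigma> > 0" "\<forall>j. distributed M lborel (\<zeta> j) (normal_density 0 \<sigma>)"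
    and X: "\<forall>i\<ge>1. AE \<omega> in M. (\<lambda>k. a k * \<zeta> (int i - int k) \<omega>) sums X i \<omega>"
    and c: "0 < \<alpha>" "\<alpha> < 1" "c \<sim>[sequentially] (\<lambda>k. C0 * real k powr (- (\<alpha> + 1) / 2))"
    and \<eta>: "iid_family M borel UNIV \<eta>" "\<forall>j. integrable M (\<eta> j) \<and> expectation (\<eta> j) = 0"
      "\<forall>j. integrable M (\<lambda>\<omega>. (\<eta> j \<omega>) ^ 4)"
    and \<epsilon>: "\<forall>i\<ge>1. AE \<omega> in M. (\<lambda>k. c k * \<eta> (int i - int k) \<omega>) sums \<epsilon> i \<omega>"
    and sq: "expectation (\<lambda>\<omega>. (\<epsilon> 1 \<omega>)\<^sup>2) = 1"
    and small: "small_oP M (\<lambda>n \<omega>. sqrt (real n * h n) / real n *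
              (\<Sum>i=1..n. real_cond_exp M (past_sigma M borel \<eta> (int i - 1)) (\<epsilon> i) \<omega> - \<epsilon> i \<omega>))"
      "small_oP M (\<lambda>n \<omega>. sqrt (real n * h n) / real n *
              (\<Sum>i=1..n. real_cond_exp M (past_sigma M borel \<eta> (int i - 1)) (\<epsilon> i) \<omega>))"
    and h5: "(\<lambda>n. h n ^ 5 * real n powr (1 - \<alpha>X)) \<longlonglongrightarrow> 0"
  shows "NW_asymp_normal M K h X Y m x"
proof -
  define p where "p = normal_density 0 \<sigma>"
  have p0: "0 \<le> p y" and ppos: "0 < p y" and pm: "p \<in> borel_measurable borel" for y
    using normal_density_pos[OF \<zeta>(2), of 0 y] by (simp_all add: p_def less_imp_le)
  have \<zeta>p: "distributed M lborel (\<zeta> j) (\<lambda>y. ennreal (p y))" for j using \<zeta>(3) by (simp add: p_def)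
  note pt = density_total[OF \<zeta>p p0 pm]
  obtain BK Bp Bm m1 where sm: "smoothing K p m BK Bp Bm m1 x"
    using smoothing_exists[OF K(1-5) pt(1,2) p0 twice_differentiable_bounded_normal[OF \<zeta>(2), folded p_def] m] by blast

  interpret Z: noise M \<zeta>
  proof (intro noise.intro iid_seq.intro iid_seq_axioms.intro noise_axioms.intro prob_space_axioms)
    show "indep_vars (\<lambda>_. borel) \<zeta> UNIV" "distr M borel (\<zeta> i) = distr M borel (\<zeta> j)" for i j
      using \<zeta>(1) by (auto simp: iid_family_def)
    show "integrable M (\<lambda>\<omega>. (\<zeta> 0 \<omega>)\<^sup>2)"
      using distributed_integrable[OF \<zeta>p, of "\<lambda>y. y\<^sup>2" 0] integrable_normal_moment[OF \<zeta>(2), of 0 2] p0 by (simp add: p_def)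
    show "expectation (\<zeta> 0) = 0"
      using distributed_integral[OF \<zeta>p, of "\<lambda>y. y" 0] integral_normal_moment_nz_1[OF \<zeta>(2), of 0] p0 by (simp add: p_def)
  qed
  \<comment> \<open>The current innovation has weight a 0 = 1 and is taken out of the
    series.\<close>
  define a' where "a' k = (if k = 0 then 0 else a k)" for k :: nat
  have a'0: "a' 0 = 0" by (simp add: a'_def)
  have a'b: "\<bar>a' k\<bar> \<le> \<bar>A0\<bar> * real k powr (- (\<alpha>X + 1) / 2)" if "1 \<le> k" for k
    using a(4) that by (simp add: a'_def abs_mult)
  define W where "W i \<omega> = (\<Sum>k. a' k * \<zeta> (i - int k) \<omega>)" for i :: int and \<omega>
  have a's: "AE \<omega> in M. (\<lambda>k. a' k * \<zeta> (int (Suc i) - int k) \<omega>) sums (X (Suc i) \<omega> - \<zeta> (int (Suc i)) \<omega>)" for i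
  proof -
    have "AE \<omega> in M. (\<lambda>k. a k * \<zeta> (int (Suc i) - int k) \<omega>) sums X (Suc i) \<omega>" using X[rule_format, of "Suc i"] by simp
    then show ?thesis
    proof eventually_elim
      case (elim \<omega>)
      have "(\<lambda>k. if k = 0 then \<zeta> (int (Suc i) - int k) \<omega> else 0) sums \<zeta> (int (Suc i)) \<omega>"
        using sums_single[of 0 "\<lambda>k. \<zeta> (int (Suc i) - int k) \<omega>"] by simp
      from sums_diff[OF elim this] show ?case
        by (rule sums_cong[THEN iffD1, rotated]) (simp add: a'_def a(1))
    qed
  qed
  have lpW: "linear_process M \<zeta> a' W"
    unfolding W_def[abs_def]
  proof (rule Z.linear_processI)
    show "summable (\<lambda>k. (a' k)\<^sup>2)" by (rule summable_square_powr[OF a(2) a'b])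
    show "AE \<omega> in M. summable (\<lambda>k. a' k * \<zeta> (int (Suc 0) - int k) \<omega>)"
      using a's[of 0] by eventually_elim (rule sums_summable)
  qed
  interpret W: linear_process M \<zeta> a' W by (rule lpW)
  have XW: "AE \<omega> in M. X (Suc i) \<omega> = W (int i + 1) \<omega> + \<zeta> (int i + 1) \<omega>" for i
    using a's[of i]
  proof eventually_elim
    case (elim \<omega>)
    then show ?case unfolding W_def by (simp add: sums_iff add.commute)
  qed
  have Wd: "distr M borel (W i) = distr M borel (W j)" for i j
    unfolding W_def[abs_def] by (rule Z.linear_distr)
  have inn: "innovations M (\<lambda>i. generated_sigma M borel {..int i} \<zeta>) (\<lambda>i. \<zeta> (int i + 1)) (\<lambda>i. W (int i + 1)) p"
    unfolding W_def[abs_def] by (rule Z.linear_innovations[where a=a' and p=p, OF a'0 pt(3) p0 pm])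
  define \<gamma> where "\<gamma> i j = 2 * Z.\<sigma>2 * W.acov (nat \<bar>int j - int i\<bar>)" for i j :: nat
  have \<gamma>0: "0 \<le> \<gamma> i j" and \<gamma>b: "\<gamma> i j \<le> 2 * Z.\<sigma>2 * (2 * W.tail 0)" for i j
    unfolding \<gamma>_def using Z.\<sigma>2_nonneg by (simp add: W.acov_nonneg) (intro mult_left_mono W.acov_bounded, simp add: Z.\<sigma>2_nonneg)
  obtain D where D: "\<And>n. (\<Sum>i<n. \<Sum>j<n. W.acov (nat \<bar>int j - int i\<bar>)) \<le> D * real n powr (2 - \<alpha>X)"
    using W.acov_double_sum_le[OF a(2,3) a'b] by blast
  have \<gamma>D: "(\<Sum>i<n. \<Sum>j<n. \<gamma> i j) \<le> (2 * Z.\<sigma>2 * D) * real n powr (2 - \<alpha>X)" for n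
    using mult_left_mono[OF D[of n], of "2 * Z.\<sigma>2"] Z.\<sigma>2_nonneg by (simp add: \<gamma>_def sum_distrib_left mult.assoc)
  have \<gamma>S: "0 \<le> (\<Sum>i<n. \<Sum>j<n. \<gamma> i j)" for n by (intro sum_nonneg \<gamma>0)
  have powr_shift: "1 / real n * real n powr (2 - \<beta>) = real n powr (1 - \<beta>)" for n :: nat and \<beta>
  proof (cases "n = 0")
    case False
    have "real n powr (2 - \<beta>) = real n powr (1 + (1 - \<beta>))" by (simp add: algebra_simps)
    then show ?thesis using False by (simp only: powr_add) simp
  qed simp

  interpret N: noise M \<eta>
  proof (intro noise.intro iid_seq.intro iid_seq_axioms.intro noise_axioms.intro prob_space_axioms)
    show "indep_vars (\<lambda>_. borel) \<eta> UNIV" "distr M borel (\<eta> i) = distr M borel (\<eta> j)" for i j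
      using \<eta>(1) by (auto simp: iid_family_def)
    then have [measurable]: "\<eta> 0 \<in> borel_measurable M" by (auto simp: indep_vars_def)
    show "integrable M (\<lambda>\<omega>. (\<eta> 0 \<omega>)\<^sup>2)"
    proof (rule Bochner_Integration.integrable_bound)
      show "integrable M (\<lambda>\<omega>. 1 + (\<eta> 0 \<omega>) ^ 4)" using \<eta>(3) by simp
      have "y\<^sup>2 \<le> 1 + y ^ 4" for y :: real
      proof -
        have "2 * y\<^sup>2 \<le> y ^ 4 + 1" using zero_le_power2[of "y\<^sup>2 - 1"] by (simp add: power2_diff)
        with zero_le_power2[of y] show ?thesis by linarith
      qed
      then show "AE \<omega> in M. norm ((\<eta> 0 \<omega>)\<^sup>2) \<le> norm (1 + (\<eta> 0 \<omega>) ^ 4)" by simp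
    qed measurable
    show "expectation (\<eta> 0) = 0" using \<eta>(2) by simp
  qed
  have i3: "integrable M (\<lambda>\<omega>. \<bar>\<eta> 0 \<omega>\<bar> ^ 3)"
  proof (rule Bochner_Integration.integrable_bound)
    show "integrable M (\<lambda>\<omega>. 1 + (\<eta> 0 \<omega>) ^ 4)" using \<eta>(3) by simp
    have "\<bar>y\<bar> ^ 3 \<le> 1 + y ^ 4" for y :: real
    proof (cases "\<bar>y\<bar> \<le> 1")
      case True
      then have "\<bar>y\<bar> ^ 3 \<le> 1" by (intro power_le_one) auto
      then show ?thesis by (simp add: add_increasing2)
    next
      case False
      then have "\<bar>y\<bar> ^ 3 \<le> \<bar>y\<bar> ^ 4" by (intro power_increasing) auto
      then show ?thesis by simp
    qed
    then show "AE \<omega> in M. norm (\<bar>\<eta> 0 \<omega>\<bar> ^ 3) \<le> norm (1 + (\<eta> 0 \<omega>) ^ 4)" by simp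
  qed measurable
  obtain Cc where cb: "\<And>k. 1 \<le> k \<Longrightarrow> \<bar>c k\<bar> \<le> Cc * real k powr (- (\<alpha> + 1) / 2)"
    using asymp_equiv_powr_bound[of c C0 "(\<alpha> + 1) / 2"] c(3) unfolding minus_divide_left by blast
  define U where "U i \<omega> = (\<Sum>k. c k * \<eta> (i - int k) \<omega>)" for i :: int and \<omega>
  have lpU: "linear_process M \<eta> c U"
    unfolding U_def[abs_def]
  proof (rule N.linear_processI)
    show "summable (\<lambda>k. (c k)\<^sup>2)" by (rule summable_square_powr[OF c(1) cb])
    have "AE \<omega> in M. (\<lambda>k. c k * \<eta> (int 1 - int k) \<omega>) sums \<epsilon> 1 \<omega>" using \<epsilon> by blast
    then show "AE \<omega> in M. summable (\<lambda>k. c k * \<eta> (int 1 - int k) \<omega>)"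
      by eventually_elim (rule sums_summable)
  qed
  interpret U: linear_process M \<eta> c U by (rule lpU)
  have \<epsilon>U: "AE \<omega> in M. \<epsilon> (Suc i) \<omega> = U (int i + 1) \<omega>" for i
  proof -
    have "AE \<omega> in M. (\<lambda>k. c k * \<eta> (int (Suc i) - int k) \<omega>) sums \<epsilon> (Suc i) \<omega>" using \<epsilon>[rule_format, of "Suc i"] by simp
    then show ?thesis unfolding U_def by eventually_elim (simp add: sums_iff add.commute)
  qed
  have U1: "expectation (\<lambda>\<omega>. (U (int 0 + 1) \<omega>)\<^sup>2) = 1"
  proof -
    have "expectation (\<lambda>\<omega>. (\<epsilon> 1 \<omega>)\<^sup>2) = expectation (\<lambda>\<omega>. (U (int 0 + 1) \<omega>)\<^sup>2)"
    proof (rule integral_cong_AE)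
      show "(\<lambda>\<omega>. (\<epsilon> 1 \<omega>)\<^sup>2) \<in> borel_measurable M" using \<epsilon>_measurable[of 1] by (intro borel_measurable_power) simp
      show "AE \<omega> in M. (\<epsilon> 1 \<omega>)\<^sup>2 = (U (int 0 + 1) \<omega>)\<^sup>2" using \<epsilon>U[of 0] by eventually_elim simp
    qed measurable
    then show ?thesis using sq by simp
  qed
  have small_sum: "small_oP M (\<lambda>n \<omega>. sqrt (real n * h n) / real n * (\<Sum>i<n. U (int i + 1) \<omega>))"
    by (rule small_oP_sum_errors[OF U.U_measurable borel_measurable_cond_exp2 \<epsilon>_measurable \<epsilon>U small])
  define T where "T n = (\<Sum>i<n. \<Sum>j<n. \<gamma> i j * \<bar>expectation (\<lambda>\<omega>. U (int i + 1) \<omega> * U (int j + 1) \<omega>)\<bar>)" for n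
  have T0: "0 \<le> T n" for n unfolding T_def by (intro sum_nonneg mult_nonneg_nonneg \<gamma>0 abs_ge_zero)
  \<comment> \<open>The uniform bound on \<gamma> times the constant of the error covariances; what
    remains is the double sum of \<open>acov\<close> for the errors.\<close>
  define R where "R = 2 * Z.\<sigma>2 * (2 * W.tail 0) * (2 * N.\<sigma>2)"
  have R0: "0 \<le> R" unfolding R_def by (rule mult_nonneg_nonneg[OF order_trans[OF \<gamma>0 \<gamma>b]]) (simp add: N.\<sigma>2_nonneg)
  have TR: "T n \<le> R * (\<Sum>i<n. \<Sum>j<n. U.acov (nat \<bar>int j - int i\<bar>))" for n
    unfolding T_def sum_distrib_left
  proof (intro sum_mono)
    fix i j
    have "\<bar>expectation (\<lambda>\<omega>. U (int i + 1) \<omega> * U (int j + 1) \<omega>)\<bar> \<le> 2 * N.\<sigma>2 * U.acov (nat \<bar>int j - int i\<bar>)"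
      using U.U_covariance[of "int i + 1" "int j + 1"] by simp
    then have "\<gamma> i j * \<bar>expectation (\<lambda>\<omega>. U (int i + 1) \<omega> * U (int j + 1) \<omega>)\<bar>
        \<le> (2 * Z.\<sigma>2 * (2 * W.tail 0)) * (2 * N.\<sigma>2 * U.acov (nat \<bar>int j - int i\<bar>))"
      by (rule mult_mono[OF \<gamma>b _ order_trans[OF \<gamma>0 \<gamma>b]]) simp
    then show "\<gamma> i j * \<bar>expectation (\<lambda>\<omega>. U (int i + 1) \<omega> * U (int j + 1) \<omega>)\<bar> \<le> R * U.acov (nat \<bar>int j - int i\<bar>)"
      unfolding R_def by (simp add: mult.assoc)
  qed
  have cross: "(\<lambda>n. h n / real n * T n) \<longlonglongrightarrow> 0"
  \<comment> \<open>For \<open>C0\<close> equal to 0 the errors have finite memory and their double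
    sum is of order n. Otherwise it is of order n^(2-\<alpha>), and the relation between bandwidth
    and memory is required.\<close>
  proof (cases "C0 = 0")
    case True
    have "\<forall>\<^sub>F k in sequentially. c k = 0" using asymp_equiv_eventually_zeros[OF c(3)] True by simp
    then obtain k0 where k0: "\<And>k. k \<ge> k0 \<Longrightarrow> c k = 0" unfolding eventually_sequentially by blast
    have TD: "T n \<le> (R * (2 * (\<Sum>k<k0. U.acov k))) * real n powr 1" for n
      using order_trans[OF TR mult_left_mono[OF U.acov_double_sum_le_finite[of k0 n, OF k0] R0]] by (simp add: mult_ac)
    show ?thesis
    proof (rule scaled_bound_tendsto_0[OF T0 TD])
      have "\<forall>\<^sub>F n in sequentially. h n = h n / real n * real n powr 1"
        using eventually_gt_at_top[of 0] by eventually_elim simp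
      then show "(\<lambda>n. h n / real n * real n powr 1) \<longlonglongrightarrow> 0" using h(1) by (rule Lim_transform_eventually[rotated])
    qed
  next
    case False
    obtain D' where D': "\<And>n. (\<Sum>i<n. \<Sum>j<n. U.acov (nat \<bar>int j - int i\<bar>)) \<le> D' * real n powr (2 - \<alpha>)"
      using U.acov_double_sum_le[OF c(1,2) cb] by blast
    have TD: "T n \<le> (R * D') * real n powr (2 - \<alpha>)" for n
      using order_trans[OF TR mult_left_mono[OF D' R0], of n] by (simp add: mult_ac)
    show ?thesis
    proof (rule scaled_bound_tendsto_0[OF T0 TD])
      have "h n / real n * real n powr (2 - \<alpha>) = h n * real n powr (1 - \<alpha>)" for n
        unfolding powr_shift[symmetric] by simp
      moreover have "(\<lambda>n. h n * real n powr (1 - \<alpha>)) \<longlonglongrightarrow> 0"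
        by (rule U.bandwidth_from_negligible_sum[OF c(1) U.\<sigma>2_pos[of "int 0 + 1"] i3 c(3) False h(1) bandwidth_pos small_sum]) (use U1 in simp)
      ultimately show "(\<lambda>n. h n / real n * real n powr (2 - \<alpha>)) \<longlonglongrightarrow> 0" by simp
    qed
  qed

  have "nw_setting M (\<lambda>i. generated_sigma M borel {..int i} \<zeta>) (\<lambda>i. \<zeta> (int i + 1)) (\<lambda>i. W (int i + 1)) p
      K m BK Bp Bm m1 x h (\<lambda>i. U (int i + 1)) \<gamma>"
  proof (intro nw_setting.intro nw_setting_axioms.intro inn sm h U.U_measurable U.U_square U1 Wd \<gamma>0 small_sum)
    show "distr M borel (U (int i + 1)) = distr M borel (U (int 0 + 1))" for i
      unfolding U_def[abs_def] by (rule N.linear_distr)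
    show "integrable M (\<lambda>\<omega>. g (W (int i + 1) \<omega>) * g (W (int j + 1) \<omega>)) \<and>
        \<bar>expectation (\<lambda>\<omega>. g (W (int i + 1) \<omega>) * g (W (int j + 1) \<omega>))\<bar> \<le> L\<^sup>2 * \<gamma> i j"
      if "\<And>w w'. \<bar>g w - g w'\<bar> \<le> L * \<bar>w - w'\<bar>" "expectation (\<lambda>\<omega>. g (W (int 0 + 1) \<omega>)) = 0" for g L i j
      using W.stationary_covariance[OF that Wd, of "int i + 1" "int j + 1"] by (simp add: \<gamma>_def)
    show "(\<lambda>n. expectation (\<lambda>\<omega>. \<bar>1 / real n * (\<Sum>i<n. (trunc B (U (int i + 1) \<omega>))\<^sup>2)
        - expectation (\<lambda>\<omega>. (trunc B (U (int 0 + 1) \<omega>))\<^sup>2)\<bar>)) \<longlonglongrightarrow> 0" for B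
      unfolding U_def by (rule N.linear_lln)
    show "(\<lambda>n. h n ^ 5 / real n * (\<Sum>i<n. \<Sum>j<n. \<gamma> i j)) \<longlonglongrightarrow> 0"
    proof (rule scaled_bound_tendsto_0[OF \<gamma>S \<gamma>D])
      have "h n ^ 5 / real n * real n powr (2 - \<alpha>X) = h n ^ 5 * real n powr (1 - \<alpha>X)" for n
        unfolding powr_shift[symmetric] by simp
      then show "(\<lambda>n. h n ^ 5 / real n * real n powr (2 - \<alpha>X)) \<longlonglongrightarrow> 0" using h5 by simp
    qed
    show "(\<lambda>n. 1 / (real n)\<^sup>2 * (\<Sum>i<n. \<Sum>j<n. \<gamma> i j)) \<longlonglongrightarrow> 0"
    proof (rule scaled_bound_tendsto_0[OF \<gamma>S \<gamma>D])
      have "(\<lambda>n. real n powr (- \<alpha>X)) \<longlonglongrightarrow> 0"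
        by (rule tendsto_neg_powr) (use a(2) filterlim_real_sequentially in auto)
      moreover have "1 / (real n)\<^sup>2 * real n powr (2 - \<alpha>X) = real n powr (- \<alpha>X)" for n
      proof -
        have "1 / (real n)\<^sup>2 * real n powr (2 - \<alpha>X) = 1 / real n * (1 / real n * real n powr (2 - \<alpha>X))"
          by (simp add: power2_eq_square)
        also have "\<dots> = real n powr (- \<alpha>X)" unfolding powr_shift using powr_shift[of n "1 + \<alpha>X"] by simp
        finally show ?thesis .
      qed
      ultimately show "(\<lambda>n. 1 / (real n)\<^sup>2 * real n powr (2 - \<alpha>X)) \<longlonglongrightarrow> 0" by simp
    qed
    show "(\<lambda>n. h n / real n * (\<Sum>i<n. \<Sum>j<n. \<gamma> i j * \<bar>expectation (\<lambda>\<omega>. U (int i + 1) \<omega> * U (int j + 1) \<omega>)\<bar>)) \<longlonglongrightarrow> 0"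
      using cross unfolding T_def .
    \<comment> \<open>The normal density is positive everywhere, hence so is its mean over the
      random argument.\<close>
    show "0 < expectation (\<lambda>\<omega>. p (x - W (int 0 + 1) \<omega>))"
    proof (rule expectation_greater)
      have [measurable]: "p \<in> borel_measurable borel" by (rule pm)
      show "integrable M (\<lambda>\<omega>. p (x - W (int 0 + 1) \<omega>))"
        by (rule integrable_const_bound[where B=Bp]) (use p0 smoothing.dens_le[OF sm] in auto)
    qed (use ppos in auto)
    show "0 < smoothing.\<kappa>1 K" using kernel_L2_pos by (simp add: smoothing.\<kappa>1_def[OF sm] kernel_L2_def)
  qed
  then show ?thesis
    by (rule nw_setting.NW_asymp_normal_transfer[OF _ X\<epsilon> XW \<epsilon>U]) (use Y in auto)
qed

end

theorem proposition2p1: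
  fixes M :: "'a measure"
    and K f m :: "real \<Rightarrow> real"
    and h :: "nat \<Rightarrow> real"
    and X Y \<epsilon> :: "nat \<Rightarrow> 'a \<Rightarrow> real"
    and x :: real
  assumes "prob_space M"
    and "\<forall>u. K u \<ge> 0"
    and "bounded (range K)"
    and "has_bochner_integral lborel K 1"
    and "has_bochner_integral lborel (\<lambda>u. u * K u) 0"
    and "integrable lborel (\<lambda>u. u\<^sup>2 * K u)"
    and "kernel_L2 K \<noteq> 0"
    and "h \<longlonglongrightarrow> 0"
    and "filterlim (\<lambda>n. real n * h n) at_top sequentially"
    and "distributed M lborel (X 1) (\<lambda>y. ennreal (f y))"
    and "\<forall>y. f y > 0"
    and "twice_differentiable_bounded f"
    and "twice_differentiable_bounded m"
    and "indep_families M borel {1..} X borel {1..} \<epsilon>"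
    and "\<forall>i\<ge>1. \<forall>\<omega>\<in>space M. Y i \<omega> = m (X i \<omega>) + \<epsilon> i \<omega>"
  shows
    "(\<forall>(S :: 'b measure) (\<eta> :: int \<Rightarrow> 'a \<Rightarrow> 'b) (G :: (nat \<Rightarrow> 'b) \<Rightarrow> real).
        iid_family M borel {1..} X
        \<and> iid_family M S UNIV \<eta>
        \<and> indep_families M S UNIV \<eta> borel {1..} X
        \<and> G \<in> borel_measurable (PiM UNIV (\<lambda>_. S))
        \<and> (\<forall>i\<ge>1. \<forall>\<omega>\<in>space M. \<epsilon> i \<omega> = G (\<lambda>k. \<eta> (int i - int k) \<omega>))
        \<and> integrable M (\<epsilon> 1) \<and> prob_space.expectation M (\<epsilon> 1) = 0
        \<and> integrable M (\<lambda>\<omega>. (\<epsilon> 1 \<omega>)\<^sup>2) \<and> prob_space.expectation M (\<lambda>\<omega>. (\<epsilon> 1 \<omega>)\<^sup>2) = 1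
        \<and> small_oP M (\<lambda>n \<omega>. sqrt (real n * h n) / real n *
              (\<Sum>i=1..n. real_cond_exp M (past_sigma M S \<eta> (int i - 1)) (\<epsilon> i) \<omega> - \<epsilon> i \<omega>))
        \<and> small_oP M (\<lambda>n \<omega>. sqrt (real n * h n) / real n *
              (\<Sum>i=1..n. real_cond_exp M (past_sigma M S \<eta> (int i - 1)) (\<epsilon> i) \<omega>))
        \<longrightarrow> NW_asymp_normal M K h X Y m x)
     \<and>
     (\<forall>(a :: nat \<Rightarrow> real) (A\<^sub>0 :: real) (\<alpha>\<^sub>X :: real) (\<zeta> :: int \<Rightarrow> 'a \<Rightarrow> real)
       (c :: nat \<Rightarrow> real) (C\<^sub>0 :: real) (\<alpha> :: real) (\<eta> :: int \<Rightarrow> 'a \<Rightarrow> real).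
        a 0 = 1
        \<and> 0 < \<alpha>\<^sub>X \<and> \<alpha>\<^sub>X < 1
        \<and> (\<forall>k\<ge>1. a k = A\<^sub>0 * real k powr (- (\<alpha>\<^sub>X + 1) / 2))
        \<and> iid_family M borel UNIV \<zeta>
        \<and> (\<exists>\<sigma>>0. \<forall>j. distributed M lborel (\<zeta> j) (normal_density 0 \<sigma>))
        \<and> (\<forall>i\<ge>1. AE \<omega> in M. (\<lambda>k. a k * \<zeta> (int i - int k) \<omega>) sums X i \<omega>)
        \<and> prob_space.variance M (X 1) = 1
        \<and> c 0 = 1
        \<and> 0 < \<alpha> \<and> \<alpha> < 1
        \<and> c \<sim>[sequentially] (\<lambda>k. C\<^sub>0 * real k powr (- (\<alpha> + 1) / 2))
        \<and> iid_family M borel UNIV \<eta>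
        \<and> (\<forall>j. integrable M (\<eta> j) \<and> prob_space.expectation M (\<eta> j) = 0)
        \<and> (\<forall>j. integrable M (\<lambda>\<omega>. (\<eta> j \<omega>) ^ 4))
        \<and> indep_families M borel UNIV \<eta> borel {1..} X
        \<and> (\<forall>i\<ge>1. AE \<omega> in M. (\<lambda>k. c k * \<eta> (int i - int k) \<omega>) sums \<epsilon> i \<omega>)
        \<and> integrable M (\<lambda>\<omega>. (\<epsilon> 1 \<omega>)\<^sup>2) \<and> prob_space.expectation M (\<lambda>\<omega>. (\<epsilon> 1 \<omega>)\<^sup>2) = 1
        \<and> small_oP M (\<lambda>n \<omega>. sqrt (real n * h n) / real n *
              (\<Sum>i=1..n. real_cond_exp M (past_sigma M borel \<eta> (int i - 1)) (\<epsilon> i) \<omega> - \<epsilon> i \<omega>))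
        \<and> small_oP M (\<lambda>n \<omega>. sqrt (real n * h n) / real n *
              (\<Sum>i=1..n. real_cond_exp M (past_sigma M borel \<eta> (int i - 1)) (\<epsilon> i) \<omega>))
        \<and> (\<lambda>n. h n ^ 5 * real n powr (1 - \<alpha>\<^sub>X)) \<longlonglongrightarrow> 0
        \<longrightarrow> NW_asymp_normal M K h X Y m x)"
proof -
  interpret prob_space M by fact
  interpret regression_setup M K m h x X Y \<epsilon>
    by unfold_locales (use assms in simp_all)
  show ?thesis
    apply (intro conjI allI impI)
    subgoal for S \<eta> G
      by (elim conjE) (rule independent_design[OF assms(10-12), of S \<eta> G])
    subgoal
      by (elim conjE exE) (rule long_memory_design)
    done
qed

end
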